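(* Let $\Phi$ be a nuclear space over $\mathbb{R}$ and let $L=\{L_t\}_{t\ge0}$ be a cylindrical Lévy process in $\Phi'$ such that for every $T>0$ the family $\{L_t:t\in[0,T]\}$ of linear maps from $\Phi$ into $L^0(\Omega,\mathscr{F},\mathbb{P})$ is equicontinuous. Then there exist a countably Hilbertian topology $\vartheta_L$ on $\Phi$ and a $(\widetilde{\Phi_{\vartheta_L}})'_\beta$-valued càdlàg process $Y=\{Y_t\}_{t\ge0}$ such that for every $\phi\in\Phi$, $Y[\phi]=\{Y_t[\phi]\}_{t\ge0}$ is a version of $L(\phi)=\{L_t(\phi)\}_{t\ge0}$. Moreover $Y$ is a $\Phi'_\beta$-valued, regular, càdlàg Lévy process that is a version of $L$ and that is unique up to indistinguishable versions.
   Context: $\Phi'_\beta$ is the strong dual of $\Phi$, $f[\phi]$ the pairing. A semi-norm $p$ on $\Phi$ is Hilbertian if $p(\phi)^2=Q(\phi,\phi)$ for a symmetric non-negative bilinear form $Q$; $\Phi_p$ is then the Hilbert completion of $\Phi/\ker p$ and, for $p\le q$, $i_{p,q}:\Phi_q\to\Phi_p$ is the canonical map. A Hausdorff locally convex space is nuclear if its topology is generated by a family of Hilbertian semi-norms such that for each member $p$ there is a member $q\ge p$ with $i_{p,q}$ Hilbert-Schmidt. $(\Omega,\mathscr{F},\mathbb{P})$ is a complete probability space; $L^0(\Omega,\mathscr{F},\mathbb{P})$ (classes of real random variables) has the topology of convergence in probability. A cylindrical random variable in $\Phi'$ is a linear map $\Phi\to L^0(\Omega,\mathscr{F},\mathbb{P})$;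 a cylindrical process is a family of these indexed by time. A cylindrical process $L$ is a cylindrical Lévy process if for all $n\geq 1$ and $\phi_1,\dots,\phi_n\in\Phi$ the $\mathbb{R}^n$-valued process $\{(L_t(\phi_1),\dots,L_t(\phi_n))\}_{t\ge0}$ is a Lévy process. A $\Phi'_\beta$-valued process $Y$ is a version of $L$ if for every $t$ and $\phi$, $Y_t[\phi]=L_t(\phi)$ $\mathbb{P}$-a.e. A (weaker) countably Hilbertian topology $\theta$ on $\Phi$ is one generated by an increasing sequence of continuous Hilbertian semi-norms on $\Phi$; $\Phi_\theta=(\Phi,\theta)$, $\Phi'_\theta$ is its dual, $\widetilde{\Phi_\theta}$ its completion and $(\widetilde{\Phi_\theta})'_\beta$ the strong dual of the completion, canonically contained in $\Phi'_\beta$. A $\Phi'_\beta$-valued random variable $X$ is regular if $\mathbb{P}(X\in\Phi'_\theta)=1$ for some such $\theta$; a process is regular if it is so at each time. Càdlàg means that a.s. the paths are right-continuous with left limits. A Borel measure on $\Phi'_\beta$ is Radon if every Borel set $\Gamma$ contains, for each $\epsilon>0$, a compact set $K$ with measure of $\Gamma\setminus K$ less than $\epsilon$; $\mathfrak{M}^1_R(\Phi'_\beta)$ is the set of Radon probability measures. A $\Phi'_\beta$-valued process is a Lévy process if it starts at $0$ a.s., has independent and stationary increments, and the law $\mu_t$ at each time $t$ is Radon with $t\mapsto\mu_t\in\mathfrak{M}^1_R(\Phi'_\beta)$ weakly continuous at $0$. *)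

theory Defs
  imports "HOL-Probability.Probability"
begin

section \<open>Topologies generated by pseudometrics and semi-norms\<close>

definition gauge_topology :: "'v set \<Rightarrow> ('v \<Rightarrow> 'v \<Rightarrow> real) set \<Rightarrow> 'v topology" where
  "gauge_topology S D = topology (\<lambda>U. U \<subseteq> S \<and>
     (\<forall>x\<in>U. \<exists>F \<epsilon>. finite F \<and> F \<subseteq> D \<and> \<epsilon> > 0 \<and> {y \<in> S. \<forall>d\<in>F. d x y < \<epsilon>} \<subseteq> U))"

lemma openin_gauge_topology:
  "openin (gauge_topology S D) U \<longleftrightarrow> U \<subseteq> S \<and>
     (\<forall>x\<in>U. \<exists>F \<epsilon>. finite F \<and> F \<subseteq> D \<and> \<epsilon> > 0 \<and> {y \<in> S. \<forall>d\<in>F. d x y < \<epsilon>} \<subseteq> U)"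
proof -
  define nbhd where
    "nbhd x U \<longleftrightarrow> (\<exists>F \<epsilon>. finite F \<and> F \<subseteq> D \<and> (\<epsilon>::real) > 0 \<and> {y \<in> S. \<forall>d\<in>F. d x y < \<epsilon>} \<subseteq> U)"
    for x U
  have mono: "nbhd x V" if "nbhd x U" "U \<subseteq> V" for x U V
    using that unfolding nbhd_def by (meson order_trans)
  have inter: "nbhd x (U \<inter> V)" if U: "nbhd x U" and V: "nbhd x V" for x U V
  proof -
    obtain F e where "finite F" "F \<subseteq> D" "e > 0" "{y \<in> S. \<forall>d\<in>F. d x y < e} \<subseteq> U"
      using U unfolding nbhd_def by blast
    moreover obtain G e' where "finite G" "G \<subseteq> D" "e' > 0" "{y \<in> S. \<forall>d\<in>G. d x y < e'} \<subseteq> V"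
      using V unfolding nbhd_def by blast
    ultimately show ?thesis
      unfolding nbhd_def by (intro exI[of _ "F \<union> G"] exI[of _ "min e e'"]) auto
  qed
  have "istopology (\<lambda>U. U \<subseteq> S \<and> (\<forall>x\<in>U. nbhd x U))"
    unfolding istopology_def
  proof (rule conjI)
    show "\<forall>U V. U \<subseteq> S \<and> (\<forall>x\<in>U. nbhd x U) \<longrightarrow> V \<subseteq> S \<and> (\<forall>x\<in>V. nbhd x V) \<longrightarrow>
        U \<inter> V \<subseteq> S \<and> (\<forall>x\<in>U \<inter> V. nbhd x (U \<inter> V))"
      using inter by blast
    show "\<forall>\<U>. (\<forall>U\<in>\<U>. U \<subseteq> S \<and> (\<forall>x\<in>U. nbhd x U)) \<longrightarrow>
        \<Union>\<U> \<subseteq> S \<and> (\<forall>x\<in>\<Union>\<U>. nbhd x (\<Union>\<U>))"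
      using mono by (meson Sup_least Union_iff Union_upper)
  qed
  then show ?thesis
    unfolding gauge_topology_def nbhd_def by (simp add: topology_inverse')
qed

lemma topspace_gauge_topology [simp]: "topspace (gauge_topology S D) = S"
proof
  show "topspace (gauge_topology S D) \<subseteq> S"
    using openin_topspace[of "gauge_topology S D"] unfolding openin_gauge_topology by blast
  have "openin (gauge_topology S D) S"
    unfolding openin_gauge_topology by (auto intro!: exI[of _ "{}"] exI[of _ "1::real"])
  then show "S \<subseteq> topspace (gauge_topology S D)" by (rule openin_subset)
qed

definition seminorm :: "('a::real_vector \<Rightarrow> real) \<Rightarrow> bool" where
  "seminorm p \<longleftrightarrow> (\<forall>x. 0 \<le> p x) \<and> (\<forall>x y. p (x + y) \<le> p x + p y) \<and>
     (\<forall>a x. p (a *\<^sub>R x) = \<bar>a\<bar> * p x)"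

definition hilbertian :: "('a::real_vector \<Rightarrow> real) \<Rightarrow> bool" where
  "hilbertian p \<longleftrightarrow> seminorm p \<and>
     (\<exists>Q. bilinear Q \<and> (\<forall>x y. Q x y = Q y x) \<and> (\<forall>x. 0 \<le> Q x x) \<and> (\<forall>x. (p x)\<^sup>2 = Q x x))"

definition seminorm_topology :: "('a::real_vector \<Rightarrow> real) set \<Rightarrow> 'a topology" where
  "seminorm_topology P = gauge_topology UNIV ((\<lambda>p x y. p (x - y)) ` P)"


section \<open>Completions\<close>

text \<open>
  All topologies that are completed below (those of one semi-norm, and the countably Hilbertian
  ones) are pseudometrizable. Their Hausdorff completion therefore consists of the classes of
  Cauchy sequences, two sequences being equivalent if their difference tends to zero. In
  particular the completion for one semi-norm \<open>p\<close> is the completion of the quotient by the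
  kernel of \<open>p\<close>.
\<close>

definition cauchy_seqs :: "'a::real_vector topology \<Rightarrow> (nat \<Rightarrow> 'a) set" where
  "cauchy_seqs T = {x. \<forall>U. openin T U \<and> 0 \<in> U \<longrightarrow> (\<exists>N. \<forall>m\<ge>N. \<forall>n\<ge>N. x m - x n \<in> U)}"

definition cauchy_rel :: "'a::real_vector topology \<Rightarrow> ((nat \<Rightarrow> 'a) \<times> (nat \<Rightarrow> 'a)) set" where
  "cauchy_rel T = {(x, y). x \<in> cauchy_seqs T \<and> y \<in> cauchy_seqs T \<and>
     limitin T (\<lambda>n. x n - y n) 0 sequentially}"

definition compl_carrier :: "'a::real_vector topology \<Rightarrow> (nat \<Rightarrow> 'a) set set" where
  "compl_carrier T = cauchy_seqs T // cauchy_rel T"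

definition compl_embed :: "'a::real_vector topology \<Rightarrow> 'a \<Rightarrow> (nat \<Rightarrow> 'a) set" where
  "compl_embed T \<phi> = cauchy_rel T `` {\<lambda>_. \<phi>}"

definition class_rep :: "(nat \<Rightarrow> 'a) set \<Rightarrow> nat \<Rightarrow> 'a" where
  "class_rep X = (SOME x. x \<in> X)"


section \<open>Nuclear spaces\<close>

text \<open>
  Norm and inner product of the Hilbert space completion of a Hilbertian semi-norm \<open>p\<close>, as limits
  along representing sequences. The form \<open>Q\<close> of \<open>p\<close> is recovered by polarization.
\<close>

definition semi_inner :: "('a::real_vector \<Rightarrow> real) \<Rightarrow> 'a \<Rightarrow> 'a \<Rightarrow> real" where
  "semi_inner p x y = ((p (x + y))\<^sup>2 - (p (x - y))\<^sup>2) / 4"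

definition hilbert_compl :: "('a::real_vector \<Rightarrow> real) \<Rightarrow> (nat \<Rightarrow> 'a) set set" where
  "hilbert_compl p = compl_carrier (seminorm_topology {p})"

definition hilbert_norm :: "('a::real_vector \<Rightarrow> real) \<Rightarrow> (nat \<Rightarrow> 'a) set \<Rightarrow> real" where
  "hilbert_norm p X = lim (\<lambda>n. p (class_rep X n))"

definition hilbert_inner ::
  "('a::real_vector \<Rightarrow> real) \<Rightarrow> (nat \<Rightarrow> 'a) set \<Rightarrow> (nat \<Rightarrow> 'a) set \<Rightarrow> real" where
  "hilbert_inner p X Y = lim (\<lambda>n. semi_inner p (class_rep X n) (class_rep Y n))"

definition hilbert_basis :: "('a::real_vector \<Rightarrow> real) \<Rightarrow> (nat \<Rightarrow> 'a) set set \<Rightarrow> bool" where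
  "hilbert_basis p E \<longleftrightarrow> E \<subseteq> hilbert_compl p \<and>
     (\<forall>e\<in>E. \<forall>f\<in>E. hilbert_inner p e f = (if e = f then 1 else 0)) \<and>
     (\<forall>X\<in>hilbert_compl p. (\<forall>e\<in>E. hilbert_inner p X e = 0) \<longrightarrow>
        X = compl_embed (seminorm_topology {p}) 0)"

text \<open>
  For \<open>p \<le> q\<close> the canonical map sends the \<open>q\<close>-class of a \<open>q\<close>-Cauchy sequence to its \<open>p\<close>-class.
\<close>

definition canonical_map ::
  "('a::real_vector \<Rightarrow> real) \<Rightarrow> ('a \<Rightarrow> real) \<Rightarrow> (nat \<Rightarrow> 'a) set \<Rightarrow> (nat \<Rightarrow> 'a) set" where
  "canonical_map p q X = cauchy_rel (seminorm_topology {p}) `` X"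

definition hilbert_schmidt_map :: "('a::real_vector \<Rightarrow> real) \<Rightarrow> ('a \<Rightarrow> real) \<Rightarrow> bool" where
  "hilbert_schmidt_map p q \<longleftrightarrow>
     (\<exists>E. hilbert_basis q E \<and> (\<lambda>e. (hilbert_norm p (canonical_map p q e))\<^sup>2) summable_on E)"

definition nuclear_space :: "'a::real_vector topology \<Rightarrow> bool" where
  "nuclear_space T \<longleftrightarrow> Hausdorff_space T \<and>
     (\<exists>P. (\<forall>p\<in>P. hilbertian p) \<and> T = seminorm_topology P \<and>
          (\<forall>p\<in>P. \<exists>q\<in>P. (\<forall>x. p x \<le> q x) \<and> hilbert_schmidt_map p q))"

definition countably_hilbertian :: "'a::real_vector topology \<Rightarrow> 'a topology \<Rightarrow> bool" where
  "countably_hilbertian T \<theta> \<longleftrightarrow>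
     (\<exists>p :: nat \<Rightarrow> 'a \<Rightarrow> real.
        (\<forall>n. hilbertian (p n) \<and> continuous_map T euclideanreal (p n)) \<and>
        (\<forall>n x. p n x \<le> p (Suc n) x) \<and> \<theta> = seminorm_topology (range p))"


section \<open>Strong duals\<close>

text \<open>
  A completion is not a type, so duals are taken of vector spaces with explicit operations; the
  underlying set is the topological space of \<open>tv_top\<close>.
\<close>

record 'v tvs =
  tv_top :: "'v topology"
  tv_add :: "'v \<Rightarrow> 'v \<Rightarrow> 'v"
  tv_scale :: "real \<Rightarrow> 'v \<Rightarrow> 'v"
  tv_zero :: 'v

definition tvs_of :: "'a::real_vector topology \<Rightarrow> 'a tvs" where
  "tvs_of T = \<lparr>tv_top = T, tv_add = (+), tv_scale = (*\<^sub>R), tv_zero = 0\<rparr>"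

text \<open>
  The topology of the completion is generated by the extensions \<open>[x] \<mapsto> lim p (x n)\<close> of the
  continuous semi-norms \<open>p\<close>.
\<close>

definition tvs_completion :: "'a::real_vector topology \<Rightarrow> (nat \<Rightarrow> 'a) set tvs" where
  "tvs_completion T = \<lparr>
     tv_top = gauge_topology (compl_carrier T)
       {\<lambda>X Y. lim (\<lambda>n. p (class_rep X n - class_rep Y n)) | p.
          seminorm p \<and> continuous_map T euclideanreal p},
     tv_add = (\<lambda>X Y. cauchy_rel T `` {\<lambda>n. x n + y n | x y. x \<in> X \<and> y \<in> Y}),
     tv_scale = (\<lambda>a X. cauchy_rel T `` {\<lambda>n. a *\<^sub>R x n | x. x \<in> X}),
     tv_zero = compl_embed T 0\<rparr>"

definition tv_bounded :: "'v tvs \<Rightarrow> 'v set \<Rightarrow> bool" where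
  "tv_bounded E B \<longleftrightarrow> B \<subseteq> topspace (tv_top E) \<and>
     (\<forall>U. openin (tv_top E) U \<and> tv_zero E \<in> U \<longrightarrow>
        (\<exists>r>0. \<forall>s. r \<le> \<bar>s\<bar> \<longrightarrow> B \<subseteq> tv_scale E s ` U))"

definition tv_dual :: "'v tvs \<Rightarrow> ('v \<Rightarrow> real) set" where
  "tv_dual E = {f. f \<in> extensional (topspace (tv_top E)) \<and>
     (\<forall>x\<in>topspace (tv_top E). \<forall>y\<in>topspace (tv_top E). f (tv_add E x y) = f x + f y) \<and>
     (\<forall>a. \<forall>x\<in>topspace (tv_top E). f (tv_scale E a x) = a * f x) \<and>
     continuous_map (tv_top E) euclideanreal f}"

text \<open>The empty set is left out because the supremum over it is not zero but unspecified.\<close>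

definition strong_dual :: "'v tvs \<Rightarrow> ('v \<Rightarrow> real) topology" where
  "strong_dual E = gauge_topology (tv_dual E)
     {\<lambda>f g. (SUP x\<in>B. \<bar>f x - g x\<bar>) | B. tv_bounded E B \<and> B \<noteq> {}}"

text \<open>The canonical map from the dual of the completion to the dual of the original space.\<close>

definition dual_restrict ::
  "'a::real_vector topology \<Rightarrow> ((nat \<Rightarrow> 'a) set \<Rightarrow> real) \<Rightarrow> 'a \<Rightarrow> real" where
  "dual_restrict T f = (\<lambda>\<phi>. f (compl_embed T \<phi>))"


section \<open>Random variables and processes\<close>

text \<open>
  Elements of \<open>L\<^sup>0\<close> are given by representatives, so identities in \<open>L\<^sup>0\<close> are almost sure
  identities. Time is \<open>real\<close>, and only times \<open>t \<ge> 0\<close> matter.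
\<close>

definition borel_of :: "'v topology \<Rightarrow> 'v measure" where
  "borel_of X = sigma (topspace X) {U. openin X U}"

definition random_process ::
  "'w measure \<Rightarrow> 'v measure \<Rightarrow> (real \<Rightarrow> 'w \<Rightarrow> 'v) \<Rightarrow> bool" where
  "random_process M N Y \<longleftrightarrow> (\<forall>t\<ge>0. Y t \<in> measurable M N)"

definition cadlag_path :: "'v topology \<Rightarrow> (real \<Rightarrow> 'v) \<Rightarrow> bool" where
  "cadlag_path X x \<longleftrightarrow> (\<forall>t\<ge>0. limitin X x (x t) (at_right t)) \<and>
     (\<forall>t>0. \<exists>l. limitin X x l (at_left t))"

definition cadlag_process ::
  "'w measure \<Rightarrow> 'v topology \<Rightarrow> (real \<Rightarrow> 'w \<Rightarrow> 'v) \<Rightarrow> bool" where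
  "cadlag_process M X Y \<longleftrightarrow> (AE w in M. cadlag_path X (\<lambda>t. Y t w))"

definition cylindrical_rv :: "'w measure \<Rightarrow> ('a::real_vector \<Rightarrow> 'w \<Rightarrow> real) \<Rightarrow> bool" where
  "cylindrical_rv M X \<longleftrightarrow> (\<forall>\<phi>. X \<phi> \<in> borel_measurable M) \<and>
     (\<forall>\<phi> \<psi>. AE w in M. X (\<phi> + \<psi>) w = X \<phi> w + X \<psi> w) \<and>
     (\<forall>a \<phi>. AE w in M. X (a *\<^sub>R \<phi>) w = a * X \<phi> w)"

definition equicontinuous_L0 ::
  "'w measure \<Rightarrow> 'a::real_vector topology \<Rightarrow> ('a \<Rightarrow> 'w \<Rightarrow> real) set \<Rightarrow> bool" where
  "equicontinuous_L0 M T F \<longleftrightarrow>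
     (\<forall>\<phi>. \<forall>\<epsilon>>0. \<forall>\<delta>>0. \<exists>U. openin T U \<and> \<phi> \<in> U \<and>
        (\<forall>X\<in>F. \<forall>\<psi>\<in>U. measure M {w \<in> space M. \<epsilon> < \<bar>X \<psi> w - X \<phi> w\<bar>} < \<delta>))"

text \<open>
  Values in \<open>\<real>\<^sup>n\<close> are functions on \<open>{..<n}\<close>, values in the dual are functions on \<open>UNIV\<close>; the index
  set \<open>I\<close> lets both share one definition of independent and stationary increments.
\<close>

definition fun_diff :: "'i set \<Rightarrow> ('i \<Rightarrow> real) \<Rightarrow> ('i \<Rightarrow> real) \<Rightarrow> 'i \<Rightarrow> real" where
  "fun_diff I f g = (\<lambda>i\<in>I. f i - g i)"

definition indep_increments ::
  "'w measure \<Rightarrow> ('i \<Rightarrow> real) measure \<Rightarrow> 'i set \<Rightarrow> (real \<Rightarrow> 'w \<Rightarrow> 'i \<Rightarrow> real) \<Rightarrow> bool" where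
  "indep_increments M N I X \<longleftrightarrow>
     (\<forall>k. \<forall>\<tau> :: nat \<Rightarrow> real. 0 \<le> \<tau> 0 \<and> (\<forall>j<k. \<tau> j < \<tau> (Suc j)) \<longrightarrow>
        prob_space.indep_vars M (\<lambda>_. N) (\<lambda>j w. fun_diff I (X (\<tau> (Suc j)) w) (X (\<tau> j) w)) {..<k})"

definition stationary_increments ::
  "'w measure \<Rightarrow> ('i \<Rightarrow> real) measure \<Rightarrow> 'i set \<Rightarrow> (real \<Rightarrow> 'w \<Rightarrow> 'i \<Rightarrow> real) \<Rightarrow> bool" where
  "stationary_increments M N I X \<longleftrightarrow>
     (\<forall>s t. 0 \<le> s \<and> s \<le> t \<longrightarrow>
        distr M N (\<lambda>w. fun_diff I (X t w) (X s w)) = distr M N (X (t - s)))"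

text \<open>
  No path regularity is required in \<open>\<real>\<^sup>n\<close>: the coordinates of a cylindrical process are only
  determined up to null sets at each time.
\<close>

definition levy_process_Rn ::
  "'w measure \<Rightarrow> nat \<Rightarrow> (real \<Rightarrow> 'w \<Rightarrow> nat \<Rightarrow> real) \<Rightarrow> bool" where
  "levy_process_Rn M n X \<longleftrightarrow>
     (let N = Pi\<^sub>M {..<n} (\<lambda>_. borel :: real measure) in
        random_process M N X \<and>
        (AE w in M. \<forall>i<n. X 0 w i = 0) \<and>
        indep_increments M N {..<n} X \<and>
        stationary_increments M N {..<n} X \<and>
        (\<forall>s\<ge>0. \<forall>\<epsilon>>0. ((\<lambda>t. measure M {w \<in> space M. \<epsilon> < L2_set (\<lambda>i. X t w i - X s w i) {..<n}})
           \<longlongrightarrow> 0) (at s within {0..})))"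

definition cylindrical_levy ::
  "'w measure \<Rightarrow> (real \<Rightarrow> 'a::real_vector \<Rightarrow> 'w \<Rightarrow> real) \<Rightarrow> bool" where
  "cylindrical_levy M L \<longleftrightarrow> (\<forall>t\<ge>0. cylindrical_rv M (L t)) \<and>
     (\<forall>n\<ge>1. \<forall>\<phi> :: nat \<Rightarrow> 'a. levy_process_Rn M n (\<lambda>t w. \<lambda>i\<in>{..<n}. L t (\<phi> i) w))"

text \<open>The condition \<open>K \<in> sets \<mu>\<close> is automatic in Hausdorff spaces, where compact sets are closed.\<close>

definition radon_prob :: "'v topology \<Rightarrow> 'v measure set" where
  "radon_prob X = {\<mu>. prob_space \<mu> \<and> sets \<mu> = sets (borel_of X) \<and>
     (\<forall>\<Gamma>\<in>sets \<mu>. \<forall>\<epsilon>>0. \<exists>K. compactin X K \<and> K \<in> sets \<mu> \<and> K \<subseteq> \<Gamma> \<and> measure \<mu> (\<Gamma> - K) < \<epsilon>)}"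

definition weakly_continuous_at_0 :: "'v topology \<Rightarrow> (real \<Rightarrow> 'v measure) \<Rightarrow> bool" where
  "weakly_continuous_at_0 X \<mu> \<longleftrightarrow>
     (\<forall>h. continuous_map X euclideanreal h \<and> bounded (h ` topspace X) \<longrightarrow>
        ((\<lambda>t. integral\<^sup>L (\<mu> t) h) \<longlongrightarrow> integral\<^sup>L (\<mu> 0) h) (at_right 0))"

definition levy_process_dual ::
  "'w measure \<Rightarrow> 'a::real_vector topology \<Rightarrow> (real \<Rightarrow> 'w \<Rightarrow> 'a \<Rightarrow> real) \<Rightarrow> bool" where
  "levy_process_dual M T Y \<longleftrightarrow>
     (let X = strong_dual (tvs_of T); N = borel_of X in
        random_process M N Y \<and>
        (AE w in M. Y 0 w = (\<lambda>_. 0)) \<and>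
        indep_increments M N UNIV Y \<and>
        stationary_increments M N UNIV Y \<and>
        (\<forall>t\<ge>0. distr M N (Y t) \<in> radon_prob X) \<and>
        weakly_continuous_at_0 X (\<lambda>t. distr M N (Y t)))"

definition regular_process ::
  "'w measure \<Rightarrow> 'a::real_vector topology \<Rightarrow> (real \<Rightarrow> 'w \<Rightarrow> 'a \<Rightarrow> real) \<Rightarrow> bool" where
  "regular_process M T Y \<longleftrightarrow>
     (\<forall>t\<ge>0. \<exists>\<theta>. countably_hilbertian T \<theta> \<and> (AE w in M. Y t w \<in> tv_dual (tvs_of \<theta>)))"

definition version_of ::
  "'w measure \<Rightarrow> (real \<Rightarrow> 'w \<Rightarrow> 'a \<Rightarrow> real) \<Rightarrow> (real \<Rightarrow> 'a \<Rightarrow> 'w \<Rightarrow> real) \<Rightarrow> bool" where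
  "version_of M Y L \<longleftrightarrow> (\<forall>t\<ge>0. \<forall>\<phi>. AE w in M. Y t w \<phi> = L t \<phi> w)"

definition indistinguishable ::
  "'w measure \<Rightarrow> (real \<Rightarrow> 'w \<Rightarrow> 'v) \<Rightarrow> (real \<Rightarrow> 'w \<Rightarrow> 'v) \<Rightarrow> bool" where
  "indistinguishable M Y Z \<longleftrightarrow> (AE w in M. \<forall>t\<ge>0. Y t w = Z t w)"

end

theory Submission
  imports Defs
begin

text \<open>
  Equicontinuity yields, for each \<open>k\<close>, a continuous Hilbertian semi-norm \<open>q\<^sub>k\<close> with
  \<open>1 - E cos (L\<^sub>t \<psi>) \<le> 2\<^bsup>-k-3\<^esup> + (q\<^sub>k \<psi>)\<^sup>2\<close> for \<open>t \<le> k\<close>, and by nuclearity the \<open>q\<^sub>k\<close> can be chosen such that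
  the maps from \<open>q\<^sub>k\<^sub>+\<^sub>1\<close> to \<open>q\<^sub>k\<close> are Hilbert--Schmidt. Gaussian averaging over Bessel families of
  \<open>q\<^sub>k\<^sub>+\<^sub>1\<close> (Minlos) bounds \<open>L\<^sub>t\<close> in the dual norm of \<open>q\<^sub>k\<^sub>+\<^sub>1\<close>, up to probability \<open>O(2\<^bsup>-k\<^esup>)\<close>, on a fixed countable
  dense subgroup of \<open>\<Phi>\<close>, and Ottaviani's inequality makes this bound uniform over rational
  \<open>t \<le> k\<close>. So almost every path is, on bounded time sets, bounded in one of these dual norms.
  On such bounded sets of functionals convergence on the dense subgroup already is strong
  convergence, because Hilbert--Schmidt maps are limits of finite-rank maps. It therefore suffices to regularize the
  countably many real processes \<open>L(d\<^sub>i)\<close>, for which the number of large oscillations over a short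
  time interval has geometric tails. All properties of the resulting process, including its Borel
  measurability and the Radon property, are transported from the Polish space of real sequences.
\<close>

section \<open>Hilbertian semi-norms and Hilbert--Schmidt bounds\<close>

text \<open>Two obstacles shape the proof. The strong dual need not be metrizable, so Borel
  measurability and inner regularity there are not read off from countably many evaluations. A
  functional is therefore coded by its values on the subgroup, that is by a real sequence. The codes
  of a dual ball of \<open>q k\<close> form a closed set \<open>A m k\<close>, on which the decoding
  \<open>\<Psi>\<close> is continuous into the strong dual; since a path stays in one such set up to
  any given time, continuity on each \<open>A m k\<close> is enough. Secondly, the exceptional null
  sets depend on the time and on the test vector. Pathwise properties are hence imposed only at
  rational times and on the countable subgroup, and a subgroup suffices because an additive
  functional bounded by a semi-norm is linear. The exponent k + 3: the Minlos estimate gives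
  probability 4 * 2^(-k-3), at most the 1/2 that Ottaviani's inequality asks for, and the latter
  doubles it to 2^(-k). Infinitely many good k are enough for a path, so it is enough that these
  bounds tend to 0.\<close>

lemma seminormD:
  assumes "seminorm p"
  shows "0 \<le> p x" "p (x + y) \<le> p x + p y" "p (a *\<^sub>R x) = \<bar>a\<bar> * p x" "p 0 = 0"
    "p (- x) = p x" "p (x - y) \<le> p x + p y" "p (x - y) = p (y - x)" "\<bar>p x - p y\<bar> \<le> p (x - y)"
proof -
  note p = assms[unfolded seminorm_def]
  show 1: "0 \<le> p x" "p (x + y) \<le> p x + p y" "p (a *\<^sub>R x) = \<bar>a\<bar> * p x" for x y a
    using p by auto
  show "p 0 = 0" using 1(3)[of 0 0] by simp
  have neg: "p (- x) = p x" for x using 1(3)[of "-1" x] by simp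
  then show "p (- x) = p x" .
  show "p (x - y) \<le> p x + p y" using 1(2)[of x "- y"] neg[of y] by simp
  show sym: "p (x - y) = p (y - x)" for x y using neg[of "x - y"] by simp
  show "\<bar>p x - p y\<bar> \<le> p (x - y)"
    using 1(2)[of "x - y" y] 1(2)[of "y - x" x] sym[of x y] by simp
qed

lemma hilbertian_seminorm: "hilbertian p \<Longrightarrow> seminorm p"
  by (simp add: hilbertian_def)

text \<open>By polarization \<open>semi_inner p\<close> equals any form \<open>Q\<close> that
  witnesses \<open>hilbertian p\<close>, hence it is bilinear. Cauchy-Schwarz is the squared
  triangle inequality for \<open>x + y\<close> and \<open>x - y\<close>.\<close>

lemma semi_inner_properties:
  assumes "hilbertian p"
  shows "bilinear (semi_inner p)" "semi_inner p x y = semi_inner p y x"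
    "semi_inner p x x = (p x)\<^sup>2" "\<bar>semi_inner p x y\<bar> \<le> p x * p y"
    "(p (x + y))\<^sup>2 = (p x)\<^sup>2 + 2 * semi_inner p x y + (p y)\<^sup>2"
    "(p (x - y))\<^sup>2 = (p x)\<^sup>2 - 2 * semi_inner p x y + (p y)\<^sup>2"
proof -
  obtain Q where Q: "bilinear Q" "\<And>x y. Q x y = Q y x" "\<And>x. (p x)\<^sup>2 = Q x x"
    using assms unfolding hilbertian_def by blast
  have eq: "semi_inner p x y = Q x y" for x y
    unfolding semi_inner_def
    by (simp add: Q(3) bilinear_ladd[OF Q(1)] bilinear_radd[OF Q(1)]
      bilinear_lsub[OF Q(1)] bilinear_rsub[OF Q(1)] Q(2)[of y x])
  then have eq': "semi_inner p = Q" by blast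
  show "bilinear (semi_inner p)" using Q(1) eq' by simp
  show "semi_inner p x y = semi_inner p y x" using Q(2) eq by simp
  show "semi_inner p x x = (p x)\<^sup>2" using Q(3) eq by simp
  show plus: "(p (x + y))\<^sup>2 = (p x)\<^sup>2 + 2 * semi_inner p x y + (p y)\<^sup>2" for x y
    by (simp add: eq Q(3) bilinear_ladd[OF Q(1)] bilinear_radd[OF Q(1)] Q(2)[of y x])
  show minus: "(p (x - y))\<^sup>2 = (p x)\<^sup>2 - 2 * semi_inner p x y + (p y)\<^sup>2"
    by (simp add: eq Q(3) bilinear_lsub[OF Q(1)] bilinear_rsub[OF Q(1)] Q(2)[of y x])
  note s = seminormD[OF hilbertian_seminorm[OF assms]]
  have "(p (x + y))\<^sup>2 \<le> (p x + p y)\<^sup>2" "(p (x - y))\<^sup>2 \<le> (p x + p y)\<^sup>2"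
    using s(1,2,6) by (auto intro!: power_mono)
  then show "\<bar>semi_inner p x y\<bar> \<le> p x * p y"
    unfolding plus minus by (simp add: power2_sum)
qed

lemma semi_inner_linear:
  assumes "hilbertian p"
  shows "linear (\<lambda>x. semi_inner p x y)" "linear (semi_inner p y)"
  using semi_inner_properties(1)[OF assms] by (auto simp: bilinear_def)

lemmas semi_inner_simps =
  linear_add[OF semi_inner_linear(1)] linear_add[OF semi_inner_linear(2)]
  linear_diff[OF semi_inner_linear(1)] linear_diff[OF semi_inner_linear(2)]
  linear_sum[OF semi_inner_linear(1)] linear_sum[OF semi_inner_linear(2)]
  linear_cmul[OF semi_inner_linear(1)] linear_cmul[OF semi_inner_linear(2)]
  linear_0[OF semi_inner_linear(1)] linear_0[OF semi_inner_linear(2)]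

section \<open>Finite orthonormal sets and Gram-Schmidt\<close>

text \<open>The vectors are taken in \<Phi> itself rather than in a completion, so that projections
  are finite sums and no limits occur.\<close>

definition orthonormal_set :: "('a::real_vector \<Rightarrow> real) \<Rightarrow> 'a set \<Rightarrow> bool" where
  "orthonormal_set q S \<longleftrightarrow> finite S \<and> (\<forall>e\<in>S. \<forall>f\<in>S. semi_inner q e f = (if e = f then 1 else 0))"

definition orth_proj :: "('a::real_vector \<Rightarrow> real) \<Rightarrow> 'a set \<Rightarrow> 'a \<Rightarrow> 'a" where
  "orth_proj q S x = (\<Sum>e\<in>S. semi_inner q x e *\<^sub>R e)"

lemma orthonormal_comb:
  assumes q: "hilbertian q" and S: "orthonormal_set q S"
  shows "f \<in> S \<Longrightarrow> semi_inner q (\<Sum>e\<in>S. c e *\<^sub>R e) f = c f"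
    and "(q (\<Sum>e\<in>S. c e *\<^sub>R e))\<^sup>2 = (\<Sum>e\<in>S. (c e)\<^sup>2)"
proof -
  have fin: "finite S" using S by (simp add: orthonormal_set_def)
  have 1: "semi_inner q (\<Sum>e\<in>S. c e *\<^sub>R e) f = c f" if "f \<in> S" for f
  proof -
    have "semi_inner q (\<Sum>e\<in>S. c e *\<^sub>R e) f = (\<Sum>e\<in>S. c e * semi_inner q e f)"
      by (simp add: semi_inner_simps[OF q])
    also have "\<dots> = (\<Sum>e\<in>S. if e = f then c e else 0)"
      using S that by (intro sum.cong) (auto simp: orthonormal_set_def)
    finally show ?thesis using fin that by simp
  qed
  then show "f \<in> S \<Longrightarrow> semi_inner q (\<Sum>e\<in>S. c e *\<^sub>R e) f = c f" .
  have "(q (\<Sum>e\<in>S. c e *\<^sub>R e))\<^sup>2 = semi_inner q (\<Sum>e\<in>S. c e *\<^sub>R e) (\<Sum>e\<in>S. c e *\<^sub>R e)"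
    by (simp add: semi_inner_properties[OF q])
  also have "\<dots> = (\<Sum>f\<in>S. c f * semi_inner q (\<Sum>e\<in>S. c e *\<^sub>R e) f)"
    by (subst linear_sum[OF semi_inner_linear(2)[OF q]]) (simp add: semi_inner_simps[OF q])
  also have "\<dots> = (\<Sum>e\<in>S. (c e)\<^sup>2)" by (intro sum.cong) (auto simp: 1 power2_eq_square)
  finally show "(q (\<Sum>e\<in>S. c e *\<^sub>R e))\<^sup>2 = (\<Sum>e\<in>S. (c e)\<^sup>2)" .
qed

lemma orth_proj:
  assumes q: "hilbertian q" and S: "orthonormal_set q S"
  shows "f \<in> S \<Longrightarrow> semi_inner q (x - orth_proj q S x) f = 0"
    and "(q (x - orth_proj q S x))\<^sup>2 = (q x)\<^sup>2 - (\<Sum>e\<in>S. (semi_inner q x e)\<^sup>2)"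
    and "(\<Sum>e\<in>S. (semi_inner q x e)\<^sup>2) \<le> (q x)\<^sup>2"
    and "q (x - orth_proj q S x) \<le> q x"
proof -
  show "f \<in> S \<Longrightarrow> semi_inner q (x - orth_proj q S x) f = 0"
    using orthonormal_comb(1)[OF q S, of f "semi_inner q x"]
    by (simp add: orth_proj_def linear_diff[OF semi_inner_linear(1)[OF q]])
  have "semi_inner q x (orth_proj q S x) = (\<Sum>e\<in>S. (semi_inner q x e)\<^sup>2)"
    by (simp add: orth_proj_def semi_inner_simps[OF q] power2_eq_square)
  then show *: "(q (x - orth_proj q S x))\<^sup>2 = (q x)\<^sup>2 - (\<Sum>e\<in>S. (semi_inner q x e)\<^sup>2)"
    using orthonormal_comb(2)[OF q S, of "semi_inner q x"]
    by (simp add: semi_inner_properties(6)[OF q] orth_proj_def)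
  then show "(\<Sum>e\<in>S. (semi_inner q x e)\<^sup>2) \<le> (q x)\<^sup>2"
    by (metis diff_ge_0_iff_ge zero_le_power2)
  have "(q (x - orth_proj q S x))\<^sup>2 \<le> (q x)\<^sup>2" unfolding * by (simp add: sum_nonneg)
  then show "q (x - orth_proj q S x) \<le> q x"
    using seminormD(1)[OF hilbertian_seminorm[OF q]] by (rule power2_le_imp_le)
qed

lemma orthonormal_insert:
  assumes q: "hilbertian q" and S: "orthonormal_set q S"
    and x: "q (x - orth_proj q S x) \<noteq> 0"
  defines "e \<equiv> (1 / q (x - orth_proj q S x)) *\<^sub>R (x - orth_proj q S x)"
  shows "orthonormal_set q (insert e S)" "e \<notin> S"
proof -
  have orth: "semi_inner q e f = 0" "semi_inner q f e = 0" if "f \<in> S" for f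
    using orth_proj(1)[OF q S that, of x] semi_inner_properties(2)[OF q]
    unfolding e_def by (simp_all add: linear_cmul[OF semi_inner_linear(1)[OF q]] linear_cmul[OF semi_inner_linear(2)[OF q]])
  have unit: "semi_inner q e e = 1"
    using x unfolding semi_inner_properties(3)[OF q] e_def seminormD(3)[OF hilbertian_seminorm[OF q]]
    by (simp add: power2_eq_square)
  show "e \<notin> S" using orth(1)[of e] unit by auto
  then show "orthonormal_set q (insert e S)"
    using S orth unit unfolding orthonormal_set_def by auto
qed

text \<open>Since \<open>q\<close> may have a kernel, the vectors of \<open>A\<close> need not lie
  in the span of \<open>S\<close>; only their remainders are null for \<open>q\<close>. These
  remainders reappear in \<open>minlos_bound\<close>.\<close>

lemma gram_schmidt:
  assumes q: "hilbertian q" and "finite A"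
  shows "\<exists>S. orthonormal_set q S \<and> (\<forall>a\<in>A. q (a - orth_proj q S a) = 0)"
  using \<open>finite A\<close>
proof (induction A)
  case empty
  then show ?case by (intro exI[of _ "{}"]) (auto simp: orthonormal_set_def)
next
  case (insert x A)
  then obtain S where S: "orthonormal_set q S" "\<And>a. a \<in> A \<Longrightarrow> q (a - orth_proj q S a) = 0" by blast
  have fin: "finite S" using S by (simp add: orthonormal_set_def)
  show ?case
  proof (cases "q (x - orth_proj q S x) = 0")
    case True
    then show ?thesis using S by blast
  next
    case False
    define r where "r = x - orth_proj q S x"
    define e where "e = (1 / q r) *\<^sub>R r"
    have e: "orthonormal_set q (insert e S)" "e \<notin> S"
      using orthonormal_insert[OF q S(1) False] by (simp_all add: e_def r_def)
    \<comment> \<open>By Pythagoras a larger orthonormal set leaves a smaller remainder, so vectors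
      already treated stay treated.\<close>
    have mono: "q (a - orth_proj q (insert e S) a) \<le> q (a - orth_proj q S a)" for a
    proof -
      have "(q (a - orth_proj q (insert e S) a))\<^sup>2 \<le> (q (a - orth_proj q S a))\<^sup>2"
        unfolding orth_proj(2)[OF q S(1)] orth_proj(2)[OF q e(1)] using e(2) fin by simp
      then show ?thesis using seminormD(1)[OF hilbertian_seminorm[OF q]] by (rule power2_le_imp_le)
    qed
    \<comment> \<open>As \<open>r\<close> is orthogonal to \<open>S\<close>, the coefficient of
      \<open>x\<close> on \<open>e\<close> is \<open>q r\<close>, and the new projection removes
      exactly \<open>r\<close>.\<close>
    have "semi_inner q x e = q r"
    proof -
      have "semi_inner q (orth_proj q S x) r = 0"
      proof -
        have "semi_inner q f r = 0" if "f \<in> S" for f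
          using orth_proj(1)[OF q S(1) that, of x] semi_inner_properties(2)[OF q] by (simp add: r_def)
        then show ?thesis unfolding orth_proj_def by (simp add: semi_inner_simps[OF q])
      qed
      moreover have "semi_inner q r r = (q r)\<^sup>2" by (rule semi_inner_properties(3)[OF q])
      ultimately have "semi_inner q x r = (q r)\<^sup>2"
        by (simp add: r_def linear_diff[OF semi_inner_linear(1)[OF q]])
      then show ?thesis using False
        by (simp add: e_def linear_cmul[OF semi_inner_linear(2)[OF q]] power2_eq_square r_def)
    qed
    then have "x - orth_proj q (insert e S) x = 0"
      using e(2) fin False by (simp add: orth_proj_def r_def e_def)
    then have "q (x - orth_proj q (insert e S) x) = 0"
      using seminormD(4)[OF hilbertian_seminorm[OF q]] by metis
    moreover have "q (a - orth_proj q (insert e S) a) = 0" if "a \<in> A" for a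
      using mono[of a] S(2)[OF that] seminormD(1)[OF hilbertian_seminorm[OF q]] by (metis antisym)
    ultimately show ?thesis using e(1) by blast
  qed
qed

section \<open>Hilbert-Schmidt bounds through Bessel families\<close>

text \<open>The condition on \<open>S\<close> says that sending coefficients to linear combinations
  is a contraction from l2 to \<open>q\<close>. For Hilbertian \<open>p\<close> \<le>
  \<open>q\<close> the least \<open>C\<close> is the squared Hilbert-Schmidt norm of the canonical
  map, without mention of completions or bases. Such families, unlike orthonormal ones, may contain
  vectors that are null for \<open>q\<close>, and they remain admissible when \<open>q\<close> is
  made smaller.\<close>

definition hs_bound :: "('a::real_vector \<Rightarrow> real) \<Rightarrow> ('a \<Rightarrow> real) \<Rightarrow> real \<Rightarrow> bool" where
  "hs_bound p q C \<longleftrightarrow> (\<forall>S. finite S \<longrightarrow>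
     (\<forall>c. (q (\<Sum>e\<in>S. c e *\<^sub>R e))\<^sup>2 \<le> (\<Sum>e\<in>S. (c e)\<^sup>2)) \<longrightarrow> (\<Sum>e\<in>S. (p e)\<^sup>2) \<le> C)"

lemma hs_boundD:
  "hs_bound p q C \<Longrightarrow> finite S \<Longrightarrow> (\<And>c. (q (\<Sum>e\<in>S. c e *\<^sub>R e))\<^sup>2 \<le> (\<Sum>e\<in>S. (c e)\<^sup>2)) \<Longrightarrow>
    (\<Sum>e\<in>S. (p e)\<^sup>2) \<le> C"
  unfolding hs_bound_def by blast

lemma hs_bound_orthonormal:
  assumes "hs_bound p q C" "hilbertian q" "orthonormal_set q S"
  shows "(\<Sum>e\<in>S. (p e)\<^sup>2) \<le> C"
  using assms(3) by (intro hs_boundD[OF assms(1)]) (auto simp: orthonormal_comb(2)[OF assms(2,3)] orthonormal_set_def)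

lemma hs_bound_mono:
  assumes "hs_bound p q C" "\<And>x. 0 \<le> q x" "\<And>x. q x \<le> q' x"
    and "\<And>x. (p' x)\<^sup>2 \<le> K * (p x)\<^sup>2" "0 \<le> K"
  shows "hs_bound p' q' (K * C)"
  unfolding hs_bound_def
proof (intro allI impI)
  fix S assume S: "finite S" "\<forall>c. (q' (\<Sum>e\<in>S. c e *\<^sub>R e))\<^sup>2 \<le> (\<Sum>e\<in>S. (c e)\<^sup>2)"
  have "(q (\<Sum>e\<in>S. c e *\<^sub>R e))\<^sup>2 \<le> (\<Sum>e\<in>S. (c e)\<^sup>2)" for c
    using S(2)[rule_format, of c] power_mono[OF assms(3,2), of "\<Sum>e\<in>S. c e *\<^sub>R e" 2] by linarith
  then have "(\<Sum>e\<in>S. (p e)\<^sup>2) \<le> C" using hs_boundD[OF assms(1) S(1)] by blast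
  then have "K * (\<Sum>e\<in>S. (p e)\<^sup>2) \<le> K * C" using assms(5) by (rule mult_left_mono)
  moreover have "(\<Sum>e\<in>S. (p' e)\<^sup>2) \<le> K * (\<Sum>e\<in>S. (p e)\<^sup>2)"
    unfolding sum_distrib_left by (intro sum_mono assms(4))
  ultimately show "(\<Sum>e\<in>S. (p' e)\<^sup>2) \<le> K * C" by linarith
qed

text \<open>Unlike the sum or the maximum, this combination of Hilbertian semi-norms is again
  Hilbertian, because the forms add up.\<close>

definition root_sum_sq :: "('i \<Rightarrow> 'a::real_vector \<Rightarrow> real) \<Rightarrow> 'i set \<Rightarrow> 'a \<Rightarrow> real" where
  "root_sum_sq p F x = sqrt (\<Sum>i\<in>F. (p i x)\<^sup>2)"

lemma root_sum_sq_L2: "root_sum_sq p F x = L2_set (\<lambda>i. p i x) F"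
  by (simp add: root_sum_sq_def L2_set_def)

lemma root_sum_sq_ge: 
  assumes "finite F" "i \<in> F" shows "p i x \<le> root_sum_sq p F x"
  using member_le_L2_set[OF assms, of "\<lambda>i. p i x"] unfolding root_sum_sq_L2 by simp

lemma hilbertian_root_sum_sq:
  fixes p :: "'i \<Rightarrow> 'a::real_vector \<Rightarrow> real"
  assumes p: "\<And>i. i \<in> F \<Longrightarrow> hilbertian (p i)"
  shows "hilbertian (root_sum_sq p F)"
proof -
  note s = seminormD[OF hilbertian_seminorm[OF p]]
  have "seminorm (root_sum_sq p F)"
    unfolding seminorm_def
  proof (intro conjI allI)
    fix x y :: 'a and a :: real
    show "0 \<le> root_sum_sq p F x" by (simp add: root_sum_sq_def sum_nonneg)
    have "root_sum_sq p F (x + y) \<le> L2_set (\<lambda>i. p i x + p i y) F"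
      unfolding root_sum_sq_L2 by (rule L2_set_mono) (auto simp: s)
    also have "\<dots> \<le> root_sum_sq p F x + root_sum_sq p F y"
      unfolding root_sum_sq_L2 by (rule L2_set_triangle_ineq)
    finally show "root_sum_sq p F (x + y) \<le> root_sum_sq p F x + root_sum_sq p F y" .
    have "root_sum_sq p F (a *\<^sub>R x) = sqrt (\<Sum>i\<in>F. a\<^sup>2 * (p i x)\<^sup>2)"
      unfolding root_sum_sq_def by (intro arg_cong[where f=sqrt] sum.cong) (auto simp: s power_mult_distrib)
    then show "root_sum_sq p F (a *\<^sub>R x) = \<bar>a\<bar> * root_sum_sq p F x"
      by (simp add: root_sum_sq_def sum_distrib_left[symmetric] real_sqrt_mult)
  qed
  moreover have "bilinear (\<lambda>x y. \<Sum>i\<in>F. semi_inner (p i) x y)"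
    unfolding bilinear_def
    by (intro conjI allI linear_compose_sum ballI semi_inner_linear p)
  moreover have "(root_sum_sq p F x)\<^sup>2 = (\<Sum>i\<in>F. semi_inner (p i) x x)" for x
  proof -
    have "(\<Sum>i\<in>F. semi_inner (p i) x x) = (\<Sum>i\<in>F. (p i x)\<^sup>2)"
      by (intro sum.cong refl semi_inner_properties(3) p)
    then show ?thesis by (simp add: root_sum_sq_def sum_nonneg)
  qed
  ultimately show ?thesis
    unfolding hilbertian_def
    by (intro conjI exI[of _ "\<lambda>x y. \<Sum>i\<in>F. semi_inner (p i) x y"])
      (auto intro!: sum.cong sum_nonneg simp: semi_inner_properties(2,3)[OF p])
qed

lemma hilbertian_cmult:
  assumes "hilbertian p" "0 \<le> K"
  shows "hilbertian (\<lambda>x. K * p x)"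
proof -
  obtain Q where Q: "bilinear Q" "\<And>x y. Q x y = Q y x" "\<And>x. 0 \<le> Q x x" "\<And>x. (p x)\<^sup>2 = Q x x"
    using assms unfolding hilbertian_def by blast
  have "bilinear (\<lambda>x y. K\<^sup>2 * Q x y)"
    using Q(1) unfolding bilinear_def by (auto intro!: linear_compose[unfolded o_def] simp: linear_iff algebra_simps)
  moreover have "seminorm (\<lambda>x. K * p x)"
    using hilbertian_seminorm[OF assms(1)] assms(2) unfolding seminorm_def
    by (auto simp: distrib_left[symmetric] mult_left_mono)
  ultimately show ?thesis unfolding hilbertian_def
    by (intro conjI exI[of _ "\<lambda>x y. K\<^sup>2 * Q x y"]) (auto simp: Q(2,3,4) power_mult_distrib)
qed

text \<open>
  Near-optimal orthonormal sets for the Hilbert--Schmidt sum: enlarging such a set by the normalized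
  remainder of \<open>x\<close> cannot gain more than \<open>\<epsilon>\<^sup>2\<close>.
\<close>
lemma hs_bound_finite_rank:
  assumes q: "hilbertian q" and p: "seminorm p" and le: "\<And>x. p x \<le> q x"
    and hs: "hs_bound p q C" and eps: "0 < \<epsilon>"
  shows "\<exists>S. orthonormal_set q S \<and> (\<forall>x. p (x - orth_proj q S x) \<le> \<epsilon> * q x)"
proof -
  define V where "V = {(\<Sum>e\<in>S. (p e)\<^sup>2) | S. orthonormal_set q S}"
  have "0 \<in> V" unfolding V_def by (auto intro!: exI[of _ "{}"] simp: orthonormal_set_def)
  have bdd: "bdd_above V"
    unfolding V_def using hs_bound_orthonormal[OF hs q] by (auto intro!: bdd_aboveI)
  have "Sup V - \<epsilon>\<^sup>2 < Sup V" using eps by simp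
  then obtain v where "v \<in> V" "Sup V - \<epsilon>\<^sup>2 < v"
    using less_cSup_iff[OF _ bdd] \<open>0 \<in> V\<close> by blast
  then obtain S where S: "orthonormal_set q S" "Sup V - \<epsilon>\<^sup>2 < (\<Sum>e\<in>S. (p e)\<^sup>2)"
    unfolding V_def by blast
  have fin: "finite S" using S(1) by (simp add: orthonormal_set_def)
  note sq = seminormD[OF hilbertian_seminorm[OF q]]
  have "p (x - orth_proj q S x) \<le> \<epsilon> * q x" for x
  proof (cases "q (x - orth_proj q S x) = 0")
    case True
    then show ?thesis using le[of "x - orth_proj q S x"] sq(1)[of x] eps
      by (metis mult_nonneg_nonneg less_imp_le order_trans)
  next
    case False
    define r where "r = x - orth_proj q S x"
    define e where "e = (1 / q r) *\<^sub>R r"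
    have e: "orthonormal_set q (insert e S)" "e \<notin> S"
      using orthonormal_insert[OF q S(1) False] by (simp_all add: e_def r_def)
    have "(\<Sum>f\<in>insert e S. (p f)\<^sup>2) \<le> Sup V"
      using e(1) by (intro cSup_upper bdd) (auto simp: V_def)
    then have "(p e)\<^sup>2 \<le> \<epsilon>\<^sup>2" using S(2) e(2) fin by simp
    then have "p e \<le> \<epsilon>" using eps by (auto intro: power2_le_imp_le)
    moreover have "p e = p r / q r" "q r > 0"
      using False sq(1)[of r] unfolding e_def r_def by (auto simp: seminormD(3)[OF p])
    ultimately have "p r \<le> \<epsilon> * q r" by (simp add: field_simps)
    also have "\<dots> \<le> \<epsilon> * q x" using orth_proj(4)[OF q S(1)] eps unfolding r_def by simp
    finally show ?thesis by (simp add: r_def)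
  qed
  then show ?thesis using S(1) by blast
qed

text \<open>Up to the error \<open>q x / (n + 1)\<close> every \<open>x\<close> lies in the span of
  a finite set \<open>S n\<close> that does not depend on \<open>x\<close>. Rational combinations of
  all the \<open>S n\<close> are therefore dense for \<open>p\<close>.\<close>

lemma hs_bound_separable:
  assumes q: "hilbertian q" and p: "seminorm p" and le: "\<And>x. p x \<le> q x" and hs: "hs_bound p q C"
  shows "\<exists>D. countable D \<and> (\<forall>x. \<forall>\<epsilon>>0. \<exists>d\<in>D. p (x - d) < \<epsilon>)"
proof -
  have "\<forall>n::nat. \<exists>S. orthonormal_set q S \<and> (\<forall>x. p (x - orth_proj q S x) \<le> (1 / real (Suc n)) * q x)"
    by (intro allI hs_bound_finite_rank[OF q p le hs]) auto
  then obtain S where S: "\<And>n. orthonormal_set q (S n)"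
    and S': "\<And>n x. p (x - orth_proj q (S n) x) \<le> (1 / real (Suc n)) * q x" by metis
  have finS: "finite (S n)" for n using S[of n] by (simp add: orthonormal_set_def)
  define D where "D = (\<Union>n. (\<lambda>c. \<Sum>e\<in>S n. of_rat (c e) *\<^sub>R e) ` (S n \<rightarrow>\<^sub>E (UNIV::rat set)))"
  have "countable D" unfolding D_def
    by (intro countable_UN countable_image countable_PiE finS) auto
  moreover have "\<exists>d\<in>D. p (x - d) < \<epsilon>" if "\<epsilon> > 0" for x \<epsilon>
  proof -
    obtain n :: nat where n: "2 * q x / \<epsilon> < real (Suc n)" using reals_Archimedean2 by (metis lessI less_trans of_nat_less_iff)
    then have "(1 / real (Suc n)) * q x < \<epsilon> / 2" using that by (simp add: field_simps)
    then have 1: "p (x - orth_proj q (S n) x) < \<epsilon> / 2" using S'[of x n] by linarith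
    \<comment> \<open>The 1 keeps \<open>K\<close> positive when \<open>p\<close> vanishes on
      \<open>S n\<close>; rounding each coefficient to within \<open>\<epsilon> / (2 * K)\<close>
      then costs less than \<open>\<epsilon> / 2\<close> in total.\<close>
    define K where "K = (\<Sum>e\<in>S n. p e) + 1"
    have K: "K > 0" unfolding K_def by (simp add: seminormD(1)[OF p] sum_nonneg add_nonneg_pos)
    have "\<exists>r::rat. \<bar>y - of_rat r\<bar> < \<epsilon> / (2 * K)" for y
    proof -
      have "0 < \<epsilon> / (2 * K)" using K that by simp
      then obtain r where "y - \<epsilon> / (2 * K) < of_rat r" "of_rat r < y"
        using of_rat_dense[of "y - \<epsilon> / (2 * K)" y] by auto
      then show ?thesis by (intro exI[of _ r]) auto
    qed
    then obtain r :: "real \<Rightarrow> rat" where r: "\<And>y. \<bar>y - of_rat (r y)\<bar> < \<epsilon> / (2 * K)" by metis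
    define d where "d = (\<Sum>e\<in>S n. of_rat (r (semi_inner q x e)) *\<^sub>R e)"
    have "d \<in> D" unfolding D_def d_def
      by (intro UN_I[of n] UNIV_I image_eqI[where x="restrict (\<lambda>e. r (semi_inner q x e)) (S n)"]) auto
    have psum: "p (sum f A) \<le> (\<Sum>e\<in>A. p (f e))" if "finite A" for f :: "'a \<Rightarrow> 'a" and A
      using that by (induction A)
        (auto simp: seminormD(4)[OF p] intro: order_trans[OF seminormD(2)[OF p]])
    have "p (orth_proj q (S n) x - d) \<le> (\<Sum>e\<in>S n. p ((semi_inner q x e - of_rat (r (semi_inner q x e))) *\<^sub>R e))"
      unfolding orth_proj_def d_def sum_subtractf[symmetric] scaleR_diff_left[symmetric]
      by (rule psum[OF finS])
    also have "\<dots> \<le> (\<Sum>e\<in>S n. \<epsilon> / (2 * K) * p e)"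
      unfolding seminormD(3)[OF p] using r seminormD(1)[OF p]
      by (intro sum_mono mult_right_mono) (auto intro: less_imp_le)
    also have "\<dots> = \<epsilon> / (2 * K) * (K - 1)" unfolding sum_distrib_left[symmetric] by (simp add: K_def)
    also have "\<dots> < \<epsilon> / 2" using K that by (simp add: field_simps)
    finally have "p (orth_proj q (S n) x - d) < \<epsilon> / 2" .
    moreover have "p (x - d) \<le> p (x - orth_proj q (S n) x) + p (orth_proj q (S n) x - d)"
      using seminormD(2)[OF p, of "x - orth_proj q (S n) x" "orth_proj q (S n) x - d"] by simp
    ultimately have "p (x - d) < \<epsilon>" using 1 by linarith
    then show ?thesis using \<open>d \<in> D\<close> by blast
  qed
  ultimately show ?thesis by blast
qed

section \<open>Topologies of semi-norms and Cauchy sequences\<close>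

lemma openin_seminorm_topology:
  "openin (seminorm_topology P) U \<longleftrightarrow>
     (\<forall>x\<in>U. \<exists>F \<epsilon>. finite F \<and> F \<subseteq> P \<and> \<epsilon> > 0 \<and> {y. \<forall>p\<in>F. p (x - y) < \<epsilon>} \<subseteq> U)"
  (is "_ \<longleftrightarrow> (\<forall>x\<in>U. ?R x)")
proof -
  let ?d = "\<lambda>(p :: 'a \<Rightarrow> real) x y. p (x - y)"
  have "(\<exists>F \<epsilon>. finite F \<and> F \<subseteq> ?d ` P \<and> \<epsilon> > 0 \<and> {y \<in> UNIV. \<forall>d\<in>F. d x y < \<epsilon>} \<subseteq> U) \<longleftrightarrow> ?R x" for x
  proof
    assume "\<exists>F \<epsilon>. finite F \<and> F \<subseteq> ?d ` P \<and> \<epsilon> > 0 \<and> {y \<in> UNIV. \<forall>d\<in>F. d x y < \<epsilon>} \<subseteq> U"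
    then obtain F \<epsilon> where F: "finite F" "F \<subseteq> ?d ` P" "\<epsilon> > 0" "{y \<in> UNIV. \<forall>d\<in>F. d x y < \<epsilon>} \<subseteq> U" by blast
    then obtain G where G: "G \<subseteq> P" "finite G" "F = ?d ` G" by (meson finite_subset_image)
    then show "?R x" using F(3,4) by (intro exI[of _ G] exI[of _ \<epsilon>]) auto
  next
    assume "?R x"
    then obtain F \<epsilon> where F: "finite F" "F \<subseteq> P" "\<epsilon> > 0" "{y. \<forall>p\<in>F. p (x - y) < \<epsilon>} \<subseteq> U" by blast
    then show "\<exists>F \<epsilon>. finite F \<and> F \<subseteq> ?d ` P \<and> \<epsilon> > 0 \<and> {y \<in> UNIV. \<forall>d\<in>F. d x y < \<epsilon>} \<subseteq> U"
      by (intro exI[of _ "?d ` F"] exI[of _ \<epsilon>]) auto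
  qed
  then show ?thesis unfolding seminorm_topology_def openin_gauge_topology by simp
qed

lemma topspace_seminorm_topology [simp]: "topspace (seminorm_topology P) = UNIV"
  by (simp add: seminorm_topology_def)

lemma openin_seminorm_ball:
  assumes "p \<in> P" "seminorm p"
  shows "openin (seminorm_topology P) {y. p (a - y) < \<epsilon>}"
  unfolding openin_seminorm_topology
proof
  fix x assume x: "x \<in> {y. p (a - y) < \<epsilon>}"
  have "p (a - y) < \<epsilon>" if "p (x - y) < \<epsilon> - p (a - x)" for y
    using seminormD(2)[OF assms(2), of "a - x" "x - y"] that by simp
  then show "\<exists>F \<epsilon>'. finite F \<and> F \<subseteq> P \<and> \<epsilon>' > 0 \<and> {y. \<forall>p\<in>F. p (x - y) < \<epsilon>'} \<subseteq> {y. p (a - y) < \<epsilon>}"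
    using assms x by (intro exI[of _ "{p}"] exI[of _ "\<epsilon> - p (a - x)"]) auto
qed

lemma limitin_seminorm_topology:
  assumes P: "\<forall>p\<in>P. seminorm p"
  shows "limitin (seminorm_topology P) f l F \<longleftrightarrow> (\<forall>p\<in>P. ((\<lambda>n. p (f n - l)) \<longlongrightarrow> 0) F)"
proof
  assume L: "limitin (seminorm_topology P) f l F"
  show "\<forall>p\<in>P. ((\<lambda>n. p (f n - l)) \<longlongrightarrow> 0) F"
  proof
    fix p assume p: "p \<in> P"
    show "((\<lambda>n. p (f n - l)) \<longlongrightarrow> 0) F"
    proof (rule tendstoI)
      fix e :: real assume "e > 0"
      have "l \<in> {y. p (l - y) < e}" using \<open>e > 0\<close> bspec[OF P p] by (simp add: seminormD)
      then have "\<forall>\<^sub>F n in F. f n \<in> {y. p (l - y) < e}"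
        using L openin_seminorm_ball[OF p bspec[OF P p]] unfolding limitin_def by blast
      then show "\<forall>\<^sub>F n in F. dist (p (f n - l)) 0 < e"
        by eventually_elim (use seminormD(1,7)[OF bspec[OF P p]] in simp)
    qed
  qed
next
  assume R: "\<forall>p\<in>P. ((\<lambda>n. p (f n - l)) \<longlongrightarrow> 0) F"
  show "limitin (seminorm_topology P) f l F"
    unfolding limitin_def
  proof (intro conjI allI impI)
    show "l \<in> topspace (seminorm_topology P)" by simp
    fix U assume U: "openin (seminorm_topology P) U \<and> l \<in> U"
    then obtain G e where G: "finite G" "G \<subseteq> P" "e > 0" "{y. \<forall>p\<in>G. p (l - y) < e} \<subseteq> U"
      unfolding openin_seminorm_topology by blast
    have "\<forall>\<^sub>F n in F. \<forall>p\<in>G. p (l - f n) < e"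
    proof (rule eventually_ball_finite[OF G(1)], rule ballI)
      fix p assume "p \<in> G"
      then have p: "p \<in> P" using G by auto
      have "\<forall>\<^sub>F n in F. dist (p (f n - l)) 0 < e" using R p G(3) by (intro tendstoD) auto
      then show "\<forall>\<^sub>F n in F. p (l - f n) < e"
        by eventually_elim (use seminormD(1,7)[OF bspec[OF P p]] in simp)
    qed
    then show "\<forall>\<^sub>F n in F. f n \<in> U" by eventually_elim (use G(4) in blast)
  qed
qed

lemma cauchy_seqs_seminorm:
  assumes P: "\<forall>p\<in>P. seminorm p"
  shows "x \<in> cauchy_seqs (seminorm_topology P) \<longleftrightarrow>
    (\<forall>p\<in>P. \<forall>\<epsilon>>0. \<exists>N. \<forall>m\<ge>N. \<forall>n\<ge>N. p (x m - x n) < \<epsilon>)"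
proof
  assume L: "x \<in> cauchy_seqs (seminorm_topology P)"
  show "\<forall>p\<in>P. \<forall>\<epsilon>>0. \<exists>N. \<forall>m\<ge>N. \<forall>n\<ge>N. p (x m - x n) < \<epsilon>"
  proof (intro ballI allI impI)
    fix p and \<epsilon> :: real assume p: "p \<in> P" and e: "\<epsilon> > 0"
    have "0 \<in> {y. p (0 - y) < \<epsilon>}" using e bspec[OF P p] by (simp add: seminormD)
    then obtain N where "\<forall>m\<ge>N. \<forall>n\<ge>N. x m - x n \<in> {y. p (0 - y) < \<epsilon>}"
      using L openin_seminorm_ball[OF p bspec[OF P p], of 0 \<epsilon>] unfolding cauchy_seqs_def by blast
    then show "\<exists>N. \<forall>m\<ge>N. \<forall>n\<ge>N. p (x m - x n) < \<epsilon>" using bspec[OF P p] by (auto simp: seminormD(7)[OF bspec[OF P p]])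
  qed
next
  assume R: "\<forall>p\<in>P. \<forall>\<epsilon>>0. \<exists>N. \<forall>m\<ge>N. \<forall>n\<ge>N. p (x m - x n) < \<epsilon>"
  show "x \<in> cauchy_seqs (seminorm_topology P)"
    unfolding cauchy_seqs_def
  proof (intro CollectI allI impI)
    fix U assume U: "openin (seminorm_topology P) U \<and> 0 \<in> U"
    then obtain G e where G: "finite G" "G \<subseteq> P" "e > 0" "{y. \<forall>p\<in>G. p (0 - y) < e} \<subseteq> U"
      unfolding openin_seminorm_topology by blast
    have "\<forall>p\<in>G. \<exists>N. \<forall>m\<ge>N. \<forall>n\<ge>N. p (x m - x n) < e" using R G by blast
    then obtain N where N: "\<And>p m n. p \<in> G \<Longrightarrow> m \<ge> N p \<Longrightarrow> n \<ge> N p \<Longrightarrow> p (x m - x n) < e" by metis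
    define K where "K = Max (insert 0 (N ` G))"
    have NK: "N p \<le> K" if "p \<in> G" for p unfolding K_def using G(1) that by (intro Max_ge) auto
    then have "x m - x n \<in> U" if "m \<ge> K" "n \<ge> K" for m n
    proof -
      have "p (0 - (x m - x n)) < e" if "p \<in> G" for p
      proof -
        have "p (x m - x n) < e" using N[OF that] NK[OF that] \<open>m \<ge> K\<close> \<open>n \<ge> K\<close> by (meson order_trans)
        moreover have "p (- (x m - x n)) = p (x m - x n)" using seminormD(5)[of p "x m - x n"] P G(2) that by blast
        ultimately show ?thesis by simp
      qed
      then show ?thesis using G(4) by blast
    qed
    then show "\<exists>N. \<forall>m\<ge>N. \<forall>n\<ge>N. x m - x n \<in> U" by blast
  qed
qed

lemma cauchy_rel_seminorm:
  assumes P: "\<forall>p\<in>P. seminorm p"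
  shows "(x, y) \<in> cauchy_rel (seminorm_topology P) \<longleftrightarrow> x \<in> cauchy_seqs (seminorm_topology P) \<and>
    y \<in> cauchy_seqs (seminorm_topology P) \<and> (\<forall>p\<in>P. (\<lambda>n. p (x n - y n)) \<longlonglongrightarrow> 0)"
  using limitin_seminorm_topology[OF P, of "\<lambda>n. x n - y n" 0 sequentially]
  by (simp add: cauchy_rel_def)

lemma equiv_cauchy_rel:
  assumes P: "\<forall>p\<in>P. seminorm p"
  shows "equiv (cauchy_seqs (seminorm_topology P)) (cauchy_rel (seminorm_topology P))"
proof (rule equivI)
  show "cauchy_rel (seminorm_topology P) \<subseteq> cauchy_seqs (seminorm_topology P) \<times> cauchy_seqs (seminorm_topology P)"
    by (auto simp: cauchy_rel_def)
  show "refl_on (cauchy_seqs (seminorm_topology P)) (cauchy_rel (seminorm_topology P))"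
    unfolding refl_on_def using P by (auto simp: cauchy_rel_seminorm[OF P] seminormD(4))
  show "sym (cauchy_rel (seminorm_topology P))"
    unfolding sym_def
  proof (intro allI impI)
    fix x y assume xy: "(x, y) \<in> cauchy_rel (seminorm_topology P)"
    have "(\<lambda>n. p (y n - x n)) = (\<lambda>n. p (x n - y n))" if "p \<in> P" for p
      using seminormD(7) P that by blast
    then show "(y, x) \<in> cauchy_rel (seminorm_topology P)"
      using xy unfolding cauchy_rel_seminorm[OF P] by (auto simp del: minus_diff_eq)
  qed
  show "trans (cauchy_rel (seminorm_topology P))"
    unfolding trans_def cauchy_rel_seminorm[OF P]
  proof (intro allI impI conjI ballI; (elim conjE)?)
    fix x y z p assume p: "p \<in> P" and "\<forall>p\<in>P. (\<lambda>n. p (x n - y n)) \<longlonglongrightarrow> 0" "\<forall>p\<in>P. (\<lambda>n. p (y n - z n)) \<longlonglongrightarrow> 0"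
    then have "(\<lambda>n. p (x n - y n) + p (y n - z n)) \<longlonglongrightarrow> 0 + 0" by (intro tendsto_add) auto
    then have lim: "(\<lambda>n. p (x n - y n) + p (y n - z n)) \<longlonglongrightarrow> 0" by simp
    have sp: "seminorm p" using P p by blast
    show "(\<lambda>n. p (x n - z n)) \<longlonglongrightarrow> 0"
    proof (rule Lim_null_comparison[OF _ lim], rule always_eventually, rule allI)
      fix n
      show "norm (p (x n - z n)) \<le> p (x n - y n) + p (y n - z n)"
        using seminormD(1)[OF sp, of "x n - z n"] seminormD(2)[OF sp, of "x n - y n" "y n - z n"] by simp
    qed
  qed auto
qed

lemma class_rep_props:
  assumes P: "\<forall>p\<in>P. seminorm p" and X: "X \<in> compl_carrier (seminorm_topology P)"
  shows "class_rep X \<in> X" "class_rep X \<in> cauchy_seqs (seminorm_topology P)"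
    "X = cauchy_rel (seminorm_topology P) `` {class_rep X}"
    "x \<in> X \<longleftrightarrow> (class_rep X, x) \<in> cauchy_rel (seminorm_topology P)"
proof -
  let ?T = "seminorm_topology P"
  note e = equiv_cauchy_rel[OF P]
  obtain y where y: "y \<in> cauchy_seqs ?T" "X = cauchy_rel ?T `` {y}"
    using X unfolding compl_carrier_def by (auto elim: quotientE)
  have "y \<in> X" unfolding y(2) using y(1) e by (metis equiv_class_self)
  then show r: "class_rep X \<in> X" unfolding class_rep_def by (rule someI[of "\<lambda>x. x \<in> X"])
  then show "class_rep X \<in> cauchy_seqs ?T" unfolding y(2) by (auto simp: cauchy_rel_def)
  have "(y, class_rep X) \<in> cauchy_rel ?T" using r y(2) by auto
  then show "X = cauchy_rel ?T `` {class_rep X}" using e y(2) by (metis equiv_class_eq)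
  then show "x \<in> X \<longleftrightarrow> (class_rep X, x) \<in> cauchy_rel ?T" by auto
qed

lemma class_in_carrier:
  "x \<in> cauchy_seqs T \<Longrightarrow> cauchy_rel T `` {x} \<in> compl_carrier T"
  unfolding compl_carrier_def by (rule quotientI)

lemma class_rep_class:
  assumes P: "\<forall>p\<in>P. seminorm p" and x: "x \<in> cauchy_seqs (seminorm_topology P)"
  shows "(class_rep (cauchy_rel (seminorm_topology P) `` {x}), x) \<in> cauchy_rel (seminorm_topology P)"
  using class_rep_props(4)[OF P class_in_carrier[OF x], of x]
    equiv_class_self[OF equiv_cauchy_rel[OF P] x] by simp

lemma cauchy_seminorm_convergent:
  assumes p: "seminorm p" and x: "\<And>\<epsilon>. \<epsilon> > 0 \<Longrightarrow> \<exists>N. \<forall>m\<ge>N. \<forall>n\<ge>N. p (x m - x n) < \<epsilon>"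
  shows "convergent (\<lambda>n. p (x n))"
proof -
  have "Cauchy (\<lambda>n. p (x n))"
    using x unfolding Cauchy_def dist_real_def
    by (meson le_less_trans seminormD(8)[OF p])
  then show ?thesis by (simp add: Cauchy_convergent_iff)
qed

lemma constant_cauchy:
  assumes P: "\<forall>p\<in>P. seminorm p"
  shows "(\<lambda>_. \<phi>) \<in> cauchy_seqs (seminorm_topology P)"
  unfolding cauchy_seqs_seminorm[OF P]
proof (intro ballI allI impI exI)
  fix p \<epsilon> and m n :: nat assume "p \<in> P" "(0::real) < \<epsilon>"
  then show "p (\<phi> - \<phi>) < \<epsilon>" using seminormD(4)[of p] P by simp
qed

text \<open>The inner product is a combination of the squared norms of \<open>x n + y n\<close>,
  \<open>x n\<close> and \<open>y n\<close>, and each of the three norms converges because its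
  sequence is Cauchy.\<close>

lemma semi_inner_cauchy_convergent:
  assumes q: "hilbertian q"
    and x: "\<And>\<epsilon>. \<epsilon> > 0 \<Longrightarrow> \<exists>N. \<forall>m\<ge>N. \<forall>n\<ge>N. q (x m - x n) < \<epsilon>"
    and y: "\<And>\<epsilon>. \<epsilon> > 0 \<Longrightarrow> \<exists>N. \<forall>m\<ge>N. \<forall>n\<ge>N. q (y m - y n) < \<epsilon>"
  shows "convergent (\<lambda>n. semi_inner q (x n) (y n))"
proof -
  note sq = hilbertian_seminorm[OF q]
  have "convergent (\<lambda>n. q (x n + y n))" 
  proof (rule cauchy_seminorm_convergent[OF sq])
    fix e :: real assume "e > 0"
    then have e2: "0 < e / 2" by simp
    obtain N where N: "\<forall>m\<ge>N. \<forall>n\<ge>N. q (x m - x n) < e / 2" using x[OF e2] by blast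
    obtain N' where N': "\<forall>m\<ge>N'. \<forall>n\<ge>N'. q (y m - y n) < e / 2" using y[OF e2] by blast
    have "q (x m + y m - (x n + y n)) < e" if "m \<ge> max N N'" "n \<ge> max N N'" for m n
    proof -
      have "q (x m + y m - (x n + y n)) = q ((x m - x n) + (y m - y n))" by (simp add: algebra_simps)
      also have "\<dots> \<le> q (x m - x n) + q (y m - y n)" by (rule seminormD(2)[OF sq])
      also have "\<dots> < e / 2 + e / 2" using N N' that by (intro add_strict_mono) auto
      finally show ?thesis by simp
    qed
    then show "\<exists>N. \<forall>m\<ge>N. \<forall>n\<ge>N. q (x m + y m - (x n + y n)) < e" by blast
  qed
  then obtain a where a: "(\<lambda>n. q (x n + y n)) \<longlonglongrightarrow> a" by (auto simp: convergent_def)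
  obtain b where b: "(\<lambda>n. q (x n)) \<longlonglongrightarrow> b" using cauchy_seminorm_convergent[OF sq x] by (auto simp: convergent_def)
  obtain c where c: "(\<lambda>n. q (y n)) \<longlonglongrightarrow> c" using cauchy_seminorm_convergent[OF sq y] by (auto simp: convergent_def)
  have "semi_inner q (x n) (y n) = ((q (x n + y n))\<^sup>2 - (q (x n))\<^sup>2 - (q (y n))\<^sup>2) / 2" for n
    using semi_inner_properties(5)[OF q, of "x n" "y n"] by simp
  moreover have "(\<lambda>n. ((q (x n + y n))\<^sup>2 - (q (x n))\<^sup>2 - (q (y n))\<^sup>2) / 2) \<longlonglongrightarrow> (a\<^sup>2 - b\<^sup>2 - c\<^sup>2) / 2"
    by (intro tendsto_intros a b c) auto
  ultimately have "(\<lambda>n. semi_inner q (x n) (y n)) \<longlonglongrightarrow> (a\<^sup>2 - b\<^sup>2 - c\<^sup>2) / 2" by (simp only:)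
  then show ?thesis unfolding convergent_def by blast
qed

text \<open>Changing the representative changes the inner product by at most
  \<open>q (x n - x' n) * q (y n)\<close>. Inner products in the completion may thus be computed
  along any representing sequence.\<close>

lemma semi_inner_equiv:
  assumes q: "hilbertian q" and xx: "(\<lambda>n. q (x n - x' n)) \<longlonglongrightarrow> 0"
    and y: "convergent (\<lambda>n. q (y n))" and l: "(\<lambda>n. semi_inner q (x n) (y n)) \<longlonglongrightarrow> l"
  shows "(\<lambda>n. semi_inner q (x' n) (y n)) \<longlonglongrightarrow> l"
proof -
  obtain c where c: "(\<lambda>n. q (y n)) \<longlonglongrightarrow> c" using y by (auto simp: convergent_def)
  have "(\<lambda>n. semi_inner q (x n - x' n) (y n)) \<longlonglongrightarrow> 0"
  proof (rule Lim_null_comparison)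
    show "(\<lambda>n. q (x n - x' n) * q (y n)) \<longlonglongrightarrow> 0" using tendsto_mult[OF xx c] by simp
    show "\<forall>\<^sub>F n in sequentially. norm (semi_inner q (x n - x' n) (y n)) \<le> q (x n - x' n) * q (y n)"
      using semi_inner_properties(4)[OF q] by simp
  qed
  then have "(\<lambda>n. semi_inner q (x n) (y n) - semi_inner q (x n - x' n) (y n)) \<longlonglongrightarrow> l - 0"
    by (intro tendsto_diff l)
  then show ?thesis by (simp add: linear_diff[OF semi_inner_linear(1)[OF q]])
qed

section \<open>Nuclear spaces\<close>

lemma seminorm_sum_le:
  assumes p: "seminorm p" and "finite A"
  shows "p (sum f A) \<le> (\<Sum>e\<in>A. p (f e))"
  using \<open>finite A\<close> by (induction A)
    (auto simp: seminormD(4)[OF p] intro: order_trans[OF seminormD(2)[OF p]])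

text \<open>
  \<open>\<beta> b\<close> is a Cauchy sequence in \<open>\<Phi>\<close> representing the basis vector \<open>b\<close> of the completion. The partial
  expansions of \<open>x\<close> converge in the completion, and the limit of the remainders is orthogonal to the
  whole basis, hence zero.
\<close>
lemma hilbert_basis_expansion:
  fixes q :: "'a::real_vector \<Rightarrow> real"
  assumes q: "hilbertian q" and E: "hilbert_basis q E"
  defines "\<beta> \<equiv> class_rep :: (nat \<Rightarrow> 'a) set \<Rightarrow> nat \<Rightarrow> 'a"
  assumes eps: "0 < \<epsilon>"
  shows "\<exists>F. finite F \<and> F \<subseteq> E \<and> (\<Sum>b\<in>F. (lim (\<lambda>n. semi_inner q x (\<beta> b n)))\<^sup>2) \<le> (q x)\<^sup>2 \<and>
    (\<forall>\<^sub>F k in sequentially. q (x - (\<Sum>b\<in>F. lim (\<lambda>n. semi_inner q x (\<beta> b n)) *\<^sub>R \<beta> b k)) < \<epsilon>)"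
proof -
  let ?T = "seminorm_topology {q}"
  note sq = hilbertian_seminorm[OF q]
  have P: "\<forall>p\<in>{q}. seminorm p" using sq by simp
  have cau: "\<exists>N. \<forall>m\<ge>N. \<forall>n\<ge>N. q (\<beta> b m - \<beta> b n) < e" if "b \<in> E" "e > 0" for b e
  proof -
    have "b \<in> compl_carrier ?T" using E that(1) by (auto simp: hilbert_basis_def hilbert_compl_def)
    then have "\<beta> b \<in> cauchy_seqs ?T" unfolding \<beta>_def by (rule class_rep_props(2)[OF P])
    then show ?thesis using that(2) by (auto simp: cauchy_seqs_seminorm[OF P])
  qed
  have cau0: "\<exists>N. \<forall>m\<ge>N. \<forall>n\<ge>N. q ((\<lambda>_. x) m - (\<lambda>_. x) n) < e" if "e > 0" for e :: real
    using that by (simp add: seminormD(4)[OF sq])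
  define c where "c b = lim (\<lambda>n. semi_inner q x (\<beta> b n))" for b
  have c: "(\<lambda>n. semi_inner q x (\<beta> b n)) \<longlonglongrightarrow> c b" if "b \<in> E" for b
    unfolding c_def using semi_inner_cauchy_convergent[OF q cau0 cau[OF that]] by (simp add: convergent_LIMSEQ_iff)
  have on: "(\<lambda>n. semi_inner q (\<beta> b n) (\<beta> b' n)) \<longlonglongrightarrow> (if b = b' then 1 else 0)" if "b \<in> E" "b' \<in> E" for b b'
  proof -
    have "lim (\<lambda>n. semi_inner q (\<beta> b n) (\<beta> b' n)) = (if b = b' then 1 else 0)"
      using E that unfolding hilbert_basis_def hilbert_inner_def \<beta>_def by blast
    moreover have "convergent (\<lambda>n. semi_inner q (\<beta> b n) (\<beta> b' n))"
      using semi_inner_cauchy_convergent[OF q cau[OF that(1)] cau[OF that(2)]] .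
    ultimately show ?thesis by (simp add: convergent_LIMSEQ_iff)
  qed
  \<comment> \<open>Basis vectors exist only as Cauchy sequences, so a finite combination of them is
    replaced by its value at stage \<open>k\<close>, and identities in the completion become limits
    in \<open>k\<close>.\<close>
  define lc where "lc d F k = (\<Sum>b\<in>F. d b *\<^sub>R \<beta> b k)" for d :: "(nat \<Rightarrow> 'a) set \<Rightarrow> real" and F k
  have lc_norm: "(\<lambda>k. (q (lc d F k))\<^sup>2) \<longlonglongrightarrow> (\<Sum>b\<in>F. (d b)\<^sup>2)" if F: "finite F" "F \<subseteq> E" for d F
  proof -
    have "(q (lc d F k))\<^sup>2 = (\<Sum>b\<in>F. \<Sum>b'\<in>F. d b * d b' * semi_inner q (\<beta> b k) (\<beta> b' k))" for k
      unfolding semi_inner_properties(3)[OF q, symmetric] lc_def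
      by (subst linear_sum[OF semi_inner_linear(1)[OF q]], subst linear_sum[OF semi_inner_linear(2)[OF q]])
        (simp add: linear_cmul[OF semi_inner_linear(1)[OF q]] linear_cmul[OF semi_inner_linear(2)[OF q]]
          mult.assoc mult.left_commute sum_distrib_left)
    moreover have "(\<lambda>k. \<Sum>b\<in>F. \<Sum>b'\<in>F. d b * d b' * semi_inner q (\<beta> b k) (\<beta> b' k)) \<longlonglongrightarrow>
        (\<Sum>b\<in>F. \<Sum>b'\<in>F. d b * d b' * (if b = b' then 1 else 0))"
      using F by (intro tendsto_sum tendsto_mult tendsto_const on) auto
    moreover have "(\<Sum>b\<in>F. \<Sum>b'\<in>F. d b * d b' * (if b = b' then 1 else 0)) = (\<Sum>b\<in>F. (d b)\<^sup>2)"
      using F(1) by (intro sum.cong refl) (simp add: if_distrib power2_eq_square cong: if_cong)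
    ultimately show ?thesis by simp
  qed
  have rem: "(\<lambda>k. (q (x - lc c F k))\<^sup>2) \<longlonglongrightarrow> (q x)\<^sup>2 - (\<Sum>b\<in>F. (c b)\<^sup>2)" if F: "finite F" "F \<subseteq> E" for F
  proof -
    have "(\<lambda>k. \<Sum>b\<in>F. c b * semi_inner q x (\<beta> b k)) \<longlonglongrightarrow> (\<Sum>b\<in>F. c b * c b)"
      using F by (intro tendsto_sum tendsto_mult tendsto_const c) auto
    then have "(\<lambda>k. semi_inner q x (lc c F k)) \<longlonglongrightarrow> (\<Sum>b\<in>F. (c b)\<^sup>2)"
      unfolding lc_def by (simp add: linear_sum[OF semi_inner_linear(2)[OF q]]
          linear_cmul[OF semi_inner_linear(2)[OF q]] power2_eq_square)
    then have "(\<lambda>k. (q x)\<^sup>2 - 2 * semi_inner q x (lc c F k) + (q (lc c F k))\<^sup>2) \<longlonglongrightarrow>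
        (q x)\<^sup>2 - 2 * (\<Sum>b\<in>F. (c b)\<^sup>2) + (\<Sum>b\<in>F. (c b)\<^sup>2)"
      by (intro tendsto_intros lc_norm F) auto
    then show ?thesis by (simp add: semi_inner_properties(6)[OF q])
  qed
  have bessel: "(\<Sum>b\<in>F. (c b)\<^sup>2) \<le> (q x)\<^sup>2" if F: "finite F" "F \<subseteq> E" for F
    using LIMSEQ_le_const[OF rem[OF F], of 0] by simp
  \<comment> \<open>The squared coefficients over finite sets are bounded by Bessel. A set
    \<open>F n\<close> that attains the supremum up to \<open>1 / Suc n\<close> leaves less than
    that to every finite set disjoint from it (\<open>extra\<close>); this works for a basis of any
    cardinality.\<close>
  define V where "V = {(\<Sum>b\<in>F. (c b)\<^sup>2) | F. finite F \<and> F \<subseteq> E}"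
  have V: "V \<noteq> {}" "bdd_above V" unfolding V_def using bessel by (auto intro!: bdd_aboveI)
  have "\<exists>F. finite F \<and> F \<subseteq> E \<and> Sup V - 1 / real (Suc n) < (\<Sum>b\<in>F. (c b)\<^sup>2)" for n
  proof -
    have "Sup V - 1 / real (Suc n) < Sup V" by simp
    then obtain v where "v \<in> V" "Sup V - 1 / real (Suc n) < v" using less_cSup_iff[OF V] by blast
    then show ?thesis unfolding V_def by blast
  qed
  then obtain F where F: "\<And>n. finite (F n)" "\<And>n. F n \<subseteq> E"
    and FV: "\<And>n::nat. Sup V - 1 / real (Suc n) < (\<Sum>b\<in>F n. (c b)\<^sup>2)" by metis
  have extra: "(\<Sum>b\<in>G - F n. (c b)\<^sup>2) < 1 / real (Suc n)" if G: "finite G" "G \<subseteq> E" for G n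
  proof -
    have "(\<Sum>b\<in>G \<union> F n. (c b)\<^sup>2) \<le> Sup V"
      using G F[of n] V by (intro cSup_upper) (auto simp: V_def)
    moreover have "(\<Sum>b\<in>G \<union> F n. (c b)\<^sup>2) = (\<Sum>b\<in>G - F n. (c b)\<^sup>2) + (\<Sum>b\<in>F n. (c b)\<^sup>2)"
      using sum.union_disjoint[of "G - F n" "F n" "\<lambda>b. (c b)\<^sup>2"] G(1) F(1)[of n]
      by (auto simp: Int_commute)
    ultimately show ?thesis using FV[of n] by linarith
  qed
  have "\<exists>K. \<forall>k\<ge>K. \<forall>k'\<ge>K. q (lc c (F n) k - lc c (F n) k') < 1 / real (Suc n)" for n
  proof -
    define \<eta> where "\<eta> = 1 / (real (Suc n) * (1 + (\<Sum>b\<in>F n. \<bar>c b\<bar>)))"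
    have S0: "0 \<le> (\<Sum>b\<in>F n. \<bar>c b\<bar>)" by (simp add: sum_nonneg)
    then have "\<eta> > 0" by (simp add: \<eta>_def add_pos_nonneg)
    then have "\<forall>b\<in>F n. \<exists>N. \<forall>m\<ge>N. \<forall>k\<ge>N. q (\<beta> b m - \<beta> b k) < \<eta>" using cau F(2) by blast
    then obtain N where N: "\<And>b m k. b \<in> F n \<Longrightarrow> N b \<le> m \<Longrightarrow> N b \<le> k \<Longrightarrow> q (\<beta> b m - \<beta> b k) < \<eta>" by metis
    define K where "K = Max (insert 0 (N ` F n))"
    have NK: "N b \<le> K" if "b \<in> F n" for b unfolding K_def using F(1)[of n] that by (intro Max_ge) auto
    have "q (lc c (F n) k - lc c (F n) k') < 1 / real (Suc n)" if "K \<le> k" "K \<le> k'" for k k'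
    proof -
      have "lc c (F n) k - lc c (F n) k' = (\<Sum>b\<in>F n. c b *\<^sub>R (\<beta> b k - \<beta> b k'))"
        by (simp add: lc_def sum_subtractf scaleR_diff_right)
      then have "q (lc c (F n) k - lc c (F n) k') \<le> (\<Sum>b\<in>F n. q (c b *\<^sub>R (\<beta> b k - \<beta> b k')))"
        using seminorm_sum_le[OF sq F(1)] by metis
      also have "\<dots> \<le> (\<Sum>b\<in>F n. \<bar>c b\<bar> * \<eta>)"
      proof (rule sum_mono)
        fix b assume "b \<in> F n"
        then have "q (\<beta> b k - \<beta> b k') \<le> \<eta>" using N[of b k k'] NK[of b] that by auto
        then show "q (c b *\<^sub>R (\<beta> b k - \<beta> b k')) \<le> \<bar>c b\<bar> * \<eta>"
          by (simp add: seminormD(3)[OF sq] mult_left_mono)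
      qed
      also have "\<dots> = (\<Sum>b\<in>F n. \<bar>c b\<bar>) * \<eta>" by (simp add: sum_distrib_right)
      also have "\<dots> < (1 + (\<Sum>b\<in>F n. \<bar>c b\<bar>)) * \<eta>" using \<open>\<eta> > 0\<close> by simp
      also have "\<dots> = 1 / real (Suc n)" using add_pos_nonneg[OF zero_less_one S0] by (simp add: \<eta>_def)
      finally show ?thesis .
    qed
    then show ?thesis by blast
  qed
  then obtain K where K: "\<And>n k k'. K n \<le> k \<Longrightarrow> K n \<le> k' \<Longrightarrow> q (lc c (F n) k - lc c (F n) k') < 1 / real (Suc n)" by metis
  \<comment> \<open>A diagonal choice: one vector of \<Phi> within \<open>1 / Suc n\<close> of all
    later stages of the remainder after \<open>F n\<close>.\<close>
  define y where "y n = x - lc c (F n) (K n)" for n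
  have y_near: "q (y n - (x - lc c (F n) k)) < 1 / real (Suc n)" if "K n \<le> k" for n k
    using K[OF that, of "K n"] by (simp add: y_def)
  \<comment> \<open>The sets \<open>F n\<close> are not nested. At a common late stage
    \<open>k\<close> the two remainders differ by the combinations over \<open>F m - F n\<close> and
    \<open>F n - F m\<close>, whose norms are small by \<open>extra\<close>.\<close>
  have y_diff: "q (y m - y n) \<le> 2 * (1 / real (Suc m)) + 2 * (1 / real (Suc n)) + sqrt (1 / real (Suc m)) + sqrt (1 / real (Suc n))" for m n
  proof -
    have 1: "q (y m - y n) \<le> 1 / real (Suc m) + 1 / real (Suc n) + q (lc c (F m - F n) k) + q (lc c (F n - F m) k)"
      if k: "K m \<le> k" "K n \<le> k" for k
    proof -
      have eq: "lc c (F n) k - lc c (F m) k = lc c (F n - F m) k - lc c (F m - F n) k"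
      proof -
        have "lc c (F n) k = lc c (F n - F m) k + lc c (F n \<inter> F m) k" for n m
          unfolding lc_def by (subst sum.union_disjoint[symmetric]) (auto simp: F(1) intro: sum.cong)
        from this[of n m] this[of m n] show ?thesis by (simp add: Int_commute)
      qed
      have "y m - y n = (y m - (x - lc c (F m) k)) + ((lc c (F n) k - lc c (F m) k) - (y n - (x - lc c (F n) k)))"
        by (simp add: algebra_simps)
      then have "q (y m - y n) \<le> q (y m - (x - lc c (F m) k)) + q ((lc c (F n) k - lc c (F m) k) - (y n - (x - lc c (F n) k)))"
        using seminormD(2)[OF sq] by metis
      moreover have "q ((lc c (F n) k - lc c (F m) k) - (y n - (x - lc c (F n) k))) \<le> q (lc c (F n) k - lc c (F m) k) + q (y n - (x - lc c (F n) k))"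
        by (rule seminormD(6)[OF sq])
      moreover have "q (lc c (F n) k - lc c (F m) k) \<le> q (lc c (F n - F m) k) + q (lc c (F m - F n) k)"
        unfolding eq by (rule seminormD(6)[OF sq])
      ultimately show ?thesis using y_near[OF k(1)] y_near[OF k(2)] by linarith
    qed
    have 2: "\<forall>\<^sub>F k in sequentially. q (lc c (F m - F n) k) < sqrt (1 / real (Suc n))" for m n
    proof -
      have "\<forall>\<^sub>F k in sequentially. (q (lc c (F m - F n) k))\<^sup>2 < 1 / real (Suc n)"
        using F extra[OF F] by (intro order_tendstoD(2)[OF lc_norm]) auto
      then show ?thesis by eventually_elim (rule real_less_rsqrt)
    qed
    have "\<forall>\<^sub>F k in sequentially. q (y m - y n) \<le> 2 * (1 / real (Suc m)) + 2 * (1 / real (Suc n)) + sqrt (1 / real (Suc m)) + sqrt (1 / real (Suc n))"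
      using 2[of m n] 2[of n m] eventually_ge_at_top[of "K m"] eventually_ge_at_top[of "K n"]
    proof eventually_elim
      case (elim k)
      have "0 \<le> 1 / real (Suc m)" "0 \<le> 1 / real (Suc n)" by auto
      then show ?case using 1[of k] elim by linarith
    qed
    then show ?thesis by simp
  qed
  have y_cau: "\<exists>N. \<forall>m\<ge>N. \<forall>n\<ge>N. q (y m - y n) < e" if "e > 0" for e
  proof -
    define g where "g n = 2 * (1 / real (Suc n)) + sqrt (1 / real (Suc n))" for n
    have "g \<longlonglongrightarrow> 2 * 0 + sqrt 0" unfolding g_def
      using LIMSEQ_inverse_real_of_nat by (intro tendsto_intros) (simp_all add: divide_inverse)
    then have "\<forall>\<^sub>F n in sequentially. g n < e / 2" using that by (intro order_tendstoD) auto
    then obtain N where "\<And>n. n \<ge> N \<Longrightarrow> g n < e / 2" unfolding eventually_sequentially by blast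
    then have N: "g n < e / 2" if "n \<ge> N" for n using that by blast
    have "q (y m - y n) < e" if "m \<ge> N" "n \<ge> N" for m n
    proof -
      have "q (y m - y n) \<le> g m + g n" using y_diff[of m n] unfolding g_def by linarith
      then show ?thesis using N[OF that(1)] N[OF that(2)] by linarith
    qed
    then show ?thesis by blast
  qed
  then have y_seq: "y \<in> cauchy_seqs ?T" by (simp add: cauchy_seqs_seminorm[OF P])
  define Y where "Y = cauchy_rel ?T `` {y}"
  have rY: "(class_rep Y, y) \<in> cauchy_rel ?T" unfolding Y_def by (rule class_rep_class[OF P y_seq])
  obtain Bq where Bq: "\<And>n. q (y n) \<le> Bq"
  proof -
    have "Bseq (\<lambda>n. q (y n))" using convergent_imp_Bseq[OF cauchy_seminorm_convergent[OF sq y_cau]] .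
    then show ?thesis using that unfolding Bseq_def by (metis abs_le_D1 real_norm_def)
  qed
  \<comment> \<open>In the limit of \<open>k\<close> the remainder after \<open>F n\<close> has
    inner product 0 with \<open>b\<close> if \<open>b\<close> is in \<open>F n\<close>, and
    \<open>c b\<close> otherwise; in the latter case \<open>extra\<close> for the singleton of
    \<open>b\<close> makes \<open>c b\<close> small.\<close>
  have orth: "(\<lambda>n. semi_inner q (y n) (\<beta> b n)) \<longlonglongrightarrow> 0" if b: "b \<in> E" for b
  proof (rule LIMSEQ_I)
    fix r :: real assume r: "r > 0"
    define e where "e = r / (2 * (\<bar>Bq\<bar> + 3))"
    have e: "e > 0" using r by (simp add: e_def)
    obtain N1 where N1: "\<And>m n. m \<ge> N1 \<Longrightarrow> n \<ge> N1 \<Longrightarrow> q (\<beta> b m - \<beta> b n) < e" using cau[OF b e] by blast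
    have "(\<lambda>n. sqrt (1 / real (Suc n)) + 2 * (1 / real (Suc n))) \<longlonglongrightarrow> sqrt 0 + 2 * 0"
      using LIMSEQ_inverse_real_of_nat by (intro tendsto_intros) (simp_all add: divide_inverse)
    then have "\<forall>\<^sub>F n in sequentially. sqrt (1 / real (Suc n)) + 2 * (1 / real (Suc n)) < e"
      using e by (intro order_tendstoD) auto
    then obtain N2 where N2: "\<And>n. n \<ge> N2 \<Longrightarrow> sqrt (1 / real (Suc n)) + 2 * (1 / real (Suc n)) < e"
      unfolding eventually_sequentially by blast
    have "\<bar>semi_inner q (y n) (\<beta> b n)\<bar> < r" if n: "n \<ge> max N1 N2" for n
    proof -
      have N2n: "sqrt (1 / real (Suc n)) + 2 * (1 / real (Suc n)) < e" using N2 n by auto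
      have sq0: "0 \<le> sqrt (1 / real (Suc n))" "0 \<le> 1 / real (Suc n)" by simp_all
      define R where "R k = x - lc c (F n) k" for k
      have "(\<lambda>k. semi_inner q x (\<beta> b k) - (\<Sum>b'\<in>F n. c b' * semi_inner q (\<beta> b' k) (\<beta> b k))) \<longlonglongrightarrow>
          c b - (\<Sum>b'\<in>F n. c b' * (if b' = b then 1 else 0))"
        using F b by (intro tendsto_diff tendsto_sum tendsto_mult tendsto_const c on) auto
      moreover have "semi_inner q (R k) (\<beta> b k) = semi_inner q x (\<beta> b k) - (\<Sum>b'\<in>F n. c b' * semi_inner q (\<beta> b' k) (\<beta> b k))" for k
        unfolding R_def lc_def by (simp add: linear_diff[OF semi_inner_linear(1)[OF q]]
          linear_sum[OF semi_inner_linear(1)[OF q]] linear_cmul[OF semi_inner_linear(1)[OF q]])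
      moreover have "(\<Sum>b'\<in>F n. c b' * (if b' = b then 1 else 0)) = (if b \<in> F n then c b else 0)"
        using F(1)[of n] by (simp add: if_distrib cong: if_cong)
      ultimately have lim: "(\<lambda>k. semi_inner q (R k) (\<beta> b k)) \<longlonglongrightarrow> c b - (if b \<in> F n then c b else 0)" by simp
      have "\<bar>c b - (if b \<in> F n then c b else 0)\<bar> \<le> sqrt (1 / real (Suc n))"
      proof (cases "b \<in> F n")
        case False
        then have "(c b)\<^sup>2 < 1 / real (Suc n)" using extra[of "{b}" n] b by (simp add: insert_Diff_if)
        then have "\<bar>c b\<bar> < sqrt (1 / real (Suc n))" by (intro real_less_rsqrt) simp
        then show ?thesis using False by simp
      qed simp
      then have "\<bar>c b - (if b \<in> F n then c b else 0)\<bar> < e"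
        using N2n sq0 by linarith
      then have ev1: "\<forall>\<^sub>F k in sequentially. \<bar>semi_inner q (R k) (\<beta> b k)\<bar> < e"
        using order_tendstoD(2)[OF tendsto_rabs[OF lim]] by blast
      have "(\<lambda>k. (q (\<beta> b k))\<^sup>2) \<longlonglongrightarrow> 1" using on[OF b b] by (simp add: semi_inner_properties(3)[OF q])
      then have "\<forall>\<^sub>F k in sequentially. (q (\<beta> b k))\<^sup>2 < 2\<^sup>2" by (rule order_tendstoD) simp
      then have ev2: "\<forall>\<^sub>F k in sequentially. q (\<beta> b k) < 2"
        by eventually_elim (rule power_less_imp_less_base[where n=2], auto)
      have "\<exists>k. \<bar>semi_inner q (R k) (\<beta> b k)\<bar> < e \<and> q (\<beta> b k) < 2 \<and> N1 \<le> k \<and> K n \<le> k"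
        using eventually_happens[OF eventually_conj[OF ev1 eventually_conj[OF ev2
          eventually_conj[OF eventually_ge_at_top[of N1] eventually_ge_at_top[of "K n"]]]]] by simp
      then obtain k where k: "\<bar>semi_inner q (R k) (\<beta> b k)\<bar> < e" "q (\<beta> b k) < 2" "N1 \<le> k" "K n \<le> k" by blast
      \<comment> \<open>Both \<open>\<beta> b n\<close> and \<open>y n\<close> are moved to one
        stage \<open>k\<close>; together with the remainder term this accounts for
        \<open>Bq + 2\<close> multiples of \<open>e\<close>.\<close>
      have "semi_inner q (y n) (\<beta> b n) = semi_inner q (y n) (\<beta> b n - \<beta> b k) + semi_inner q (y n - R k) (\<beta> b k) + semi_inner q (R k) (\<beta> b k)"
        by (simp add: linear_diff[OF semi_inner_linear(1)[OF q]] linear_diff[OF semi_inner_linear(2)[OF q]])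
      moreover have "\<bar>semi_inner q (y n) (\<beta> b n - \<beta> b k)\<bar> \<le> \<bar>Bq\<bar> * e"
      proof -
        have "q (y n) * q (\<beta> b n - \<beta> b k) \<le> \<bar>Bq\<bar> * e"
          using Bq[of n] N1[of n k] n k(3) seminormD(1)[OF sq] by (intro mult_mono) (auto intro: less_imp_le)
        then show ?thesis using semi_inner_properties(4)[OF q, of "y n" "\<beta> b n - \<beta> b k"] by linarith
      qed
      moreover have "\<bar>semi_inner q (y n - R k) (\<beta> b k)\<bar> \<le> e"
      proof -
        have "q (y n - R k) * q (\<beta> b k) \<le> (1 / real (Suc n)) * 2"
          using y_near[OF k(4)] k(2) seminormD(1)[OF sq] unfolding R_def by (intro mult_mono) (auto intro: less_imp_le)
        moreover have "2 * (1 / real (Suc n)) \<le> e" using N2n sq0 by linarith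
        ultimately show ?thesis using semi_inner_properties(4)[OF q, of "y n - R k" "\<beta> b k"] by linarith
      qed
      ultimately have "\<bar>semi_inner q (y n) (\<beta> b n)\<bar> \<le> (\<bar>Bq\<bar> + 2) * e" using k(1) by (simp add: algebra_simps)
      also have "\<dots> < r" using r add_pos_nonneg[OF _ mult_nonneg_nonneg[of r "\<bar>Bq\<bar>"], of "r * 4"] by (simp add: e_def field_simps)
      finally show ?thesis .
    qed
    then show "\<exists>N. \<forall>n\<ge>N. norm (semi_inner q (y n) (\<beta> b n) - 0) < r"
      by (intro exI[of _ "max N1 N2"]) (simp only: diff_zero real_norm_def, blast)
  qed
  \<comment> \<open>The only use of the maximality of the basis: an element of the completion
    orthogonal to all of \<open>E\<close> is zero.\<close>
  have "Y = compl_embed ?T 0"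
  proof -
    have "Y \<in> hilbert_compl q" unfolding hilbert_compl_def Y_def by (rule class_in_carrier[OF y_seq])
    moreover have "hilbert_inner q Y b = 0" if b: "b \<in> E" for b
    proof -
      have "(\<lambda>n. q (y n - class_rep Y n)) \<longlonglongrightarrow> 0"
        using rY seminormD(7)[OF sq] by (simp add: cauchy_rel_seminorm[OF P])
      then have "(\<lambda>n. semi_inner q (class_rep Y n) (\<beta> b n)) \<longlonglongrightarrow> 0"
        using semi_inner_equiv[OF q _ cauchy_seminorm_convergent[OF sq cau[OF b]] orth[OF b]] by blast
      then show ?thesis unfolding hilbert_inner_def \<beta>_def by (rule limI)
    qed
    ultimately show ?thesis using E unfolding hilbert_basis_def by blast
  qed
  then have "y \<in> cauchy_rel ?T `` {\<lambda>_. 0}"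
    using equiv_class_self[OF equiv_cauchy_rel[OF P] y_seq] by (simp add: Y_def compl_embed_def)
  then have "(\<lambda>n. q (0 - y n)) \<longlonglongrightarrow> 0" by (simp add: cauchy_rel_seminorm[OF P])
  then have "(\<lambda>n. q (y n)) \<longlonglongrightarrow> 0" by (simp add: seminormD(5)[OF sq])
  then have "(\<lambda>n. q (y n) + 1 / real (Suc n)) \<longlonglongrightarrow> 0 + 0"
    using LIMSEQ_inverse_real_of_nat by (intro tendsto_add) (simp_all add: divide_inverse)
  then have "\<forall>\<^sub>F n in sequentially. q (y n) + 1 / real (Suc n) < \<epsilon>" using eps by (intro order_tendstoD) auto
  then obtain n where n: "q (y n) + 1 / real (Suc n) < \<epsilon>" unfolding eventually_sequentially by blast
  have "q (x - lc c (F n) k) < \<epsilon>" if "K n \<le> k" for k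
  proof -
    have "q (x - lc c (F n) k) = q (y n - (y n - (x - lc c (F n) k)))" by simp
    also have "\<dots> \<le> q (y n) + q (y n - (x - lc c (F n) k))" by (rule seminormD(6)[OF sq])
    finally show ?thesis using y_near[OF that] n by linarith
  qed
  then have "\<forall>\<^sub>F k in sequentially. q (x - lc c (F n) k) < \<epsilon>" unfolding eventually_sequentially by blast
  then show ?thesis using F[of n] bessel[OF F, of n] unfolding lc_def c_def
    by (intro exI[of _ "F n"] conjI)
qed


section \<open>From Hilbert-Schmidt maps of completions to Hilbert-Schmidt bounds\<close>

lemma has_sum_finite_sum:
  fixes f :: "'g \<Rightarrow> 'b \<Rightarrow> real"
  assumes "finite G" "\<And>g. g \<in> G \<Longrightarrow> f g summable_on E"
  shows "((\<lambda>b. \<Sum>g\<in>G. f g b) has_sum (\<Sum>g\<in>G. infsum (f g) E)) E"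
  using assms by (induction G) (auto intro!: has_sum_add)

text \<open>The sum over one given basis has to dominate the sum over every Bessel family in \<Phi>.
  Both are compared through finitely many functionals \<open>lf g\<close>: for each of them, the
  squares over a Bessel family are at most the squares over the basis (\<open>main\<close>).\<close>

lemma hs_bound_hilbert_schmidt_map:
  fixes p q :: "'a::real_vector \<Rightarrow> real"
  assumes p: "hilbertian p" and q: "hilbertian q" and le: "\<And>x. p x \<le> q x"
    and hs: "hilbert_schmidt_map p q"
  shows "\<exists>C. hs_bound p q C"
proof -
  obtain E where E: "hilbert_basis q E"
    and summ: "(\<lambda>e. (hilbert_norm p (canonical_map p q e))\<^sup>2) summable_on E"
    using hs unfolding hilbert_schmidt_map_def by blast
  note sq = hilbertian_seminorm[OF q] and sp = hilbertian_seminorm[OF p]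
  define \<beta> where "\<beta> = (class_rep :: (nat \<Rightarrow> 'a) set \<Rightarrow> nat \<Rightarrow> 'a)"
  define h where "h b = hilbert_norm p (canonical_map p q b)" for b
  have Pq: "\<forall>p\<in>{q}. seminorm p" and Pp: "\<forall>r\<in>{p}. seminorm r" using sq sp by auto
  have \<beta>q: "\<beta> b \<in> cauchy_seqs (seminorm_topology {q})" if "b \<in> E" for b
    using E that unfolding \<beta>_def by (intro class_rep_props(2)[OF Pq]) (auto simp: hilbert_basis_def hilbert_compl_def)
  have qp: "x \<in> cauchy_seqs (seminorm_topology {p})" if "x \<in> cauchy_seqs (seminorm_topology {q})" for x
    using that le unfolding cauchy_seqs_seminorm[OF Pq] cauchy_seqs_seminorm[OF Pp]
    by (auto) (meson le_less_trans)
  have cauq: "\<exists>N. \<forall>m\<ge>N. \<forall>n\<ge>N. q (\<beta> b m - \<beta> b n) < e" if "b \<in> E" "e > 0" for b e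
    using \<beta>q[OF that(1)] that(2) by (auto simp: cauchy_seqs_seminorm[OF Pq])
  have caup: "\<exists>N. \<forall>m\<ge>N. \<forall>n\<ge>N. p (\<beta> b m - \<beta> b n) < e" if "b \<in> E" "e > 0" for b e
    using qp[OF \<beta>q[OF that(1)]] that(2) by (auto simp: cauchy_seqs_seminorm[OF Pp])
  \<comment> \<open>The sequence that represents \<open>b\<close> for \<open>q\<close> also
    represents its image under the canonical map, since \<open>p\<close> \<le>
    \<open>q\<close>.\<close>
  have h: "(\<lambda>k. p (\<beta> b k)) \<longlonglongrightarrow> h b" if b: "b \<in> E" for b
  proof -
    have bc: "b \<in> compl_carrier (seminorm_topology {q})"
      using E b by (auto simp: hilbert_basis_def hilbert_compl_def)
    have "canonical_map p q b = cauchy_rel (seminorm_topology {p}) `` {\<beta> b}"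
    proof -
      have "(x, y) \<in> cauchy_rel (seminorm_topology {p})" if "(x, y) \<in> cauchy_rel (seminorm_topology {q})" for x y
        using that qp le seminormD(1)[OF sp] unfolding cauchy_rel_seminorm[OF Pq] cauchy_rel_seminorm[OF Pp]
        by (auto intro!: Lim_null_comparison[of "\<lambda>n. p (x n - y n)" "\<lambda>n. q (x n - y n)"])
      then have "(\<beta> b, x) \<in> cauchy_rel (seminorm_topology {p})" if "x \<in> b" for x
        using that class_rep_props(4)[OF Pq bc] unfolding \<beta>_def by blast
      moreover have "\<beta> b \<in> b" unfolding \<beta>_def by (rule class_rep_props(1)[OF Pq bc])
      ultimately show ?thesis
        using equiv_cauchy_rel[OF Pp] unfolding canonical_map_def equiv_def by (blast dest: transD)
    qed
    then have "(class_rep (canonical_map p q b), \<beta> b) \<in> cauchy_rel (seminorm_topology {p})"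
      using class_rep_class[OF Pp qp[OF \<beta>q[OF b]]] by simp
    then have cau: "class_rep (canonical_map p q b) \<in> cauchy_seqs (seminorm_topology {p})"
      and dz: "(\<lambda>n. p (class_rep (canonical_map p q b) n - \<beta> b n)) \<longlonglongrightarrow> 0"
      by (auto simp: cauchy_rel_seminorm[OF Pp])
    have "convergent (\<lambda>n. p (class_rep (canonical_map p q b) n))"
      using cau by (intro cauchy_seminorm_convergent[OF sp]) (auto simp: cauchy_seqs_seminorm[OF Pp])
    then have l: "(\<lambda>n. p (class_rep (canonical_map p q b) n)) \<longlonglongrightarrow> h b"
      by (simp add: h_def hilbert_norm_def convergent_LIMSEQ_iff)
    have "(\<lambda>n. p (\<beta> b n) - p (class_rep (canonical_map p q b) n)) \<longlonglongrightarrow> 0"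
      by (rule Lim_null_comparison[OF _ dz])
        (use seminormD(8)[OF sp] seminormD(7)[OF sp] in \<open>auto intro!: always_eventually\<close>)
    from tendsto_add[OF this l] show ?thesis by simp
  qed
  have "hs_bound p q (\<Sum>\<^sub>\<infinity>b\<in>E. (h b)\<^sup>2)"
    unfolding hs_bound_def
  proof (intro allI impI)
    fix S assume fS: "finite S" and S: "\<forall>c. (q (\<Sum>e\<in>S. c e *\<^sub>R e))\<^sup>2 \<le> (\<Sum>e\<in>S. (c e)\<^sup>2)"
    \<comment> \<open>The set is orthonormal for \<open>p\<close>: the squares of the
      \<open>lf g\<close> sum up to the square of \<open>p\<close> exactly on \<open>S\<close>, and
      by Bessel to at most the square of \<open>h b\<close> on the basis.\<close>
    obtain G where G: "orthonormal_set p G" "\<forall>a\<in>S. p (a - orth_proj p G a) = 0"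
      using gram_schmidt[OF p fS] by blast
    have fG: "finite G" using G by (simp add: orthonormal_set_def)
    define lf where "lf g x = semi_inner p x g" for g x
    define lfl where "lfl g b = lim (\<lambda>k. lf g (\<beta> b k))" for g b
    have lin: "linear (lf g)" for g unfolding lf_def by (rule semi_inner_linear(1)[OF p])
    have conv: "(\<lambda>k. lf g (\<beta> b k)) \<longlonglongrightarrow> lfl g b" if "b \<in> E" for g b
    proof -
      have "\<exists>N. \<forall>m\<ge>N. \<forall>n\<ge>N. p ((\<lambda>_. g) m - (\<lambda>_. g) n) < e" if "e > 0" for e :: real
        using that by (simp add: seminormD(4)[OF sp])
      then have "convergent (\<lambda>k. semi_inner p (\<beta> b k) g)"
        using semi_inner_cauchy_convergent[OF p caup[OF that], of "\<lambda>_. g"] by blast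
      then show ?thesis unfolding lfl_def lf_def by (simp add: convergent_LIMSEQ_iff)
    qed
    have bes: "(\<Sum>g\<in>G. (lfl g b)\<^sup>2) \<le> (h b)\<^sup>2" if b: "b \<in> E" for b
    proof (rule LIMSEQ_le)
      show "(\<lambda>k. \<Sum>g\<in>G. (lf g (\<beta> b k))\<^sup>2) \<longlonglongrightarrow> (\<Sum>g\<in>G. (lfl g b)\<^sup>2)"
        by (intro tendsto_sum tendsto_power conv b)
      show "(\<lambda>k. (p (\<beta> b k))\<^sup>2) \<longlonglongrightarrow> (h b)\<^sup>2" by (intro tendsto_power h b)
      show "\<exists>N. \<forall>n\<ge>N. (\<Sum>g\<in>G. (lf g (\<beta> b n))\<^sup>2) \<le> (p (\<beta> b n))\<^sup>2"
        using orth_proj(3)[OF p G(1)] unfolding lf_def by blast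
    qed
    have summ_l: "(\<lambda>b. (lfl g b)\<^sup>2) summable_on E" if "g \<in> G" for g
    proof (rule summable_on_comparison_test[OF summ])
      fix b assume b: "b \<in> E"
      have "(lfl g b)\<^sup>2 \<le> (\<Sum>g\<in>G. (lfl g b)\<^sup>2)" using fG that by (intro member_le_sum) auto
      then show "(lfl g b)\<^sup>2 \<le> (hilbert_norm p (canonical_map p q b))\<^sup>2"
        using bes[OF b] by (simp add: h_def)
    qed simp
    \<comment> \<open>Duality: the functional is tested on \<open>x\<close>, the combination of
      \<open>S\<close> with its own values as coefficients. Then \<open>lf g x\<close> is \<sigma>,
      the Bessel condition bounds the square of \<open>q x\<close> by \<sigma>, and Cauchy-Schwarz
      against the basis gives \<sigma> \<le> sqrt \<sigma> * sqrt \<Lambda>.\<close>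
    have main: "(\<Sum>s\<in>S. (lf g s)\<^sup>2) \<le> (\<Sum>\<^sub>\<infinity>b\<in>E. (lfl g b)\<^sup>2)" if g: "g \<in> G" for g
    proof -
      define x where "x = (\<Sum>s\<in>S. lf g s *\<^sub>R s)"
      define \<sigma> where "\<sigma> = (\<Sum>s\<in>S. (lf g s)\<^sup>2)"
      define \<Lambda> where "\<Lambda> = (\<Sum>\<^sub>\<infinity>b\<in>E. (lfl g b)\<^sup>2)"
      have \<sigma>0: "0 \<le> \<sigma>" unfolding \<sigma>_def by (simp add: sum_nonneg)
      have \<Lambda>0: "0 \<le> \<Lambda>" unfolding \<Lambda>_def by (simp add: infsum_nonneg)
      have lx: "lf g x = \<sigma>" unfolding x_def \<sigma>_def by (simp add: linear_sum[OF lin] linear_cmul[OF lin] power2_eq_square)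
      have qx: "(q x)\<^sup>2 \<le> \<sigma>" using S unfolding x_def \<sigma>_def by blast
      have pg: "\<bar>lf g y\<bar> \<le> q y" for y
      proof -
        have "(p g)\<^sup>2 = 1" using G(1) g by (simp add: orthonormal_set_def semi_inner_properties(3)[OF p, symmetric])
        then have "p g = 1" using seminormD(1)[OF sp, of g] by (simp add: power2_eq_1_iff)
        then show ?thesis using semi_inner_properties(4)[OF p, of y g] le[of y] by (simp add: lf_def)
      qed
      \<comment> \<open>The \<epsilon> is the norm of the remainder in the basis expansion of
        \<open>x\<close>; it enters directly because \<open>lf g\<close> is bounded by
        \<open>q\<close>.\<close>
      have "\<sigma> \<le> q x * sqrt \<Lambda> + \<epsilon>" if \<epsilon>: "\<epsilon> > 0" for \<epsilon>
      proof -
        define c where "c b = lim (\<lambda>n. semi_inner q x (\<beta> b n))" for b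
        obtain F where F: "finite F" "F \<subseteq> E" and c2: "(\<Sum>b\<in>F. (c b)\<^sup>2) \<le> (q x)\<^sup>2"
          and Fe: "\<forall>\<^sub>F k in sequentially. q (x - (\<Sum>b\<in>F. c b *\<^sub>R \<beta> b k)) < \<epsilon>"
          using hilbert_basis_expansion[OF q E \<epsilon>, of x] unfolding \<beta>_def c_def by blast
        have cauc: "\<exists>N. \<forall>m\<ge>N. \<forall>n\<ge>N. q ((\<lambda>_. x) m - (\<lambda>_. x) n) < e" if "e > 0" for e :: real
          using that by (simp add: seminormD(4)[OF sq])
        have c: "(\<lambda>n. semi_inner q x (\<beta> b n)) \<longlonglongrightarrow> c b" if "b \<in> E" for b
          unfolding c_def using semi_inner_cauchy_convergent[OF q cauc cauq[OF that]] by (simp add: convergent_LIMSEQ_iff)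
        have "(\<Sum>b\<in>F. (lfl g b)\<^sup>2) \<le> \<Lambda>"
          unfolding \<Lambda>_def using finite_sum_le_infsum[OF summ_l[OF g] F] by simp
        have lim: "(\<lambda>k. (\<Sum>b\<in>F. c b * lf g (\<beta> b k)) + \<epsilon>) \<longlonglongrightarrow> (\<Sum>b\<in>F. c b * lfl g b) + \<epsilon>"
          using F by (intro tendsto_add tendsto_sum tendsto_mult tendsto_const conv) auto
        have "\<forall>\<^sub>F k in sequentially. \<sigma> \<le> (\<Sum>b\<in>F. c b * lf g (\<beta> b k)) + \<epsilon>"
          using Fe
        proof eventually_elim
          case (elim k)
          have "lf g x = lf g (\<Sum>b\<in>F. c b *\<^sub>R \<beta> b k) + lf g (x - (\<Sum>b\<in>F. c b *\<^sub>R \<beta> b k))"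
            by (simp add: linear_diff[OF lin])
          moreover have "lf g (\<Sum>b\<in>F. c b *\<^sub>R \<beta> b k) = (\<Sum>b\<in>F. c b * lf g (\<beta> b k))"
            by (simp add: linear_sum[OF lin] linear_cmul[OF lin])
          ultimately show ?case using lx pg[of "x - (\<Sum>b\<in>F. c b *\<^sub>R \<beta> b k)"] elim by linarith
        qed
        then have "\<sigma> \<le> (\<Sum>b\<in>F. c b * lfl g b) + \<epsilon>"
          using lim by (intro tendsto_lowerbound[OF lim]) auto
        also have "(\<Sum>b\<in>F. c b * lfl g b) \<le> L2_set c F * L2_set (lfl g) F"
          by (rule order_trans[OF _ L2_set_mult_ineq]) (intro sum_mono, simp add: abs_mult[symmetric])
        also have "\<dots> \<le> q x * sqrt \<Lambda>"
          using c2 \<open>(\<Sum>b\<in>F. (lfl g b)\<^sup>2) \<le> \<Lambda>\<close> seminormD(1)[OF sq, of x]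
          by (intro mult_mono) (auto simp: L2_set_def intro: real_le_lsqrt sum_nonneg)
        finally show ?thesis by simp
      qed
      then have "\<sigma> \<le> q x * sqrt \<Lambda>" by (rule field_le_epsilon)
      also have "\<dots> \<le> sqrt \<sigma> * sqrt \<Lambda>" using qx \<Lambda>0 by (intro mult_right_mono real_le_rsqrt) auto
      finally have "\<sigma> \<le> sqrt \<sigma> * sqrt \<Lambda>" .
      then have "sqrt \<sigma> * sqrt \<sigma> \<le> sqrt \<sigma> * sqrt \<Lambda>" using \<sigma>0 by simp
      then have "\<sigma> = 0 \<or> sqrt \<sigma> \<le> sqrt \<Lambda>"
        using mult_left_le_imp_le[of "sqrt \<sigma>" "sqrt \<sigma>" "sqrt \<Lambda>"] \<sigma>0 by fastforce
      then show ?thesis using \<Lambda>0 unfolding \<sigma>_def[symmetric] \<Lambda>_def[symmetric] by auto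
    qed
    have "(\<Sum>s\<in>S. (p s)\<^sup>2) = (\<Sum>s\<in>S. \<Sum>g\<in>G. (lf g s)\<^sup>2)"
    proof (rule sum.cong[OF refl])
      fix s assume "s \<in> S"
      then have "0 = (p s)\<^sup>2 - (\<Sum>g\<in>G. (lf g s)\<^sup>2)"
        using G(2) orth_proj(2)[OF p G(1), of s] unfolding lf_def by simp
      then show "(p s)\<^sup>2 = (\<Sum>g\<in>G. (lf g s)\<^sup>2)" by simp
    qed
    also have "\<dots> = (\<Sum>g\<in>G. \<Sum>s\<in>S. (lf g s)\<^sup>2)" by (rule sum.swap)
    also have "\<dots> \<le> (\<Sum>g\<in>G. \<Sum>\<^sub>\<infinity>b\<in>E. (lfl g b)\<^sup>2)" by (intro sum_mono main)
    also have "\<dots> = (\<Sum>\<^sub>\<infinity>b\<in>E. \<Sum>g\<in>G. (lfl g b)\<^sup>2)"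
      by (rule infsumI[symmetric], rule has_sum_finite_sum[OF fG]) (simp add: summ_l)
    also have "\<dots> \<le> (\<Sum>\<^sub>\<infinity>b\<in>E. (h b)\<^sup>2)"
      by (rule infsum_mono[OF has_sum_imp_summable[OF has_sum_finite_sum[OF fG]]])
        (use summ bes summ_l in \<open>simp_all add: h_def\<close>)
    finally show "(\<Sum>s\<in>S. (p s)\<^sup>2) \<le> (\<Sum>\<^sub>\<infinity>b\<in>E. (h b)\<^sup>2)" .
  qed
  then show ?thesis by blast
qed


section \<open>Continuous semi-norms and Hilbert-Schmidt majorants\<close>

lemma continuous_map_seminorm_iff:
  fixes p :: "'a::real_vector \<Rightarrow> real"
  assumes P: "\<forall>r\<in>P. seminorm r" and p: "seminorm p"
  shows "continuous_map (seminorm_topology P) euclideanreal p \<longleftrightarrow>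
    (\<exists>F C. finite F \<and> F \<subseteq> P \<and> 0 \<le> C \<and> (\<forall>x. p x \<le> C * (\<Sum>r\<in>F. r x)))"
proof
  assume "continuous_map (seminorm_topology P) euclideanreal p"
  from openin_continuous_map_preimage[OF this, of "{..<1}"]
  have "openin (seminorm_topology P) {x. p x < 1}" by simp
  moreover have "0 \<in> {x. p x < 1}" by (simp add: seminormD(4)[OF p])
  ultimately have "\<exists>F \<epsilon>. finite F \<and> F \<subseteq> P \<and> \<epsilon> > 0 \<and> {y. \<forall>r\<in>F. r (0 - y) < \<epsilon>} \<subseteq> {x. p x < 1}"
    by (rule openin_seminorm_topology[THEN iffD1, THEN bspec])
  then obtain F e where F: "finite F" "F \<subseteq> P" "e > 0"
    and Fe: "{y. \<forall>r\<in>F. r (0 - y) < e} \<subseteq> {x. p x < 1}" by blast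
  have s: "seminorm r" if "r \<in> F" for r using P F that by blast
  have "p x \<le> (1 / e) * (\<Sum>r\<in>F. r x)" for x
  proof (rule field_le_epsilon)
    fix d :: real assume d: "d > 0"
    \<comment> \<open>The summand \<open>d * e\<close> makes the scaling factor \<open>e / t\<close>
      meaningful even where all semi-norms of \<open>F\<close> vanish at \<open>x\<close>; it costs
      only the additive \<open>d\<close>.\<close>
    define t where "t = (\<Sum>r\<in>F. r x) + d * e"
    have t0: "0 \<le> (\<Sum>r\<in>F. r x)" using s seminormD(1) by (auto intro!: sum_nonneg)
    then have t: "t > 0" using d F(3) by (simp add: t_def add_nonneg_pos)
    have "r (0 - (e / t) *\<^sub>R x) < e" if r: "r \<in> F" for r
    proof -
      have "r x \<le> (\<Sum>r\<in>F. r x)" using F(1) r s seminormD(1) by (intro member_le_sum) auto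
      moreover have "0 < d * e" using d F(3) by simp
      ultimately have "r x < t" unfolding t_def by linarith
      then have "e / t * r x < e" using F(3) t by (simp add: field_simps)
      then show ?thesis using seminormD(3,5)[OF s[OF r]] t F(3) by simp
    qed
    then have "p ((e / t) *\<^sub>R x) < 1" using Fe by blast
    then have "e / t * p x < 1" using seminormD(3)[OF p] t F(3) by simp
    then have "p x < t / e" using t F(3) by (simp add: field_simps)
    then show "p x \<le> (1 / e) * (\<Sum>r\<in>F. r x) + d" using F(3) by (simp add: t_def field_simps)
  qed
  then show "\<exists>F C. finite F \<and> F \<subseteq> P \<and> 0 \<le> C \<and> (\<forall>x. p x \<le> C * (\<Sum>r\<in>F. r x))"
    using F by (intro exI[of _ F] exI[of _ "1 / e"]) auto
next
  assume "\<exists>F C. finite F \<and> F \<subseteq> P \<and> 0 \<le> C \<and> (\<forall>x. p x \<le> C * (\<Sum>r\<in>F. r x))"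
  then obtain F C where F: "finite F" "F \<subseteq> P" "0 \<le> C" "\<And>x. p x \<le> C * (\<Sum>r\<in>F. r x)" by blast
  show "continuous_map (seminorm_topology P) euclideanreal p"
    unfolding continuous_map_def
  proof (intro conjI allI impI)
    fix U :: "real set" assume "openin euclideanreal U"
    then have U: "open U" by simp
    show "openin (seminorm_topology P) {x \<in> topspace (seminorm_topology P). p x \<in> U}"
      unfolding openin_seminorm_topology
    proof
      fix x assume "x \<in> {x \<in> topspace (seminorm_topology P). p x \<in> U}"
      then obtain e where e: "e > 0" "\<And>y. \<bar>y - p x\<bar> < e \<Longrightarrow> y \<in> U"
        using U unfolding open_dist dist_real_def by auto
      define d where "d = e / (C * real (card F) + 1)"
      have Cn: "C * real (card F) + 1 > 0" using F(3) by (simp add: add_nonneg_pos)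
      have d: "d > 0" using e(1) Cn by (simp add: d_def)
      have "p y \<in> U" if y: "\<forall>r\<in>F. r (x - y) < d" for y
      proof (rule e(2))
        have "(\<Sum>r\<in>F. r (x - y)) \<le> real (card F) * d"
          using sum_bounded_above[of F "\<lambda>r. r (x - y)" d] y by (simp add: less_imp_le)
        then have "C * (\<Sum>r\<in>F. r (x - y)) \<le> C * (real (card F) * d)" using F(3) by (rule mult_left_mono)
        also have "\<dots> < (C * real (card F) + 1) * d" using d by (simp add: algebra_simps)
        also have "\<dots> = e" using Cn by (simp add: d_def)
        finally have "p (x - y) < e" using F(4)[of "x - y"] by linarith
        then show "\<bar>p y - p x\<bar> < e" using seminormD(8)[OF p, of y x] seminormD(7)[OF p, of x y] by linarith
      qed
      then show "\<exists>G \<epsilon>. finite G \<and> G \<subseteq> P \<and> \<epsilon> > 0 \<and>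
          {y. \<forall>r\<in>G. r (x - y) < \<epsilon>} \<subseteq> {x \<in> topspace (seminorm_topology P). p x \<in> U}"
        using F d by (intro exI[of _ F] exI[of _ d]) auto
    qed
  qed simp
qed

lemma continuous_seminorm_le_sum:
  assumes P: "\<forall>r\<in>P. seminorm r" and p: "seminorm p" and I: "finite I"
    and s: "\<And>i. i \<in> I \<Longrightarrow> seminorm (s i)"
    and c: "\<And>i. i \<in> I \<Longrightarrow> continuous_map (seminorm_topology P) euclideanreal (s i)"
    and le: "0 \<le> C" "\<And>x. p x \<le> C * (\<Sum>i\<in>I. s i x)"
  shows "continuous_map (seminorm_topology P) euclideanreal p"
proof -
  have "\<forall>i\<in>I. \<exists>F K. finite F \<and> F \<subseteq> P \<and> 0 \<le> K \<and> (\<forall>x. s i x \<le> K * (\<Sum>r\<in>F. r x))"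
    using continuous_map_seminorm_iff[OF P s] c by blast
  then obtain F K where F: "\<And>i. i \<in> I \<Longrightarrow> finite (F i) \<and> F i \<subseteq> P \<and> 0 \<le> K i \<and> (\<forall>x. s i x \<le> K i * (\<Sum>r\<in>F i. r x))"
    by metis
  define G where "G = (\<Union>i\<in>I. F i)"
  have G: "finite G" "G \<subseteq> P" using F I by (auto simp: G_def)
  have "p x \<le> (C * (\<Sum>i\<in>I. K i)) * (\<Sum>r\<in>G. r x)" for x
  proof -
    have "s i x \<le> K i * (\<Sum>r\<in>G. r x)" if "i \<in> I" for i
    proof -
      have "(\<Sum>r\<in>F i. r x) \<le> (\<Sum>r\<in>G. r x)"
        using that G P seminormD(1) by (intro sum_mono2) (auto simp: G_def)
      then show ?thesis using F[OF that] by (meson mult_left_mono order_trans)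
    qed
    then have "(\<Sum>i\<in>I. s i x) \<le> (\<Sum>i\<in>I. K i) * (\<Sum>r\<in>G. r x)"
      unfolding sum_distrib_right by (rule sum_mono)
    then show ?thesis using le(2)[of x] mult_left_mono[OF _ le(1)] by (metis mult.assoc order_trans)
  qed
  moreover have "0 \<le> C * (\<Sum>i\<in>I. K i)" using le(1) F by (simp add: sum_nonneg)
  ultimately show ?thesis using continuous_map_seminorm_iff[OF P p] G by blast
qed

text \<open>Nuclearity provides majorants only for members of the generating family. A continuous
  semi-norm is bounded by finitely many members, and the Euclidean combination of their majorants,
  suitably scaled, serves for all of them at once.\<close>

lemma nuclear_space_dominating:
  fixes T :: "'a::real_vector topology"
  assumes T: "nuclear_space T" and p: "seminorm p" "continuous_map T euclideanreal p"
  shows "\<exists>q C. hilbertian q \<and> continuous_map T euclideanreal q \<and> (\<forall>x. p x \<le> q x) \<and> hs_bound p q C"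
proof -
  obtain P where Ph: "\<And>p. p \<in> P \<Longrightarrow> hilbertian p" and TP: "T = seminorm_topology P"
    and hs: "\<And>p. p \<in> P \<Longrightarrow> \<exists>q\<in>P. (\<forall>x. p x \<le> q x) \<and> hilbert_schmidt_map p q"
    using T unfolding nuclear_space_def by blast
  have P: "\<forall>r\<in>P. seminorm r" using Ph hilbertian_seminorm by blast
  obtain F K where F: "finite F" "F \<subseteq> P" "0 \<le> K" "\<And>x. p x \<le> K * (\<Sum>r\<in>F. r x)"
    using p continuous_map_seminorm_iff[OF P p(1)] unfolding TP by blast
  have "\<exists>q C. q \<in> P \<and> (\<forall>x. r x \<le> q x) \<and> hs_bound r q C" if "r \<in> F" for r
  proof -
    have rP: "r \<in> P" using F that by blast
    then obtain q where q: "q \<in> P" "\<And>x. r x \<le> q x" "hilbert_schmidt_map r q" using hs by blast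
    then show ?thesis using hs_bound_hilbert_schmidt_map[OF Ph[OF rP] Ph[OF q(1)] q(2,3)] by blast
  qed
  then obtain q C where q: "\<And>r. r \<in> F \<Longrightarrow> q r \<in> P" "\<And>r x. r \<in> F \<Longrightarrow> r x \<le> q r x"
    and C: "\<And>r. r \<in> F \<Longrightarrow> hs_bound r (q r) (C r)" by metis
  \<comment> \<open>The factor \<open>card F\<close> compares the sum over \<open>F\<close> with the
    Euclidean combination; the 1 ensures that \<open>Q\<close> also dominates every
    \<open>q r\<close>.\<close>
  define K' where "K' = K * real (card F) + 1"
  have K': "1 \<le> K'" "0 \<le> K'" using F(3) by (simp_all add: K'_def add_nonneg_pos)
  have rF: "0 \<le> r x" if "r \<in> F" for r x using seminormD(1) P F that by blast
  have r_le: "r x \<le> root_sum_sq (\<lambda>r. r) F x" if "r \<in> F" for r x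
    using root_sum_sq_ge[OF F(1) that, of "\<lambda>r. r"] by simp
  have rss0: "0 \<le> root_sum_sq s F x" for s :: "('a \<Rightarrow> real) \<Rightarrow> 'a \<Rightarrow> real" and x by (simp add: root_sum_sq_def sum_nonneg)
  have p_le: "p x \<le> K' * root_sum_sq (\<lambda>r. r) F x" for x
  proof -
    have "(\<Sum>r\<in>F. r x) \<le> real (card F) * root_sum_sq (\<lambda>r. r) F x"
      using sum_bounded_above[of F "\<lambda>r. r x"] r_le by simp
    then have "K * (\<Sum>r\<in>F. r x) \<le> K * (real (card F) * root_sum_sq (\<lambda>r. r) F x)" using F(3) by (rule mult_left_mono)
    also have "\<dots> \<le> K' * root_sum_sq (\<lambda>r. r) F x" using rss0[of "\<lambda>r. r" x] by (simp add: K'_def algebra_simps)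
    finally show ?thesis using F(4)[of x] by linarith
  qed
  define Q where "Q x = K' * root_sum_sq q F x" for x
  have hQ: "hilbertian Q" unfolding Q_def
    by (intro hilbertian_cmult hilbertian_root_sum_sq K' Ph q(1))
  have q_le: "root_sum_sq q F x \<le> Q x" for x
    using mult_right_mono[OF K'(1) rss0[of q x]] by (simp add: Q_def)
  have mono: "root_sum_sq (\<lambda>r. r) F x \<le> root_sum_sq q F x" for x
    unfolding root_sum_sq_L2 by (rule L2_set_mono) (auto intro: q(2) rF)
  have pQ: "p x \<le> Q x" for x
    using p_le[of x] mult_left_mono[OF mono[of x] K'(2)] unfolding Q_def by linarith
  have "hs_bound p Q (K'\<^sup>2 * (\<Sum>r\<in>F. C r))"
    unfolding hs_bound_def
  proof (intro allI impI)
    fix S assume S: "finite S" "\<forall>c. (Q (\<Sum>e\<in>S. c e *\<^sub>R e))\<^sup>2 \<le> (\<Sum>e\<in>S. (c e)\<^sup>2)"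
    have "(\<Sum>e\<in>S. (r e)\<^sup>2) \<le> 1 * C r" if r: "r \<in> F" for r
    proof -
      have "hs_bound r Q (1 * C r)"
      proof (rule hs_bound_mono[OF C[OF r]])
        show "0 \<le> q r x" for x using seminormD(1) P q(1)[OF r] by blast
        show "q r x \<le> Q x" for x using root_sum_sq_ge[OF F(1) r, of q x] q_le[of x] by linarith
      qed auto
      then show ?thesis using S by (auto intro: hs_boundD)
    qed
    then have "(\<Sum>r\<in>F. \<Sum>e\<in>S. (r e)\<^sup>2) \<le> (\<Sum>r\<in>F. C r)" by (intro sum_mono) simp
    then have "K'\<^sup>2 * (\<Sum>r\<in>F. \<Sum>e\<in>S. (r e)\<^sup>2) \<le> K'\<^sup>2 * (\<Sum>r\<in>F. C r)" by (rule mult_left_mono) simp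
    moreover have "(\<Sum>e\<in>S. (p e)\<^sup>2) \<le> (\<Sum>e\<in>S. K'\<^sup>2 * (\<Sum>r\<in>F. (r e)\<^sup>2))"
    proof (rule sum_mono)
      fix e
      have "(p e)\<^sup>2 \<le> (K' * root_sum_sq (\<lambda>r. r) F e)\<^sup>2" by (intro power_mono p_le seminormD(1)[OF p(1)])
      then show "(p e)\<^sup>2 \<le> K'\<^sup>2 * (\<Sum>r\<in>F. (r e)\<^sup>2)"
        by (simp add: power_mult_distrib root_sum_sq_def sum_nonneg)
    qed
    moreover have "(\<Sum>e\<in>S. K'\<^sup>2 * (\<Sum>r\<in>F. (r e)\<^sup>2)) = K'\<^sup>2 * (\<Sum>r\<in>F. \<Sum>e\<in>S. (r e)\<^sup>2)"
      unfolding sum_distrib_left[symmetric] by (subst sum.swap) simp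
    ultimately show "(\<Sum>e\<in>S. (p e)\<^sup>2) \<le> K'\<^sup>2 * (\<Sum>r\<in>F. C r)" by linarith
  qed
  moreover have "continuous_map T euclideanreal Q"
    unfolding TP
  proof (rule continuous_seminorm_le_sum[OF P hilbertian_seminorm[OF hQ] F(1)])
    show "seminorm (q r)" if "r \<in> F" for r using P q(1)[OF that] by blast
    show "continuous_map (seminorm_topology P) euclideanreal (q r)" if "r \<in> F" for r
      using P q(1)[OF that] by (intro iffD2[OF continuous_map_seminorm_iff[OF P]] exI[of _ "{q r}"] exI[of _ 1]) auto
    show "Q x \<le> K' * (\<Sum>r\<in>F. q r x)" for x
    proof -
      have "L2_set (\<lambda>r. q r x) F \<le> (\<Sum>r\<in>F. q r x)"
        by (rule L2_set_le_sum) (use P q(1) seminormD(1) in blast)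
      then show ?thesis using K'(2) unfolding Q_def root_sum_sq_L2 by (rule mult_left_mono)
    qed
  qed (rule K')
  ultimately show ?thesis using hQ pQ by blast
qed

lemma nuclear_space_separable:
  assumes T: "nuclear_space T" and p: "seminorm p" "continuous_map T euclideanreal p"
  shows "\<exists>D. countable D \<and> (\<forall>x. \<forall>\<epsilon>>0. \<exists>d\<in>D. p (x - d) < \<epsilon>)"
proof -
  obtain q C where "hilbertian q" "\<And>x. p x \<le> q x" "hs_bound p q C"
    using nuclear_space_dominating[OF assms] by blast
  then show ?thesis using hs_bound_separable p(1) by blast
qed

section \<open>Minlos-type estimates\<close>

lemma std_normal_integral_cos:
  "(\<integral>g. cos (a + b * g) \<partial>std_normal_distribution) = cos a * exp (- b\<^sup>2 / 2)"
proof -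
  interpret N: real_distribution std_normal_distribution by (rule real_dist_normal_dist)
  have int: "integrable std_normal_distribution (\<lambda>g. iexp (b * g))"
    by (rule N.integrable_iexp) auto
  have ch: "(CLINT g|std_normal_distribution. iexp (b * g)) = complex_of_real (exp (- b\<^sup>2 / 2))"
    using char_std_normal_distribution unfolding char_def by (metis (no_types))
  have "(\<integral>g. Re (iexp (b * g)) \<partial>std_normal_distribution) = exp (- b\<^sup>2 / 2)"
    using integral_Re[OF int] ch by simp
  moreover have "(\<integral>g. Im (iexp (b * g)) \<partial>std_normal_distribution) = 0"
    using integral_Im[OF int] ch by simp
  moreover have "Re (iexp (b * g)) = cos (b * g)" "Im (iexp (b * g)) = sin (b * g)" for g
    by (simp_all add: Re_exp Im_exp)
  ultimately have c: "(\<integral>g. cos (b * g) \<partial>std_normal_distribution) = exp (- b\<^sup>2 / 2)"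
    and s: "(\<integral>g. sin (b * g) \<partial>std_normal_distribution) = 0" by simp_all
  have ic: "integrable std_normal_distribution (\<lambda>g. cos (b * g))"
    and isin: "integrable std_normal_distribution (\<lambda>g. sin (b * g))"
    by (auto intro!: N.integrable_const_bound[where B=1])
  show ?thesis by (simp add: cos_add c s ic isin)
qed

lemma std_normal_integral_quadratic:
  "integrable std_normal_distribution (\<lambda>g. a + b * g + c * g\<^sup>2)"
  "(\<integral>g. a + b * g + c * g\<^sup>2 \<partial>std_normal_distribution) = a + c"
proof -
  interpret N: real_distribution std_normal_distribution by (rule real_dist_normal_dist)
  have i1: "integrable std_normal_distribution (\<lambda>g. g)"
    using integrable_std_normal_distribution_moment[of 1] by simp
  have i2: "integrable std_normal_distribution (\<lambda>g. g\<^sup>2)"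
    by (rule integrable_std_normal_distribution_moment)
  have 1: "(\<integral>g. g \<partial>std_normal_distribution) = 0"
    using integral_std_normal_distribution_moment_odd[of 1] by simp
  have 2: "(\<integral>g. g\<^sup>2 \<partial>std_normal_distribution) = 1"
    using std_normal_distribution_even_moments(1)[of 1] by simp
  show "integrable std_normal_distribution (\<lambda>g. a + b * g + c * g\<^sup>2)"
    by (intro Bochner_Integration.integrable_add integrable_mult_right i1 i2) auto
  show "(\<integral>g. a + b * g + c * g\<^sup>2 \<partial>std_normal_distribution) = a + c"
    using N.prob_space by (simp add: i1 i2 1 2)
qed

lemma cylindrical_rv_measurable:
  "cylindrical_rv M X \<Longrightarrow> X \<phi> \<in> borel_measurable M"
  by (simp add: cylindrical_rv_def)

lemma cylindrical_rv_sum: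
  assumes X: "cylindrical_rv M X" and S: "finite S"
  shows "AE w in M. X (\<Sum>e\<in>S. c e *\<^sub>R f e) w = (\<Sum>e\<in>S. c e * X (f e) w)"
  using S
proof (induction S)
  case empty
  have "AE w in M. X (0 *\<^sub>R 0) w = 0 * X 0 w" using X unfolding cylindrical_rv_def by blast
  then show ?case by simp
next
  case (insert e S)
  have "AE w in M. X (c e *\<^sub>R f e + (\<Sum>e\<in>S. c e *\<^sub>R f e)) w = X (c e *\<^sub>R f e) w + X (\<Sum>e\<in>S. c e *\<^sub>R f e) w"
    "AE w in M. X (c e *\<^sub>R f e) w = c e * X (f e) w"
    using X unfolding cylindrical_rv_def by blast+
  then show ?case using insert.IH by eventually_elim (simp add: insert.hyps)
qed

lemma cylindrical_rv_zero:
  assumes X: "cylindrical_rv M X" shows "AE w in M. X 0 w = 0"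
  using cylindrical_rv_sum[OF X finite.emptyI] by simp

lemma cylindrical_rv_diff:
  assumes X: "cylindrical_rv M X" shows "AE w in M. X (\<phi> - \<psi>) w = X \<phi> w - X \<psi> w"
proof -
  have "AE w in M. X (\<phi> + (-1) *\<^sub>R \<psi>) w = X \<phi> w + X ((-1) *\<^sub>R \<psi>) w"
    "AE w in M. X ((-1) *\<^sub>R \<psi>) w = (-1) * X \<psi> w"
    using X unfolding cylindrical_rv_def by blast+
  then show ?thesis by eventually_elim simp
qed

text \<open>
  One vector \<open>e\<close> at a time, \<open>exp (- s\<^sup>2 X(e)\<^sup>2 / 2)\<close> is written as the Gaussian average of
  \<open>cos (s g X(e))\<close>; this needs \<open>\<psi>\<close> to be arbitrary in the induction.
\<close>
lemma (in prob_space) gaussian_average_bound: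
  fixes X :: "'v::real_vector \<Rightarrow> 'a \<Rightarrow> real"
  assumes X: "cylindrical_rv M X" and p: "hilbertian p"
    and bound: "\<And>\<psi>. 1 - expectation (\<lambda>w. cos (X \<psi> w)) \<le> \<eta> + (p \<psi>)\<^sup>2"
    and S: "finite S"
  shows "1 - expectation (\<lambda>w. exp (- s\<^sup>2 / 2 * (\<Sum>e\<in>S. (X e w)\<^sup>2)) * cos (X \<psi> w))
    \<le> \<eta> + s\<^sup>2 * (\<Sum>e\<in>S. (p e)\<^sup>2) + (p \<psi>)\<^sup>2"
  using S
proof (induction S arbitrary: \<psi>)
  case empty
  then show ?case using bound[of \<psi>] by simp
next
  case (insert e S)
  interpret N: real_distribution std_normal_distribution by (rule real_dist_normal_dist)
  interpret P: pair_prob_space M std_normal_distribution ..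
  note [measurable] = cylindrical_rv_measurable[OF X]
  define G where "G w = exp (- s\<^sup>2 / 2 * (\<Sum>e\<in>S. (X e w)\<^sup>2))" for w
  have G[measurable]: "G \<in> borel_measurable M" unfolding G_def by measurable
  have G01: "0 \<le> G w" "G w \<le> 1" for w
    unfolding G_def by (auto simp: sum_nonneg mult_nonpos_nonneg)
  \<comment> \<open>Integrated over \<open>g\<close> this produces the Gaussian factor for
    \<open>e\<close>; integrated over \<open>w\<close> it is the expression of the induction
    hypothesis at \<open>\<psi> + (s * g) *\<^sub>R e\<close>.\<close>
  define H where "H w g = G w * cos (X \<psi> w + (s * X e w) * g)" for w g
  have Hb: "\<bar>H w g\<bar> \<le> 1" for w g
    using mult_mono[OF G01(2)[of w] abs_cos_le_one[of "X \<psi> w + (s * X e w) * g"]] G01(1)[of w]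
    unfolding H_def by (simp add: abs_mult)
  have Hm[measurable]: "case_prod H \<in> borel_measurable (M \<Otimes>\<^sub>M std_normal_distribution)"
    unfolding H_def split_def by measurable
  have Hint: "integrable (M \<Otimes>\<^sub>M std_normal_distribution) (case_prod H)"
    using Hb by (intro P.integrable_const_bound[where B=1]) auto
  have eq1: "(\<integral>g. H w g \<partial>std_normal_distribution) = exp (- s\<^sup>2 / 2 * (\<Sum>e\<in>insert e S. (X e w)\<^sup>2)) * cos (X \<psi> w)" for w
  proof -
    have "(\<integral>g. H w g \<partial>std_normal_distribution) = G w * (cos (X \<psi> w) * exp (- (s * X e w)\<^sup>2 / 2))"
      unfolding H_def by (simp add: std_normal_integral_cos)
    also have "\<dots> = (exp (- s\<^sup>2 / 2 * (\<Sum>e\<in>S. (X e w)\<^sup>2)) * exp (- (s * X e w)\<^sup>2 / 2)) * cos (X \<psi> w)"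
      by (simp add: G_def)
    also have "exp (- s\<^sup>2 / 2 * (\<Sum>e\<in>S. (X e w)\<^sup>2)) * exp (- (s * X e w)\<^sup>2 / 2) =
        exp (- s\<^sup>2 / 2 * (\<Sum>e\<in>insert e S. (X e w)\<^sup>2))"
      unfolding exp_add[symmetric] using insert.hyps by (simp add: algebra_simps power_mult_distrib add_divide_distrib)
    finally show ?thesis .
  qed
  have eq2: "(\<integral>w. H w g \<partial>M) = expectation (\<lambda>w. G w * cos (X (\<psi> + (s * g) *\<^sub>R e) w))" for g
  proof (rule integral_cong_AE)
    have "AE w in M. X (\<psi> + (s * g) *\<^sub>R e) w = X \<psi> w + X ((s * g) *\<^sub>R e) w"
      "AE w in M. X ((s * g) *\<^sub>R e) w = s * g * X e w"
      using X unfolding cylindrical_rv_def by blast+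
    then show "AE w in M. H w g = G w * cos (X (\<psi> + (s * g) *\<^sub>R e) w)"
      by eventually_elim (simp add: H_def ac_simps)
  qed (simp_all add: H_def)
  define R where "R = 1 - \<eta> - s\<^sup>2 * (\<Sum>e\<in>S. (p e)\<^sup>2) - (p \<psi>)\<^sup>2"
  \<comment> \<open>The inductive bound is quadratic in \<open>g\<close>. Under the Gaussian the
    linear term disappears and the second moment 1 leaves exactly the new summand with
    \<open>(p e)\<^sup>2\<close>.\<close>
  have low: "R + (- 2 * s * semi_inner p \<psi> e) * g + (- (s\<^sup>2 * (p e)\<^sup>2)) * g\<^sup>2 \<le> (\<integral>w. H w g \<partial>M)" for g
  proof -
    have "(p (\<psi> + (s * g) *\<^sub>R e))\<^sup>2 = (p \<psi>)\<^sup>2 + 2 * s * semi_inner p \<psi> e * g + s\<^sup>2 * (p e)\<^sup>2 * g\<^sup>2"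
      by (simp add: semi_inner_properties(5)[OF p] linear_cmul[OF semi_inner_linear(2)[OF p]]
        seminormD(3)[OF hilbertian_seminorm[OF p]] power_mult_distrib)
    then show ?thesis using insert.IH[of "\<psi> + (s * g) *\<^sub>R e"] unfolding eq2 R_def G_def by (simp add: algebra_simps)
  qed
  have "R + (- (s\<^sup>2 * (p e)\<^sup>2)) \<le> (\<integral>g. (\<integral>w. H w g \<partial>M) \<partial>std_normal_distribution)"
    unfolding std_normal_integral_quadratic(2)[of R "- 2 * s * semi_inner p \<psi> e" "- (s\<^sup>2 * (p e)\<^sup>2)", symmetric]
    by (intro integral_mono std_normal_integral_quadratic(1) P.integrable_snd[OF Hint] low)
  also have "\<dots> = (\<integral>w. (\<integral>g. H w g \<partial>std_normal_distribution) \<partial>M)"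
    by (rule P.Fubini_integral[OF Hint])
  finally show ?case unfolding eq1 R_def using insert.hyps by (simp add: algebra_simps)
qed

text \<open>Chebyshev's inequality for \<open>1 - exp (- s\<^sup>2 / 2 * A)\<close>. Its expectation
  is at most 2 \<eta>, and on the event in question it is at least 1/2, which gives 4
  \<eta>.\<close>

lemma (in prob_space) minlos_bound_bessel:
  fixes X :: "'v::real_vector \<Rightarrow> 'a \<Rightarrow> real"
  assumes X: "cylindrical_rv M X" and p: "hilbertian p"
    and bound: "\<And>\<psi>. 1 - expectation (\<lambda>w. cos (X \<psi> w)) \<le> \<eta> + (p \<psi>)\<^sup>2"
    and \<eta>: "0 < \<eta>" and S: "finite S" "(\<Sum>e\<in>S. (p e)\<^sup>2) \<le> C" and C: "0 \<le> C"
  shows "prob {w \<in> space M. 4 * (C + 1) / \<eta> < (\<Sum>e\<in>S. (X e w)\<^sup>2)} \<le> 4 * \<eta>"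
proof -
  note [measurable] = cylindrical_rv_measurable[OF X]
  have "0 < C + 1" using C by simp
  \<comment> \<open>With this \<open>s\<close> the Gaussian cost \<open>s\<^sup>2 * C\<close> is at
    most \<eta>, while on the event \<open>s\<^sup>2 * A\<close> exceeds 4. Using
    \<open>C + 1\<close> avoids division by zero.\<close>
  define s where "s = sqrt (\<eta> / (C + 1))"
  have s2: "s\<^sup>2 = \<eta> / (C + 1)" using \<eta> C by (simp add: s_def)
  define A where "A w = (\<Sum>e\<in>S. (X e w)\<^sup>2)" for w
  have [measurable]: "A \<in> borel_measurable M" unfolding A_def by measurable
  have A0: "0 \<le> A w" for w by (simp add: A_def sum_nonneg)
  define B where "B = {w \<in> space M. 4 * (C + 1) / \<eta> < A w}"
  have [measurable]: "B \<in> sets M" unfolding B_def by measurable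
  have bd: "\<bar>exp (- s\<^sup>2 / 2 * A w)\<bar> \<le> 1" for w using A0[of w] by (simp add: mult_nonpos_nonneg)
  have int: "integrable M (\<lambda>w. exp (- s\<^sup>2 / 2 * A w))"
    using bd by (intro integrable_const_bound[where B=1]) auto
  have "expectation (\<lambda>w. exp (- s\<^sup>2 / 2 * A w) * cos (X 0 w)) = expectation (\<lambda>w. exp (- s\<^sup>2 / 2 * A w))"
    using cylindrical_rv_zero[OF X] by (intro integral_cong_AE) auto
  then have "1 - expectation (\<lambda>w. exp (- s\<^sup>2 / 2 * A w)) \<le> \<eta> + s\<^sup>2 * (\<Sum>e\<in>S. (p e)\<^sup>2)"
    using gaussian_average_bound[OF X p bound S(1), of s 0]
    by (simp add: A_def seminormD(4)[OF hilbertian_seminorm[OF p]])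
  moreover have "s\<^sup>2 * (\<Sum>e\<in>S. (p e)\<^sup>2) \<le> \<eta>"
  proof -
    have "s\<^sup>2 * (\<Sum>e\<in>S. (p e)\<^sup>2) \<le> s\<^sup>2 * C" using S(2) by (rule mult_left_mono) simp
    also have "\<dots> \<le> \<eta>" using \<eta> C unfolding s2 by (simp add: field_simps)
    finally show ?thesis .
  qed
  moreover have "prob B / 2 \<le> expectation (\<lambda>w. 1 - exp (- s\<^sup>2 / 2 * A w))"
  proof -
    have "indicator B w / 2 \<le> 1 - exp (- s\<^sup>2 / 2 * A w)" for w
    proof (cases "w \<in> B")
      case True
      then have "4 * (C + 1) / \<eta> < A w" by (simp add: B_def)
      then have "s\<^sup>2 * (4 * (C + 1) / \<eta>) \<le> s\<^sup>2 * A w" by (intro mult_left_mono) auto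
      moreover have "s\<^sup>2 * (4 * (C + 1) / \<eta>) = 4"
      proof -
        have "\<eta> / D * (4 * D / \<eta>) = 4" if "0 < D" for D using that \<eta> by simp
        then show ?thesis unfolding s2 using \<open>0 < C + 1\<close> by blast
      qed
      ultimately have "- s\<^sup>2 / 2 * A w \<le> - 1" by simp
      then have "exp (- s\<^sup>2 / 2 * A w) \<le> exp (- 1)" by simp
      moreover have "exp (- 1 :: real) \<le> 1 / 2" using exp_ge_add_one_self[of "1::real"] by (simp add: exp_minus field_simps)
      ultimately have "exp (- s\<^sup>2 / 2 * A w) \<le> 1 / 2" by linarith
      then show ?thesis using True by simp
    next
      case False
      then show ?thesis using bd[of w] by simp
    qed
    then have "expectation (\<lambda>w. indicator B w / 2) \<le> expectation (\<lambda>w. 1 - exp (- s\<^sup>2 / 2 * A w))"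
      using int by (intro integral_mono) (auto simp: less_top[symmetric])
    then show ?thesis by simp
  qed
  moreover have "expectation (\<lambda>w. 1 - exp (- s\<^sup>2 / 2 * A w)) = 1 - expectation (\<lambda>w. exp (- s\<^sup>2 / 2 * A w))"
    using int prob_space by (subst Bochner_Integration.integral_diff) auto
  ultimately show ?thesis unfolding B_def A_def by linarith
qed

text \<open>Sums of squares over an orthonormal set control \<open>X\<close> on its span by
  Cauchy-Schwarz. The parameter \<delta> pays for the remainders \<open>z d\<close>: they are null
  for \<open>q\<close>, but \<open>X\<close> need not vanish on them.\<close>

lemma (in prob_space) minlos_bound:
  fixes X :: "'v::real_vector \<Rightarrow> 'a \<Rightarrow> real"
  assumes X: "cylindrical_rv M X" and p: "hilbertian p" and q: "hilbertian q"
    and le: "\<And>x. p x \<le> q x" and hs: "hs_bound p q C"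
    and bound: "\<And>\<psi>. 1 - expectation (\<lambda>w. cos (X \<psi> w)) \<le> \<eta> + (p \<psi>)\<^sup>2"
    and \<eta>: "0 < \<eta>" and A: "finite A" and \<delta>: "0 < \<delta>"
  shows "prob {w \<in> space M. \<exists>d\<in>A. sqrt (4 * (C + 1) / \<eta>) * (q d + \<delta>) < \<bar>X d w\<bar>} \<le> 4 * \<eta>"
proof -
  note [measurable] = cylindrical_rv_measurable[OF X]
  note sp = hilbertian_seminorm[OF p] and sq = hilbertian_seminorm[OF q]
  have C: "0 \<le> C" using hs_boundD[OF hs, of "{}"] by (simp add: seminormD(4)[OF sq])
  define R where "R = sqrt (4 * (C + 1) / \<eta>)"
  have R: "0 < R" "R\<^sup>2 = 4 * (C + 1) / \<eta>" using C \<eta> by (simp_all add: R_def)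
  obtain S where S: "orthonormal_set q S" "\<And>a. a \<in> A \<Longrightarrow> q (a - orth_proj q S a) = 0"
    using gram_schmidt[OF q A] by blast
  have fS: "finite S" using S by (simp add: orthonormal_set_def)
  define z where "z d = d - orth_proj q S d" for d
  \<comment> \<open>Vectors that are null for \<open>q\<close> stay so after multiplication by
    \<open>1 / \<delta>\<close> and keep a family Bessel. Having them in the family bounds
    \<open>X (z d)\<close> by \<delta> times the radius.\<close>
  define Z where "Z = (\<lambda>d. (1 / \<delta>) *\<^sub>R z d) ` A"
  have fZ: "finite Z" using A by (simp add: Z_def)
  have qZ: "q f = 0" if "f \<in> Z" for f using that S(2) by (auto simp: Z_def z_def seminormD(3)[OF sq])
  have disj: "S \<inter> Z = {}"
  proof -
    have "(q f)\<^sup>2 = 1" if "f \<in> S" for f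
      using S(1) that by (simp add: orthonormal_set_def semi_inner_properties(3)[OF q, symmetric])
    then show ?thesis using qZ by fastforce
  qed
  have bes: "(q (\<Sum>e\<in>S \<union> Z. c e *\<^sub>R e))\<^sup>2 \<le> (\<Sum>e\<in>S \<union> Z. (c e)\<^sup>2)" for c
  proof -
    have "q (\<Sum>e\<in>Z. c e *\<^sub>R e) \<le> (\<Sum>e\<in>Z. q (c e *\<^sub>R e))" by (rule seminorm_sum_le[OF sq fZ])
    also have "\<dots> = 0" using qZ by (simp add: seminormD(3)[OF sq])
    finally have "q (\<Sum>e\<in>S \<union> Z. c e *\<^sub>R e) \<le> q (\<Sum>e\<in>S. c e *\<^sub>R e)"
      using seminormD(2)[OF sq, of "\<Sum>e\<in>S. c e *\<^sub>R e" "\<Sum>e\<in>Z. c e *\<^sub>R e"]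
      by (simp add: sum.union_disjoint[OF fS fZ disj])
    then have "(q (\<Sum>e\<in>S \<union> Z. c e *\<^sub>R e))\<^sup>2 \<le> (\<Sum>e\<in>S. (c e)\<^sup>2)"
      using power_mono[OF _ seminormD(1)[OF sq], of _ "q (\<Sum>e\<in>S. c e *\<^sub>R e)" 2] orthonormal_comb(2)[OF q S(1), of c] by simp
    also have "\<dots> \<le> (\<Sum>e\<in>S \<union> Z. (c e)\<^sup>2)" using fS fZ by (intro sum_mono2) auto
    finally show ?thesis .
  qed
  have "(\<Sum>e\<in>S \<union> Z. (p e)\<^sup>2) \<le> C" using hs_boundD[OF hs _ bes] fS fZ by blast
  then have "prob {w \<in> space M. R\<^sup>2 < (\<Sum>e\<in>S \<union> Z. (X e w)\<^sup>2)} \<le> 4 * \<eta>"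
    unfolding R(2) using fS fZ by (intro minlos_bound_bessel[OF X p bound \<eta> _ _ C]) auto
  moreover have "prob {w \<in> space M. \<exists>d\<in>A. R * (q d + \<delta>) < \<bar>X d w\<bar>} \<le> prob {w \<in> space M. R\<^sup>2 < (\<Sum>e\<in>S \<union> Z. (X e w)\<^sup>2)}"
  proof (rule finite_measure_mono_AE)
    have "AE w in M. \<forall>d\<in>A. X d w = (\<Sum>e\<in>S. semi_inner q d e * X e w) + \<delta> * X ((1 / \<delta>) *\<^sub>R z d) w"
    proof (rule AE_finite_allI[OF A])
      fix d
      have "AE w in M. X (orth_proj q S d + \<delta> *\<^sub>R ((1 / \<delta>) *\<^sub>R z d)) w = X (orth_proj q S d) w + X (\<delta> *\<^sub>R ((1 / \<delta>) *\<^sub>R z d)) w"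
        "AE w in M. X (\<delta> *\<^sub>R ((1 / \<delta>) *\<^sub>R z d)) w = \<delta> * X ((1 / \<delta>) *\<^sub>R z d) w"
        using X unfolding cylindrical_rv_def by blast+
      moreover have "AE w in M. X (orth_proj q S d) w = (\<Sum>e\<in>S. semi_inner q d e * X e w)"
        unfolding orth_proj_def by (rule cylindrical_rv_sum[OF X fS])
      ultimately show "AE w in M. X d w = (\<Sum>e\<in>S. semi_inner q d e * X e w) + \<delta> * X ((1 / \<delta>) *\<^sub>R z d) w"
        by eventually_elim (use \<delta> in \<open>simp add: z_def\<close>)
    qed
    then show "AE w in M. w \<in> {w \<in> space M. \<exists>d\<in>A. R * (q d + \<delta>) < \<bar>X d w\<bar>} \<longrightarrow>
        w \<in> {w \<in> space M. R\<^sup>2 < (\<Sum>e\<in>S \<union> Z. (X e w)\<^sup>2)}"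
    proof eventually_elim
      case (elim w)
      have "\<bar>X d w\<bar> \<le> R * (q d + \<delta>)" if "(\<Sum>e\<in>S \<union> Z. (X e w)\<^sup>2) \<le> R\<^sup>2" "d \<in> A" for d
      proof -
        have sum: "(\<Sum>e\<in>S. (X e w)\<^sup>2) + (\<Sum>e\<in>Z. (X e w)\<^sup>2) \<le> R\<^sup>2"
          using that(1) by (simp add: sum.union_disjoint[OF fS fZ disj])
        have nn: "0 \<le> (\<Sum>e\<in>S. (X e w)\<^sup>2)" "0 \<le> (\<Sum>e\<in>Z. (X e w)\<^sup>2)" by (simp_all add: sum_nonneg)
        have zZ: "(1 / \<delta>) *\<^sub>R z d \<in> Z" unfolding Z_def using that(2) by (rule imageI)
        have "(X ((1 / \<delta>) *\<^sub>R z d) w)\<^sup>2 \<le> (\<Sum>e\<in>Z. (X e w)\<^sup>2)"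
          using fZ zZ by (intro member_le_sum) auto
        then have "(X ((1 / \<delta>) *\<^sub>R z d) w)\<^sup>2 \<le> R\<^sup>2" using sum nn(1) by linarith
        then have "\<bar>X ((1 / \<delta>) *\<^sub>R z d) w\<bar> \<le> R" using R(1) by (simp add: abs_le_square_iff[symmetric])
        then have "\<bar>\<delta> * X ((1 / \<delta>) *\<^sub>R z d) w\<bar> \<le> \<delta> * R"
          unfolding abs_mult using \<delta> by (intro mult_mono) auto
        moreover have "\<bar>\<Sum>e\<in>S. semi_inner q d e * X e w\<bar> \<le> q d * R"
        proof -
          have S2: "(\<Sum>e\<in>S. (X e w)\<^sup>2) \<le> R\<^sup>2" using sum nn(2) by linarith
          have "\<bar>\<Sum>e\<in>S. semi_inner q d e * X e w\<bar> \<le> (\<Sum>e\<in>S. \<bar>semi_inner q d e\<bar> * \<bar>X e w\<bar>)"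
            by (rule order_trans[OF sum_abs]) (simp add: abs_mult)
          also have "\<dots> \<le> L2_set (semi_inner q d) S * L2_set (\<lambda>e. X e w) S" by (rule L2_set_mult_ineq)
          also have "\<dots> \<le> q d * R"
            using orth_proj(3)[OF q S(1), of d] seminormD(1)[OF sq, of d] S2 R(1)
            by (intro mult_mono) (auto simp: L2_set_def intro: real_le_lsqrt sum_nonneg)
          finally show ?thesis .
        qed
        ultimately show ?thesis using elim that(2) by (auto simp: algebra_simps)
      qed
      then show ?case by (auto simp: not_le[symmetric])
    qed
  qed measurable
  ultimately show ?thesis by (simp add: R_def)
qed

section \<open>Random walks\<close>

text \<open>With \<open>B\<close> meaning a large increment, the longest chain counts successive
  large oscillations; neighbouring pairs may share an end. The order is left general because both
  indices of a walk and real times occur.\<close>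

primrec chain :: "('t::linorder \<Rightarrow> 't \<Rightarrow> bool) \<Rightarrow> 't set \<Rightarrow> nat \<Rightarrow> 't \<Rightarrow> bool" where
  "chain B F 0 s = True"
| "chain B F (Suc n) s = (\<exists>u\<in>F. \<exists>v\<in>F. s \<le> u \<and> u < v \<and> B u v \<and> chain B F n v)"

definition walk_sum :: "(nat \<Rightarrow> nat \<Rightarrow> real) \<Rightarrow> nat \<Rightarrow> nat \<Rightarrow> nat \<Rightarrow> real" where
  "walk_sum f j k x = (\<Sum>i\<in>{j..<k}. f i x)"

text \<open>Many coordinates are watched at once, since a dual-norm bound concerns many test
  vectors. The thresholds \<open>r\<close> stay fixed, and \<open>c\<close> takes the values 1, 2
  and 4, doubling with each use of the triangle inequality.\<close>

definition exceeds :: "nat \<Rightarrow> (nat \<Rightarrow> real) \<Rightarrow> real \<Rightarrow> (nat \<Rightarrow> real) \<Rightarrow> bool" where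
  "exceeds n r c v \<longleftrightarrow> (\<exists>x\<in>{..<n}. c * r x < \<bar>v x\<bar>)"

definition first_exit :: "nat \<Rightarrow> (nat \<Rightarrow> real) \<Rightarrow> (nat \<Rightarrow> nat \<Rightarrow> real) \<Rightarrow> nat \<Rightarrow> nat \<Rightarrow> bool" where
  "first_exit n r f j k \<longleftrightarrow> exceeds n r 2 (walk_sum f j k) \<and> (\<forall>l\<in>{j..<k}. \<not> exceeds n r 2 (walk_sum f j l))"

lemma walk_sum_restrict:
  "{j..<k} \<subseteq> A \<Longrightarrow> walk_sum (restrict f A) j k = walk_sum f j k"
  by (auto simp: walk_sum_def fun_eq_iff intro!: sum.cong)

lemma walk_sum_split:
  "j \<le> k \<Longrightarrow> k \<le> m \<Longrightarrow> walk_sum f j m x = walk_sum f j k x + walk_sum f k m x"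
  unfolding walk_sum_def by (simp add: sum.atLeastLessThan_concat)

text \<open>Locality: chains that start at or after \<open>k\<close> read only the steps from
  \<open>k\<close> on. This is the form in which \<open>indep_blocks\<close> turns disjoint index
  ranges into independence.\<close>

lemma chain_restrict:
  assumes "k \<le> j" "j \<le> m"
  shows "chain (\<lambda>u v. exceeds n r c (walk_sum (restrict f {k..<m}) u v)) {..m} i j \<longleftrightarrow>
    chain (\<lambda>u v. exceeds n r c (walk_sum f u v)) {..m} i j"
  using assms
proof (induction i arbitrary: j)
  case (Suc i)
  have "walk_sum (restrict f {k..<m}) u v = walk_sum f u v" if "j \<le> u" "v \<le> m" for u v
    using that Suc.prems by (intro walk_sum_restrict) auto
  moreover have "chain (\<lambda>u v. exceeds n r c (walk_sum (restrict f {k..<m}) u v)) {..m} i v \<longleftrightarrow>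
      chain (\<lambda>u v. exceeds n r c (walk_sum f u v)) {..m} i v" if "j \<le> u" "u < v" "v \<le> m" for u v
    using that Suc.prems by (intro Suc.IH) auto
  ultimately show ?case unfolding chain.simps by (intro bex_cong conj_cong refl) auto
qed simp

abbreviation vecM :: "nat \<Rightarrow> (nat \<Rightarrow> real) measure" where
  "vecM n \<equiv> Pi\<^sub>M {..<n} (\<lambda>_. borel)"

lemma measurable_exceeds:
  assumes "{j..<k} \<subseteq> A"
  shows "Measurable.pred (Pi\<^sub>M A (\<lambda>_. vecM n)) (\<lambda>f. exceeds n r c (walk_sum f j k))"
  unfolding exceeds_def walk_sum_def
proof (intro pred_intros_finite)
  fix x assume x: "x \<in> {..<n}"
  have "(\<lambda>f. f i x) \<in> borel_measurable (Pi\<^sub>M A (\<lambda>_. vecM n))" if "i \<in> {j..<k}" for i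
    using that assms x
      measurable_compose[OF measurable_component_singleton[of i A "\<lambda>_. vecM n"] measurable_component_singleton[of x "{..<n}" "\<lambda>_. borel"]]
    by auto
  then have [measurable]: "(\<lambda>f. \<Sum>i\<in>{j..<k}. f i x) \<in> borel_measurable (Pi\<^sub>M A (\<lambda>_. vecM n))"
    by (intro borel_measurable_sum)
  show "Measurable.pred (Pi\<^sub>M A (\<lambda>_. vecM n)) (\<lambda>f. c * r x < \<bar>\<Sum>i\<in>{j..<k}. f i x\<bar>)"
    by measurable
qed simp

lemma measurable_first_exit:
  assumes "{j..<k} \<subseteq> A"
  shows "Measurable.pred (Pi\<^sub>M A (\<lambda>_. vecM n)) (\<lambda>f. first_exit n r f j k)"
  unfolding first_exit_def using assms
  by (intro pred_intros_finite pred_intros_logic measurable_exceeds) auto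

lemma measurable_chain:
  assumes "{j..<m} \<subseteq> A"
  shows "Measurable.pred (Pi\<^sub>M A (\<lambda>_. vecM n))
    (\<lambda>f. chain (\<lambda>u v. exceeds n r c (walk_sum f u v)) {..m} i j)"
  using assms
proof (induction i arbitrary: j)
  case (Suc i)
  have step: "Measurable.pred (Pi\<^sub>M A (\<lambda>_. vecM n)) (\<lambda>f. j \<le> u \<and> u < v \<and>
      exceeds n r c (walk_sum f u v) \<and> chain (\<lambda>u v. exceeds n r c (walk_sum f u v)) {..m} i v)"
    if "v \<le> m" for u v
  proof (cases "j \<le> u \<and> u < v")
    case True
    then have "{u..<v} \<subseteq> A" "{v..<m} \<subseteq> A" using Suc.prems that by auto
    then have "Measurable.pred (Pi\<^sub>M A (\<lambda>_. vecM n)) (\<lambda>f. exceeds n r c (walk_sum f u v) \<and>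
        chain (\<lambda>u v. exceeds n r c (walk_sum f u v)) {..m} i v)"
      by (intro pred_intros_logic measurable_exceeds Suc.IH)
    then show ?thesis using True by simp
  next
    case False
    then have eq: "(\<lambda>f. j \<le> u \<and> u < v \<and>
      exceeds n r c (walk_sum f u v) \<and> chain (\<lambda>u v. exceeds n r c (walk_sum f u v)) {..m} i v) = (\<lambda>_. False)" by auto
    show ?thesis by (subst eq) (rule measurable_const, simp)
  qed
  then show ?case unfolding chain.simps
    by (intro pred_intros_finite(4) finite_atMost step) (simp only: atMost_iff)
qed simp

text \<open>The predicates live on whole sequences but read only their own block, as the restriction
  hypotheses say; so \<open>first_exit\<close> and \<open>chain\<close> can be used without
  reindexing.\<close>

lemma (in prob_space) indep_blocks:
  assumes ind: "indep_vars (\<lambda>_. N) \<xi> {..<m}" and AB: "A \<inter> B = {}" "A \<subseteq> {..<m}" "B \<subseteq> {..<m}"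
    and P: "Measurable.pred (Pi\<^sub>M A (\<lambda>_. N)) P" "\<And>f. P (restrict f A) = P f"
    and Q: "Measurable.pred (Pi\<^sub>M B (\<lambda>_. N)) Q" "\<And>f. Q (restrict f B) = Q f"
  shows "prob {w \<in> space M. P (\<lambda>i. \<xi> i w) \<and> Q (\<lambda>i. \<xi> i w)} =
    prob {w \<in> space M. P (\<lambda>i. \<xi> i w)} * prob {w \<in> space M. Q (\<lambda>i. \<xi> i w)}"
proof -
  let ?A = "\<lambda>w. restrict (\<lambda>i. \<xi> i w) A" and ?B = "\<lambda>w. restrict (\<lambda>i. \<xi> i w) B"
  let ?U = "{f \<in> space (Pi\<^sub>M A (\<lambda>_. N)). P f}" and ?V = "{f \<in> space (Pi\<^sub>M B (\<lambda>_. N)). Q f}"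
  have iv: "indep_var (Pi\<^sub>M A (\<lambda>_. N)) ?A (Pi\<^sub>M B (\<lambda>_. N)) ?B"
    by (rule indep_var_restrict[OF ind AB])
  have U: "?U \<in> sets (Pi\<^sub>M A (\<lambda>_. N))" using P(1) by simp
  have V: "?V \<in> sets (Pi\<^sub>M B (\<lambda>_. N))" using Q(1) by simp
  have Am: "?A w \<in> space (Pi\<^sub>M A (\<lambda>_. N))" and Bm: "?B w \<in> space (Pi\<^sub>M B (\<lambda>_. N))" if "w \<in> space M" for w
    using indep_var_rv1[OF iv] indep_var_rv2[OF iv] that by (auto dest: measurable_space)
  have "(\<lambda>x. (?A x, ?B x)) -` (?U \<times> ?V) \<inter> space M = {w \<in> space M. P (\<lambda>i. \<xi> i w) \<and> Q (\<lambda>i. \<xi> i w)}"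
    "?A -` ?U \<inter> space M = {w \<in> space M. P (\<lambda>i. \<xi> i w)}"
    "?B -` ?V \<inter> space M = {w \<in> space M. Q (\<lambda>i. \<xi> i w)}"
    using P(2) Q(2) Am Bm by auto
  then show ?thesis using indep_varD[OF iv U V] by simp
qed

lemma (in prob_space) pred_walk:
  assumes ind: "indep_vars (\<lambda>_. N) \<xi> {..<m}" and A: "A \<subseteq> {..<m}"
    and P: "Measurable.pred (Pi\<^sub>M A (\<lambda>_. N)) P" "\<And>f. P (restrict f A) = P f"
  shows "{w \<in> space M. P (\<lambda>i. \<xi> i w)} \<in> events"
proof -
  have "(\<lambda>w. restrict (\<lambda>i. \<xi> i w) A) \<in> measurable M (Pi\<^sub>M A (\<lambda>_. N))"
    using ind A by (intro measurable_restrict) (auto simp: indep_vars_def)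
  from measurable_compose[OF this P(1)] show ?thesis by (simp add: P(2))
qed

lemma first_exit_exists:
  assumes "exceeds n r 2 (walk_sum f j k)"
  shows "\<exists>l\<le>k. first_exit n r f j l"
proof -
  define l where "l = (LEAST l. exceeds n r 2 (walk_sum f j l))"
  have "exceeds n r 2 (walk_sum f j l)" "l \<le> k"
    unfolding l_def using assms by (auto intro: LeastI Least_le)
  moreover have "\<not> exceeds n r 2 (walk_sum f j i)" if "i < l" for i
    using that unfolding l_def by (rule not_less_Least)
  ultimately show ?thesis unfolding first_exit_def by auto
qed

lemma first_exit_unique: "first_exit n r f j k \<Longrightarrow> first_exit n r f j l \<Longrightarrow> j < k \<Longrightarrow> j < l \<Longrightarrow> k = l"
  unfolding first_exit_def by (metis atLeastLessThan_iff less_imp_le linorder_neqE_nat)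

lemma exceeds_walk_sum_less:
  assumes "\<And>x. 0 < r x" "0 \<le> c" "exceeds n r c (walk_sum f j k)"
  shows "j < k"
proof (rule ccontr)
  assume "\<not> j < k"
  then have "walk_sum f j k x = 0" for x by (simp add: walk_sum_def)
  then show False using assms by (fastforce simp: exceeds_def mult_less_0_iff dest: less_asym)
qed

lemma exceeds_add:
  assumes "exceeds n r (c + d) (\<lambda>x. v x + w x)" shows "exceeds n r c v \<or> exceeds n r d w"
proof (rule ccontr)
  assume "\<not> ?thesis"
  then have "\<bar>v x\<bar> \<le> c * r x" "\<bar>w x\<bar> \<le> d * r x" if "x < n" for x using that unfolding exceeds_def by force+
  then have "\<bar>v x + w x\<bar> \<le> (c + d) * r x" if "x < n" for x
    using that abs_triangle_ineq[of "v x" "w x"] by (fastforce simp: distrib_right)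
  then show False using assms unfolding exceeds_def by fastforce
qed

lemma exceeds_minus: "exceeds n r c (\<lambda>x. - v x) = exceeds n r c v"
  by (simp add: exceeds_def)

text \<open>After the first exit from level 2 the remaining steps are independent of the past and,
  with probability at least 1/2, move by at most level 1. In that case the endpoint is beyond level
  1, an event of probability at most \<beta>; hence the factor 2.\<close>

lemma (in prob_space) ottaviani:
  assumes ind: "indep_vars (\<lambda>_. vecM n) \<xi> {..<m}" and r: "\<And>x. 0 < r x" and \<beta>: "\<beta> \<le> 1 / 2" and j: "j \<le> m"
    and small: "\<And>k. j \<le> k \<Longrightarrow> k \<le> m \<Longrightarrow> prob {w \<in> space M. exceeds n r 1 (walk_sum (\<lambda>i. \<xi> i w) k m)} \<le> \<beta>"
  shows "prob {w \<in> space M. \<exists>k\<in>{j<..m}. first_exit n r (\<lambda>i. \<xi> i w) j k} \<le> 2 * \<beta>"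
proof -
  define U where "U k = {w \<in> space M. first_exit n r (\<lambda>i. \<xi> i w) j k}" for k
  define V where "V k = {w \<in> space M. \<not> exceeds n r 1 (walk_sum (\<lambda>i. \<xi> i w) k m)}" for k
  have loc: "first_exit n r (restrict f {j..<k}) j k = first_exit n r f j k" for f k
  proof -
    have "walk_sum (restrict f {j..<k}) j l = walk_sum f j l" if "l \<le> k" for l
      using that by (intro walk_sum_restrict) auto
    then show ?thesis unfolding first_exit_def by auto
  qed
  have loc': "(\<not> exceeds n r 1 (walk_sum (restrict f {k..<m}) k m)) = (\<not> exceeds n r 1 (walk_sum f k m))" for f k
    by (subst walk_sum_restrict) auto
  have fm: "Measurable.pred (Pi\<^sub>M {j..<k} (\<lambda>_. vecM n)) (\<lambda>f. first_exit n r f j k)" for k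
    by (rule measurable_first_exit) simp
  have U: "U k \<in> events" if "k \<le> m" for k
    unfolding U_def using that
    by (intro pred_walk[where A="{j..<k}" and P="\<lambda>f. first_exit n r f j k", OF ind _ fm loc]) auto
  have Vm: "Measurable.pred (Pi\<^sub>M {k..<m} (\<lambda>_. vecM n)) (\<lambda>f. \<not> exceeds n r 1 (walk_sum f k m))" for k
    by (intro pred_intros_logic measurable_exceeds) simp
  have V: "V k \<in> events" for k
    unfolding V_def
    by (intro pred_walk[where A="{k..<m}" and P="\<lambda>f. \<not> exceeds n r 1 (walk_sum f k m)", OF ind _ Vm loc']) auto
  have Vp: "1 / 2 \<le> prob (V k)" if "j \<le> k" "k \<le> m" for k
  proof -
    have "{w \<in> space M. exceeds n r 1 (walk_sum (\<lambda>i. \<xi> i w) k m)} = space M - V k" by (auto simp: V_def)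
    then have "prob (space M - V k) \<le> \<beta>" using small[OF that] by simp
    then show ?thesis using \<beta> prob_compl[OF V] by simp
  qed
  have UV: "prob (U k \<inter> V k) = prob (U k) * prob (V k)" if "k \<le> m" for k
  proof -
    have "U k \<inter> V k = {w \<in> space M. first_exit n r (\<lambda>i. \<xi> i w) j k \<and> \<not> exceeds n r 1 (walk_sum (\<lambda>i. \<xi> i w) k m)}"
      by (auto simp: U_def V_def)
    moreover have "{j..<k} \<inter> {k..<m} = {}" "{j..<k} \<subseteq> {..<m}" "{k..<m} \<subseteq> {..<m}" using that by auto
    ultimately show ?thesis unfolding U_def V_def using
      indep_blocks[where A="{j..<k}" and P="\<lambda>f. first_exit n r f j k" and B="{k..<m}" and
        Q="\<lambda>f. \<not> exceeds n r 1 (walk_sum f k m)", OF ind _ _ _ fm loc Vm loc'] by simp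
  qed
  have disj: "disjoint_family_on U {j<..m}"
    unfolding disjoint_family_on_def U_def using first_exit_unique by fastforce
  have "{w \<in> space M. \<exists>k\<in>{j<..m}. first_exit n r (\<lambda>i. \<xi> i w) j k} = (\<Union>k\<in>{j<..m}. U k)" by (auto simp: U_def)
  then have "prob {w \<in> space M. \<exists>k\<in>{j<..m}. first_exit n r (\<lambda>i. \<xi> i w) j k} = (\<Sum>k\<in>{j<..m}. prob (U k))"
    using finite_measure_finite_Union[OF _ _ disj] U by (auto simp: image_subset_iff)
  also have "\<dots> \<le> (\<Sum>k\<in>{j<..m}. 2 * prob (U k \<inter> V k))"
  proof (rule sum_mono)
    fix k assume "k \<in> {j<..m}"
    then show "prob (U k) \<le> 2 * prob (U k \<inter> V k)"
      using UV[of k] mult_left_mono[OF Vp[of k], of "prob (U k)"] by simp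
  qed
  also have "\<dots> = 2 * prob (\<Union>k\<in>{j<..m}. U k \<inter> V k)"
  proof -
    have "prob (\<Union>k\<in>{j<..m}. U k \<inter> V k) = (\<Sum>k\<in>{j<..m}. prob (U k \<inter> V k))"
    proof (rule finite_measure_finite_Union)
      show "disjoint_family_on (\<lambda>k. U k \<inter> V k) {j<..m}"
        using disj unfolding disjoint_family_on_def by blast
    qed (use U V in auto)
    then show ?thesis by (simp add: sum_distrib_left)
  qed
  \<comment> \<open>The walk up to \<open>k\<close> is the whole walk minus the rest; the rest does
    not exceed level 1 in any coordinate, so the whole walk must.\<close>
  also have "(\<Union>k\<in>{j<..m}. U k \<inter> V k) \<subseteq> {w \<in> space M. exceeds n r 1 (walk_sum (\<lambda>i. \<xi> i w) j m)}"
  proof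
    fix w assume "w \<in> (\<Union>k\<in>{j<..m}. U k \<inter> V k)"
    then obtain k where k: "j < k" "k \<le> m" "w \<in> U k" "w \<in> V k" by auto
    have "walk_sum (\<lambda>i. \<xi> i w) j k = (\<lambda>x. walk_sum (\<lambda>i. \<xi> i w) j m x + - walk_sum (\<lambda>i. \<xi> i w) k m x)"
      using walk_sum_split[of j k m] k by auto
    moreover have "exceeds n r (1 + 1) (walk_sum (\<lambda>i. \<xi> i w) j k)" using k by (simp add: U_def first_exit_def)
    ultimately show "w \<in> {w \<in> space M. exceeds n r 1 (walk_sum (\<lambda>i. \<xi> i w) j m)}"
      using exceeds_add[of n r 1 1 "walk_sum (\<lambda>i. \<xi> i w) j m" "\<lambda>x. - walk_sum (\<lambda>i. \<xi> i w) k m x"] k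
      by (auto simp: U_def V_def exceeds_minus)
  qed
  then have "prob (\<Union>k\<in>{j<..m}. U k \<inter> V k) \<le> \<beta>"
  proof (rule order_trans[OF finite_measure_mono small[OF order_refl j]])
    show "{w \<in> space M. exceeds n r 1 (walk_sum (\<lambda>i. \<xi> i w) j m)} \<in> events"
      using measurable_exceeds[where j=j and k=m and A="{j..<m}" and n=n and r=r and c=1] walk_sum_restrict[of j m "{j..<m}"]
      by (intro pred_walk[where A="{j..<m}" and P="\<lambda>f. exceeds n r 1 (walk_sum f j m)", OF ind]) auto
  qed
  finally show ?thesis by simp
qed

text \<open>
  Whichever of the two ends of the first large jump is far from the start, the walk has left the
  start by the end of that jump; the remaining jumps are independent of the path up to the exit.
\<close>
lemma (in prob_space) chain_bound:
  assumes ind: "indep_vars (\<lambda>_. vecM n) \<xi> {..<m}" and r: "\<And>x. 0 < r x" and c: "0 \<le> c"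
    and exit: "\<And>j. j \<le> m \<Longrightarrow> prob {w \<in> space M. \<exists>k\<in>{j<..m}. first_exit n r (\<lambda>i. \<xi> i w) j k} \<le> c"
    and j: "j \<le> m"
  shows "prob {w \<in> space M. chain (\<lambda>u v. exceeds n r 4 (walk_sum (\<lambda>i. \<xi> i w) u v)) {..m} i j} \<le> c ^ i"
  using j
proof (induction i arbitrary: j)
  case 0
  then show ?case by simp
next
  case (Suc i)
  define U where "U k = {w \<in> space M. first_exit n r (\<lambda>i. \<xi> i w) j k}" for k
  define V where "V k = {w \<in> space M. chain (\<lambda>u v. exceeds n r 4 (walk_sum (\<lambda>i. \<xi> i w) u v)) {..m} i k}" for k
  have loc: "first_exit n r (restrict f {j..<k}) j k = first_exit n r f j k" for f k
  proof -
    have "walk_sum (restrict f {j..<k}) j l = walk_sum f j l" if "l \<le> k" for l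
      using that by (intro walk_sum_restrict) auto
    then show ?thesis unfolding first_exit_def by auto
  qed
  have fm: "Measurable.pred (Pi\<^sub>M {j..<k} (\<lambda>_. vecM n)) (\<lambda>f. first_exit n r f j k)" for k
    by (rule measurable_first_exit) simp
  have U: "U k \<in> events" if "k \<le> m" for k
    unfolding U_def using that
    by (intro pred_walk[where A="{j..<k}" and P="\<lambda>f. first_exit n r f j k", OF ind _ fm loc]) auto
  let ?Q = "\<lambda>k f. chain (\<lambda>u v. exceeds n r 4 (walk_sum f u v)) {..m} i k"
  have cm: "Measurable.pred (Pi\<^sub>M {k..<m} (\<lambda>_. vecM n)) (?Q k)" for k
    by (rule measurable_chain) simp
  have V: "V k \<in> events" if "k \<le> m" for k
    unfolding V_def using that
    by (intro pred_walk[where A="{k..<m}" and P="?Q k", OF ind _ cm chain_restrict]) auto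
  have UV: "prob (U k \<inter> V k) = prob (U k) * prob (V k)" if "k \<le> m" for k
  proof -
    have "U k \<inter> V k = {w \<in> space M. first_exit n r (\<lambda>i. \<xi> i w) j k \<and>
        chain (\<lambda>u v. exceeds n r 4 (walk_sum (\<lambda>i. \<xi> i w) u v)) {..m} i k}"
      by (auto simp: U_def V_def)
    moreover have "{j..<k} \<inter> {k..<m} = {}" "{j..<k} \<subseteq> {..<m}" "{k..<m} \<subseteq> {..<m}" using that by auto
    ultimately show ?thesis unfolding U_def V_def using
      indep_blocks[where A="{j..<k}" and P="\<lambda>f. first_exit n r f j k" and B="{k..<m}" and
        Q="?Q k", OF ind _ _ _ fm loc cm chain_restrict[OF order_refl that]] by simp
  qed
  have disj: "disjoint_family_on U {j<..m}"
    unfolding disjoint_family_on_def U_def using first_exit_unique by fastforce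
  have "{w \<in> space M. chain (\<lambda>u v. exceeds n r 4 (walk_sum (\<lambda>i. \<xi> i w) u v)) {..m} (Suc i) j}
      \<subseteq> (\<Union>k\<in>{j<..m}. U k \<inter> V k)"
  proof
    fix w assume w: "w \<in> {w \<in> space M. chain (\<lambda>u v. exceeds n r 4 (walk_sum (\<lambda>i. \<xi> i w) u v)) {..m} (Suc i) j}"
    define S where "S = walk_sum (\<lambda>i. \<xi> i w)"
    obtain u v where uv: "j \<le> u" "u < v" "v \<le> m" "exceeds n r 4 (S u v)"
      "chain (\<lambda>u v. exceeds n r 4 (S u v)) {..m} i v"
      using w unfolding S_def by auto
    have "S u v = (\<lambda>x. S j v x + - S j u x)"
      using walk_sum_split[of j u v] uv unfolding S_def by auto
    then have "exceeds n r (2 + 2) (\<lambda>x. S j v x + - S j u x)" using uv(4) by simp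
    then have "exceeds n r 2 (S j v) \<or> exceeds n r 2 (S j u)"
      using exceeds_add[of n r 2 2 "S j v" "\<lambda>x. - S j u x"] by (simp add: exceeds_minus)
    then obtain k where k: "k \<le> v" "first_exit n r (\<lambda>i. \<xi> i w) j k"
      using first_exit_exists uv(2) unfolding S_def by (meson less_imp_le order_trans)
    have "j < k" using k(2) exceeds_walk_sum_less[of r 2] r unfolding first_exit_def by auto
    \<comment> \<open>The rest of the chain starts at \<open>v\<close>, possibly after the exit
      \<open>k\<close>. Counted from \<open>k\<close> it depends only on steps after the
      exit.\<close>
    have mono: "chain B F i v \<Longrightarrow> k \<le> v \<Longrightarrow> chain B F i k" for B and F :: "nat set"
      by (cases i) (auto, meson order_trans)
    have "w \<in> U k \<inter> V k" using w k mono[OF uv(5)] unfolding U_def V_def S_def by auto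
    then show "w \<in> (\<Union>k\<in>{j<..m}. U k \<inter> V k)" using \<open>j < k\<close> k uv by auto
  qed
  then have "prob {w \<in> space M. chain (\<lambda>u v. exceeds n r 4 (walk_sum (\<lambda>i. \<xi> i w) u v)) {..m} (Suc i) j}
      \<le> prob (\<Union>k\<in>{j<..m}. U k \<inter> V k)"
    using U V by (intro finite_measure_mono) auto
  also have "\<dots> \<le> (\<Sum>k\<in>{j<..m}. prob (U k \<inter> V k))"
    using U V by (intro finite_measure_subadditive_finite) auto
  also have "\<dots> \<le> (\<Sum>k\<in>{j<..m}. prob (U k) * c ^ i)"
  proof (rule sum_mono)
    fix k assume "k \<in> {j<..m}"
    then show "prob (U k \<inter> V k) \<le> prob (U k) * c ^ i"
      using Suc.IH[of k] UV[of k] by (simp add: V_def mult_left_mono)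
  qed
  also have "\<dots> = prob (\<Union>k\<in>{j<..m}. U k) * c ^ i"
    using finite_measure_finite_Union[OF _ _ disj] U by (auto simp: image_subset_iff sum_distrib_right)
  also have "(\<Union>k\<in>{j<..m}. U k) = {w \<in> space M. \<exists>k\<in>{j<..m}. first_exit n r (\<lambda>i. \<xi> i w) j k}"
    by (auto simp: U_def)
  also have "prob \<dots> * c ^ i \<le> c * c ^ i" using exit[OF Suc.prems] c by (intro mult_right_mono) auto
  finally show ?case by simp
qed

section \<open>Cylindrical Levy processes\<close>

lemma chain_start_mono: "chain B F i v \<Longrightarrow> s \<le> v \<Longrightarrow> chain B F i s"
  by (cases i) (auto, meson order_trans)

lemma chain_set_mono: "chain B F i s \<Longrightarrow> F \<subseteq> G \<Longrightarrow> chain B G i s"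
proof (induction i arbitrary: s)
  case (Suc i)
  then show ?case by (simp) (meson subsetD)
qed simp

text \<open>A chain uses finitely many points. This reduces chains of rational times to the finite
  sets for which the walk estimates hold.\<close>

lemma chain_UN:
  assumes "chain B (\<Union>m. F m) i s" "incseq F"
  shows "\<exists>m::nat. chain B (F m) i s"
  using assms(1)
proof (induction i arbitrary: s)
  case (Suc i)
  then obtain u v a b where uv: "u \<in> F a" "v \<in> F b" "s \<le> u" "u < v" "B u v" "chain B (\<Union>m. F m) i v" by auto
  obtain c where c: "chain B (F c) i v" using Suc.IH[OF uv(6)] by blast
  have mono: "F k \<subseteq> F (max a (max b c))" if "k \<le> max a (max b c)" for k
    using assms(2) that by (simp add: incseqD)
  have "chain B (F (max a (max b c))) i v" "u \<in> F (max a (max b c))" "v \<in> F (max a (max b c))"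
    using chain_set_mono[OF c mono] mono[of a] mono[of b] uv(1,2) by (auto simp: le_max_iff_disj)
  then show ?case using uv by auto
qed simp

lemma chain_index:
  fixes \<tau> :: "nat \<Rightarrow> real"
  assumes \<tau>: "\<forall>i k. i < k \<longrightarrow> k \<le> m \<longrightarrow> \<tau> i < \<tau> k"
  shows "chain B (\<tau> ` {..m}) n (\<tau> j) \<Longrightarrow> j \<le> m \<Longrightarrow> chain (\<lambda>u v. B (\<tau> u) (\<tau> v)) {..m} n j"
proof (induction n arbitrary: j)
  case (Suc n)
  then obtain u v where uv: "u \<le> m" "v \<le> m" "\<tau> j \<le> \<tau> u" "\<tau> u < \<tau> v" "B (\<tau> u) (\<tau> v)"
    "chain B (\<tau> ` {..m}) n (\<tau> v)" by auto
  have "j \<le> u" using \<tau>[rule_format, of u j] uv(3) Suc.prems(2) by force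
  moreover have "u < v" using \<tau>[rule_format, of v u] uv(1,4) by (metis linorder_cases less_asym less_irrefl)
  ultimately show ?case using uv Suc.IH[OF uv(6)] by auto
qed simp

section \<open>One-sided limits along the rationals\<close>

lemma rational_limit_exists:
  fixes x :: "real \<Rightarrow> real"
  assumes cau: "\<And>\<epsilon>. \<epsilon> > 0 \<Longrightarrow> \<exists>\<delta>>0. \<forall>s\<in>A. \<forall>s'\<in>A. \<bar>s - t\<bar> < \<delta> \<longrightarrow> \<bar>s' - t\<bar> < \<delta> \<longrightarrow> \<bar>x s - x s'\<bar> \<le> \<epsilon>"
    and A: "t \<in> closure A" "t \<notin> A"
  shows "\<exists>l. (x \<longlongrightarrow> l) (at t within A)"
proof -
  obtain \<sigma> where \<sigma>: "\<And>n. \<sigma> n \<in> A" "\<sigma> \<longlonglongrightarrow> t"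
    using A(1) unfolding closure_sequential by blast
  have ev: "\<forall>\<^sub>F n in sequentially. \<bar>\<sigma> n - t\<bar> < \<delta>" if "\<delta> > 0" for \<delta>
    using tendstoD[OF \<sigma>(2) that] by (simp add: dist_real_def)
  have "Cauchy (\<lambda>n. x (\<sigma> n))"
    unfolding Cauchy_def
  proof (intro allI impI)
    fix e :: real assume "e > 0"
    then obtain \<delta> where \<delta>: "\<delta> > 0" "\<forall>s\<in>A. \<forall>s'\<in>A. \<bar>s - t\<bar> < \<delta> \<longrightarrow> \<bar>s' - t\<bar> < \<delta> \<longrightarrow> \<bar>x s - x s'\<bar> \<le> e / 2"
      using cau[of "e / 2"] by auto
    obtain N where N: "\<And>n. n \<ge> N \<Longrightarrow> \<bar>\<sigma> n - t\<bar> < \<delta>" using ev[OF \<delta>(1)] unfolding eventually_sequentially by blast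
    have "dist (x (\<sigma> m)) (x (\<sigma> n)) < e" if "m \<ge> N" "n \<ge> N" for m n
    proof -
      have "\<bar>x (\<sigma> m) - x (\<sigma> n)\<bar> \<le> e / 2" using \<delta>(2) \<sigma>(1) N[OF that(1)] N[OF that(2)] by blast
      then show ?thesis using \<open>e > 0\<close> unfolding dist_real_def by linarith
    qed
    then show "\<exists>N. \<forall>m\<ge>N. \<forall>n\<ge>N. dist (x (\<sigma> m)) (x (\<sigma> n)) < e" by blast
  qed
  then obtain l where l: "(\<lambda>n. x (\<sigma> n)) \<longlonglongrightarrow> l" using Cauchy_convergent convergent_def by blast
  have "(x \<longlongrightarrow> l) (at t within A)"
  proof (rule tendstoI)
    fix e :: real assume e: "e > 0"
    then obtain \<delta> where \<delta>: "\<delta> > 0" "\<forall>s\<in>A. \<forall>s'\<in>A. \<bar>s - t\<bar> < \<delta> \<longrightarrow> \<bar>s' - t\<bar> < \<delta> \<longrightarrow> \<bar>x s - x s'\<bar> \<le> e / 2"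
      using cau[of "e / 2"] by auto
    obtain n where n: "\<bar>\<sigma> n - t\<bar> < \<delta>" "dist (x (\<sigma> n)) l < e / 2"
      using eventually_happens[OF eventually_conj[OF ev[OF \<delta>(1)] tendstoD[OF l, of "e / 2"]]] e by auto
    have "dist (x s) l < e" if "s \<in> A" "\<bar>s - t\<bar> < \<delta>" for s
    proof -
      have "\<bar>x s - x (\<sigma> n)\<bar> \<le> e / 2" using \<delta>(2) that n(1) \<sigma>(1) by blast
      then show ?thesis using n(2) unfolding dist_real_def by linarith
    qed
    then show "\<forall>\<^sub>F s in at t within A. dist (x s) l < e"
      unfolding eventually_at dist_real_def using \<delta>(1) by (intro exI[of _ \<delta>]) auto
  qed
  then show ?thesis by blast
qed

lemma rats_closure:
  fixes a b :: real
  assumes "a < b" shows "a \<in> closure (\<rat> \<inter> {a<..<b})" "b \<in> closure (\<rat> \<inter> {a<..<b})"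
proof -
  show "a \<in> closure (\<rat> \<inter> {a<..<b})" unfolding closure_approachable
  proof (intro allI impI)
    fix e :: real assume "e > 0"
    then obtain r where "r \<in> \<rat>" "a < r" "r < min b (a + e)" using Rats_dense_in_real[of a "min b (a + e)"] assms by auto
    then show "\<exists>y\<in>\<rat> \<inter> {a<..<b}. dist y a < e" by (intro bexI[of _ r]) (auto simp: dist_real_def)
  qed
  show "b \<in> closure (\<rat> \<inter> {a<..<b})" unfolding closure_approachable
  proof (intro allI impI)
    fix e :: real assume "e > 0"
    then obtain r where "r \<in> \<rat>" "max a (b - e) < r" "r < b" using Rats_dense_in_real[of "max a (b - e)" b] assms by auto
    then show "\<exists>y\<in>\<rat> \<inter> {a<..<b}. dist y b < e" by (intro bexI[of _ r]) (auto simp: dist_real_def)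
  qed
qed

text \<open>Oscillations above \<epsilon> arbitrarily close to \<open>t\<close> would build chains
  of any length: on the right of \<open>t\<close> each new pair is put in front of the chain found
  so far, on the left the chain is continued towards \<open>t\<close>.\<close>

lemma no_chain_cauchy:
  fixes x :: "real \<Rightarrow> real"
  assumes nc: "\<not> chain (\<lambda>u v. \<epsilon> < \<bar>x v - x u\<bar>) (\<rat> \<inter> {a..b}) N a" and \<epsilon>: "\<epsilon> > 0"
  shows "a \<le> t \<Longrightarrow> t < b \<Longrightarrow>
      \<exists>\<delta>>0. \<forall>s\<in>\<rat> \<inter> {t<..}. \<forall>s'\<in>\<rat> \<inter> {t<..}. \<bar>s - t\<bar> < \<delta> \<longrightarrow> \<bar>s' - t\<bar> < \<delta> \<longrightarrow> \<bar>x s - x s'\<bar> \<le> \<epsilon>"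
    and "a < t \<Longrightarrow> t \<le> b \<Longrightarrow>
      \<exists>\<delta>>0. \<forall>s\<in>\<rat> \<inter> {0<..<t}. \<forall>s'\<in>\<rat> \<inter> {0<..<t}. \<bar>s - t\<bar> < \<delta> \<longrightarrow> \<bar>s' - t\<bar> < \<delta> \<longrightarrow> \<bar>x s - x s'\<bar> \<le> \<epsilon>"
proof -
  assume t: "a \<le> t" "t < b"
  show "\<exists>\<delta>>0. \<forall>s\<in>\<rat> \<inter> {t<..}. \<forall>s'\<in>\<rat> \<inter> {t<..}. \<bar>s - t\<bar> < \<delta> \<longrightarrow> \<bar>s' - t\<bar> < \<delta> \<longrightarrow> \<bar>x s - x s'\<bar> \<le> \<epsilon>"
  proof (rule ccontr)
    assume neg: "\<not> ?thesis"
    have pair: "\<exists>u v. u \<in> \<rat> \<and> v \<in> \<rat> \<and> t < u \<and> u < v \<and> v < c \<and> \<epsilon> < \<bar>x v - x u\<bar>" if "t < c" for c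
    proof -
      have "0 < c - t" using that by simp
      then have "\<not> (\<forall>s\<in>\<rat> \<inter> {t<..}. \<forall>s'\<in>\<rat> \<inter> {t<..}. \<bar>s - t\<bar> < c - t \<longrightarrow> \<bar>s' - t\<bar> < c - t \<longrightarrow> \<bar>x s - x s'\<bar> \<le> \<epsilon>)"
        using neg by blast
      then obtain s s' where s: "s \<in> \<rat> \<inter> {t<..}" "s' \<in> \<rat> \<inter> {t<..}" "\<bar>s - t\<bar> < c - t" "\<bar>s' - t\<bar> < c - t" "\<epsilon> < \<bar>x s - x s'\<bar>"
        by (auto simp: not_le)
      then have "s \<noteq> s'" using \<epsilon> by auto
      then consider "s < s'" | "s' < s" by linarith
      then show ?thesis
      proof cases
        case 1
        then show ?thesis using s by (intro exI[of _ s] exI[of _ s']) (auto simp: abs_minus_commute)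
      next
        case 2
        then show ?thesis using s by (intro exI[of _ s'] exI[of _ s]) auto
      qed
    qed
    have "\<exists>s. t < s \<and> s < b \<and> chain (\<lambda>u v. \<epsilon> < \<bar>x v - x u\<bar>) (\<rat> \<inter> {a..b}) n s" for n
    proof (induction n)
      case 0
      show ?case using t dense[OF t(2)] by auto
    next
      case (Suc n)
      then obtain s where s: "t < s" "s < b" "chain (\<lambda>u v. \<epsilon> < \<bar>x v - x u\<bar>) (\<rat> \<inter> {a..b}) n s" by blast
      obtain u v where uv: "u \<in> \<rat>" "v \<in> \<rat>" "t < u" "u < v" "v < s" "\<epsilon> < \<bar>x v - x u\<bar>"
        using pair[OF s(1)] by blast
      have "chain (\<lambda>u v. \<epsilon> < \<bar>x v - x u\<bar>) (\<rat> \<inter> {a..b}) n v" using chain_start_mono[OF s(3)] uv by simp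
      then have "chain (\<lambda>u v. \<epsilon> < \<bar>x v - x u\<bar>) (\<rat> \<inter> {a..b}) (Suc n) u"
        unfolding chain.simps using uv s t by (intro bexI[of _ u] bexI[of _ v]) auto
      then show ?case using uv s by (intro exI[of _ u]) auto
    qed
    then have "chain (\<lambda>u v. \<epsilon> < \<bar>x v - x u\<bar>) (\<rat> \<inter> {a..b}) N a"
      using t chain_start_mono by (meson less_imp_le order_trans)
    then show False using nc by blast
  qed
next
  assume t: "a < t" "t \<le> b"
  show "\<exists>\<delta>>0. \<forall>s\<in>\<rat> \<inter> {0<..<t}. \<forall>s'\<in>\<rat> \<inter> {0<..<t}. \<bar>s - t\<bar> < \<delta> \<longrightarrow> \<bar>s' - t\<bar> < \<delta> \<longrightarrow> \<bar>x s - x s'\<bar> \<le> \<epsilon>"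
  proof (rule ccontr)
    assume neg: "\<not> ?thesis"
    have pair: "\<exists>u v. u \<in> \<rat> \<and> v \<in> \<rat> \<and> c < u \<and> u < v \<and> v < t \<and> \<epsilon> < \<bar>x v - x u\<bar>" if "c < t" for c
    proof -
      have "0 < t - c" using that by simp
      then have "\<not> (\<forall>s\<in>\<rat> \<inter> {0<..<t}. \<forall>s'\<in>\<rat> \<inter> {0<..<t}. \<bar>s - t\<bar> < t - c \<longrightarrow> \<bar>s' - t\<bar> < t - c \<longrightarrow> \<bar>x s - x s'\<bar> \<le> \<epsilon>)"
        using neg by blast
      then obtain s s' where s: "s \<in> \<rat> \<inter> {0<..<t}" "s' \<in> \<rat> \<inter> {0<..<t}" "\<bar>s - t\<bar> < t - c" "\<bar>s' - t\<bar> < t - c" "\<epsilon> < \<bar>x s - x s'\<bar>"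
        by (auto simp: not_le)
      then have "s \<noteq> s'" using \<epsilon> by auto
      then consider "s < s'" | "s' < s" by linarith
      then show ?thesis
      proof cases
        case 1
        then show ?thesis using s by (intro exI[of _ s] exI[of _ s']) (auto simp: abs_minus_commute)
      next
        case 2
        then show ?thesis using s by (intro exI[of _ s'] exI[of _ s]) auto
      qed
    qed
    have "a \<le> c \<Longrightarrow> c < t \<Longrightarrow> chain (\<lambda>u v. \<epsilon> < \<bar>x v - x u\<bar>) (\<rat> \<inter> {a..b}) n c" for n c
    proof (induction n arbitrary: c)
      case (Suc n)
      obtain u v where uv: "u \<in> \<rat>" "v \<in> \<rat>" "c < u" "u < v" "v < t" "\<epsilon> < \<bar>x v - x u\<bar>"
        using pair[OF Suc.prems(2)] by blast
      then have "chain (\<lambda>u v. \<epsilon> < \<bar>x v - x u\<bar>) (\<rat> \<inter> {a..b}) n v" using Suc by auto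
      then show ?case
        unfolding chain.simps using uv t Suc.prems by (intro bexI[of _ u] bexI[of _ v]) auto
    qed simp
    then show False using nc t by blast
  qed
qed

lemma finite_enum:
  fixes F :: "real set"
  assumes F: "finite F" "F \<noteq> {}"
  shows "\<exists>m \<tau>. F = \<tau> ` {..m::nat} \<and> (\<forall>i k. i < k \<longrightarrow> k \<le> m \<longrightarrow> \<tau> i < \<tau> k)"
proof -
  let ?l = "sorted_list_of_set F"
  have len: "length ?l = card F" "card F > 0" using F by (simp_all add: card_gt_0_iff)
  have "F = (!) ?l ` {..<card F}"
    using F set_conv_nth[of ?l] len by (auto simp: image_def)
  moreover have "{..<card F} = {..card F - 1}" using len(2) by auto
  moreover have "?l ! i < ?l ! k" if "i < k" "k \<le> card F - 1" for i k
    using sorted_wrt_nth_less[OF sorted_list_of_set.strict_sorted_key_list_of_set, of i k F] that len by auto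
  ultimately show ?thesis by (intro exI[of _ "card F - 1"] exI[of _ "(!) ?l"]) auto
qed

section \<open>Maximal inequality and oscillations of the real processes\<close>

locale cyl_levy = prob_space M for M :: "'w measure" +
  fixes L :: "real \<Rightarrow> 'v::real_vector \<Rightarrow> 'w \<Rightarrow> real"
  assumes levy: "cylindrical_levy M L"
begin

definition vec :: "nat \<Rightarrow> (nat \<Rightarrow> 'v) \<Rightarrow> real \<Rightarrow> 'w \<Rightarrow> nat \<Rightarrow> real" where
  "vec n \<phi> t w = (\<lambda>i\<in>{..<n}. L t (\<phi> i) w)"

definition incr :: "nat \<Rightarrow> (nat \<Rightarrow> 'v) \<Rightarrow> (nat \<Rightarrow> real) \<Rightarrow> nat \<Rightarrow> 'w \<Rightarrow> nat \<Rightarrow> real" where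
  "incr n \<phi> \<tau> j w = fun_diff {..<n} (vec n \<phi> (\<tau> (Suc j)) w) (vec n \<phi> (\<tau> j) w)"

lemma cyl: "0 \<le> t \<Longrightarrow> cylindrical_rv M (L t)"
  using levy by (simp add: cylindrical_levy_def)

lemma L_measurable [measurable]: "0 \<le> t \<Longrightarrow> L t \<phi> \<in> borel_measurable M"
  using cyl cylindrical_rv_measurable by blast

lemma levy_Rn: "1 \<le> n \<Longrightarrow> levy_process_Rn M n (vec n \<phi>)"
  using levy unfolding cylindrical_levy_def vec_def by blast

lemma vec_measurable: "0 \<le> t \<Longrightarrow> vec n \<phi> t \<in> measurable M (vecM n)"
  unfolding vec_def by (rule measurable_restrict) simp

lemma indep_incr:
  assumes n: "1 \<le> n" and \<tau>: "0 \<le> \<tau> 0" "\<forall>i k. i < k \<longrightarrow> k \<le> m \<longrightarrow> \<tau> i < \<tau> k"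
  shows "indep_vars (\<lambda>_. vecM n) (incr n \<phi> \<tau>) {..<m}"
proof -
  have "indep_increments M (vecM n) {..<n} (vec n \<phi>)"
    using levy_Rn[OF n] by (simp add: levy_process_Rn_def Let_def)
  then have "indep_vars (\<lambda>_. vecM n) (\<lambda>j w. fun_diff {..<n} (vec n \<phi> (\<tau> (Suc j)) w) (vec n \<phi> (\<tau> j) w)) {..<m}"
    using \<tau> unfolding indep_increments_def by simp
  then show ?thesis by (simp add: incr_def[abs_def])
qed

lemma walk_sum_incr:
  "j \<le> k \<Longrightarrow> x < n \<Longrightarrow> walk_sum (\<lambda>i. incr n \<phi> \<tau> i w) j k x = L (\<tau> k) (\<phi> x) w - L (\<tau> j) (\<phi> x) w"
  by (use sum_Suc_diff'[of j k "\<lambda>i. L (\<tau> i) (\<phi> x) w"] in \<open>simp add: walk_sum_def incr_def fun_diff_def vec_def\<close>)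

lemma exceeds_incr:
  "j \<le> k \<Longrightarrow> exceeds n r c (walk_sum (\<lambda>i. incr n \<phi> \<tau> i w) j k) \<longleftrightarrow>
    (\<exists>x<n. c * r x < \<bar>L (\<tau> k) (\<phi> x) w - L (\<tau> j) (\<phi> x) w\<bar>)"
  unfolding exceeds_def by (auto simp: walk_sum_incr)

lemma increment_prob:
  fixes n :: nat
  assumes n: "1 \<le> n" and st: "0 \<le> s" "s \<le> t"
  shows "prob {w \<in> space M. \<exists>x<n. r x < \<bar>L t (\<phi> x) w - L s (\<phi> x) w\<bar>} = prob {w \<in> space M. \<exists>x<n. r x < \<bar>L (t - s) (\<phi> x) w\<bar>}"
proof -
  have d: "distr M (vecM n) (\<lambda>w. fun_diff {..<n} (vec n \<phi> t w) (vec n \<phi> s w)) = distr M (vecM n) (vec n \<phi> (t - s))"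
    using levy_Rn[OF n, of \<phi>] st unfolding levy_process_Rn_def stationary_increments_def Let_def by blast
  have fm: "(\<lambda>w. fun_diff {..<n} (vec n \<phi> t w) (vec n \<phi> s w)) \<in> measurable M (vecM n)"
    unfolding fun_diff_def using st by (intro measurable_restrict) (simp add: vec_def)
  define U where "U = {f \<in> space (vecM n). \<exists>x\<in>{..<n}. r x < \<bar>f x\<bar>}"
  have U: "U \<in> sets (vecM n)" unfolding U_def by measurable
  have "measure (distr M (vecM n) (\<lambda>w. fun_diff {..<n} (vec n \<phi> t w) (vec n \<phi> s w))) U =
      prob {w \<in> space M. \<exists>x<n. r x < \<bar>L t (\<phi> x) w - L s (\<phi> x) w\<bar>}"
    unfolding measure_distr[OF fm U]
    using measurable_space[OF fm] by (intro arg_cong[where f=prob]) (auto simp: U_def fun_diff_def vec_def)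
  moreover have "measure (distr M (vecM n) (vec n \<phi> (t - s))) U = prob {w \<in> space M. \<exists>x<n. r x < \<bar>L (t - s) (\<phi> x) w\<bar>}"
    using st measurable_space[OF vec_measurable[of "t - s" n \<phi>]]
    by (subst measure_distr[OF vec_measurable U]) (auto intro!: arg_cong[where f=prob] simp: U_def vec_def)
  ultimately show ?thesis using d by simp
qed

text \<open>By stationarity the remaining increment over [\<open>\<tau> k\<close>,
  \<open>\<tau> m\<close>] has the law of some \<open>L u\<close> with \<open>u\<close> \<le>
  \<open>h\<close>, so a single smallness hypothesis covers every stage of the walk.\<close>

lemma levy_exit:
  assumes n: "1 \<le> n" and \<tau>: "0 \<le> \<tau> 0" "\<forall>i k. i < k \<longrightarrow> k \<le> m \<longrightarrow> \<tau> i < \<tau> k" "\<tau> m - \<tau> 0 \<le> h"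
    and r: "\<And>x. 0 < r x" and \<beta>: "\<beta> \<le> 1 / 2"
    and small: "\<And>u. 0 \<le> u \<Longrightarrow> u \<le> h \<Longrightarrow> prob {w \<in> space M. \<exists>x<n. r x < \<bar>L u (\<phi> x) w\<bar>} \<le> \<beta>"
    and j: "j \<le> m"
  shows "prob {w \<in> space M. \<exists>k\<in>{j<..m}. first_exit n r (\<lambda>i. incr n \<phi> \<tau> i w) j k} \<le> 2 * \<beta>"
proof (rule ottaviani[OF indep_incr[OF n \<tau>(1,2)] r \<beta> j])
  fix k assume k: "k \<le> m"
  have 1: "0 \<le> \<tau> k" "\<tau> k \<le> \<tau> m" "\<tau> m - \<tau> k \<le> h"
    using \<tau>(1,3) \<tau>(2)[rule_format, of 0 k] \<tau>(2)[rule_format, of k m] k by (cases "k = 0"; cases "k = m"; force)+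
  have "prob {w \<in> space M. exceeds n r 1 (walk_sum (\<lambda>i. incr n \<phi> \<tau> i w) k m)} =
      prob {w \<in> space M. \<exists>x<n. r x < \<bar>L (\<tau> m) (\<phi> x) w - L (\<tau> k) (\<phi> x) w\<bar>}"
    using k by (simp add: exceeds_incr)
  also have "\<dots> \<le> \<beta>" using small[of "\<tau> m - \<tau> k"] 1 increment_prob[OF n 1(1,2)] by simp
  finally show "prob {w \<in> space M. exceeds n r 1 (walk_sum (\<lambda>i. incr n \<phi> \<tau> i w) k m)} \<le> \<beta>" .
qed

lemma L0: "AE w in M. L 0 \<phi> w = 0"
proof -
  have "AE w in M. \<forall>i<1. vec 1 (\<lambda>_. \<phi>) 0 w i = 0"
    using levy_Rn[of 1] by (simp add: levy_process_Rn_def Let_def)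
  then show ?thesis by eventually_elim (simp add: vec_def)
qed

lemma levy_sup:
  fixes n :: nat
  assumes n: "1 \<le> n" and F: "finite F" "F \<subseteq> {0..h}"
    and r: "\<And>x. 0 < r x" and \<beta>: "\<beta> \<le> 1 / 2"
    and small: "\<And>u. 0 \<le> u \<Longrightarrow> u \<le> h \<Longrightarrow> prob {w \<in> space M. \<exists>x<n. r x < \<bar>L u (\<phi> x) w\<bar>} \<le> \<beta>"
    and h: "0 \<le> h"
  shows "prob {w \<in> space M. \<exists>t\<in>F. \<exists>x<n. 2 * r x < \<bar>L t (\<phi> x) w\<bar>} \<le> 2 * \<beta>"
proof -
  \<comment> \<open>Time 0 is added as starting point: outside a null set the walk sums from index 0
    are then values of \<open>L\<close> and not only increments.\<close>
  obtain m :: nat and \<tau> :: "nat \<Rightarrow> real" where \<tau>: "insert 0 F = \<tau> ` {..m}" "\<forall>i k. i < k \<longrightarrow> k \<le> m \<longrightarrow> \<tau> i < \<tau> k"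
    using finite_enum[of "insert 0 F"] F(1) by blast
  have \<tau>h: "0 \<le> \<tau> i" "\<tau> i \<le> h" if "i \<le> m" for i
  proof -
    have "\<tau> i \<in> insert 0 F" unfolding \<tau>(1) using that by blast
    then show "0 \<le> \<tau> i" "\<tau> i \<le> h" using F(2) h by auto
  qed
  obtain i where i: "i \<le> m" "\<tau> i = 0" using \<tau>(1) by (metis atMost_iff imageE insertI1)
  have \<tau>0: "\<tau> 0 = 0" using \<tau>(2)[rule_format, of 0 i] \<tau>h[of 0] i by (cases "i = 0") auto
  let ?E = "{w \<in> space M. \<exists>k\<in>{0<..m}. first_exit n r (\<lambda>i. incr n \<phi> \<tau> i w) 0 k}"
  have E: "?E \<in> events"
  proof -
    have "{w \<in> space M. first_exit n r (\<lambda>i. incr n \<phi> \<tau> i w) 0 k} \<in> events" if k: "k \<le> m" for k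
    proof (rule pred_walk[where A="{..<m}" and P="\<lambda>f. first_exit n r f 0 k"])
      show "indep_vars (\<lambda>_. vecM n) (incr n \<phi> \<tau>) {..<m}" by (rule indep_incr[OF n _ \<tau>(2)]) (simp add: \<tau>0)
      show "Measurable.pred (Pi\<^sub>M {..<m} (\<lambda>_. vecM n)) (\<lambda>f. first_exit n r f 0 k)"
        using k by (intro measurable_first_exit) auto
      have "walk_sum (restrict f {..<m}) 0 l = walk_sum f 0 l" if "l \<le> k" for f l
        using that k by (intro walk_sum_restrict) auto
      then show "first_exit n r (restrict f {..<m}) 0 k = first_exit n r f 0 k" for f
        unfolding first_exit_def by auto
    qed simp
    then have "(\<Union>k\<in>{0<..m}. {w \<in> space M. first_exit n r (\<lambda>i. incr n \<phi> \<tau> i w) 0 k}) \<in> events" by auto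
    moreover have "?E = (\<Union>k\<in>{0<..m}. {w \<in> space M. first_exit n r (\<lambda>i. incr n \<phi> \<tau> i w) 0 k})" by auto
    ultimately show ?thesis by simp
  qed
  have "AE w in M. \<forall>x\<in>{..<n}. L 0 (\<phi> x) w = 0" by (rule AE_finite_allI) (simp_all add: L0)
  then have "AE w in M. w \<in> {w \<in> space M. \<exists>t\<in>F. \<exists>x<n. 2 * r x < \<bar>L t (\<phi> x) w\<bar>} \<longrightarrow> w \<in> ?E"
  proof eventually_elim
    case (elim w)
    show ?case
    proof
      assume w: "w \<in> {w \<in> space M. \<exists>t\<in>F. \<exists>x<n. 2 * r x < \<bar>L t (\<phi> x) w\<bar>}"
      then obtain t x where tx: "t \<in> F" "x < n" "2 * r x < \<bar>L t (\<phi> x) w\<bar>" by blast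
      then obtain k where k: "k \<le> m" "t = \<tau> k" using \<tau>(1) by (metis atMost_iff imageE insertI2)
      have "exceeds n r 2 (walk_sum (\<lambda>i. incr n \<phi> \<tau> i w) 0 k)"
        using tx k elim by (auto simp: exceeds_incr \<tau>0)
      then obtain l where l: "l \<le> k" "first_exit n r (\<lambda>i. incr n \<phi> \<tau> i w) 0 l" using first_exit_exists by blast
      then have "0 < l" using exceeds_walk_sum_less[of r 2] r unfolding first_exit_def by fastforce
      then show "w \<in> ?E" using l k w by auto
    qed
  qed
  then have "prob {w \<in> space M. \<exists>t\<in>F. \<exists>x<n. 2 * r x < \<bar>L t (\<phi> x) w\<bar>} \<le> prob ?E"
    using E by (rule finite_measure_mono_AE)
  also have "\<dots> \<le> 2 * \<beta>" using \<tau>h[of m] \<tau>0 by (intro levy_exit[OF n _ \<tau>(2) _ r \<beta> small]) auto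
  finally show ?thesis .
qed

text \<open>Only a measurable cover is asserted; it is enough for the null set in
  \<open>no_long_chains\<close>.\<close>

lemma levy_chain:
  assumes F: "finite F" "F \<subseteq> {a..a + h}" and a: "0 \<le> a" and \<epsilon>: "0 < \<epsilon>" and \<beta>: "0 \<le> \<beta>" "\<beta> \<le> 1 / 2"
    and small: "\<And>u. 0 \<le> u \<Longrightarrow> u \<le> h \<Longrightarrow> prob {w \<in> space M. \<epsilon> < \<bar>L u \<phi> w\<bar>} \<le> \<beta>"
  shows "\<exists>A\<in>events. {w \<in> space M. chain (\<lambda>u v. 4 * \<epsilon> < \<bar>L v \<phi> w - L u \<phi> w\<bar>) F i a} \<subseteq> A \<and> prob A \<le> (2 * \<beta>) ^ i"
proof (cases "F = {}")
  case True
  show ?thesis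
  proof (cases i)
    case 0
    then show ?thesis by (intro bexI[of _ "space M"]) (auto simp: prob_space)
  next
    case (Suc k)
    then show ?thesis using True \<beta>(1) by (intro bexI[of _ "{}"]) auto
  qed
next
  case False
  then obtain m :: nat and \<tau> :: "nat \<Rightarrow> real" where \<tau>: "F = \<tau> ` {..m}" "\<forall>i k. i < k \<longrightarrow> k \<le> m \<longrightarrow> \<tau> i < \<tau> k"
    using finite_enum[OF F(1)] by blast
  have \<tau>h: "a \<le> \<tau> i" "\<tau> i \<le> a + h" if "i \<le> m" for i using \<tau>(1) F(2) that by auto
  have \<tau>0: "0 \<le> \<tau> 0" using \<tau>h(1)[of 0] a by simp
  define \<psi> where "\<psi> = (\<lambda>_::nat. \<phi>)"
  define r where "r = (\<lambda>_::nat. \<epsilon>)"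
  have ind: "indep_vars (\<lambda>_. vecM 1) (incr 1 \<psi> \<tau>) {..<m}" by (rule indep_incr[OF _ \<tau>0 \<tau>(2)]) simp
  let ?A = "{w \<in> space M. chain (\<lambda>u v. exceeds 1 r 4 (walk_sum (\<lambda>i. incr 1 \<psi> \<tau> i w) u v)) {..m} i 0}"
  have "prob ?A \<le> (2 * \<beta>) ^ i"
  proof (rule chain_bound[OF ind])
    fix j assume "j \<le> m"
    then show "prob {w \<in> space M. \<exists>k\<in>{j<..m}. first_exit 1 r (\<lambda>i. incr 1 \<psi> \<tau> i w) j k} \<le> 2 * \<beta>"
      using \<epsilon> \<tau>h[of m] \<tau>h[of 0] \<beta> small
      by (intro levy_exit[OF _ \<tau>0 \<tau>(2), where h=h]) (auto simp: r_def \<psi>_def)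
  qed (use \<beta> \<epsilon> in \<open>auto simp: r_def\<close>)
  moreover have "?A \<in> events"
  proof (rule pred_walk[OF ind, where A="{0..<m}" and P="\<lambda>f. chain (\<lambda>u v. exceeds 1 r 4 (walk_sum f u v)) {..m} i 0"])
    show "Measurable.pred (Pi\<^sub>M {0..<m} (\<lambda>_. vecM 1)) (\<lambda>f. chain (\<lambda>u v. exceeds 1 r 4 (walk_sum f u v)) {..m} i 0)"
      by (rule measurable_chain) simp
    show "chain (\<lambda>u v. exceeds 1 r 4 (walk_sum (restrict f {0..<m}) u v)) {..m} i 0 =
        chain (\<lambda>u v. exceeds 1 r 4 (walk_sum f u v)) {..m} i 0" for f
      by (rule chain_restrict) auto
  qed auto
  moreover have "{w \<in> space M. chain (\<lambda>u v. 4 * \<epsilon> < \<bar>L v \<phi> w - L u \<phi> w\<bar>) F i a} \<subseteq> ?A"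
  proof
    fix w assume "w \<in> {w \<in> space M. chain (\<lambda>u v. 4 * \<epsilon> < \<bar>L v \<phi> w - L u \<phi> w\<bar>) F i a}"
    then have w: "w \<in> space M" "chain (\<lambda>u v. 4 * \<epsilon> < \<bar>L v \<phi> w - L u \<phi> w\<bar>) F i a" by auto
    \<comment> \<open>The window starts at \<open>a\<close>, the walk at the first point of
      \<open>F\<close>; no pair of the chain lies in between.\<close>
    have "chain (\<lambda>u v. 4 * \<epsilon> < \<bar>L v \<phi> w - L u \<phi> w\<bar>) F i (\<tau> 0)"
    proof (cases i)
      case (Suc i')
      have "\<tau> 0 \<le> u" if uF: "u \<in> F" for u
      proof -
        obtain k where k: "k \<le> m" "u = \<tau> k" using uF \<tau>(1) by auto
        then show ?thesis using \<tau>(2)[rule_format, of 0 k] by (cases "k = 0") auto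
      qed
      then show ?thesis using w(2) unfolding Suc by auto
    qed simp
    then have 1: "chain (\<lambda>u v. 4 * \<epsilon> < \<bar>L (\<tau> v) \<phi> w - L (\<tau> u) \<phi> w\<bar>) {..m} i 0"
      using chain_index[OF \<tau>(2), of "\<lambda>u v. 4 * \<epsilon> < \<bar>L v \<phi> w - L u \<phi> w\<bar>" i 0] unfolding \<tau>(1) by simp
    have "chain (\<lambda>u v. 4 * \<epsilon> < \<bar>L (\<tau> v) \<phi> w - L (\<tau> u) \<phi> w\<bar>) {..m} i j \<Longrightarrow>
        chain (\<lambda>u v. exceeds 1 r 4 (walk_sum (\<lambda>i. incr 1 \<psi> \<tau> i w) u v)) {..m} i j" for j
    proof (induction i arbitrary: j)
      case (Suc i)
      then obtain u v where uv: "u \<le> m" "v \<le> m" "j \<le> u" "u < v" "4 * \<epsilon> < \<bar>L (\<tau> v) \<phi> w - L (\<tau> u) \<phi> w\<bar>"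
        "chain (\<lambda>u v. 4 * \<epsilon> < \<bar>L (\<tau> v) \<phi> w - L (\<tau> u) \<phi> w\<bar>) {..m} i v" by auto
      have "exceeds 1 r 4 (walk_sum (\<lambda>i. incr 1 \<psi> \<tau> i w) u v)"
        using uv by (simp add: exceeds_incr r_def \<psi>_def)
      then show ?case using uv Suc.IH[OF uv(6)] by auto
    qed simp
    then show "w \<in> ?A" using 1 w by blast
  qed
  ultimately show ?thesis by blast
qed

lemma stochastic_continuity:
  assumes s: "0 \<le> s" and \<epsilon>: "0 < \<epsilon>"
  shows "((\<lambda>t. prob {w \<in> space M. \<epsilon> < \<bar>L t \<phi> w - L s \<phi> w\<bar>}) \<longlongrightarrow> 0) (at s within {0..})"
proof -
  have "((\<lambda>t. prob {w \<in> space M. \<epsilon> < L2_set (\<lambda>i. vec 1 (\<lambda>_. \<phi>) t w i - vec 1 (\<lambda>_. \<phi>) s w i) {..<1}}) \<longlongrightarrow> 0) (at s within {0..})"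
    using levy_Rn[of 1 "\<lambda>_. \<phi>"] s \<epsilon> unfolding levy_process_Rn_def Let_def by auto
  moreover have "L2_set (\<lambda>i. vec 1 (\<lambda>_. \<phi>) t w i - vec 1 (\<lambda>_. \<phi>) s w i) {..<1} = \<bar>L t \<phi> w - L s \<phi> w\<bar>" for t w
    by (simp add: L2_set_def vec_def)
  ultimately show ?thesis by simp
qed

lemma small_time:
  assumes \<epsilon>: "0 < \<epsilon>" and \<beta>: "0 < \<beta>"
  shows "\<exists>h>0. \<forall>u. 0 \<le> u \<longrightarrow> u \<le> h \<longrightarrow> prob {w \<in> space M. \<epsilon> < \<bar>L u \<phi> w\<bar>} \<le> \<beta>"
proof -
  have eq: "prob {w \<in> space M. \<epsilon> < \<bar>L u \<phi> w - L 0 \<phi> w\<bar>} = prob {w \<in> space M. \<epsilon> < \<bar>L u \<phi> w\<bar>}" if "0 \<le> u" for u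
  proof (rule finite_measure_eq_AE)
    show "AE w in M. (w \<in> {w \<in> space M. \<epsilon> < \<bar>L u \<phi> w - L 0 \<phi> w\<bar>}) = (w \<in> {w \<in> space M. \<epsilon> < \<bar>L u \<phi> w\<bar>})"
      using L0[of \<phi>] by eventually_elim auto
  qed (use that in measurable)
  have z: "prob {w \<in> space M. \<epsilon> < \<bar>L 0 \<phi> w\<bar>} = 0"
    using eq[of 0] \<epsilon> by simp
  have "\<forall>\<^sub>F t in at 0 within {0..}. prob {w \<in> space M. \<epsilon> < \<bar>L t \<phi> w - L 0 \<phi> w\<bar>} < \<beta>"
    using order_tendstoD(2)[OF stochastic_continuity[of 0 \<epsilon> \<phi>] \<beta>] \<epsilon> by simp
  then obtain d where d: "d > 0" "\<And>t. 0 \<le> t \<Longrightarrow> t \<noteq> 0 \<Longrightarrow> dist t 0 < d \<Longrightarrow> prob {w \<in> space M. \<epsilon> < \<bar>L t \<phi> w - L 0 \<phi> w\<bar>} < \<beta>"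
    unfolding eventually_at by auto
  have "prob {w \<in> space M. \<epsilon> < \<bar>L u \<phi> w\<bar>} \<le> \<beta>" if "0 \<le> u" "u \<le> d / 2" for u
    using d(2)[of u] d(1) that z eq[of u] \<beta> by (cases "u = 0") (auto intro: less_imp_le)
  then show ?thesis using d(1) by (intro exI[of _ "d / 2"]) auto
qed

text \<open>With threshold \<open>\<epsilon> / 4\<close> and probability 1/4 the geometric bound is
  2^(-i), so almost surely not all lengths occur. The length \<open>h\<close> of the window is the
  same for all \<open>a\<close>, which \<open>regulated_paths\<close> relies on.\<close>

lemma no_long_chains:
  assumes \<epsilon>: "0 < \<epsilon>"
  shows "\<exists>h>0. \<forall>a\<ge>0. AE w in M. \<exists>i. \<not> chain (\<lambda>u v. \<epsilon> < \<bar>L v \<phi> w - L u \<phi> w\<bar>) (\<rat> \<inter> {a..a + h}) i a"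
proof -
  obtain h where h: "h > 0" "\<And>u. 0 \<le> u \<Longrightarrow> u \<le> h \<Longrightarrow> prob {w \<in> space M. \<epsilon> / 4 < \<bar>L u \<phi> w\<bar>} \<le> 1 / 4"
    using small_time[of "\<epsilon> / 4" "1 / 4" \<phi>] \<epsilon> by auto
  have "AE w in M. \<exists>i. \<not> chain (\<lambda>u v. \<epsilon> < \<bar>L v \<phi> w - L u \<phi> w\<bar>) (\<rat> \<inter> {a..a + h}) i a" if a: "0 \<le> a" for a
  proof -
    have "countable (\<rat> \<inter> {a..a + h})" by (simp add: countable_rat)
    moreover have "\<rat> \<inter> {a..a + h} \<noteq> {}"
      using Rats_dense_in_real[of a "a + h"] h(1) by force
    ultimately obtain e :: "nat \<Rightarrow> real" where e: "\<rat> \<inter> {a..a + h} = range e"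
      by (metis uncountable_def)
    define F where "F m = e ` {..m}" for m
    have F: "finite (F m)" "F m \<subseteq> {a..a + h}" for m using e unfolding F_def by auto
    have UF: "\<rat> \<inter> {a..a + h} = (\<Union>m. F m)" unfolding e F_def by auto
    have incF: "incseq F" unfolding F_def incseq_def by auto
    define B where "B w u v \<longleftrightarrow> \<epsilon> < \<bar>L v \<phi> w - L u \<phi> w\<bar>" for w u v
    define Ch where "Ch m i = {w \<in> space M. chain (B w) (F m) i a}" for m i
    have "\<exists>A\<in>events. Ch m i \<subseteq> A \<and> prob A \<le> (1 / 2) ^ i" for m i
    proof -
      have e: "0 < \<epsilon> / 4" "(0::real) \<le> 1 / 4" "(1::real) / 4 \<le> 1 / 2" "4 * (\<epsilon> / 4) = \<epsilon>" "2 * (1 / 4) = (1 / 2 :: real)"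
        using \<epsilon> by auto
      show ?thesis unfolding Ch_def B_def
        using levy_chain[OF F(1)[of m] F(2)[of m] a e(1-3) h(2), of i] unfolding e(4,5) .
    qed
    then obtain A where A: "\<And>m i. A m i \<in> events" "\<And>m i. Ch m i \<subseteq> A m i"
      "\<And>m i. prob (A m i) \<le> (1 / 2) ^ i" by metis
    \<comment> \<open>The covers need not increase with \<open>m\<close>. Their lower limit is
      measurable, contains the event for all rational times of the window, and inherits the
      bound.\<close>
    define D where "D i = (\<Union>m. \<Inter>k\<in>{m..}. A k i)" for i
    have D: "D i \<in> events" for i unfolding D_def using A(1) by auto
    have inD: "w \<in> D i" if w: "w \<in> space M" "chain (B w) (\<rat> \<inter> {a..a + h}) i a" for w i
    proof -
      obtain m where m: "chain (B w) (F m) i a" using chain_UN[OF w(2)[unfolded UF] incF] by blast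
      have "w \<in> A k i" if k: "k \<ge> m" for k
        using A(2)[of k i] chain_set_mono[OF m incseqD[OF incF k]] w(1) unfolding Ch_def by blast
      then show ?thesis unfolding D_def by blast
    qed
    have pD: "prob (D i) \<le> (1 / 2) ^ i" for i
    proof -
      have "(\<lambda>m. prob (\<Inter>k\<in>{m..}. A k i)) \<longlonglongrightarrow> prob (D i)"
        unfolding D_def using A(1)
        by (intro finite_Lim_measure_incseq) (auto simp: incseq_def)
      moreover have "prob (\<Inter>k\<in>{m..}. A k i) \<le> (1 / 2) ^ i" for m
        using A by (intro order_trans[OF finite_measure_mono A(3)[of m i]]) auto
      ultimately show ?thesis by (intro LIMSEQ_le_const2) blast+
    qed
    have "prob (\<Inter>i. D i) \<le> 0"
    proof (rule LIMSEQ_le_const)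
      show "(\<lambda>i. (1 / 2 :: real) ^ i) \<longlonglongrightarrow> 0" by (intro LIMSEQ_realpow_zero) auto
      show "\<exists>N. \<forall>n\<ge>N. prob (\<Inter>i. D i) \<le> (1 / 2) ^ n"
        using D by (intro exI[of _ 0] allI impI order_trans[OF finite_measure_mono pD]) auto
    qed
    then have "(\<Inter>i. D i) \<in> null_sets M" using D by (intro null_setsI) (auto simp: emeasure_eq_measure measure_nonneg antisym)
    then show ?thesis
    proof (rule AE_I')
      show "{w \<in> space M. \<not> (\<exists>i. \<not> chain (\<lambda>u v. \<epsilon> < \<bar>L v \<phi> w - L u \<phi> w\<bar>) (\<rat> \<inter> {a..a + h}) i a)} \<subseteq> (\<Inter>i. D i)"
        using inD unfolding B_def[abs_def] by blast
    qed
  qed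
  then show ?thesis using h(1) by blast
qed

text \<open>For each \<open>k\<close> the number of oscillations above \<open>1 / Suc k\<close> is
  limited in every window of length \<open>h k\<close> with rational start, outside one null set. By
  \<open>no_chain_cauchy\<close> this is the Cauchy criterion on either side of every
  \<open>t\<close>.\<close>

lemma regulated_paths:
  "AE w in M. (\<forall>t\<ge>0. \<exists>l. ((\<lambda>s. L s \<phi> w) \<longlongrightarrow> l) (at t within \<rat> \<inter> {t<..})) \<and>
     (\<forall>t>0. \<exists>l. ((\<lambda>s. L s \<phi> w) \<longlongrightarrow> l) (at t within \<rat> \<inter> {0<..<t}))"
proof -
  define NC where "NC k d a w \<longleftrightarrow> (\<exists>i. \<not> chain (\<lambda>u v. 1 / real (Suc k) < \<bar>L v \<phi> w - L u \<phi> w\<bar>) (\<rat> \<inter> {a..a + d}) i a)" for k d a w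
  have "\<forall>k. \<exists>d>0. \<forall>a\<ge>0. AE w in M. NC k d a w"
    unfolding NC_def by (rule allI, rule no_long_chains) simp
  then obtain h where h: "\<And>k::nat. h k > 0" and NC: "\<And>k a. a \<ge> 0 \<Longrightarrow> AE w in M. NC k (h k) a w"
    by metis
  have c: "countable (\<rat> \<inter> {0::real..})" by (rule countable_Int1[OF countable_rat])
  have "AE w in M. \<forall>a\<in>\<rat> \<inter> {0..}. NC k (h k) a w" for k
    by (rule iffD2[OF AE_ball_countable[OF c]]) (auto intro: NC)
  then have "AE w in M. \<forall>k. \<forall>a\<in>\<rat> \<inter> {0..}. NC k (h k) a w"
    by (subst AE_all_countable) blast
  then show ?thesis
  proof eventually_elim
    case (elim w)
    define x where "x s = L s \<phi> w" for s
    have nc: "\<exists>i. \<not> chain (\<lambda>u v. 1 / real (Suc k) < \<bar>x v - x u\<bar>) (\<rat> \<inter> {a..a + h k}) i a"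
      if "a \<in> \<rat>" "0 \<le> a" for a k
    proof -
      have "NC k (h k) a w" using elim that by auto
      then show ?thesis unfolding NC_def x_def .
    qed
    \<comment> \<open>As \<open>h k\<close> does not depend on the start, windows with rational left
      ends reach every real \<open>t\<close>, so countably many null sets suffice.\<close>
    have start: "\<exists>a\<in>\<rat>. 0 \<le> a \<and> a < t \<and> t < a + d" if "0 < t" "0 < d" for t d :: real
      using Rats_dense_in_real[of "max 0 (t - d)" t] that by force
    have small: "\<exists>k. 1 / real (Suc k) < \<epsilon>" if "\<epsilon> > 0" for \<epsilon>
      using that nat_approx_posE by blast
    show ?case
    proof (intro conjI allI impI)
      fix t :: real assume t: "0 \<le> t"
      show "\<exists>l. ((\<lambda>s. L s \<phi> w) \<longlongrightarrow> l) (at t within \<rat> \<inter> {t<..})"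
        unfolding x_def[symmetric]
      proof (rule rational_limit_exists)
        show "t \<in> closure (\<rat> \<inter> {t<..})"
          by (rule subsetD[OF closure_mono rats_closure(1)[of t "t + 1"]]) auto
        fix \<epsilon> :: real assume "\<epsilon> > 0"
        then obtain k where k: "1 / real (Suc k) < \<epsilon>" using small by blast
        obtain a where a: "a \<in> \<rat>" "0 \<le> a" "a \<le> t" "t < a + h k"
          using t start[of t "h k"] h[of k] by (cases "t = 0") (force intro: less_imp_le)+
        obtain i where i: "\<not> chain (\<lambda>u v. 1 / real (Suc k) < \<bar>x v - x u\<bar>) (\<rat> \<inter> {a..a + h k}) i a"
          using nc[OF a(1,2)] by blast
        have "0 < 1 / real (Suc k)" by simp
        from no_chain_cauchy(1)[OF i this a(3,4)] show "\<exists>\<delta>>0. \<forall>s\<in>\<rat> \<inter> {t<..}. \<forall>s'\<in>\<rat> \<inter> {t<..}. \<bar>s - t\<bar> < \<delta> \<longrightarrow> \<bar>s' - t\<bar> < \<delta> \<longrightarrow> \<bar>x s - x s'\<bar> \<le> \<epsilon>"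
          using k by (meson less_imp_le order_trans)
      qed simp
    next
      fix t :: real assume t: "0 < t"
      show "\<exists>l. ((\<lambda>s. L s \<phi> w) \<longlongrightarrow> l) (at t within \<rat> \<inter> {0<..<t})"
        unfolding x_def[symmetric]
      proof (rule rational_limit_exists)
        show "t \<in> closure (\<rat> \<inter> {0<..<t})" by (rule rats_closure(2)[OF t])
        fix \<epsilon> :: real assume "\<epsilon> > 0"
        then obtain k where k: "1 / real (Suc k) < \<epsilon>" using small by blast
        obtain a where a: "a \<in> \<rat>" "0 \<le> a" "a < t" "t < a + h k" using start[OF t h[of k]] by blast
        obtain i where i: "\<not> chain (\<lambda>u v. 1 / real (Suc k) < \<bar>x v - x u\<bar>) (\<rat> \<inter> {a..a + h k}) i a"
          using nc[OF a(1,2)] by blast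
        have "0 < 1 / real (Suc k)" by simp
        from no_chain_cauchy(2)[OF i this a(3) less_imp_le[OF a(4)]] show "\<exists>\<delta>>0. \<forall>s\<in>\<rat> \<inter> {0<..<t}. \<forall>s'\<in>\<rat> \<inter> {0<..<t}. \<bar>s - t\<bar> < \<delta> \<longrightarrow> \<bar>s' - t\<bar> < \<delta> \<longrightarrow> \<bar>x s - x s'\<bar> \<le> \<epsilon>"
          using k by (meson less_imp_le order_trans)
      qed simp
    qed
  qed
qed

end

section \<open>Functionals determined by a countable dense set\<close>

lemma gauge_topology_continuous:
  assumes "\<And>x. x \<in> topspace X \<Longrightarrow> f x \<in> S"
    and "\<And>x d \<epsilon>. x \<in> topspace X \<Longrightarrow> d \<in> D \<Longrightarrow> 0 < \<epsilon> \<Longrightarrow>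
      \<exists>U. openin X U \<and> x \<in> U \<and> (\<forall>y\<in>U. d (f x) (f y) < \<epsilon>)"
  shows "continuous_map X (gauge_topology S D) f"
  unfolding continuous_map_def
proof (intro conjI allI impI)
  show "f \<in> topspace X \<rightarrow> topspace (gauge_topology S D)" using assms(1) by auto
  fix V assume V: "openin (gauge_topology S D) V"
  show "openin X {x \<in> topspace X. f x \<in> V}"
  proof (subst openin_subopen, intro ballI)
    fix x assume x: "x \<in> {x \<in> topspace X. f x \<in> V}"
    then have "\<exists>F \<epsilon>. finite F \<and> F \<subseteq> D \<and> \<epsilon> > 0 \<and> {y \<in> S. \<forall>d\<in>F. d (f x) y < \<epsilon>} \<subseteq> V"
      using V unfolding openin_gauge_topology by blast
    then obtain F \<epsilon> where F: "finite F" "F \<subseteq> D" "\<epsilon> > 0" "{y \<in> S. \<forall>d\<in>F. d (f x) y < \<epsilon>} \<subseteq> V" by blast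
    have "\<forall>d\<in>F. \<exists>U. openin X U \<and> x \<in> U \<and> (\<forall>y\<in>U. d (f x) (f y) < \<epsilon>)"
      using assms(2) F x by blast
    then obtain U where U: "\<And>d. d \<in> F \<Longrightarrow> openin X (U d) \<and> x \<in> U d \<and> (\<forall>y\<in>U d. d (f x) (f y) < \<epsilon>)" by metis
    define W where "W = topspace X \<inter> (\<Inter>d\<in>F. U d)"
    have "openin X W"
      unfolding W_def using F(1) U by (cases "F = {}") (auto intro!: openin_Int openin_Inter)
    moreover have "x \<in> W" using x U by (auto simp: W_def)
    moreover have "W \<subseteq> {x \<in> topspace X. f x \<in> V}"
      using U F(4) assms(1) by (auto simp: W_def)
    ultimately show "\<exists>W. openin X W \<and> x \<in> W \<and> W \<subseteq> {x \<in> topspace X. f x \<in> V}" by blast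
  qed
qed

lemma gauge_ball_open:
  assumes d: "d \<in> D" and tri: "\<And>x y z. x \<in> S \<Longrightarrow> y \<in> S \<Longrightarrow> z \<in> S \<Longrightarrow> d x z \<le> d x y + d y z" and a: "a \<in> S"
  shows "openin (gauge_topology S D) {y \<in> S. d a y < (\<epsilon>::real)}"
  unfolding openin_gauge_topology
proof (intro conjI ballI)
  fix x assume x: "x \<in> {y \<in> S. d a y < \<epsilon>}"
  have "{y \<in> S. \<forall>d'\<in>{d}. d' x y < \<epsilon> - d a x} \<subseteq> {y \<in> S. d a y < \<epsilon>}"
  proof
    fix y assume y: "y \<in> {y \<in> S. \<forall>d'\<in>{d}. d' x y < \<epsilon> - d a x}"
    then have "d a y \<le> d a x + d x y" using x a by (intro tri) auto
    then show "y \<in> {y \<in> S. d a y < \<epsilon>}" using y by auto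
  qed
  then show "\<exists>F \<epsilon>'. finite F \<and> F \<subseteq> D \<and> 0 < \<epsilon>' \<and> {y \<in> S. \<forall>d\<in>F. d x y < \<epsilon>'} \<subseteq> {y \<in> S. d a y < \<epsilon>}"
    using d x by (intro exI[of _ "{d}"] exI[of _ "\<epsilon> - d a x"]) auto
qed auto

text \<open>One criterion for the dual of \<Phi> and for the dual of the completion.
  \<open>Q\<close> plays the part of a semi-norm: it is bounded on bounded sets, and nearness in the
  dual norm of \<open>Q\<close> therefore is nearness in every generator of the strong
  topology.\<close>

lemma strong_dual_continuous:
  fixes E :: "'v tvs" and \<Psi> :: "'b \<Rightarrow> 'v \<Rightarrow> real"
  assumes dual: "\<And>a. a \<in> topspace X \<Longrightarrow> \<Psi> a \<in> tv_dual E"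
    and Q: "\<And>B. tv_bounded E B \<Longrightarrow> \<exists>s. \<forall>x\<in>B. Q x \<le> s"
    and near: "\<And>a \<epsilon>. a \<in> topspace X \<Longrightarrow> 0 < \<epsilon> \<Longrightarrow> \<exists>U. openin X U \<and> a \<in> U \<and>
      (\<forall>b\<in>U. \<forall>x\<in>topspace (tv_top E). \<bar>\<Psi> a x - \<Psi> b x\<bar> \<le> \<epsilon> * Q x)"
  shows "continuous_map X (strong_dual E) \<Psi>"
  unfolding strong_dual_def
proof (rule gauge_topology_continuous[OF dual])
  fix a and d :: "('v \<Rightarrow> real) \<Rightarrow> ('v \<Rightarrow> real) \<Rightarrow> real" and \<epsilon> :: real
  assume a: "a \<in> topspace X" and "d \<in> {\<lambda>f g. (SUP x\<in>B. \<bar>f x - g x\<bar>) | B. tv_bounded E B \<and> B \<noteq> {}}" and \<epsilon>: "0 < \<epsilon>"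
  then obtain B where B: "d = (\<lambda>f g. SUP x\<in>B. \<bar>f x - g x\<bar>)" "tv_bounded E B" "B \<noteq> {}" by blast
  obtain s where s: "\<And>x. x \<in> B \<Longrightarrow> Q x \<le> s" using Q[OF B(2)] by blast
  have BE: "B \<subseteq> topspace (tv_top E)" using B(2) by (simp add: tv_bounded_def)
  \<comment> \<open>The factor 2 turns the weak inequality for a supremum into the strict one that
    is required.\<close>
  define \<eta> where "\<eta> = \<epsilon> / (2 * (\<bar>s\<bar> + 1))"
  have \<eta>: "0 < \<eta>" using \<epsilon> by (simp add: \<eta>_def)
  obtain U where U: "openin X U" "a \<in> U"
    "\<And>b x. b \<in> U \<Longrightarrow> x \<in> topspace (tv_top E) \<Longrightarrow> \<bar>\<Psi> a x - \<Psi> b x\<bar> \<le> \<eta> * Q x"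
    using near[OF a \<eta>] by blast
  have "d (\<Psi> a) (\<Psi> b) < \<epsilon>" if b: "b \<in> U" for b
  proof -
    have "d (\<Psi> a) (\<Psi> b) \<le> \<eta> * (\<bar>s\<bar> + 1)"
      unfolding B(1)
    proof (rule cSUP_least[OF B(3)])
      fix x assume x: "x \<in> B"
      have "\<eta> * Q x \<le> \<eta> * (\<bar>s\<bar> + 1)" using s[OF x] \<eta> by (intro mult_left_mono) auto
      then show "\<bar>\<Psi> a x - \<Psi> b x\<bar> \<le> \<eta> * (\<bar>s\<bar> + 1)" using U(3)[OF b, of x] BE x by auto
    qed
    also have "\<dots> = \<epsilon> / 2"
    proof -
      have *: "\<epsilon> / (2 * c) * c = \<epsilon> / 2" if "0 < c" for c :: real using that by simp
      show ?thesis unfolding \<eta>_def by (rule *) simp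
    qed
    finally show ?thesis using \<epsilon> by simp
  qed
  then show "\<exists>U. openin X U \<and> a \<in> U \<and> (\<forall>b\<in>U. d (\<Psi> a) (\<Psi> b) < \<epsilon>)" using U by blast
qed

section \<open>Duals of spaces with a semi-norm topology\<close>

lemma tvs_of_simps [simp]:
  "tv_top (tvs_of T) = T" "tv_add (tvs_of T) = (+)" "tv_scale (tvs_of T) = (*\<^sub>R)" "tv_zero (tvs_of T) = 0"
  by (simp_all add: tvs_of_def)

lemma continuous_map_linear:
  fixes f :: "'a::real_vector \<Rightarrow> real"
  assumes P: "\<forall>r\<in>P. seminorm r" and p: "seminorm p" "continuous_map (seminorm_topology P) euclideanreal p"
    and f: "linear f" "\<And>x. \<bar>f x\<bar> \<le> K * p x"
  shows "continuous_map (seminorm_topology P) euclideanreal f"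
proof -
  have K: "\<bar>f x\<bar> \<le> (\<bar>K\<bar> + 1) * p x" for x
  proof -
    have "K * p x \<le> (\<bar>K\<bar> + 1) * p x" using seminormD(1)[OF p(1), of x] by (intro mult_right_mono) auto
    then show ?thesis using f(2)[of x] by linarith
  qed
  obtain F C where F: "finite F" "F \<subseteq> P" "0 \<le> C" "\<And>x. p x \<le> C * (\<Sum>r\<in>F. r x)"
    using p continuous_map_seminorm_iff[OF P p(1)] by blast
  show ?thesis
    unfolding continuous_map_def
  proof (intro conjI allI impI)
    fix U :: "real set" assume "openin euclideanreal U"
    then have U: "open U" by simp
    have s: "\<forall>r\<in>P. seminorm r" by (rule P)
    show "openin (seminorm_topology P) {x \<in> topspace (seminorm_topology P). f x \<in> U}"
      unfolding openin_seminorm_topology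
    proof
      fix x assume "x \<in> {x \<in> topspace (seminorm_topology P). f x \<in> U}"
      then obtain e where e: "e > 0" "\<And>y. \<bar>y - f x\<bar> < e \<Longrightarrow> y \<in> U"
        using U unfolding open_dist dist_real_def by auto
      define d where "d = e / ((\<bar>K\<bar> + 1) * C * real (card F) + 1)"
      have Cn: "(\<bar>K\<bar> + 1) * C * real (card F) + 1 > 0" using F(3) by (simp add: add_nonneg_pos)
      have d: "d > 0" using e(1) Cn by (simp add: d_def)
      have "f y \<in> U" if y: "\<forall>r\<in>F. r (x - y) < d" for y
      proof (rule e(2))
        have "(\<Sum>r\<in>F. r (x - y)) \<le> real (card F) * d"
          using sum_bounded_above[of F "\<lambda>r. r (x - y)" d] y by (simp add: less_imp_le)
        then have "C * (\<Sum>r\<in>F. r (x - y)) \<le> C * (real (card F) * d)" using F(3) by (rule mult_left_mono)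
        then have "p (x - y) \<le> C * (real (card F) * d)" using F(4)[of "x - y"] by linarith
        then have "(\<bar>K\<bar> + 1) * p (x - y) \<le> (\<bar>K\<bar> + 1) * (C * (real (card F) * d))" by (intro mult_left_mono) auto
        also have "\<dots> < ((\<bar>K\<bar> + 1) * C * real (card F) + 1) * d" using d by (simp add: algebra_simps)
        also have "\<dots> = e" using Cn by (simp add: d_def)
        finally have "\<bar>f (x - y)\<bar> < e" using K[of "x - y"] by linarith
        then show "\<bar>f y - f x\<bar> < e" by (simp add: linear_diff[OF f(1)] abs_minus_commute)
      qed
      then show "\<exists>G \<epsilon>. finite G \<and> G \<subseteq> P \<and> \<epsilon> > 0 \<and>
          {y. \<forall>r\<in>G. r (x - y) < \<epsilon>} \<subseteq> {x \<in> topspace (seminorm_topology P). f x \<in> U}"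
        using F d by (intro exI[of _ F] exI[of _ d]) auto
    qed
  qed simp
qed

lemma tv_dual_tvs_of:
  assumes P: "\<forall>r\<in>P. seminorm r"
  shows "f \<in> tv_dual (tvs_of (seminorm_topology P)) \<longleftrightarrow>
    linear f \<and> continuous_map (seminorm_topology P) euclideanreal f"
  unfolding tv_dual_def by (auto simp: linear_iff)

lemma abs_linear_seminorm: "linear f \<Longrightarrow> seminorm (\<lambda>x. \<bar>f x :: real\<bar>)"
  unfolding seminorm_def by (auto simp: linear_add linear_cmul abs_mult)

lemma tv_dual_dominated:
  fixes f :: "'a::real_vector \<Rightarrow> real"
  assumes P: "\<forall>r\<in>P. seminorm r" and f: "f \<in> tv_dual (tvs_of (seminorm_topology P))"
  shows "\<exists>F C. finite F \<and> F \<subseteq> P \<and> 0 \<le> C \<and> (\<forall>x. \<bar>f x\<bar> \<le> C * (\<Sum>r\<in>F. r x))"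
proof -
  have lin: "linear f" and c: "continuous_map (seminorm_topology P) euclideanreal f"
    using f unfolding tv_dual_tvs_of[OF P] by auto
  have "continuous_map (seminorm_topology P) euclideanreal (\<lambda>x. \<bar>f x\<bar>)"
    using c by (rule continuous_map_real_abs)
  then show ?thesis using continuous_map_seminorm_iff[OF P abs_linear_seminorm[OF lin]] by simp
qed

lemma tv_bounded_seminorm:
  assumes p: "seminorm p" "continuous_map T euclideanreal p" and T: "topspace T = UNIV"
    and B: "tv_bounded (tvs_of T) B"
  shows "\<exists>s. \<forall>x\<in>B. p x \<le> s"
proof -
  have "openin T {x \<in> topspace T. p x \<in> {..<1}}" using p(2) by (rule openin_continuous_map_preimage) simp
  then have "openin T {x. p x < 1}" using T by simp
  then obtain r where r: "r > 0" "\<And>s. r \<le> \<bar>s\<bar> \<Longrightarrow> B \<subseteq> (*\<^sub>R) s ` {x. p x < 1}"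
    using B unfolding tv_bounded_def by (auto simp: seminormD(4)[OF p(1)])
  have "p x \<le> r" if xB: "x \<in> B" for x
  proof -
    obtain u where u: "x = r *\<^sub>R u" "p u < 1" using r(2)[of r] r(1) xB by auto
    then show ?thesis using r(1) by (simp add: seminormD(3)[OF p(1)])
  qed
  then show ?thesis by blast
qed

lemma tv_bounded_singleton:
  assumes P: "\<forall>r\<in>P. seminorm r"
  shows "tv_bounded (tvs_of (seminorm_topology P)) {x}"
  unfolding tv_bounded_def
proof (intro conjI allI impI)
  fix U assume "openin (tv_top (tvs_of (seminorm_topology P))) U \<and> tv_zero (tvs_of (seminorm_topology P)) \<in> U"
  then have "openin (seminorm_topology P) U" "0 \<in> U" by simp_all
  then have "\<exists>F \<epsilon>. finite F \<and> F \<subseteq> P \<and> \<epsilon> > 0 \<and> {y. \<forall>p\<in>F. p (0 - y) < \<epsilon>} \<subseteq> U"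
    by (rule openin_seminorm_topology[THEN iffD1, THEN bspec])
  then obtain F \<epsilon> where F: "finite F" "F \<subseteq> P" "\<epsilon> > 0" "{y. \<forall>p\<in>F. p (0 - y) < \<epsilon>} \<subseteq> U" by blast
  define t where "t = (\<Sum>p\<in>F. p x)"
  have pF: "seminorm p" if "p \<in> F" for p using P F that by blast
  have t: "0 \<le> t" unfolding t_def using pF seminormD(1) by (intro sum_nonneg) blast
  have "{x} \<subseteq> (*\<^sub>R) s ` U" if s: "t / \<epsilon> + 1 \<le> \<bar>s\<bar>" for s
  proof -
    have "0 < t / \<epsilon> + 1" using t F(3) by (simp add: add_nonneg_pos)
    then have s0: "\<bar>s\<bar> > 0" using s by linarith
    then have s1: "s \<noteq> 0" by simp
    have "p (0 - (1 / s) *\<^sub>R x) < \<epsilon>" if p: "p \<in> F" for p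
    proof -
      have "p x \<le> t" unfolding t_def using F(1) p pF seminormD(1) by (intro member_le_sum) auto
      also have "t < \<epsilon> * \<bar>s\<bar>" using s F(3) by (simp add: field_simps)
      finally have "p x / \<bar>s\<bar> < \<epsilon>" using s0 by (simp add: field_simps)
      then show ?thesis using seminormD(3,5)[OF pF[OF p]] by simp
    qed
    then have "(1 / s) *\<^sub>R x \<in> U" using F(4) by blast
    then show ?thesis using s1 by (auto intro!: image_eqI[of _ _ "(1 / s) *\<^sub>R x"])
  qed
  then show "\<exists>r>0. \<forall>s. r \<le> \<bar>s\<bar> \<longrightarrow> {x} \<subseteq> tv_scale (tvs_of (seminorm_topology P)) s ` U"
    using t F(3) by (intro exI[of _ "t / \<epsilon> + 1"]) (auto simp: add_nonneg_pos)
qed simp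

lemma topspace_strong_dual [simp]: "topspace (strong_dual E) = tv_dual E"
  by (simp add: strong_dual_def)

lemma strong_dual_eval_continuous:
  assumes P: "\<forall>r\<in>P. seminorm r"
  shows "continuous_map (strong_dual (tvs_of (seminorm_topology P))) euclideanreal (\<lambda>f. f x)"
  unfolding continuous_map_def
proof (intro conjI allI impI)
  fix U :: "real set" assume "openin euclideanreal U"
  then have U: "open U" by simp
  show "openin (strong_dual (tvs_of (seminorm_topology P))) {f \<in> topspace (strong_dual (tvs_of (seminorm_topology P))). f x \<in> U}"
    unfolding strong_dual_def openin_gauge_topology
  proof (intro conjI ballI)
    let ?S = "tv_dual (tvs_of (seminorm_topology P))"
    let ?D = "{\<lambda>f g. (SUP x\<in>B. \<bar>f x - g x\<bar>) | B. tv_bounded (tvs_of (seminorm_topology P)) B \<and> B \<noteq> {}}"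
    fix f assume f: "f \<in> {f \<in> topspace (gauge_topology ?S ?D). f x \<in> U}"
    then obtain e where e: "e > 0" "\<And>y. \<bar>y - f x\<bar> < e \<Longrightarrow> y \<in> U"
      using U unfolding open_dist dist_real_def by auto
    have mem: "(\<lambda>f g. SUP x\<in>{x}. \<bar>f x - g x\<bar>) \<in> ?D" using tv_bounded_singleton[OF P] by blast
    show "\<exists>F \<epsilon>. finite F \<and> F \<subseteq> ?D \<and> 0 < \<epsilon> \<and>
        {y \<in> ?S. \<forall>d\<in>F. d f y < \<epsilon>} \<subseteq> {f \<in> topspace (gauge_topology ?S ?D). f x \<in> U}"
    proof (intro exI conjI)
      show "{\<lambda>f g. SUP x\<in>{x}. \<bar>f x - g x\<bar>} \<subseteq> ?D" using mem by (rule insert_subsetI) simp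
      show "{y \<in> ?S. \<forall>d\<in>{\<lambda>f g. SUP x\<in>{x}. \<bar>f x - g x\<bar>}. d f y < e} \<subseteq> {f \<in> topspace (gauge_topology ?S ?D). f x \<in> U}"
        using e(2) by (auto simp: abs_minus_commute)
    qed (use e in auto)
  qed auto
qed auto

lemma strong_dual_Hausdorff:
  assumes P: "\<forall>r\<in>P. seminorm r"
  shows "Hausdorff_space (strong_dual (tvs_of (seminorm_topology P)))"
  unfolding Hausdorff_space_def
proof (intro allI impI)
  let ?X = "strong_dual (tvs_of (seminorm_topology P))"
  fix f g :: "'a \<Rightarrow> real" assume fg: "f \<in> topspace ?X \<and> g \<in> topspace ?X \<and> f \<noteq> g"
  then obtain x where x: "f x \<noteq> g x" by blast
  obtain U V where UV: "open U" "open V" "f x \<in> U" "g x \<in> V" "U \<inter> V = {}"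
    using hausdorff[OF x] by blast
  note ev = openin_continuous_map_preimage[OF strong_dual_eval_continuous[OF P, of x]]
  have "openin ?X {h \<in> topspace ?X. h x \<in> U}" "openin ?X {h \<in> topspace ?X. h x \<in> V}"
    using ev UV by simp_all
  then show "\<exists>U V. openin ?X U \<and> openin ?X V \<and> f \<in> U \<and> g \<in> V \<and> disjnt U V"
    using fg UV by (intro exI[of _ "{h \<in> topspace ?X. h x \<in> U}"] exI[of _ "{h \<in> topspace ?X. h x \<in> V}"])
      (auto simp: disjnt_def)
qed

text \<open>The defect \<open>h t\<close> of homogeneity is additive in \<open>t\<close> and
  vanishes at integers, so it depends only on the fractional part of \<open>t\<close> and is
  bounded; a bounded additive function is zero. Functionals extended from a subgroup are at first
  only additive.\<close>

lemma additive_bounded_linear: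
  fixes f :: "'a::real_vector \<Rightarrow> real"
  assumes add: "\<And>x y. f (x + y) = f x + f y" and p: "seminorm p" and le: "\<And>x. \<bar>f x\<bar> \<le> K * p x"
  shows "linear f"
proof (rule linearI)
  fix c :: real and x
  define h where "h t = f (t *\<^sub>R x) - t * f x" for t :: real
  have hadd: "h (s + t) = h s + h t" for s t by (simp add: h_def scaleR_add_left add algebra_simps)
  have h0: "h 0 = 0" using hadd[of 0 0] by simp
  have h1: "h 1 = 0" by (simp add: h_def)
  have hn: "h (real n * t) = real n * h t" for n t
    by (induction n) (simp_all add: h0 distrib_right hadd)
  have hneg: "h (- t) = - h t" for t using hadd[of t "- t"] h0 by simp
  have hint: "h (of_int z) = 0" for z
  proof (cases "z \<ge> 0")
    case True
    then show ?thesis using hn[of "nat z" 1] h1 by simp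
  next
    case False
    then show ?thesis using hn[of "nat (- z)" 1] h1 hneg[of "of_int z"] by simp
  qed
  define B where "B = \<bar>K\<bar> * p x + \<bar>f x\<bar>"
  have bd: "\<bar>h t\<bar> \<le> B" for t
  proof -
    define u where "u = frac t"
    have u: "0 \<le> u" "u \<le> 1" by (simp_all add: u_def frac_lt_1 less_imp_le)
    have "h t = h (of_int \<lfloor>t\<rfloor>) + h u" unfolding hadd[symmetric] u_def frac_def by simp
    then have "h t = h u" using hint by simp
    moreover have "\<bar>f (u *\<^sub>R x)\<bar> \<le> \<bar>K\<bar> * p x"
    proof -
      have "\<bar>f (u *\<^sub>R x)\<bar> \<le> K * (u * p x)" using le[of "u *\<^sub>R x"] u(1) by (simp add: seminormD(3)[OF p])
      also have "\<dots> \<le> \<bar>K\<bar> * (1 * p x)"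
        using u seminormD(1)[OF p, of x] by (intro mult_mono) (auto intro: mult_right_mono)
      finally show ?thesis by simp
    qed
    moreover have "\<bar>u * f x\<bar> \<le> \<bar>f x\<bar>" using u by (simp add: abs_mult mult_left_le_one_le)
    ultimately show ?thesis unfolding B_def h_def by linarith
  qed
  have "h c = 0"
  proof (rule ccontr)
    assume "h c \<noteq> 0"
    then obtain n :: nat where "B < real n * \<bar>h c\<bar>" using reals_Archimedean3[of "\<bar>h c\<bar>"] by auto
    moreover have "real n * \<bar>h c\<bar> = \<bar>h (real n * c)\<bar>" by (simp add: hn abs_mult)
    ultimately show False using bd[of "real n * c"] by linarith
  qed
  then show "f (c *\<^sub>R x) = c *\<^sub>R f x" by (simp add: h_def)
qed (rule add)

lemma scale_cancel: "0 < c \<Longrightarrow> 0 < k \<Longrightarrow> k * (c * (e / (k * c))) = (e::real)"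
  by simp

section \<open>Dual balls coded by real sequences\<close>

text \<open>The \<open>d i\<close> run through a countable subgroup that is dense for all semi-norms
  at once. Rational multiples are not included; homogeneity is recovered by
  \<open>additive_bounded_linear\<close>.\<close>

locale dual_frame =
  fixes q :: "nat \<Rightarrow> 'a::real_vector \<Rightarrow> real" and C :: "nat \<Rightarrow> real" and d :: "nat \<Rightarrow> 'a"
  assumes hilb: "hilbertian (q k)"
    and q_mono1: "q k x \<le> q (Suc k) x"
    and q_hs: "hs_bound (q k) (q (Suc k)) (C k)"
    and d_dense: "0 < \<epsilon> \<Longrightarrow> \<exists>i. q k (x - d i) < \<epsilon>"
    and d_add: "\<exists>l. d l = d i + d j"
    and d_diff: "\<exists>l. d l = d i - d j"
begin

lemma sq: "seminorm (q k)" by (rule hilbertian_seminorm[OF hilb])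

lemma q_mono: "k \<le> l \<Longrightarrow> q k x \<le> q l x"
proof (induction l rule: dec_induct)
  case (step n)
  then show ?case using q_mono1[of n x] by linarith
qed (rule order_refl)

text \<open>The values on the subgroup of the functionals in the ball of radius \<open>m\<close> of
  the dual norm of \<open>q k\<close>.\<close>

definition A :: "nat \<Rightarrow> nat \<Rightarrow> (nat \<Rightarrow> real) set" where
  "A m k = {a. (\<forall>i j l. d l = d i + d j \<longrightarrow> a l = a i + a j) \<and> (\<forall>i. \<bar>a i\<bar> \<le> real m * q k (d i))}"

text \<open>Index and precision grow together, and the semi-norms increase; hence
  \<open>d (idx x n)\<close> tends to \<open>x\<close> in every \<open>q k\<close>.\<close>

definition idx :: "'a \<Rightarrow> nat \<Rightarrow> nat" where
  "idx x n = (SOME i. q n (x - d i) < 1 / real (Suc n))"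

text \<open>The indices do not depend on \<open>a\<close>, so for fixed \<open>x\<close> this is a
  limit of fixed coordinates and hence measurable in \<open>a\<close>. The limit is meaningful only
  for \<open>a\<close> in some \<open>A m k\<close>.\<close>

definition \<Psi> :: "(nat \<Rightarrow> real) \<Rightarrow> 'a \<Rightarrow> real" where
  "\<Psi> a x = lim (\<lambda>n. a (idx x n))"

lemma idx: "q n (x - d (idx x n)) < 1 / real (Suc n)"
proof -
  have "\<exists>i. q n (x - d i) < 1 / real (Suc n)" by (rule d_dense) simp
  then show ?thesis unfolding idx_def by (rule someI_ex[of "\<lambda>i. q n (x - d i) < 1 / real (Suc n)"])
qed

lemma A_diff:
  assumes "a \<in> A m k" shows "\<bar>a i - a j\<bar> \<le> real m * q k (d i - d j)"
proof -
  obtain l where l: "d l = d i - d j" using d_diff by blast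
  then have "d i = d l + d j" by simp
  then have "a i = a l + a j" using assms by (simp add: A_def)
  moreover have "\<bar>a l\<bar> \<le> real m * q k (d l)" using assms by (simp add: A_def)
  ultimately show ?thesis using l by simp
qed

lemma A_mono:
  assumes "m \<le> m'" "k \<le> k'" shows "A m k \<subseteq> A m' k'"
proof
  fix a assume a: "a \<in> A m k"
  have "real m * q k x \<le> real m' * q k' x" for x
    using assms q_mono[OF assms(2)] seminormD(1)[OF sq] by (intro mult_mono) auto
  then show "a \<in> A m' k'" using a unfolding A_def by (fastforce intro: order_trans)
qed

lemma \<Psi>_limit_approx:
  assumes a: "a \<in> A m k"
  shows \<Psi>_limit: "(\<lambda>n. a (idx x n)) \<longlonglongrightarrow> \<Psi> a x"
    and \<Psi>_approx: "\<bar>a i - \<Psi> a x\<bar> \<le> real m * q k (d i - x)"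
proof -
  have bd: "\<bar>a i - a (idx x n)\<bar> \<le> real m * (q k (d i - x) + 1 / real (Suc n))" if "k \<le> n" for i n
  proof -
    have "q k (d i - d (idx x n)) \<le> q k (d i - x) + q k (x - d (idx x n))"
      using seminormD(2)[OF sq, of k "d i - x" "x - d (idx x n)"] by simp
    also have "q k (x - d (idx x n)) \<le> 1 / real (Suc n)"
      using q_mono[OF that, of "x - d (idx x n)"] idx[of n x] by linarith
    finally have "real m * q k (d i - d (idx x n)) \<le> real m * (q k (d i - x) + 1 / real (Suc n))"
      by (intro mult_left_mono) auto
    then show ?thesis using A_diff[OF a, of i "idx x n"] by linarith
  qed
  have z: "(\<lambda>n. real m * (c + 1 / real (Suc n))) \<longlonglongrightarrow> real m * (c + 0)" for c
    using LIMSEQ_inverse_real_of_nat by (intro tendsto_intros) (simp add: divide_inverse)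
  have "Cauchy (\<lambda>n. a (idx x n))"
    unfolding Cauchy_def
  proof (intro allI impI)
    fix e :: real assume e: "e > 0"
    have "\<forall>\<^sub>F n in sequentially. real m * (0 + 1 / real (Suc n)) < e / 2"
      using z[of 0] e by (intro order_tendstoD) auto
    then obtain N where N: "\<And>n. n \<ge> N \<Longrightarrow> real m * (1 / real (Suc n)) < e / 2" unfolding eventually_sequentially add_0 by blast
    have "dist (a (idx x i)) (a (idx x j)) < e" if ij: "i \<ge> max N k" "j \<ge> max N k" for i j
    proof -
      have "q k (d (idx x i) - x) \<le> 1 / real (Suc i)"
        using q_mono[of k i "x - d (idx x i)"] idx[of i x] ij(1) seminormD(7)[OF sq, of k x] by simp
      then have "real m * q k (d (idx x i) - x) \<le> real m * (1 / real (Suc i))" by (intro mult_left_mono) auto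
      then have "\<bar>a (idx x i) - a (idx x j)\<bar> \<le> real m * (1 / real (Suc i)) + real m * (1 / real (Suc j))"
        using bd[of j "idx x i"] ij(2) by (simp add: distrib_left)
      moreover have "i \<ge> N" "j \<ge> N" using ij by auto
      ultimately show ?thesis using N[of i] N[of j] unfolding dist_real_def by linarith
    qed
    then show "\<exists>N. \<forall>i\<ge>N. \<forall>j\<ge>N. dist (a (idx x i)) (a (idx x j)) < e" by blast
  qed
  then show lim: "(\<lambda>n. a (idx x n)) \<longlonglongrightarrow> \<Psi> a x"
    unfolding \<Psi>_def by (simp add: Cauchy_convergent_iff convergent_LIMSEQ_iff)
  have "(\<lambda>n. \<bar>a i - a (idx x n)\<bar>) \<longlonglongrightarrow> \<bar>a i - \<Psi> a x\<bar>" by (intro tendsto_intros lim)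
  then show "\<bar>a i - \<Psi> a x\<bar> \<le> real m * q k (d i - x)"
    using LIMSEQ_le[OF _ z[of "q k (d i - x)"]] bd by fastforce
qed

lemma \<Psi>_d [simp]: "a \<in> A m k \<Longrightarrow> \<Psi> a (d i) = a i"
  using \<Psi>_approx[of a m k i "d i"] by (simp add: seminormD(4)[OF sq])

lemma \<Psi>_bound:
  assumes a: "a \<in> A m k"
  shows "\<bar>\<Psi> a x\<bar> \<le> real m * q k x"
proof (rule field_le_epsilon)
  fix e :: real assume e: "e > 0"
  define \<eta> where "\<eta> = e / (2 * (real m + 1))"
  have \<eta>: "\<eta> > 0" using e by (simp add: \<eta>_def add_nonneg_pos)
  obtain i where i: "q k (x - d i) < \<eta>" using d_dense[OF \<eta>] by blast
  have 1: "\<bar>a i - \<Psi> a x\<bar> \<le> real m * \<eta>"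
    using \<Psi>_approx[OF a, of i x] mult_left_mono[OF less_imp_le[OF i], of "real m"] seminormD(7)[OF sq, of k x "d i"] by simp
  have "q k (d i) \<le> q k x + \<eta>"
    using seminormD(6)[OF sq, of k x "x - d i"] i by simp
  then have "real m * q k (d i) \<le> real m * (q k x + \<eta>)" by (rule mult_left_mono) simp
  moreover have "\<bar>a i\<bar> \<le> real m * q k (d i)" using a by (simp add: A_def)
  ultimately have "\<bar>\<Psi> a x\<bar> \<le> real m * q k x + 2 * (real m * \<eta>)" using 1 by (simp add: distrib_left)
  also have "2 * (real m * \<eta>) \<le> 2 * ((real m + 1) * \<eta>)" using \<eta> by simp
  also have "\<dots> = e" unfolding \<eta>_def by (rule scale_cancel) simp_all
  finally show "\<bar>\<Psi> a x\<bar> \<le> real m * q k x + e" by simp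
qed

text \<open>Both functionals are continuous for \<open>q (max k l)\<close>, in which the
  \<open>d i\<close> are dense.\<close>

lemma \<Psi>_unique:
  assumes a: "a \<in> A m k" and f: "\<And>i. f (d i) = a i" "linear f" "\<And>x. \<bar>f x\<bar> \<le> K * q l x"
  shows "\<Psi> a x = f x"
proof -
  have K: "K * y \<le> \<bar>K\<bar> * y" if "0 \<le> y" for y :: real using that by (intro mult_right_mono) auto
  have "\<bar>\<Psi> a x - f x\<bar> \<le> 0 + e" if e: "e > 0" for e
  proof -
    define \<eta> where "\<eta> = e / (real m + \<bar>K\<bar> + 1)"
    have \<eta>: "\<eta> > 0" using e by (simp add: \<eta>_def add_nonneg_pos)
    obtain i where i: "q (max k l) (x - d i) < \<eta>" using d_dense[OF \<eta>] by blast
    have 1: "q k (d i - x) \<le> \<eta>" "q l (d i - x) \<le> \<eta>"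
      using i q_mono[of k "max k l" "x - d i"] q_mono[of l "max k l" "x - d i"] seminormD(7)[OF sq, of _ x "d i"] by auto
    have "\<bar>a i - \<Psi> a x\<bar> \<le> real m * \<eta>"
      using \<Psi>_approx[OF a, of i x] mult_left_mono[OF 1(1), of "real m"] by simp
    moreover have "\<bar>f (d i - x)\<bar> \<le> \<bar>K\<bar> * \<eta>"
      using f(3)[of "d i - x"] K[OF seminormD(1)[OF sq], of l "d i - x"] mult_left_mono[OF 1(2), of "\<bar>K\<bar>"] by simp
    ultimately have "\<bar>\<Psi> a x - f x\<bar> \<le> (real m + \<bar>K\<bar>) * \<eta>"
      by (simp add: linear_diff[OF f(2)] f(1) distrib_right)
    also have "\<dots> \<le> (real m + \<bar>K\<bar> + 1) * \<eta>" using \<eta> by simp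
    also have "\<dots> = e" by (simp add: \<eta>_def add_nonneg_pos)
    finally show ?thesis by simp
  qed
  then have "\<bar>\<Psi> a x - f x\<bar> \<le> 0" by (rule field_le_epsilon)
  then show ?thesis by simp
qed

lemma \<Psi>_linear:
  assumes a: "a \<in> A m k" shows "linear (\<Psi> a)"
proof (rule additive_bounded_linear[OF _ sq \<Psi>_bound[OF a]])
  fix x y
  have "\<bar>\<Psi> a (x + y) - (\<Psi> a x + \<Psi> a y)\<bar> \<le> 0 + e" if e: "e > 0" for e
  proof -
    \<comment> \<open>The three approximations of \<open>x\<close>, \<open>y\<close> and
      \<open>x + y\<close> cost 1, 1 and 2 units of \<open>real m * \<eta>\<close>.\<close>
    define \<eta> where "\<eta> = e / (4 * (real m + 1))"
    have \<eta>: "\<eta> > 0" using e by (simp add: \<eta>_def add_nonneg_pos)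
    obtain i j where ij: "q k (x - d i) < \<eta>" "q k (y - d j) < \<eta>" using d_dense[OF \<eta>] by blast
    obtain l where l: "d l = d i + d j" using d_add by blast
    have al: "a l = a i + a j" using a l by (simp add: A_def)
    have 1: "q k (d i - x) \<le> \<eta>" "q k (d j - y) \<le> \<eta>"
      using ij seminormD(7)[OF sq, of k x] seminormD(7)[OF sq, of k y] by auto
    then have 2: "q k (d l - (x + y)) \<le> 2 * \<eta>"
      using seminormD(2)[OF sq, of k "d i - x" "d j - y"] by (simp add: l algebra_simps)
    have "\<bar>a i - \<Psi> a x\<bar> \<le> real m * \<eta>" "\<bar>a j - \<Psi> a y\<bar> \<le> real m * \<eta>" "\<bar>a l - \<Psi> a (x + y)\<bar> \<le> real m * (2 * \<eta>)"
      using \<Psi>_approx[OF a, of i x] \<Psi>_approx[OF a, of j y] \<Psi>_approx[OF a, of l "x + y"]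
        mult_left_mono[OF 1(1), of "real m"] mult_left_mono[OF 1(2), of "real m"] mult_left_mono[OF 2, of "real m"] by auto
    then have "\<bar>\<Psi> a (x + y) - (\<Psi> a x + \<Psi> a y)\<bar> \<le> 4 * (real m * \<eta>)" using al by simp
    also have "\<dots> \<le> 4 * ((real m + 1) * \<eta>)" using \<eta> by simp
    also have "\<dots> = e" unfolding \<eta>_def by (rule scale_cancel) simp_all
    finally show ?thesis by simp
  qed
  then have "\<bar>\<Psi> a (x + y) - (\<Psi> a x + \<Psi> a y)\<bar> \<le> 0" by (rule field_le_epsilon)
  then show "\<Psi> a (x + y) = \<Psi> a x + \<Psi> a y" by simp
qed

lemma \<Psi>_diff:
  assumes a: "a \<in> A m k" "b \<in> A m' k'"
  shows "(\<lambda>i. a i - b i) \<in> A (m + m') (max k k')" "\<Psi> (\<lambda>i. a i - b i) x = \<Psi> a x - \<Psi> b x"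
proof -
  have bd: "\<bar>\<Psi> a y - \<Psi> b y\<bar> \<le> real (m + m') * q (max k k') y" for y
  proof -
    have "real m * q k y \<le> real m * q (max k k') y" "real m' * q k' y \<le> real m' * q (max k k') y"
      by (intro mult_left_mono q_mono; simp)+
    then show ?thesis using \<Psi>_bound[OF a(1), of y] \<Psi>_bound[OF a(2), of y] by (simp add: distrib_right)
  qed
  have "\<bar>a i - b i\<bar> \<le> real (m + m') * q (max k k') (d i)" for i
    using bd[of "d i"] \<Psi>_d[OF a(1), of i] \<Psi>_d[OF a(2), of i] by simp
  then show in_A: "(\<lambda>i. a i - b i) \<in> A (m + m') (max k k')"
    using a unfolding A_def by auto
  have "linear (\<lambda>y. \<Psi> a y - \<Psi> b y)"
    using \<Psi>_linear[OF a(1)] \<Psi>_linear[OF a(2)] by (rule linear_compose_sub)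
  from \<Psi>_unique[OF in_A _ this bd] show "\<Psi> (\<lambda>i. a i - b i) x = \<Psi> a x - \<Psi> b x"
    using \<Psi>_d[OF a(1)] \<Psi>_d[OF a(2)] by simp
qed

lemma zero_A: "(\<lambda>_. 0) \<in> A 0 0" "\<Psi> (\<lambda>_. 0) = (\<lambda>_. 0)"
proof -
  show "(\<lambda>_. 0) \<in> A 0 0" by (simp add: A_def)
  then show "\<Psi> (\<lambda>_. 0) = (\<lambda>_. 0)" using \<Psi>_bound[of "\<lambda>_. 0" 0 0] by auto
qed

text \<open>On \<open>A m k\<close> convergence along the countable dense set is convergence in the dual norm of \<open>q (k + 1)\<close>.\<close>
lemma \<Psi>_near:
  assumes a: "a \<in> A m k" and \<epsilon>: "0 < \<epsilon>"
  shows "\<exists>U. open U \<and> a \<in> U \<and> (\<forall>b\<in>U \<inter> A m k. \<forall>x. \<bar>\<Psi> a x - \<Psi> b x\<bar> \<le> \<epsilon> * q (Suc k) x)"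
proof -
  \<comment> \<open>The difference of two functionals of \<open>A m k\<close> is bounded by
    \<open>2 * m\<close> in the dual norm of \<open>q k\<close>, so the part of \<open>x\<close>
    outside the finite rank projection contributes at most half of \<epsilon>.\<close>
  define \<epsilon>' where "\<epsilon>' = \<epsilon> / (4 * (real m + 1))"
  have m1: "real m + 1 > 0" by simp
  have \<epsilon>': "\<epsilon>' > 0" using \<epsilon> m1 by (simp add: \<epsilon>'_def)
  obtain S where S: "orthonormal_set (q (Suc k)) S"
    "\<And>x. q k (x - orth_proj (q (Suc k)) S x) \<le> \<epsilon>' * q (Suc k) x"
    using hs_bound_finite_rank[OF hilb sq q_mono1 q_hs \<epsilon>'] by blast
  have fS: "finite S" using S by (simp add: orthonormal_set_def)
  define c where "c = real (card S) + 1"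
  have c: "c > 0" by (simp add: c_def)
  \<comment> \<open>On each vector of \<open>S\<close> the difference is at most \<delta> at the
    nearby \<open>d (\<iota> e)\<close> plus \<open>2 * (m + 1) * \<eta>\<close>, which equals
    \<delta>; \<open>c\<close> such terms give the other half of \<epsilon>.\<close>
  define \<eta> where "\<eta> = \<epsilon> / (8 * c * (real m + 1))"
  have \<eta>: "\<eta> > 0" using \<epsilon> c m1 by (simp add: \<eta>_def)
  define \<delta> where "\<delta> = \<epsilon> / (4 * c)"
  have \<delta>: "\<delta> > 0" using \<epsilon> c by (simp add: \<delta>_def)
  have "\<forall>e. \<exists>i. q k (e - d i) < \<eta>" using d_dense[OF \<eta>] by blast
  then obtain \<iota> where \<iota>: "\<And>e. q k (e - d (\<iota> e)) < \<eta>" by metis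
  \<comment> \<open>Only the finitely many coordinates that approximate the vectors of
    \<open>S\<close> are restricted, which makes this a neighbourhood in the product
    topology.\<close>
  define U where "U = {b. \<forall>i\<in>\<iota> ` S. b i \<in> {a i - \<delta><..<a i + \<delta>}}"
  have "U = (\<Inter>i\<in>\<iota> ` S. (\<lambda>b. b i) -` {a i - \<delta><..<a i + \<delta>})" by (auto simp: U_def)
  moreover have "open ((\<lambda>b::nat \<Rightarrow> real. b i) -` {a i - \<delta><..<a i + \<delta>})" for i
    by (rule open_vimage) (auto intro!: continuous_intros)
  ultimately have "open U" using fS by auto
  moreover have "a \<in> U" using \<delta> by (simp add: U_def)
  moreover have "\<bar>\<Psi> a x - \<Psi> b x\<bar> \<le> \<epsilon> * q (Suc k) x" if b: "b \<in> U" "b \<in> A m k" for b x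
  proof -
    define g where "g x = \<Psi> a x - \<Psi> b x" for x
    have lin: "linear g" unfolding g_def using \<Psi>_linear[OF a] \<Psi>_linear[OF b(2)] by (rule linear_compose_sub)
    have gb: "\<bar>g y\<bar> \<le> 2 * real m * q k y" for y
      using \<Psi>_bound[OF a, of y] \<Psi>_bound[OF b(2), of y] unfolding g_def by linarith
    have ge: "\<bar>g e\<bar> \<le> \<epsilon> / (2 * c)" if e: "e \<in> S" for e
    proof -
      have "g (d (\<iota> e)) = a (\<iota> e) - b (\<iota> e)" using \<Psi>_d[OF a] \<Psi>_d[OF b(2)] by (simp add: g_def)
      then have 1: "\<bar>g (d (\<iota> e))\<bar> < \<delta>" using b(1) e by (auto simp: U_def)
      have "\<bar>g (e - d (\<iota> e))\<bar> \<le> 2 * (real m + 1) * \<eta>"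
      proof -
        have "2 * real m * q k (e - d (\<iota> e)) \<le> 2 * (real m + 1) * \<eta>"
          using \<iota>[of e] seminormD(1)[OF sq, of k "e - d (\<iota> e)"] by (intro mult_mono) auto
        then show ?thesis using gb[of "e - d (\<iota> e)"] by linarith
      qed
      also have "\<dots> = \<delta>" using c m1 by (simp add: \<eta>_def \<delta>_def divide_simps)
      finally have "\<bar>g e\<bar> \<le> \<delta> + \<delta>" using 1 by (simp add: linear_diff[OF lin])
      also have "\<dots> = \<epsilon> / (2 * c)" by (simp add: \<delta>_def)
      finally show ?thesis .
    qed
    have q0: "0 \<le> q (Suc k) x" by (rule seminormD(1)[OF sq])
    have "\<bar>g (orth_proj (q (Suc k)) S x)\<bar> \<le> (\<Sum>e\<in>S. q (Suc k) x * (\<epsilon> / (2 * c)))"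
    proof -
      have "\<bar>g (orth_proj (q (Suc k)) S x)\<bar> \<le> (\<Sum>e\<in>S. \<bar>semi_inner (q (Suc k)) x e * g e\<bar>)"
        unfolding orth_proj_def by (simp add: linear_sum[OF lin] linear_cmul[OF lin] sum_abs)
      also have "\<dots> \<le> (\<Sum>e\<in>S. q (Suc k) x * (\<epsilon> / (2 * c)))"
      proof (rule sum_mono)
        fix e assume e: "e \<in> S"
        have "(semi_inner (q (Suc k)) x e)\<^sup>2 \<le> (\<Sum>e\<in>S. (semi_inner (q (Suc k)) x e)\<^sup>2)"
          using fS e by (intro member_le_sum) auto
        also have "\<dots> \<le> (q (Suc k) x)\<^sup>2" by (rule orth_proj(3)[OF hilb S(1)])
        finally have "\<bar>semi_inner (q (Suc k)) x e\<bar> \<le> q (Suc k) x" using q0 by (simp add: abs_le_square_iff[symmetric])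
        then show "\<bar>semi_inner (q (Suc k)) x e * g e\<bar> \<le> q (Suc k) x * (\<epsilon> / (2 * c))"
          unfolding abs_mult using ge[OF e] q0 by (intro mult_mono) auto
      qed
      finally show ?thesis .
    qed
    also have "\<dots> \<le> c * (q (Suc k) x * (\<epsilon> / (2 * c)))"
    proof -
      have "real (card S) \<le> c" by (simp add: c_def)
      then show ?thesis unfolding sum_constant using q0 \<epsilon> c by (intro mult_right_mono) auto
    qed
    also have "\<dots> = \<epsilon> / 2 * q (Suc k) x" using c by simp
    finally have 1: "\<bar>g (orth_proj (q (Suc k)) S x)\<bar> \<le> \<epsilon> / 2 * q (Suc k) x" .
    have "2 * real m * q k (x - orth_proj (q (Suc k)) S x) \<le> 2 * (real m + 1) * (\<epsilon>' * q (Suc k) x)"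
      using S(2)[of x] seminormD(1)[OF sq] by (intro mult_mono) auto
    also have "\<dots> = \<epsilon> / 2 * q (Suc k) x"
    proof -
      have "2 * c * (\<epsilon> / (4 * c) * y) = \<epsilon> / 2 * y" if "0 < c" for c y :: real using that by simp
      then show ?thesis unfolding \<epsilon>'_def using m1 by blast
    qed
    finally have "\<bar>g (x - orth_proj (q (Suc k)) S x)\<bar> \<le> \<epsilon> / 2 * q (Suc k) x"
      using gb[of "x - orth_proj (q (Suc k)) S x"] by linarith
    then have "\<bar>g x\<bar> \<le> \<epsilon> * q (Suc k) x" using 1 unfolding linear_diff[OF lin] by linarith
    then show ?thesis by (simp add: g_def)
  qed
  ultimately show ?thesis by blast
qed

lemma closed_A: "closed (A m k)"
proof -
  have "A m k = (\<Inter>i. \<Inter>j. \<Inter>l. {a. d l = d i + d j \<longrightarrow> a l = a i + a j}) \<inter> (\<Inter>i. {a. \<bar>a i\<bar> \<le> real m * q k (d i)})"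
    by (auto simp: A_def)
  moreover have "closed {a :: nat \<Rightarrow> real. d l = d i + d j \<longrightarrow> a l = a i + a j}" for i j l
    by (cases "d l = d i + d j") (auto intro!: closed_Collect_eq continuous_on_add continuous_on_product_coordinates)
  moreover have "closed {a :: nat \<Rightarrow> real. \<bar>a i\<bar> \<le> real m * q k (d i)}" for i
    by (intro closed_Collect_le continuous_on_rabs continuous_on_product_coordinates continuous_on_const)
  ultimately show ?thesis by (auto intro!: closed_Int closed_INT)
qed

lemma \<Psi>_near_openin:
  assumes "a \<in> topspace (top_of_set (A m k))" "0 < \<epsilon>"
  shows "\<exists>U. openin (top_of_set (A m k)) U \<and> a \<in> U \<and> (\<forall>b\<in>U. \<forall>x. \<bar>\<Psi> a x - \<Psi> b x\<bar> \<le> \<epsilon> * q (Suc k) x)"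
proof -
  obtain U where "open U" "a \<in> U" "\<forall>b\<in>U \<inter> A m k. \<forall>x. \<bar>\<Psi> a x - \<Psi> b x\<bar> \<le> \<epsilon> * q (Suc k) x"
    using \<Psi>_near[of a m k \<epsilon>] assms by auto
  then show ?thesis using assms by (intro exI[of _ "A m k \<inter> U"]) (auto simp: openin_open)
qed

text \<open>Continuity is asserted on each \<open>A m k\<close> separately. The semi-norm that
  controls bounded sets is \<open>q (Suc k)\<close>, one step above the one defining the ball,
  because \<open>\<Psi>_near\<close> loses a Hilbert-Schmidt map.\<close>

lemma \<Psi>_continuous:
  assumes P: "\<forall>r\<in>P. seminorm r" and qc: "\<And>k. continuous_map (seminorm_topology P) euclideanreal (q k)"
  shows "continuous_map (top_of_set (A m k)) (strong_dual (tvs_of (seminorm_topology P))) \<Psi>"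
proof (rule strong_dual_continuous)
  fix a assume a: "a \<in> topspace (top_of_set (A m k))"
  then show "\<Psi> a \<in> tv_dual (tvs_of (seminorm_topology P))"
    unfolding tv_dual_tvs_of[OF P]
    using \<Psi>_linear[of a m k] continuous_map_linear[OF P sq qc \<Psi>_linear \<Psi>_bound, of a m k] by simp
next
  show "\<exists>s. \<forall>x\<in>B. q (Suc k) x \<le> s" if "tv_bounded (tvs_of (seminorm_topology P)) B" for B
    using tv_bounded_seminorm[OF sq qc _ that] by simp
next
  fix a and \<epsilon> :: real assume a: "a \<in> topspace (top_of_set (A m k))" and \<epsilon>: "0 < \<epsilon>"
  show "\<exists>U. openin (top_of_set (A m k)) U \<and> a \<in> U \<and>
      (\<forall>b\<in>U. \<forall>x\<in>topspace (tv_top (tvs_of (seminorm_topology P))). \<bar>\<Psi> a x - \<Psi> b x\<bar> \<le> \<epsilon> * q (Suc k) x)"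
    using \<Psi>_near_openin[OF a \<epsilon>] by blast
qed

section \<open>Extension of functionals to the completion\<close>

text \<open>Restricted to the carrier because \<open>tv_dual\<close> consists of extensional
  functions.\<close>

definition ext :: "('a \<Rightarrow> real) \<Rightarrow> (nat \<Rightarrow> 'a) set \<Rightarrow> real" where
  "ext f = (\<lambda>X\<in>compl_carrier (seminorm_topology (range q)). lim (\<lambda>n. f (class_rep X n)))"

abbreviation \<theta> :: "'a topology" where "\<theta> \<equiv> seminorm_topology (range q)"

text \<open>This has the shape of the generating pseudometrics of \<open>tvs_completion\<close>; the
  distance to \<open>compl_embed \<theta> 0\<close> is the extension of \<open>q k\<close> to the
  completion.\<close>

definition Qc :: "nat \<Rightarrow> (nat \<Rightarrow> 'a) set \<Rightarrow> (nat \<Rightarrow> 'a) set \<Rightarrow> real" where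
  "Qc k X Y = lim (\<lambda>n. q k (class_rep X n - class_rep Y n))"

lemma Pq: "\<forall>r\<in>range q. seminorm r" using sq by blast

lemma q_cont: "continuous_map \<theta> euclideanreal (q k)"
  by (rule iffD2[OF continuous_map_seminorm_iff[OF Pq sq]], intro exI[of _ "{q k}"] exI[of _ 1]) auto

lemma rel_iff:
  "(x, y) \<in> cauchy_rel \<theta> \<longleftrightarrow> x \<in> cauchy_seqs \<theta> \<and> y \<in> cauchy_seqs \<theta> \<and> (\<forall>k. (\<lambda>n. q k (x n - y n)) \<longlonglongrightarrow> 0)"
  unfolding cauchy_rel_seminorm[OF Pq] by blast

lemma seqs_iff: "x \<in> cauchy_seqs \<theta> \<longleftrightarrow> (\<forall>k. \<forall>\<epsilon>>0. \<exists>N. \<forall>m\<ge>N. \<forall>n\<ge>N. q k (x m - x n) < \<epsilon>)"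
  unfolding cauchy_seqs_seminorm[OF Pq] by blast

lemma seqs_limit:
  assumes f: "linear f" "\<And>x. \<bar>f x\<bar> \<le> K * q k x" and x: "x \<in> cauchy_seqs \<theta>"
  shows "convergent (\<lambda>n. f (x n))"
proof -
  have "Cauchy (\<lambda>n. f (x n))"
    unfolding Cauchy_def
  proof (intro allI impI)
    fix e :: real assume e: "e > 0"
    then have "e / (\<bar>K\<bar> + 1) > 0" by (simp add: add_nonneg_pos)
    then obtain N where N: "\<forall>m\<ge>N. \<forall>n\<ge>N. q k (x m - x n) < e / (\<bar>K\<bar> + 1)" using x unfolding seqs_iff by blast
    have "dist (f (x m)) (f (x n)) < e" if "m \<ge> N" "n \<ge> N" for m n
    proof -
      have "q k (x m - x n) < e / (\<bar>K\<bar> + 1)" using N that by blast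
      then have "(\<bar>K\<bar> + 1) * q k (x m - x n) < e" by (simp add: pos_less_divide_eq add_nonneg_pos mult.commute)
      moreover have "K * q k (x m - x n) \<le> (\<bar>K\<bar> + 1) * q k (x m - x n)"
        using seminormD(1)[OF sq] by (intro mult_right_mono) auto
      ultimately show ?thesis using f(2)[of "x m - x n"] unfolding dist_real_def linear_diff[OF f(1)] by linarith
    qed
    then show "\<exists>N. \<forall>m\<ge>N. \<forall>n\<ge>N. dist (f (x m)) (f (x n)) < e" by blast
  qed
  then show ?thesis by (simp add: Cauchy_convergent_iff)
qed

lemma ext_limit:
  assumes f: "linear f" "\<And>x. \<bar>f x\<bar> \<le> K * q k x" and X: "X \<in> compl_carrier \<theta>" "x \<in> X"
  shows "(\<lambda>n. f (x n)) \<longlonglongrightarrow> ext f X"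
proof -
  have r: "(class_rep X, x) \<in> cauchy_rel \<theta>" using class_rep_props(4)[OF Pq X(1)] X(2) by simp
  have "(\<lambda>n. f (class_rep X n)) \<longlonglongrightarrow> ext f X"
    using seqs_limit[OF f class_rep_props(2)[OF Pq X(1)]] X(1) by (simp add: ext_def convergent_LIMSEQ_iff)
  moreover have "(\<lambda>n. f (x n - class_rep X n)) \<longlonglongrightarrow> 0"
  proof (rule Lim_null_comparison)
    have "(\<lambda>n. q k (class_rep X n - x n)) \<longlonglongrightarrow> 0" using r by (simp add: rel_iff)
    then show "(\<lambda>n. K * q k (class_rep X n - x n)) \<longlonglongrightarrow> 0" by (rule tendsto_mult_right_zero)
    show "\<forall>\<^sub>F n in sequentially. norm (f (x n - class_rep X n)) \<le> K * q k (class_rep X n - x n)"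
      using f(2) seminormD(7)[OF sq, of k] by (metis (mono_tags, lifting) always_eventually real_norm_def)
  qed
  ultimately show ?thesis using tendsto_add by (fastforce simp: linear_diff[OF f(1)])
qed

lemma seqs_diff:
  assumes "x \<in> cauchy_seqs \<theta>" "y \<in> cauchy_seqs \<theta>"
  shows "(\<lambda>n. x n - y n) \<in> cauchy_seqs \<theta>"
  unfolding seqs_iff
proof (intro allI impI)
  fix k and \<epsilon> :: real assume "0 < \<epsilon>"
  then have e2: "0 < \<epsilon> / 2" by simp
  obtain N where N: "\<forall>m\<ge>N. \<forall>n\<ge>N. q k (x m - x n) < \<epsilon> / 2" using assms(1) e2 unfolding seqs_iff by blast
  obtain N' where N': "\<forall>m\<ge>N'. \<forall>n\<ge>N'. q k (y m - y n) < \<epsilon> / 2" using assms(2) e2 unfolding seqs_iff by blast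
  have "q k (x m - y m - (x n - y n)) < \<epsilon>" if "m \<ge> max N N'" "n \<ge> max N N'" for m n
  proof -
    have "q k (x m - y m - (x n - y n)) = q k ((x m - x n) - (y m - y n))" by (simp add: algebra_simps)
    also have "\<dots> \<le> q k (x m - x n) + q k (y m - y n)" by (rule seminormD(6)[OF sq])
    also have "\<dots> < \<epsilon> / 2 + \<epsilon> / 2" using N N' that by (intro add_strict_mono) auto
    finally show ?thesis by simp
  qed
  then show "\<exists>N. \<forall>m\<ge>N. \<forall>n\<ge>N. q k (x m - y m - (x n - y n)) < \<epsilon>" by blast
qed

lemma Qc_limit:
  assumes X: "X \<in> compl_carrier \<theta>" "x \<in> X" and Y: "Y \<in> compl_carrier \<theta>" "y \<in> Y"
  shows "(\<lambda>n. q k (x n - y n)) \<longlonglongrightarrow> Qc k X Y"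
proof -
  have rx: "(class_rep X, x) \<in> cauchy_rel \<theta>" using class_rep_props(4)[OF Pq X(1)] X(2) by simp
  have ry: "(class_rep Y, y) \<in> cauchy_rel \<theta>" using class_rep_props(4)[OF Pq Y(1)] Y(2) by simp
  have "convergent (\<lambda>n. q k (class_rep X n - class_rep Y n))"
    using seqs_diff[OF class_rep_props(2)[OF Pq X(1)] class_rep_props(2)[OF Pq Y(1)]]
    by (intro cauchy_seminorm_convergent[OF sq]) (simp add: seqs_iff)
  then have 1: "(\<lambda>n. q k (class_rep X n - class_rep Y n)) \<longlonglongrightarrow> Qc k X Y"
    by (simp add: Qc_def convergent_LIMSEQ_iff)
  have "(\<lambda>n. q k (class_rep X n - x n)) \<longlonglongrightarrow> 0" "(\<lambda>n. q k (class_rep Y n - y n)) \<longlonglongrightarrow> 0"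
    using rx ry by (simp_all add: rel_iff)
  then have z: "(\<lambda>n. q k (class_rep X n - x n) + q k (class_rep Y n - y n)) \<longlonglongrightarrow> 0"
    using tendsto_add by fastforce
  have "(\<lambda>n. q k (x n - y n) - q k (class_rep X n - class_rep Y n)) \<longlonglongrightarrow> 0"
  proof (rule Lim_null_comparison[OF always_eventually z], rule allI)
    fix n
    have "\<bar>q k (x n - y n) - q k (class_rep X n - class_rep Y n)\<bar> \<le> q k (x n - y n - (class_rep X n - class_rep Y n))"
      by (rule seminormD(8)[OF sq])
    also have "x n - y n - (class_rep X n - class_rep Y n) = (class_rep Y n - y n) - (class_rep X n - x n)" by simp
    also have "q k \<dots> \<le> q k (class_rep Y n - y n) + q k (class_rep X n - x n)" by (rule seminormD(6)[OF sq])
    finally show "norm (q k (x n - y n) - q k (class_rep X n - class_rep Y n)) \<le> q k (class_rep X n - x n) + q k (class_rep Y n - y n)"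
      by simp
  qed
  from tendsto_add[OF this 1] show ?thesis by simp
qed

text \<open>In \<open>tvs_completion\<close> the operations form the set of all results over all
  representatives and close it under the relation. It is a single class as soon as one result
  \<open>z\<close> is related to all others.\<close>

lemma class_of_set:
  assumes "z \<in> S" "\<And>s. s \<in> S \<Longrightarrow> (z, s) \<in> cauchy_rel \<theta>"
  shows "cauchy_rel \<theta> `` S \<in> compl_carrier \<theta>" "z \<in> cauchy_rel \<theta> `` S"
proof -
  note e = equiv_cauchy_rel[OF Pq]
  have zz: "(z, z) \<in> cauchy_rel \<theta>" using assms by blast
  then have zs: "z \<in> cauchy_seqs \<theta>" by (simp add: rel_iff)
  have "trans (cauchy_rel \<theta>)" using e by (simp add: equiv_def)
  then have "cauchy_rel \<theta> `` S = cauchy_rel \<theta> `` {z}" using assms by (blast dest: transD)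
  then show "cauchy_rel \<theta> `` S \<in> compl_carrier \<theta>" "z \<in> cauchy_rel \<theta> `` S"
    using class_in_carrier[OF zs] zz by auto
qed

lemma completion_ops:
  assumes X: "X \<in> compl_carrier \<theta>" and Y: "Y \<in> compl_carrier \<theta>"
  shows "tv_add (tvs_completion \<theta>) X Y \<in> compl_carrier \<theta>"
    "(\<lambda>n. class_rep X n + class_rep Y n) \<in> tv_add (tvs_completion \<theta>) X Y"
    "tv_scale (tvs_completion \<theta>) c X \<in> compl_carrier \<theta>"
    "(\<lambda>n. c *\<^sub>R class_rep X n) \<in> tv_scale (tvs_completion \<theta>) c X"
proof -
  have neg: "(\<lambda>n. - y n) \<in> cauchy_seqs \<theta>" if "y \<in> cauchy_seqs \<theta>" for y
    using seqs_diff[OF constant_cauchy[OF Pq, of 0] that] by simp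
  have plus: "(\<lambda>n. x n + y n) \<in> cauchy_seqs \<theta>" if "x \<in> cauchy_seqs \<theta>" "y \<in> cauchy_seqs \<theta>" for x y
    using seqs_diff[OF that(1) neg[OF that(2)]] by simp
  have scale: "(\<lambda>n. c *\<^sub>R x n) \<in> cauchy_seqs \<theta>" if x: "x \<in> cauchy_seqs \<theta>" for x
    unfolding seqs_iff
  proof (intro allI impI)
    fix k and \<epsilon> :: real assume "0 < \<epsilon>"
    then have "0 < \<epsilon> / (\<bar>c\<bar> + 1)" by (simp add: add_nonneg_pos)
    then obtain N where N: "\<forall>m\<ge>N. \<forall>n\<ge>N. q k (x m - x n) < \<epsilon> / (\<bar>c\<bar> + 1)" using x unfolding seqs_iff by blast
    have "q k (c *\<^sub>R x m - c *\<^sub>R x n) < \<epsilon>" if "m \<ge> N" "n \<ge> N" for m n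
    proof -
      have "q k (x m - x n) < \<epsilon> / (\<bar>c\<bar> + 1)" using N that by blast
      then have "(\<bar>c\<bar> + 1) * q k (x m - x n) < \<epsilon>" by (simp add: pos_less_divide_eq add_nonneg_pos mult.commute)
      moreover have "\<bar>c\<bar> * q k (x m - x n) \<le> (\<bar>c\<bar> + 1) * q k (x m - x n)"
        using seminormD(1)[OF sq] by (intro mult_right_mono) auto
      ultimately show ?thesis unfolding scaleR_diff_right[symmetric] seminormD(3)[OF sq] by linarith
    qed
    then show "\<exists>N. \<forall>m\<ge>N. \<forall>n\<ge>N. q k (c *\<^sub>R x m - c *\<^sub>R x n) < \<epsilon>" by blast
  qed
  note cX = class_rep_props[OF Pq X] and cY = class_rep_props[OF Pq Y]
  have relX: "x \<in> cauchy_seqs \<theta>" "(\<lambda>n. q k (class_rep X n - x n)) \<longlonglongrightarrow> 0" if "x \<in> X" for x k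
    using that cX(4)[of x] by (auto simp: rel_iff)
  have relY: "y \<in> cauchy_seqs \<theta>" "(\<lambda>n. q k (class_rep Y n - y n)) \<longlonglongrightarrow> 0" if "y \<in> Y" for y k
    using that cY(4)[of y] by (auto simp: rel_iff)
  let ?S = "{\<lambda>n. x n + y n | x y. x \<in> X \<and> y \<in> Y}"
  have S1: "(\<lambda>n. class_rep X n + class_rep Y n) \<in> ?S" using cX(1) cY(1) by blast
  have S2: "((\<lambda>n. class_rep X n + class_rep Y n), s) \<in> cauchy_rel \<theta>" if s: "s \<in> ?S" for s
  proof -
    obtain x y where xy: "s = (\<lambda>n. x n + y n)" "x \<in> X" "y \<in> Y" using s by blast
    have "(\<lambda>n. q k (class_rep X n + class_rep Y n - (x n + y n))) \<longlonglongrightarrow> 0" for k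
    proof (rule Lim_null_comparison[OF always_eventually], rule allI)
      have "(\<lambda>n. q k (class_rep X n - x n) + q k (class_rep Y n - y n)) \<longlonglongrightarrow> 0 + 0"
        using relX(2)[OF xy(2)] relY(2)[OF xy(3)] by (rule tendsto_add)
      then show "(\<lambda>n. q k (class_rep X n - x n) + q k (class_rep Y n - y n)) \<longlonglongrightarrow> 0" by simp
      fix n
      show "norm (q k (class_rep X n + class_rep Y n - (x n + y n))) \<le> q k (class_rep X n - x n) + q k (class_rep Y n - y n)"
        using seminormD(2)[OF sq, of k "class_rep X n - x n" "class_rep Y n - y n"]
          seminormD(1)[OF sq, of k "class_rep X n + class_rep Y n - (x n + y n)"] by (simp add: algebra_simps)
    qed
    then show ?thesis
      unfolding rel_iff xy(1) using plus[OF cX(2) cY(2)] plus[OF relX(1)[OF xy(2)] relY(1)[OF xy(3)]] by blast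
  qed
  have add: "tv_add (tvs_completion \<theta>) X Y = cauchy_rel \<theta> `` ?S" by (simp add: tvs_completion_def)
  show "tv_add (tvs_completion \<theta>) X Y \<in> compl_carrier \<theta>"
    "(\<lambda>n. class_rep X n + class_rep Y n) \<in> tv_add (tvs_completion \<theta>) X Y"
    unfolding add using class_of_set[OF S1 S2] by blast+
  let ?R = "{\<lambda>n. c *\<^sub>R x n | x. x \<in> X}"
  have R1: "(\<lambda>n. c *\<^sub>R class_rep X n) \<in> ?R" using cX(1) by blast
  have R2: "((\<lambda>n. c *\<^sub>R class_rep X n), s) \<in> cauchy_rel \<theta>" if s: "s \<in> ?R" for s
  proof -
    obtain x where x: "s = (\<lambda>n. c *\<^sub>R x n)" "x \<in> X" using s by blast
    have "(\<lambda>n. q k (c *\<^sub>R class_rep X n - c *\<^sub>R x n)) \<longlonglongrightarrow> 0" for k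
      unfolding scaleR_diff_right[symmetric] seminormD(3)[OF sq]
      by (rule tendsto_mult_right_zero[OF relX(2)[OF x(2)]])
    then show ?thesis unfolding rel_iff x(1) using scale[OF cX(2)] scale[OF relX(1)[OF x(2)]] by blast
  qed
  have sc: "tv_scale (tvs_completion \<theta>) c X = cauchy_rel \<theta> `` ?R" by (simp add: tvs_completion_def)
  show "tv_scale (tvs_completion \<theta>) c X \<in> compl_carrier \<theta>"
    "(\<lambda>n. c *\<^sub>R class_rep X n) \<in> tv_scale (tvs_completion \<theta>) c X"
    unfolding sc using class_of_set[OF R1 R2] by blast+
qed

lemma embed_props:
  "compl_embed \<theta> \<phi> \<in> compl_carrier \<theta>" "(\<lambda>_. \<phi>) \<in> compl_embed \<theta> \<phi>"
proof -
  have c: "(\<lambda>_. \<phi>) \<in> cauchy_seqs \<theta>" by (rule constant_cauchy[OF Pq])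
  show "compl_embed \<theta> \<phi> \<in> compl_carrier \<theta>" unfolding compl_embed_def by (rule class_in_carrier[OF c])
  show "(\<lambda>_. \<phi>) \<in> compl_embed \<theta> \<phi>" unfolding compl_embed_def
    by (rule equiv_class_self[OF equiv_cauchy_rel[OF Pq] c])
qed

lemma ext_embed:
  assumes "linear f" "\<And>x. \<bar>f x\<bar> \<le> K * q k x"
  shows "ext f (compl_embed \<theta> \<phi>) = f \<phi>"
  using ext_limit[OF assms embed_props, of \<phi>] LIMSEQ_unique tendsto_const by blast

lemma completion_top:
  "tv_top (tvs_completion \<theta>) = gauge_topology (compl_carrier \<theta>)
     {\<lambda>X Y. lim (\<lambda>n. p (class_rep X n - class_rep Y n)) | p. seminorm p \<and> continuous_map \<theta> euclideanreal p}"
  "tv_zero (tvs_completion \<theta>) = compl_embed \<theta> 0"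
  by (simp_all add: tvs_completion_def)

lemma Qc_gauge:
  "Qc k \<in> {\<lambda>X Y. lim (\<lambda>n. p (class_rep X n - class_rep Y n)) | p. seminorm p \<and> continuous_map \<theta> euclideanreal p}"
  using sq q_cont unfolding Qc_def[abs_def] by blast

lemma Qc_triangle:
  assumes "X \<in> compl_carrier \<theta>" "Y \<in> compl_carrier \<theta>" "Z \<in> compl_carrier \<theta>"
  shows "Qc k X Z \<le> Qc k X Y + Qc k Y Z"
proof (rule LIMSEQ_le)
  note r = class_rep_props(1)[OF Pq]
  show "(\<lambda>n. q k (class_rep X n - class_rep Z n)) \<longlonglongrightarrow> Qc k X Z"
    using assms r by (intro Qc_limit) auto
  show "(\<lambda>n. q k (class_rep X n - class_rep Y n) + q k (class_rep Y n - class_rep Z n)) \<longlonglongrightarrow> Qc k X Y + Qc k Y Z"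
    using assms r by (intro tendsto_add Qc_limit) auto
  show "\<exists>N. \<forall>n\<ge>N. q k (class_rep X n - class_rep Z n) \<le> q k (class_rep X n - class_rep Y n) + q k (class_rep Y n - class_rep Z n)"
    using seminormD(2)[OF sq, of k "class_rep X n - class_rep Y n" "class_rep Y n - class_rep Z n" for n] by auto
qed

lemma ext_dual:
  assumes f: "linear f" "\<And>x. \<bar>f x\<bar> \<le> K * q k x"
  shows "ext f \<in> tv_dual (tvs_completion \<theta>)"
  unfolding tv_dual_def completion_top(1) topspace_gauge_topology
proof (intro CollectI conjI ballI allI)
  show "ext f \<in> extensional (compl_carrier \<theta>)" by (simp add: ext_def)
  fix X assume X: "X \<in> compl_carrier \<theta>"
  note lX = ext_limit[OF f X class_rep_props(1)[OF Pq X]]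
  show "ext f (tv_scale (tvs_completion \<theta>) c X) = c * ext f X" for c
  proof (rule LIMSEQ_unique)
    show "(\<lambda>n. f (c *\<^sub>R class_rep X n)) \<longlonglongrightarrow> ext f (tv_scale (tvs_completion \<theta>) c X)"
      by (rule ext_limit[OF f completion_ops(3,4)[OF X X]])
    show "(\<lambda>n. f (c *\<^sub>R class_rep X n)) \<longlonglongrightarrow> c * ext f X"
      using tendsto_mult_left[OF lX, of c] by (simp add: linear_cmul[OF f(1)])
  qed
  fix Y assume Y: "Y \<in> compl_carrier \<theta>"
  show "ext f (tv_add (tvs_completion \<theta>) X Y) = ext f X + ext f Y"
  proof (rule LIMSEQ_unique)
    show "(\<lambda>n. f (class_rep X n + class_rep Y n)) \<longlonglongrightarrow> ext f (tv_add (tvs_completion \<theta>) X Y)"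
      by (rule ext_limit[OF f completion_ops(1,2)[OF X Y]])
    show "(\<lambda>n. f (class_rep X n + class_rep Y n)) \<longlonglongrightarrow> ext f X + ext f Y"
      using tendsto_add[OF lX ext_limit[OF f Y class_rep_props(1)[OF Pq Y]]] by (simp add: linear_add[OF f(1)])
  qed
next
  let ?D = "{\<lambda>X Y. lim (\<lambda>n. p (class_rep X n - class_rep Y n)) | p. seminorm p \<and> continuous_map \<theta> euclideanreal p}"
  \<comment> \<open>A functional bounded by \<open>K * q k\<close> extends to a Lipschitz function
    for \<open>Qc k\<close>, one of the generating pseudometrics.\<close>
  have lip: "\<bar>ext f X - ext f Y\<bar> \<le> \<bar>K\<bar> * Qc k X Y" if X: "X \<in> compl_carrier \<theta>" and Y: "Y \<in> compl_carrier \<theta>" for X Y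
  proof (rule LIMSEQ_le)
    note cX = class_rep_props(1)[OF Pq X] and cY = class_rep_props(1)[OF Pq Y]
    show "(\<lambda>n. \<bar>f (class_rep X n) - f (class_rep Y n)\<bar>) \<longlonglongrightarrow> \<bar>ext f X - ext f Y\<bar>"
      by (intro tendsto_rabs tendsto_diff ext_limit[OF f] X Y cX cY)
    show "(\<lambda>n. \<bar>K\<bar> * q k (class_rep X n - class_rep Y n)) \<longlonglongrightarrow> \<bar>K\<bar> * Qc k X Y"
      by (intro tendsto_mult_left Qc_limit X Y cX cY)
    have "\<bar>f x - f y\<bar> \<le> \<bar>K\<bar> * q k (x - y)" for x y
    proof -
      have "K * q k (x - y) \<le> \<bar>K\<bar> * q k (x - y)" using seminormD(1)[OF sq] by (intro mult_right_mono) auto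
      then show ?thesis using f(2)[of "x - y"] by (simp add: linear_diff[OF f(1)])
    qed
    then show "\<exists>N. \<forall>n\<ge>N. \<bar>f (class_rep X n) - f (class_rep Y n)\<bar> \<le> \<bar>K\<bar> * q k (class_rep X n - class_rep Y n)" by blast
  qed
  show "continuous_map (gauge_topology (compl_carrier \<theta>) ?D) euclideanreal (ext f)"
    unfolding continuous_map_def[of "gauge_topology (compl_carrier \<theta>) ?D"]
  proof (intro conjI allI impI)
    fix U :: "real set" assume "openin euclideanreal U"
    then have U: "open U" by simp
    show "openin (gauge_topology (compl_carrier \<theta>) ?D) {X \<in> topspace (gauge_topology (compl_carrier \<theta>) ?D). ext f X \<in> U}"
      unfolding openin_gauge_topology
    proof (intro conjI ballI)
      fix X assume X: "X \<in> {X \<in> topspace (gauge_topology (compl_carrier \<theta>) ?D). ext f X \<in> U}"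
      then obtain e where e: "e > 0" "\<And>y. \<bar>y - ext f X\<bar> < e \<Longrightarrow> y \<in> U"
        using U unfolding open_dist dist_real_def by auto
      have e1: "e / (\<bar>K\<bar> + 1) > 0" using e(1) by (simp add: add_nonneg_pos)
      show "\<exists>F \<epsilon>. finite F \<and> F \<subseteq> ?D \<and> 0 < \<epsilon> \<and> {Y \<in> compl_carrier \<theta>. \<forall>d\<in>F. d X Y < \<epsilon>}
          \<subseteq> {X \<in> topspace (gauge_topology (compl_carrier \<theta>) ?D). ext f X \<in> U}"
      proof (intro exI conjI)
        show "{Qc k} \<subseteq> ?D" using Qc_gauge by (rule insert_subsetI) simp
        show "{Y \<in> compl_carrier \<theta>. \<forall>d\<in>{Qc k}. d X Y < e / (\<bar>K\<bar> + 1)}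
          \<subseteq> {X \<in> topspace (gauge_topology (compl_carrier \<theta>) ?D). ext f X \<in> U}"
        proof
          fix Y assume Y: "Y \<in> {Y \<in> compl_carrier \<theta>. \<forall>d\<in>{Qc k}. d X Y < e / (\<bar>K\<bar> + 1)}"
          have YC: "Y \<in> compl_carrier \<theta>" and YQ: "Qc k X Y < e / (\<bar>K\<bar> + 1)" using Y by auto
          have XC: "X \<in> compl_carrier \<theta>" using X by simp
          have "\<bar>K\<bar> * Qc k X Y \<le> \<bar>K\<bar> * (e / (\<bar>K\<bar> + 1))" using YQ by (intro mult_left_mono) auto
          also have "\<dots> < e" using e(1) by (simp add: field_simps add_nonneg_pos)
          finally have "\<bar>ext f Y - ext f X\<bar> < e" using lip[OF XC YC] by linarith
          then show "Y \<in> {X \<in> topspace (gauge_topology (compl_carrier \<theta>) ?D). ext f X \<in> U}" using e(2) YC by simp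
        qed
      qed (use e1 in auto)
    qed auto
  qed auto
qed

text \<open>A bounded set is absorbed by the open unit ball of \<open>Qc k\<close> around zero, and
  the extended semi-norm is homogeneous.\<close>

lemma Qc_bounded:
  assumes B: "tv_bounded (tvs_completion \<theta>) B"
  shows "\<exists>s. \<forall>X\<in>B. Qc k X (compl_embed \<theta> 0) \<le> s"
proof -
  let ?Z = "compl_embed \<theta> 0"
  define U where "U = {Y \<in> compl_carrier \<theta>. Qc k ?Z Y < 1}"
  have sym: "Qc k X Y = Qc k Y X" for X Y unfolding Qc_def by (simp add: seminormD(7)[OF sq])
  have "openin (tv_top (tvs_completion \<theta>)) U"
    unfolding completion_top(1) U_def by (rule gauge_ball_open[OF Qc_gauge Qc_triangle embed_props(1)])
  moreover have "?Z \<in> U"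
  proof -
    have "Qc k ?Z ?Z = 0" by (simp add: Qc_def seminormD(4)[OF sq])
    then show ?thesis using embed_props(1) by (simp add: U_def)
  qed
  ultimately obtain r where r: "r > 0" "\<And>s. r \<le> \<bar>s\<bar> \<Longrightarrow> B \<subseteq> tv_scale (tvs_completion \<theta>) s ` U"
    using B unfolding tv_bounded_def completion_top(2) by blast
  have "Qc k X ?Z \<le> r" if X: "X \<in> B" for X
  proof -
    obtain Y where Y: "X = tv_scale (tvs_completion \<theta>) r Y" "Y \<in> U" using r(2)[of r] r(1) X by auto
    have YC: "Y \<in> compl_carrier \<theta>" and YQ: "Qc k ?Z Y < 1" using Y(2) by (auto simp: U_def)
    have 1: "(\<lambda>n. q k (r *\<^sub>R class_rep Y n - 0)) \<longlonglongrightarrow> Qc k X ?Z"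
      unfolding Y(1) by (rule Qc_limit[OF completion_ops(3,4)[OF YC YC] embed_props])
    have 2: "(\<lambda>n. r * q k (class_rep Y n - 0)) \<longlonglongrightarrow> r * Qc k Y ?Z"
      by (intro tendsto_mult_left Qc_limit[OF YC class_rep_props(1)[OF Pq YC] embed_props])
    have "(\<lambda>n. q k (r *\<^sub>R class_rep Y n - 0)) = (\<lambda>n. r * q k (class_rep Y n - 0))"
      using r(1) by (simp add: seminormD(3)[OF sq])
    then have "Qc k X ?Z = r * Qc k Y ?Z" using LIMSEQ_unique[OF 1] 2 by (simp only:)
    also have "\<dots> \<le> r" using YQ r(1) sym[of ?Z Y] by simp
    finally show ?thesis .
  qed
  then show ?thesis by blast
qed

text \<open>The estimate of \<open>\<Psi>_near\<close> holds at every vector of \<Phi> and survives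
  the limit along a representing sequence, with \<open>Qc (Suc k)\<close> in place of
  \<open>q (Suc k)\<close>.\<close>

lemma ext_\<Psi>_continuous:
  "continuous_map (top_of_set (A m k)) (strong_dual (tvs_completion \<theta>)) (\<lambda>a. ext (\<Psi> a))"
proof (rule strong_dual_continuous)
  fix a assume "a \<in> topspace (top_of_set (A m k))"
  then have a: "a \<in> A m k" by simp
  show "ext (\<Psi> a) \<in> tv_dual (tvs_completion \<theta>)" by (rule ext_dual[OF \<Psi>_linear[OF a] \<Psi>_bound[OF a]])
next
  show "\<exists>s. \<forall>X\<in>B. Qc (Suc k) X (compl_embed \<theta> 0) \<le> s" if "tv_bounded (tvs_completion \<theta>) B" for B
    by (rule Qc_bounded[OF that])
next
  fix a and \<epsilon> :: real assume a: "a \<in> topspace (top_of_set (A m k))" and \<epsilon>: "0 < \<epsilon>"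
  obtain U where U: "openin (top_of_set (A m k)) U" "a \<in> U" "\<And>b x. b \<in> U \<Longrightarrow> \<bar>\<Psi> a x - \<Psi> b x\<bar> \<le> \<epsilon> * q (Suc k) x"
    using \<Psi>_near_openin[OF a \<epsilon>] by blast
  have "\<bar>ext (\<Psi> a) X - ext (\<Psi> b) X\<bar> \<le> \<epsilon> * Qc (Suc k) X (compl_embed \<theta> 0)"
    if b: "b \<in> U" and X: "X \<in> compl_carrier \<theta>" for b X
  proof (rule LIMSEQ_le)
    have aA: "a \<in> A m k" and bA: "b \<in> A m k" using a openin_subset[OF U(1)] b by auto
    note cX = class_rep_props(1)[OF Pq X]
    show "(\<lambda>n. \<bar>\<Psi> a (class_rep X n) - \<Psi> b (class_rep X n)\<bar>) \<longlonglongrightarrow> \<bar>ext (\<Psi> a) X - ext (\<Psi> b) X\<bar>"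
      by (intro tendsto_rabs tendsto_diff ext_limit[OF \<Psi>_linear[OF aA] \<Psi>_bound[OF aA]]
        ext_limit[OF \<Psi>_linear[OF bA] \<Psi>_bound[OF bA]] X cX)
    show "(\<lambda>n. \<epsilon> * q (Suc k) (class_rep X n - 0)) \<longlonglongrightarrow> \<epsilon> * Qc (Suc k) X (compl_embed \<theta> 0)"
      by (intro tendsto_mult_left Qc_limit[OF X cX embed_props])
    show "\<exists>N. \<forall>n\<ge>N. \<bar>\<Psi> a (class_rep X n) - \<Psi> b (class_rep X n)\<bar> \<le> \<epsilon> * q (Suc k) (class_rep X n - 0)"
      using U(3)[OF b] by simp
  qed
  then show "\<exists>U. openin (top_of_set (A m k)) U \<and> a \<in> U \<and>
      (\<forall>b\<in>U. \<forall>X\<in>topspace (tv_top (tvs_completion \<theta>)). \<bar>ext (\<Psi> a) X - ext (\<Psi> b) X\<bar> \<le> \<epsilon> * Qc (Suc k) X (compl_embed \<theta> 0))"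
    using U(1,2) unfolding completion_top(1) topspace_gauge_topology by blast
qed

end

section \<open>The regularized process\<close>

text \<open>Truncating the distance at 1 lets both kinds of convergence pass to expectations: the
  almost sure one by domination, the one in probability by splitting at \<epsilon>.\<close>

lemma (in prob_space) AE_limits_agree:
  fixes X :: "nat \<Rightarrow> 'a \<Rightarrow> real"
  assumes [measurable]: "\<And>n. X n \<in> borel_measurable M" "Y \<in> borel_measurable M" "Z \<in> borel_measurable M"
    and ae: "AE w in M. (\<lambda>n. X n w) \<longlonglongrightarrow> Y w"
    and pr: "\<And>\<epsilon>. 0 < \<epsilon> \<Longrightarrow> (\<lambda>n. prob {w \<in> space M. \<epsilon> < \<bar>X n w - Z w\<bar>}) \<longlonglongrightarrow> 0"
  shows "AE w in M. Y w = Z w"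
proof -
  define g where "g n w = min 1 \<bar>X n w - Z w\<bar>" for n w
  define h where "h w = min 1 \<bar>Y w - Z w\<bar>" for w
  have [measurable]: "g n \<in> borel_measurable M" "h \<in> borel_measurable M" for n
    unfolding g_def[abs_def] h_def[abs_def] by measurable
  have g01: "0 \<le> g n w" "g n w \<le> 1" and h01: "0 \<le> h w" "h w \<le> 1" for n w by (auto simp: g_def h_def)
  have lim: "(\<lambda>n. expectation (g n)) \<longlonglongrightarrow> expectation h"
  proof (rule integral_dominated_convergence[where w="\<lambda>_. 1"])
    show "AE w in M. (\<lambda>n. g n w) \<longlonglongrightarrow> h w"
      using ae by eventually_elim (auto simp: g_def h_def intro!: tendsto_min tendsto_rabs tendsto_diff)
    show "AE w in M. norm (g n w) \<le> 1" for n using g01 by simp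
  qed auto
  have int: "integrable M (g n)" "integrable M h" for n
    using g01 h01 by (auto intro!: integrable_const_bound[where B=1])
  have "expectation h \<le> 0 + e" if e: "e > 0" for e
  proof (rule LIMSEQ_le[OF lim])
    have "(\<lambda>n. prob {w \<in> space M. e < \<bar>X n w - Z w\<bar>} + e) \<longlonglongrightarrow> 0 + e"
      by (intro tendsto_add pr e tendsto_const)
    then show "(\<lambda>n. prob {w \<in> space M. e < \<bar>X n w - Z w\<bar>} + e) \<longlonglongrightarrow> 0 + e" .
    have "expectation (g n) \<le> prob {w \<in> space M. e < \<bar>X n w - Z w\<bar>} + e" for n
    proof -
      define B where "B = {w \<in> space M. e < \<bar>X n w - Z w\<bar>}"
      have B: "B \<in> events" unfolding B_def by measurable
      have iB: "integrable M (\<lambda>w. indicator B w :: real)" using B by (intro integrable_real_indicator) (auto simp: less_top[symmetric])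
      have "expectation (g n) \<le> expectation (\<lambda>w. indicator B w + e)"
      proof (rule integral_mono[OF int(1) Bochner_Integration.integrable_add[OF iB integrable_const]])
        show "g n w \<le> indicator B w + e" if "w \<in> space M" for w
          using that e by (cases "w \<in> B") (auto simp: g_def B_def min_def)
      qed
      also have "\<dots> = prob {w \<in> space M. e < \<bar>X n w - Z w\<bar>} + e"
        using prob_space B by (subst Bochner_Integration.integral_add[OF iB integrable_const]) (simp_all add: B_def)
      finally show ?thesis .
    qed
    then show "\<exists>N. \<forall>n\<ge>N. expectation (g n) \<le> prob {w \<in> space M. e < \<bar>X n w - Z w\<bar>} + e" by blast
  qed
  then have "expectation h \<le> 0" by (rule field_le_epsilon)
  then have "expectation h = 0" using Bochner_Integration.integral_nonneg[of M h] h01 by (simp add: antisym)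
  then have "AE w in M. h w = 0" using int h01 by (subst (asm) integral_nonneg_eq_0_iff_AE) auto
  then show ?thesis by eventually_elim (auto simp: h_def min_def split: if_splits)
qed

lemma dense_sequence:
  fixes q :: "nat \<Rightarrow> 'a::real_vector \<Rightarrow> real"
  assumes "\<And>k. \<exists>D. countable D \<and> (\<forall>x. \<forall>\<epsilon>>0. \<exists>d\<in>D. q k (x - d) < \<epsilon>)"
  shows "\<exists>d :: nat \<Rightarrow> 'a. (\<forall>k x \<epsilon>. 0 < \<epsilon> \<longrightarrow> (\<exists>i. q k (x - d i) < \<epsilon>)) \<and>
    (\<forall>i j. \<exists>l. d l = d i + d j) \<and> (\<forall>i j. \<exists>l. d l = d i - d j)"
proof -
  obtain D where D: "\<And>k. countable (D k)" "\<And>k x \<epsilon>. 0 < \<epsilon> \<Longrightarrow> \<exists>d\<in>D k. q k (x - d) < \<epsilon>"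
    using assms by metis
  define G where "G = insert 0 (\<Union>k. D k)"
  have "countable G" "G \<noteq> {}" using D(1) by (auto simp: G_def)
  then obtain e :: "nat \<Rightarrow> 'a" where e: "range e = G" by (metis uncountable_def)
  \<comment> \<open>Elements of the generated subgroup are coded by lists of signed generators:
    concatenation adds, flipping the signs negates, and such lists are countable.\<close>
  define s where "s l = sum_list (map (\<lambda>(b, i). if b then e i else - e i) l)" for l :: "(bool \<times> nat) list"
  define d where "d n = s (from_nat n)" for n
  have surj: "\<exists>n. d n = s l" for l by (intro exI[of _ "to_nat l"]) (simp add: d_def)
  have neg: "s (map (\<lambda>(b, i). (\<not> b, i)) l) = - s l" for l
    by (induction l) (auto simp: s_def)
  show ?thesis
  proof (intro exI[of _ d] conjI allI impI)
    fix k x and \<epsilon> :: real assume "0 < \<epsilon>"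
    then obtain y where y: "y \<in> D k" "q k (x - y) < \<epsilon>" using D(2) by blast
    have "y \<in> range e" using y(1) unfolding e G_def by blast
    then obtain i where i: "e i = y" by blast
    obtain n where "d n = s [(True, i)]" using surj by blast
    then show "\<exists>i. q k (x - d i) < \<epsilon>" using y i by (intro exI[of _ n]) (simp add: s_def)
  next
    fix i j
    obtain n where "d n = s (from_nat i @ from_nat j)" using surj by blast
    then show "\<exists>l. d l = d i + d j" by (intro exI[of _ n]) (simp add: s_def d_def)
    obtain n where "d n = s (from_nat i @ map (\<lambda>(b, i). (\<not> b, i)) (from_nat j))" using surj by blast
    then have "d n = s (from_nat i) + s (map (\<lambda>(b, i). (\<not> b, i)) (from_nat j))" by (simp add: s_def)
    then show "\<exists>l. d l = d i - d j" by (intro exI[of _ n]) (simp add: neg d_def)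
  qed
qed

lemma tendsto_sequence_iff:
  fixes f :: "'b \<Rightarrow> nat \<Rightarrow> real"
  shows "(f \<longlongrightarrow> l) F \<longleftrightarrow> (\<forall>i. ((\<lambda>s. f s i) \<longlongrightarrow> l i) F)"
  using limitin_componentwise[of "\<lambda>_. euclideanreal" UNIV f l F]
  by (simp add: euclidean_product_topology)

context cyl_levy
begin

section \<open>Choice of the semi-norms\<close>

text \<open>Either \<psi> lies in the neighbourhood given by equicontinuity, where \<eta> alone
  suffices, or \<open>p \<psi>\<close> is at least 2, where the left side, being at most 2, is below
  the square of \<open>p \<psi>\<close>.\<close>

lemma nuclear_char_bound:
  assumes T: "nuclear_space T" and eq: "\<forall>S>0. equicontinuous_L0 M T (L ` {0..S})" and S: "0 \<le> S" and \<eta>: "0 < \<eta>"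
  shows "\<exists>p. hilbertian p \<and> continuous_map T euclideanreal p \<and>
    (\<forall>t \<psi>. 0 \<le> t \<longrightarrow> t \<le> S \<longrightarrow> 1 - expectation (\<lambda>w. cos (L t \<psi> w)) \<le> \<eta> + (p \<psi>)\<^sup>2)"
proof -
  obtain P where Ph: "\<And>p. p \<in> P \<Longrightarrow> hilbertian p" and TP: "T = seminorm_topology P"
    using T unfolding nuclear_space_def by blast
  have P: "\<forall>r\<in>P. seminorm r" using Ph hilbertian_seminorm by blast
  \<comment> \<open>Since 1 - cos x is at most x^2 / 2, values up to \<epsilon> contribute \<eta>/2.
    The exceptional set has probability below \<eta>/4 and 1 - cos is at most 2 there, which gives
    the other \<eta>/2.\<close>
  define \<epsilon> where "\<epsilon> = sqrt \<eta>"
  have \<epsilon>: "0 < \<epsilon>" "\<epsilon>\<^sup>2 = \<eta>" using \<eta> by (simp_all add: \<epsilon>_def)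
  \<comment> \<open>The horizon is enlarged because \<open>S\<close> may be 0, while equicontinuity
    is given for positive horizons.\<close>
  have eq1: "equicontinuous_L0 M T (L ` {0..S + 1})" using eq S by simp
  have "0 < \<eta> / 4" using \<eta> by simp
  then obtain U where U: "openin T U" "0 \<in> U"
    "\<forall>X\<in>L ` {0..S + 1}. \<forall>\<psi>\<in>U. prob {w \<in> space M. \<epsilon> < \<bar>X \<psi> w - X 0 w\<bar>} < \<eta> / 4"
    using eq1[unfolded equicontinuous_L0_def, rule_format, OF \<epsilon>(1), of "\<eta> / 4" 0] by blast
  have UP: "openin (seminorm_topology P) U" using U(1) TP by simp
  have "\<exists>F \<epsilon>. finite F \<and> F \<subseteq> P \<and> \<epsilon> > 0 \<and> {y. \<forall>p\<in>F. p (0 - y) < \<epsilon>} \<subseteq> U"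
    by (rule openin_seminorm_topology[THEN iffD1, THEN bspec, OF UP U(2)])
  then obtain F e where F: "finite F" "F \<subseteq> P" "e > 0" "{y. \<forall>p\<in>F. p (0 - y) < e} \<subseteq> U" by blast
  define r where "r = root_sum_sq (\<lambda>p::'v \<Rightarrow> real. p) F"
  \<comment> \<open>Scaled so that \<open>p\<close> is at least 2 wherever \<open>r\<close> is at
    least \<open>e\<close>.\<close>
  define p where "p x = (2 / e) * r x" for x
  have hr: "hilbertian r" unfolding r_def using F(2) Ph by (intro hilbertian_root_sum_sq) auto
  have hp: "hilbertian p" unfolding p_def using hr F(3) by (intro hilbertian_cmult) auto
  have pF: "seminorm s" if "s \<in> F" for s using P F(2) that by blast
  have cp: "continuous_map T euclideanreal p"
    unfolding TP
  proof (rule continuous_seminorm_le_sum[OF P hilbertian_seminorm[OF hp] F(1) pF])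
    show "continuous_map (seminorm_topology P) euclideanreal s" if "s \<in> F" for s
      using that F(2) pF[OF that] by (intro iffD2[OF continuous_map_seminorm_iff[OF P]] exI[of _ "{s}"] exI[of _ 1]) auto
    show "p x \<le> (2 / e) * (\<Sum>s\<in>F. s x)" for x
      unfolding p_def r_def root_sum_sq_L2 using F(3) pF seminormD(1)
      by (intro mult_left_mono L2_set_le_sum) auto
  qed (use F(3) in auto)
  have "1 - expectation (\<lambda>w. cos (L t \<psi> w)) \<le> \<eta> + (p \<psi>)\<^sup>2" if t: "0 \<le> t" "t \<le> S" for t \<psi>
  proof (cases "r \<psi> < e")
    case True
    have "s (0 - \<psi>) < e" if s: "s \<in> F" for s
      using True root_sum_sq_ge[OF F(1) s, of "\<lambda>s. s" \<psi>] seminormD(5)[OF pF[OF s], of \<psi>] by (simp add: r_def)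
    then have "\<psi> \<in> U" using F(4) by blast
    then have pU: "prob {w \<in> space M. \<epsilon> < \<bar>L t \<psi> w - L t 0 w\<bar>} < \<eta> / 4" using U(3) t by auto
    have [measurable]: "L t \<psi> \<in> borel_measurable M" "L t 0 \<in> borel_measurable M" using t by auto
    have pr: "prob {w \<in> space M. \<epsilon> < \<bar>L t \<psi> w\<bar>} < \<eta> / 4"
    proof -
      have "prob {w \<in> space M. \<epsilon> < \<bar>L t \<psi> w\<bar>} = prob {w \<in> space M. \<epsilon> < \<bar>L t \<psi> w - L t 0 w\<bar>}"
      proof (rule finite_measure_eq_AE)
        show "AE w in M. (w \<in> {w \<in> space M. \<epsilon> < \<bar>L t \<psi> w\<bar>}) = (w \<in> {w \<in> space M. \<epsilon> < \<bar>L t \<psi> w - L t 0 w\<bar>})"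
          using cylindrical_rv_zero[OF cyl[OF t(1)]] by eventually_elim auto
      qed measurable
      then show ?thesis using pU by simp
    qed
    define B where "B = {w \<in> space M. \<epsilon> < \<bar>L t \<psi> w\<bar>}"
    have [measurable]: "B \<in> sets M" unfolding B_def by measurable
    have ci: "integrable M (\<lambda>w. cos (L t \<psi> w))" by (intro integrable_const_bound[where B=1]) auto
    have "1 - expectation (\<lambda>w. cos (L t \<psi> w)) = expectation (\<lambda>w. 1 - cos (L t \<psi> w))"
      using ci prob_space by (subst Bochner_Integration.integral_diff) auto
    also have "\<dots> \<le> expectation (\<lambda>w. \<eta> / 2 + 2 * indicator B w)"
    proof (rule integral_mono_AE)
      show "AE w in M. 1 - cos (L t \<psi> w) \<le> \<eta> / 2 + 2 * indicator B w"
      proof (rule AE_I2)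
        fix w assume w: "w \<in> space M"
        show "1 - cos (L t \<psi> w) \<le> \<eta> / 2 + 2 * indicator B w"
        proof (cases "w \<in> B")
          case True
          then have "indicator B w = (1::real)" by simp
          then show ?thesis using cos_ge_minus_one[of "L t \<psi> w"] \<eta> by linarith
        next
          case False
          then have "\<bar>L t \<psi> w\<bar> \<le> \<epsilon>" using w by (simp add: B_def)
          then have "(L t \<psi> w)\<^sup>2 \<le> \<epsilon>\<^sup>2" using \<epsilon>(1) by (simp add: abs_le_square_iff[symmetric])
          moreover have "1 - cos (L t \<psi> w) \<le> (L t \<psi> w)\<^sup>2 / 2"
          proof -
            have "1 - cos (L t \<psi> w) = 2 * (sin (L t \<psi> w / 2))\<^sup>2" using cos_double_sin[of "L t \<psi> w / 2"] by simp
            also have "(sin (L t \<psi> w / 2))\<^sup>2 \<le> (L t \<psi> w / 2)\<^sup>2"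
              using abs_sin_x_le_abs_x[of "L t \<psi> w / 2"] by (rule abs_le_square_iff[THEN iffD1])
            finally show ?thesis by (simp add: power_divide)
          qed
          ultimately show ?thesis using False \<epsilon>(2) by simp
        qed
      qed
    qed (use ci in \<open>auto simp: less_top[symmetric]\<close>)
    also have "\<dots> = \<eta> / 2 + 2 * prob B"
      using prob_space by (subst Bochner_Integration.integral_add) (auto simp: less_top[symmetric])
    also have "\<dots> \<le> \<eta> + (p \<psi>)\<^sup>2" using pr unfolding B_def by (simp add: add_increasing2)
    finally show ?thesis .
  next
    case False
    then have "2 \<le> p \<psi>" using F(3) by (simp add: p_def field_simps)
    then have "2\<^sup>2 \<le> (p \<psi>)\<^sup>2" by (intro power_mono) auto
    moreover have "- 1 \<le> expectation (\<lambda>w. cos (L t \<psi> w))"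
    proof -
      have [measurable]: "L t \<psi> \<in> borel_measurable M" using t by auto
      have "expectation (\<lambda>w. - 1) \<le> expectation (\<lambda>w. cos (L t \<psi> w))"
        by (intro integral_mono integrable_const_bound[where B=1]) auto
      then show ?thesis using prob_space by simp
    qed
    ultimately show ?thesis using \<eta> by simp
  qed
  then show ?thesis using hp cp by blast
qed

text \<open>The same \<open>k\<close> serves as time horizon, as index of the semi-norm and as
  exponent. Dependent choice makes each new semi-norm dominate both its predecessor, with a
  Hilbert-Schmidt bound, and the semi-norm that equicontinuity gives for its own horizon.\<close>

lemma seminorm_sequence:
  assumes T: "nuclear_space T" and eq: "\<forall>S>0. equicontinuous_L0 M T (L ` {0..S})"
  shows "\<exists>q C. \<forall>k. hilbertian (q k) \<and> continuous_map T euclideanreal (q k) \<and> (\<forall>x. q k x \<le> q (Suc k) x) \<and>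
    hs_bound (q k) (q (Suc k)) (C k) \<and>
    (\<forall>t \<psi>. 0 \<le> t \<longrightarrow> t \<le> real k \<longrightarrow> 1 - expectation (\<lambda>w. cos (L t \<psi> w)) \<le> (1 / 2) ^ (k + 3) + (q k \<psi>)\<^sup>2)"
proof -
  obtain P where Ph: "\<And>p. p \<in> P \<Longrightarrow> hilbertian p" and TP: "T = seminorm_topology P"
    using T unfolding nuclear_space_def by blast
  have P: "\<forall>r\<in>P. seminorm r" using Ph hilbertian_seminorm by blast
  have "\<exists>p. hilbertian p \<and> continuous_map T euclideanreal p \<and>
    (\<forall>t \<psi>. 0 \<le> t \<longrightarrow> t \<le> real k \<longrightarrow> 1 - expectation (\<lambda>w. cos (L t \<psi> w)) \<le> (1 / 2) ^ (k + 3) + (p \<psi>)\<^sup>2)" for k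
    by (rule nuclear_char_bound[OF T eq]) simp_all
  then obtain p where p: "\<And>k. hilbertian (p k)" "\<And>k. continuous_map T euclideanreal (p k)"
    "\<And>k t \<psi>. 0 \<le> t \<Longrightarrow> t \<le> real k \<Longrightarrow> 1 - expectation (\<lambda>w. cos (L t \<psi> w)) \<le> (1 / 2) ^ (k + 3) + (p k \<psi>)\<^sup>2" by metis
  define PP where "PP k q \<longleftrightarrow> hilbertian q \<and> continuous_map T euclideanreal q \<and> (\<forall>x. p k x \<le> q x)" for k q
  define QQ where "QQ q q' \<longleftrightarrow> (\<forall>x. q x \<le> q' x) \<and> (\<exists>C. hs_bound q q' C)" for q q' :: "'v \<Rightarrow> real"
  have "\<exists>f. \<forall>n. PP n (f n) \<and> QQ (f n) (f (Suc n))"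
  proof (rule dependent_nat_choice[where Q="\<lambda>_. QQ"])
    show "\<exists>q. PP 0 q" using p(1,2) unfolding PP_def by blast
    fix q n assume q: "PP n q"
    \<comment> \<open>Both requirements are first merged into one Hilbertian semi-norm and then
      majorized together.\<close>
    define s where "s = root_sum_sq (\<lambda>b. if b then q else p (Suc n)) UNIV"
    have hs: "hilbertian s" unfolding s_def using q p(1) by (intro hilbertian_root_sum_sq) (auto simp: PP_def)
    have cs: "continuous_map T euclideanreal s"
      unfolding TP
    proof (rule continuous_seminorm_le_sum[OF P hilbertian_seminorm[OF hs], where I=UNIV and C=1 and s="\<lambda>b. if b then q else p (Suc n)"])
      show "seminorm (if b then q else p (Suc n))" for b
        using q p(1) hilbertian_seminorm by (auto simp: PP_def)
      show "continuous_map (seminorm_topology P) euclideanreal (if b then q else p (Suc n))" for b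
        using q p(2) TP by (auto simp: PP_def)
      then show "s x \<le> 1 * (\<Sum>b\<in>UNIV. (if b then q else p (Suc n)) x)" for x
        unfolding s_def root_sum_sq_L2 using seminormD(1) hilbertian_seminorm q p(1)
        by (simp only: mult_1, intro L2_set_le_sum) (auto simp: PP_def)
    qed auto
    have qs: "q x \<le> s x" "p (Suc n) x \<le> s x" for x
      using root_sum_sq_ge[of UNIV True "\<lambda>b. if b then q else p (Suc n)" x]
        root_sum_sq_ge[of UNIV False "\<lambda>b. if b then q else p (Suc n)" x] by (auto simp: s_def)
    obtain Q C where Q: "hilbertian Q" "continuous_map T euclideanreal Q" "\<And>x. s x \<le> Q x" "hs_bound s Q C"
      using nuclear_space_dominating[OF T hilbertian_seminorm[OF hs] cs] by blast
    have q0: "0 \<le> q x" for x using q hilbertian_seminorm seminormD(1) unfolding PP_def by blast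
    have "hs_bound q Q (1 * C)"
    proof (rule hs_bound_mono[OF Q(4)])
      show "0 \<le> Q x" for x using Q(1) hilbertian_seminorm seminormD(1) by blast
      show "(q x)\<^sup>2 \<le> 1 * (s x)\<^sup>2" for x using qs(1)[of x] q0[of x] by (simp add: power_mono)
    qed auto
    moreover have "q x \<le> Q x" "p (Suc n) x \<le> Q x" for x using qs[of x] Q(3)[of x] by auto
    ultimately show "\<exists>q'. PP (Suc n) q' \<and> QQ q q'" using Q(1,2) unfolding PP_def QQ_def by blast
  qed
  then obtain q where q: "\<And>n. PP n (q n)" "\<And>n. QQ (q n) (q (Suc n))" by blast
  then obtain C where C: "\<And>k. hs_bound (q k) (q (Suc k)) (C k)" unfolding QQ_def by metis
  have "1 - expectation (\<lambda>w. cos (L t \<psi> w)) \<le> (1 / 2) ^ (k + 3) + (q k \<psi>)\<^sup>2" if "0 \<le> t" "t \<le> real k" for k t \<psi>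
  proof -
    have "0 \<le> p k \<psi>" "p k \<psi> \<le> q k \<psi>" using q(1)[of k] p(1) hilbertian_seminorm seminormD(1) unfolding PP_def by blast+
    then have "(p k \<psi>)\<^sup>2 \<le> (q k \<psi>)\<^sup>2" by (intro power_mono) auto
    then show ?thesis using p(3)[OF that, of \<psi>] by linarith
  qed
  then show ?thesis using q C unfolding PP_def QQ_def by (intro exI[of _ q] exI[of _ C]) blast
qed

end

section \<open>Dual-norm bounds that are uniform in time\<close>

locale levy_frame = cyl_levy M L + dual_frame q C d
  for M :: "'w measure" and L :: "real \<Rightarrow> 'v::real_vector \<Rightarrow> 'w \<Rightarrow> real"
    and q :: "nat \<Rightarrow> 'v \<Rightarrow> real" and C :: "nat \<Rightarrow> real" and d :: "nat \<Rightarrow> 'v" +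
  assumes char_bound: "0 \<le> t \<Longrightarrow> t \<le> real k \<Longrightarrow>
    1 - expectation (\<lambda>w. cos (L t \<psi> w)) \<le> (1 / 2) ^ (k + 3) + (q k \<psi>)\<^sup>2"
begin

text \<open>The radius of \<open>minlos_bound\<close> for \<eta> = 2^(-k-3).\<close>

definition R :: "nat \<Rightarrow> real" where "R k = sqrt (4 * (C k + 1) / (1 / 2) ^ (k + 3))"

lemma C_nonneg: "0 \<le> C k"
  using hs_boundD[OF q_hs, of "{}"] by (simp add: seminormD(4)[OF sq])

lemma R_pos: "0 < R k" using C_nonneg[of k] by (simp add: R_def add_nonneg_pos)

lemma minlos_L:
  assumes t: "0 \<le> t" "t \<le> real k" and V: "finite V" and \<delta>: "0 < \<delta>"
  shows "prob {w \<in> space M. \<exists>x\<in>V. R k * (q (Suc k) x + \<delta>) < \<bar>L t x w\<bar>} \<le> 4 * (1 / 2) ^ (k + 3)"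
  unfolding R_def
  by (rule minlos_bound[OF cyl[OF t(1)] hilb hilb q_mono1 q_hs char_bound[OF t] _ V \<delta>]) simp

text \<open>The factor 2 is the level at which \<open>levy_sup\<close> controls all times. Rational
  times and the countable subgroup keep this a countable union of events.\<close>

definition bad :: "nat \<Rightarrow> 'w \<Rightarrow> bool" where
  "bad k w \<longleftrightarrow> (\<exists>t\<in>\<rat> \<inter> {0..real k}. \<exists>x. 2 * R k * q (Suc k) (d x) < \<bar>L t (d x) w\<bar>)"

text \<open>Both estimates concern finite sets: Minlos finitely many vectors, Ottaviani finitely
  many times. The exceptional event is the increasing union of the events \<open>E n\<close>;
  strictness of the inequality absorbs the error \<open>1 / Suc n\<close>.\<close>

lemma bad_prob:
  "{w \<in> space M. bad k w} \<in> events" "prob {w \<in> space M. bad k w} \<le> 8 * (1 / 2) ^ (k + 3)"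
proof -
  have c: "countable (\<rat> \<inter> {0..real k})" by (rule countable_Int1[OF countable_rat])
  have ne: "\<rat> \<inter> {0..real k} \<noteq> {}" by (auto intro!: exI[of _ 0])
  obtain e :: "nat \<Rightarrow> real" where e: "range e = \<rat> \<inter> {0..real k}" using c ne by (metis uncountable_def)
  have e0: "0 \<le> e i" "e i \<le> real k" for i using e by auto
  define E where "E n = {w \<in> space M. \<exists>t\<in>e ` {..n}. \<exists>x<Suc n. 2 * (R k * (q (Suc k) (d x) + 1 / real (Suc n))) < \<bar>L t (d x) w\<bar>}" for n
  have Em: "E n \<in> events" for n
  proof -
    have [measurable]: "L (e i) (d x) \<in> borel_measurable M" for i x using e0(1)[of i] by simp
    have "{w \<in> space M. 2 * (R k * (q (Suc k) (d x) + 1 / real (Suc n))) < \<bar>L (e i) (d x) w\<bar>} \<in> events" for i x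
      by measurable
    moreover have "E n = (\<Union>i\<in>{..n}. \<Union>x\<in>{..<Suc n}. {w \<in> space M. 2 * (R k * (q (Suc k) (d x) + 1 / real (Suc n))) < \<bar>L (e i) (d x) w\<bar>})"
      by (auto simp: E_def)
    ultimately show ?thesis by auto
  qed
  have Ep: "prob (E n) \<le> 8 * (1 / 2) ^ (k + 3)" for n
  proof -
    have "(1 / 2 :: real) ^ k \<le> 1" by (simp add: power_le_one)
    then have b: "4 * (1 / 2) ^ (k + 3) \<le> (1 / 2 :: real)" by (simp add: power_add power3_eq_cube)
    have "prob {w \<in> space M. \<exists>x<Suc n. R k * (q (Suc k) (d x) + 1 / real (Suc n)) < \<bar>L u (d x) w\<bar>} \<le> 4 * (1 / 2) ^ (k + 3)"
      if u: "0 \<le> u" "u \<le> real k" for u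
    proof -
      have "{w \<in> space M. \<exists>x<Suc n. R k * (q (Suc k) (d x) + 1 / real (Suc n)) < \<bar>L u (d x) w\<bar>} =
          {w \<in> space M. \<exists>x\<in>d ` {..<Suc n}. R k * (q (Suc k) x + 1 / real (Suc n)) < \<bar>L u x w\<bar>}" by auto
      then show ?thesis using minlos_L[OF u, of "d ` {..<Suc n}" "1 / real (Suc n)"] by simp
    qed
    then have "prob {w \<in> space M. \<exists>t\<in>e ` {..n}. \<exists>x<Suc n. 2 * (R k * (q (Suc k) (d x) + 1 / real (Suc n))) < \<bar>L t (d x) w\<bar>} \<le> 2 * (4 * (1 / 2) ^ (k + 3))"
      using e0 R_pos[of k] seminormD(1)[OF sq, of "Suc k"]
      by (intro levy_sup[where h="real k"] b) (auto intro!: mult_pos_pos add_nonneg_pos)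
    then show ?thesis by (simp add: E_def)
  qed
  have inc: "incseq E"
    unfolding incseq_def
  proof (intro allI impI subsetI)
    fix m n w assume mn: "m \<le> n" and w: "w \<in> E m"
    then obtain i x where ix: "w \<in> space M" "i \<le> m" "x < Suc m" "2 * (R k * (q (Suc k) (d x) + 1 / real (Suc m))) < \<bar>L (e i) (d x) w\<bar>"
      by (auto simp: E_def)
    have "1 / real (Suc n) \<le> 1 / real (Suc m)" using mn by (simp add: frac_le)
    then have "2 * (R k * (q (Suc k) (d x) + 1 / real (Suc n))) \<le> 2 * (R k * (q (Suc k) (d x) + 1 / real (Suc m)))"
      using R_pos[of k] by (intro mult_left_mono add_left_mono) auto
    then have "2 * (R k * (q (Suc k) (d x) + 1 / real (Suc n))) < \<bar>L (e i) (d x) w\<bar>" using ix(4) by linarith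
    then show "w \<in> E n" unfolding E_def using ix(1-3) mn
      by (intro CollectI conjI bexI[of _ "e i"] exI[of _ x]) auto
  qed
  have UE: "{w \<in> space M. bad k w} = (\<Union>n. E n)"
  proof
    show "(\<Union>n. E n) \<subseteq> {w \<in> space M. bad k w}"
    proof
      fix w assume "w \<in> (\<Union>n. E n)"
      then obtain n i x where ix: "w \<in> space M" "2 * (R k * (q (Suc k) (d x) + 1 / real (Suc n))) < \<bar>L (e i) (d x) w\<bar>"
        by (auto simp: E_def)
      have "2 * (R k * (q (Suc k) (d x) + 0)) \<le> 2 * (R k * (q (Suc k) (d x) + 1 / real (Suc n)))"
        using R_pos[of k] by (intro mult_left_mono add_left_mono) auto
      then have "2 * R k * q (Suc k) (d x) < \<bar>L (e i) (d x) w\<bar>" using ix(2) by simp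
      moreover have "e i \<in> \<rat> \<inter> {0..real k}" using e by blast
      ultimately show "w \<in> {w \<in> space M. bad k w}" using ix(1) unfolding bad_def by blast
    qed
    show "{w \<in> space M. bad k w} \<subseteq> (\<Union>n. E n)"
    proof
      fix w assume "w \<in> {w \<in> space M. bad k w}"
      then obtain t x where tx: "w \<in> space M" "t \<in> \<rat> \<inter> {0..real k}" "2 * R k * q (Suc k) (d x) < \<bar>L t (d x) w\<bar>"
        unfolding bad_def by blast
      obtain i where i: "t = e i" using e tx(2) by (metis imageE)
      have "(\<lambda>n. 2 * (R k * (q (Suc k) (d x) + 1 / real (Suc n)))) \<longlonglongrightarrow> 2 * (R k * (q (Suc k) (d x) + 0))"
        using LIMSEQ_inverse_real_of_nat by (intro tendsto_intros) (simp add: divide_inverse)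
      then have "\<forall>\<^sub>F n in sequentially. 2 * (R k * (q (Suc k) (d x) + 1 / real (Suc n))) < \<bar>L t (d x) w\<bar>"
        by (rule order_tendstoD(2)) (use tx(3) in simp)
      then obtain N where N: "\<And>n. n \<ge> N \<Longrightarrow> 2 * (R k * (q (Suc k) (d x) + 1 / real (Suc n))) < \<bar>L t (d x) w\<bar>"
        unfolding eventually_sequentially by blast
      have "w \<in> E (max N (max i x))"
        unfolding E_def using N[of "max N (max i x)"] tx(1) i by (auto intro!: bexI[of _ i] exI[of _ x])
      then show "w \<in> (\<Union>n. E n)" by blast
    qed
  qed
  show "{w \<in> space M. bad k w} \<in> events" unfolding UE using Em by auto
  have "(\<lambda>n. prob (E n)) \<longlonglongrightarrow> prob (\<Union>n. E n)" using Em inc by (intro finite_Lim_measure_incseq) auto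
  then show "prob {w \<in> space M. bad k w} \<le> 8 * (1 / 2) ^ (k + 3)"
    unfolding UE by (rule LIMSEQ_le_const2) (use Ep in blast)
qed

text \<open>The event that all \<open>k\<close> from \<open>K\<close> on are bad is contained in
  each single one of them, and these have probability at most 2^(-k). One good \<open>k\<close>
  beyond any given horizon is all that a path needs.\<close>

lemma AE_not_bad: "AE w in M. \<forall>K. \<exists>k\<ge>K. \<not> bad k w"
proof (subst AE_all_countable, rule allI)
  fix K
  let ?B = "\<Inter>k\<in>{K..}. {w \<in> space M. bad k w}"
  have B: "?B \<in> events" using bad_prob(1) by (intro sets.countable_INT') auto
  have "prob ?B \<le> 0"
  proof (rule LIMSEQ_le_const)
    have "(\<lambda>i. (1 / 2 :: real) ^ i) \<longlonglongrightarrow> 0" by (intro LIMSEQ_realpow_zero) auto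
    then show "(\<lambda>i. (1 / 2 :: real) ^ i) \<longlonglongrightarrow> 0" .
    have "prob ?B \<le> (1 / 2) ^ n" if "n \<ge> K" for n
    proof -
      have "prob ?B \<le> prob {w \<in> space M. bad n w}" using that bad_prob(1) by (intro finite_measure_mono) auto
      also have "\<dots> \<le> 8 * (1 / 2) ^ (n + 3)" by (rule bad_prob(2))
      also have "\<dots> = (1 / 2) ^ n" by (simp add: power_add power3_eq_cube)
      finally show ?thesis .
    qed
    then show "\<exists>N. \<forall>n\<ge>N. prob ?B \<le> (1 / 2) ^ n" by blast
  qed
  then have "?B \<in> null_sets M" using B by (intro null_setsI) (auto simp: emeasure_eq_measure measure_nonneg antisym)
  then show "AE w in M. \<exists>k\<ge>K. \<not> bad k w" by (rule AE_I') auto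
qed

text \<open>Additivity is required only at rational times and for the \<open>d i\<close>, hence for
  countably many almost sure identities.\<close>

definition good :: "'w \<Rightarrow> bool" where
  "good w \<longleftrightarrow> (\<forall>i. \<forall>t\<ge>0. \<exists>l. ((\<lambda>s. L s (d i) w) \<longlongrightarrow> l) (at t within \<rat> \<inter> {t<..})) \<and>
     (\<forall>i. \<forall>t>0. \<exists>l. ((\<lambda>s. L s (d i) w) \<longlongrightarrow> l) (at t within \<rat> \<inter> {0<..<t})) \<and>
     (\<forall>K. \<exists>k\<ge>K. \<not> bad k w) \<and>
     (\<forall>t\<in>\<rat> \<inter> {0..}. \<forall>i j l. d l = d i + d j \<longrightarrow> L t (d l) w = L t (d i) w + L t (d j) w)"

lemma AE_good: "AE w in M. good w"
proof -
  have c: "countable (\<rat> \<inter> {0::real..})" by (rule countable_Int1[OF countable_rat])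
  have 1: "AE w in M. \<forall>i. (\<forall>t\<ge>0. \<exists>l. ((\<lambda>s. L s (d i) w) \<longlongrightarrow> l) (at t within \<rat> \<inter> {t<..})) \<and>
     (\<forall>t>0. \<exists>l. ((\<lambda>s. L s (d i) w) \<longlongrightarrow> l) (at t within \<rat> \<inter> {0<..<t}))"
    by (subst AE_all_countable) (blast intro: regulated_paths)
  have "AE w in M. \<forall>i j l. d l = d i + d j \<longrightarrow> L t (d l) w = L t (d i) w + L t (d j) w" if t: "0 \<le> t" for t
  proof (subst AE_all_countable, rule allI, subst AE_all_countable, rule allI, subst AE_all_countable, rule allI)
    fix i j l
    have "AE w in M. L t (d i + d j) w = L t (d i) w + L t (d j) w"
      using cyl[OF t] unfolding cylindrical_rv_def by blast
    then show "AE w in M. d l = d i + d j \<longrightarrow> L t (d l) w = L t (d i) w + L t (d j) w"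
      by eventually_elim simp
  qed
  then have 2: "AE w in M. \<forall>t\<in>\<rat> \<inter> {0..}. \<forall>i j l. d l = d i + d j \<longrightarrow> L t (d l) w = L t (d i) w + L t (d j) w"
    by (subst AE_ball_countable[OF c]) simp
  show ?thesis using 1 2 AE_not_bad unfolding good_def by eventually_elim blast
qed

section \<open>Construction of the paths as right limits\<close>

text \<open>A measurable null set that covers all exceptional points; setting paths to zero on it
  keeps them measurable.\<close>

definition N0 :: "'w set" where "N0 = (SOME N. N \<in> null_sets M \<and> {w \<in> space M. \<not> good w} \<subseteq> N)"

lemma N0: "N0 \<in> null_sets M" "w \<in> space M \<Longrightarrow> w \<notin> N0 \<Longrightarrow> good w"
proof -
  obtain N where "{w \<in> space M. \<not> good w} \<subseteq> N" "emeasure M N = 0" "N \<in> events"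
    using AE_good by (rule AE_E) blast
  then have "\<exists>N. N \<in> null_sets M \<and> {w \<in> space M. \<not> good w} \<subseteq> N" by (intro exI[of _ N]) auto
  then have *: "N0 \<in> null_sets M \<and> {w \<in> space M. \<not> good w} \<subseteq> N0"
    unfolding N0_def by (rule someI_ex[of "\<lambda>N. N \<in> null_sets M \<and> {w \<in> space M. \<not> good w} \<subseteq> N"])
  then show "N0 \<in> null_sets M" "w \<in> space M \<Longrightarrow> w \<notin> N0 \<Longrightarrow> good w" by auto
qed

text \<open>Rational times approaching \<open>t\<close> strictly from the right, chosen
  independently of \<open>w\<close>, so that right limits become limits of sequences of random
  variables.\<close>

definition \<sigma> :: "real \<Rightarrow> nat \<Rightarrow> real" where
  "\<sigma> t n = (SOME s. s \<in> \<rat> \<and> t < s \<and> s < t + 1 / real (Suc n))"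

lemma \<sigma>: "\<sigma> t n \<in> \<rat>" "t < \<sigma> t n" "\<sigma> t n < t + 1 / real (Suc n)"
proof -
  have "\<exists>s. s \<in> \<rat> \<and> t < s \<and> s < t + 1 / real (Suc n)"
    using Rats_dense_in_real[of t "t + 1 / real (Suc n)"] by auto
  then have "\<sigma> t n \<in> \<rat> \<and> t < \<sigma> t n \<and> \<sigma> t n < t + 1 / real (Suc n)"
    unfolding \<sigma>_def by (rule someI_ex[of "\<lambda>s. s \<in> \<rat> \<and> t < s \<and> s < t + 1 / real (Suc n)"])
  then show "\<sigma> t n \<in> \<rat>" "t < \<sigma> t n" "\<sigma> t n < t + 1 / real (Suc n)" by auto
qed

lemma \<sigma>_lim: "filterlim (\<sigma> t) (at t within \<rat> \<inter> {t<..}) sequentially"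
proof -
  have "(\<lambda>n. t + 1 / real (Suc n)) \<longlonglongrightarrow> t + 0"
    using LIMSEQ_inverse_real_of_nat by (intro tendsto_intros) (simp add: divide_inverse)
  then have u: "(\<lambda>n. t + 1 / real (Suc n)) \<longlonglongrightarrow> t" by simp
  have "\<sigma> t \<longlonglongrightarrow> t"
    by (rule tendsto_sandwich[OF _ _ tendsto_const u]; intro always_eventually allI less_imp_le \<sigma>)
  then show ?thesis using \<sigma>[of t] unfolding filterlim_at by (auto simp: less_imp_neq[symmetric])
qed

text \<open>The default value 0 puts every value of \<open>path\<close> into some
  \<open>A m m\<close>, for all arguments, so that \<open>\<Psi>\<close> can be applied without side
  conditions.\<close>

definition path :: "real \<Rightarrow> 'w \<Rightarrow> nat \<Rightarrow> real" where
  "path t w i = (if w \<in> N0 \<or> w \<notin> space M \<or> t < 0 then 0 else lim (\<lambda>n. L (\<sigma> t n) (d i) w))"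

lemma path_lim:
  assumes w: "w \<in> space M" "w \<notin> N0" and t: "0 \<le> t"
  shows "((\<lambda>s. L s (d i) w) \<longlongrightarrow> path t w i) (at t within \<rat> \<inter> {t<..})"
    and "(\<lambda>n. L (\<sigma> t n) (d i) w) \<longlonglongrightarrow> path t w i"
proof -
  obtain l where l: "((\<lambda>s. L s (d i) w) \<longlongrightarrow> l) (at t within \<rat> \<inter> {t<..})"
    using N0(2)[OF w] t unfolding good_def by blast
  have s: "(\<lambda>n. L (\<sigma> t n) (d i) w) \<longlonglongrightarrow> l" by (rule filterlim_compose[OF l \<sigma>_lim])
  then have "path t w i = l" using w t by (simp add: path_def limI)
  then show "((\<lambda>s. L s (d i) w) \<longlongrightarrow> path t w i) (at t within \<rat> \<inter> {t<..})"
    "(\<lambda>n. L (\<sigma> t n) (d i) w) \<longlonglongrightarrow> path t w i" using l s by simp_all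
qed

lemma path_measurable [measurable]:
  assumes t: "0 \<le> t" shows "(\<lambda>w. path t w i) \<in> borel_measurable M"
proof (rule borel_measurable_LIMSEQ_real)
  have N: "N0 \<in> events" using N0(1) by auto
  show "(\<lambda>w. if w \<in> N0 then 0 else L (\<sigma> t n) (d i) w) \<in> borel_measurable M" for n
    using \<sigma>(2)[of t n] t N by (intro measurable_If_set) auto
  show "(\<lambda>n. if w \<in> N0 then 0 else L (\<sigma> t n) (d i) w) \<longlonglongrightarrow> path t w i" if "w \<in> space M" for w
    using path_lim(2)[OF that _ t] by (cases "w \<in> N0") (auto simp: path_def)
qed

text \<open>Along \<open>\<sigma> t\<close> the variables converge almost surely to the right limit
  and, by stochastic continuity, in probability to the value at \<open>t\<close>.\<close>

lemma path_eq_L: 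
  assumes t: "0 \<le> t" shows "AE w in M. path t w i = L t (d i) w"
proof (rule AE_limits_agree[where X="\<lambda>n. L (\<sigma> t n) (d i)"])
  show "L (\<sigma> t n) (d i) \<in> borel_measurable M" for n using \<sigma>(2)[of t n] t by simp
  show "AE w in M. (\<lambda>n. L (\<sigma> t n) (d i) w) \<longlonglongrightarrow> path t w i"
    using AE_not_in[OF N0(1)] AE_space by eventually_elim (rule path_lim(2)[OF _ _ t])
  fix \<epsilon> :: real assume e: "0 < \<epsilon>"
  have "filterlim (\<sigma> t) (at t within {0..}) sequentially"
    using t by (intro filterlim_mono[OF \<sigma>_lim at_le order_refl]) auto
  from filterlim_compose[OF stochastic_continuity[OF t e] this]
  show "(\<lambda>n. prob {w \<in> space M. \<epsilon> < \<bar>L (\<sigma> t n) (d i) w - L t (d i) w\<bar>}) \<longlonglongrightarrow> 0" .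
qed (use t in auto)

section \<open>Local dual bounds, regularity of the paths and the version property\<close>

text \<open>Some \<open>k\<close> beyond \<open>S\<close> is not bad, and its bound in the dual norm
  of \<open>q (Suc k)\<close> holds at all rational times up to \<open>k\<close>
  simultaneously.\<close>

lemma rational_A:
  assumes w: "w \<in> space M" "w \<notin> N0"
  shows "\<exists>m k. \<forall>s\<in>\<rat> \<inter> {0..S}. (\<lambda>i. L s (d i) w) \<in> A m k"
proof -
  have g: "good w" by (rule N0(2)[OF w])
  obtain k where k: "nat \<lceil>S\<rceil> \<le> k" "\<not> bad k w" using g unfolding good_def by blast
  have Sk: "S \<le> real k" using k(1) by linarith
  define m where "m = nat \<lceil>2 * R k\<rceil>"
  have m: "2 * R k \<le> real m" unfolding m_def by linarith
  have "(\<lambda>i. L s (d i) w) \<in> A m (Suc k)" if s: "s \<in> \<rat> \<inter> {0..S}" for s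
    unfolding A_def
  proof (intro CollectI conjI allI impI)
    have s': "s \<in> \<rat> \<inter> {0..}" "s \<in> \<rat> \<inter> {0..real k}" using s Sk by auto
    show "L s (d l) w = L s (d i) w + L s (d j) w" if "d l = d i + d j" for i j l
      using g s'(1) that unfolding good_def by blast
    fix i
    have "\<bar>L s (d i) w\<bar> \<le> 2 * R k * q (Suc k) (d i)" using k(2) s'(2) unfolding bad_def by (simp add: not_less)
    also have "\<dots> \<le> real m * q (Suc k) (d i)" using m seminormD(1)[OF sq] by (rule mult_right_mono)
    finally show "\<bar>L s (d i) w\<bar> \<le> real m * q (Suc k) (d i)" .
  qed
  then show ?thesis by blast
qed

lemma path_A_local:
  assumes w: "w \<in> space M"
  shows "\<exists>m k. \<forall>t\<in>{0..S}. path t w \<in> A m k"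
proof (cases "w \<in> N0")
  case True
  then have "path t w = (\<lambda>_. 0)" for t by (auto simp: path_def)
  then show ?thesis using zero_A(1) by auto
next
  case False
  \<comment> \<open>The rational times \<open>\<sigma> t n\<close> may exceed \<open>t\<close> by
    almost 1, hence the longer horizon.\<close>
  obtain m k where mk: "\<And>s. s \<in> \<rat> \<inter> {0..S + 1} \<Longrightarrow> (\<lambda>i. L s (d i) w) \<in> A m k"
    using rational_A[OF w False, of "S + 1"] by blast
  have "path t w \<in> A m k" if t: "t \<in> {0..S}" for t
  proof -
    have t0: "0 \<le> t" using t by simp
    have "(\<lambda>n. (\<lambda>i. L (\<sigma> t n) (d i) w)) \<longlonglongrightarrow> path t w"
      unfolding tendsto_sequence_iff using path_lim(2)[OF w False t0] by blast
    moreover have "(\<lambda>i. L (\<sigma> t n) (d i) w) \<in> A m k" for n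
    proof (rule mk)
      have "1 / real (Suc n) \<le> 1" by simp
      then have "\<sigma> t n \<le> S + 1" using \<sigma>(3)[of t n] t unfolding atLeastAtMost_iff by linarith
      then show "\<sigma> t n \<in> \<rat> \<inter> {0..S + 1}" using \<sigma>(1,2)[of t n] t by auto
    qed
    ultimately show ?thesis
      using closed_sequentially[OF closed_A, of "\<lambda>n i. L (\<sigma> t n) (d i) w" m k "path t w"] by simp
  qed
  then show ?thesis by blast
qed

lemma path_A: "\<exists>m. path t w \<in> A m m"
proof (cases "w \<in> space M \<and> 0 \<le> t")
  case True
  then obtain m k where "\<forall>u\<in>{0..t}. path u w \<in> A m k" using path_A_local[of w t] by blast
  then have "path t w \<in> A m k" using True by simp
  then show ?thesis using A_mono[of m "max m k" k "max m k"] by auto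
next
  case False
  then have "path t w = (\<lambda>_. 0)" by (auto simp: path_def fun_eq_iff)
  then show ?thesis using zero_A(1) by auto
qed

text \<open>For \<open>s\<close> slightly to the right of \<open>t\<close> the rational times
  \<open>\<sigma> s n\<close> also end up between \<open>t\<close> and \<open>t + \<delta>\<close>,
  so the limit at \<open>s\<close> inherits the closeness to \<open>path t w i\<close>.\<close>

lemma path_coordinate_right:
  assumes w: "w \<in> space M" and t: "0 \<le> t"
  shows "((\<lambda>s. path s w i) \<longlongrightarrow> path t w i) (at_right t)"
proof (cases "w \<in> N0")
  case True
  then show ?thesis by (simp add: path_def)
next
  case False
  show ?thesis
  proof (rule tendstoI)
    fix e :: real assume e: "e > 0"
    have "\<forall>\<^sub>F s in at t within \<rat> \<inter> {t<..}. dist (L s (d i) w) (path t w i) < e / 2"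
      using e by (intro tendstoD[OF path_lim(1)[OF w False t]]) auto
    then obtain \<delta> where \<delta>: "\<delta> > 0"
      "\<And>s. s \<in> \<rat> \<Longrightarrow> t < s \<Longrightarrow> s < t + \<delta> \<Longrightarrow> dist (L s (d i) w) (path t w i) < e / 2"
      unfolding eventually_at by (auto simp: dist_real_def)
    have "dist (path s w i) (path t w i) < e" if s: "t < s" "s < t + \<delta>" for s
    proof -
      have "(\<lambda>n. dist (L (\<sigma> s n) (d i) w) (path t w i)) \<longlonglongrightarrow> dist (path s w i) (path t w i)"
        using s t by (intro tendsto_dist path_lim(2)[OF w False] tendsto_const) auto
      moreover have "\<forall>\<^sub>F n in sequentially. dist (L (\<sigma> s n) (d i) w) (path t w i) \<le> e / 2"
      proof -
        have "\<forall>\<^sub>F n in sequentially. 1 / real (Suc n) < t + \<delta> - s"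
          using LIMSEQ_inverse_real_of_nat s(2) by (intro order_tendstoD(2)[where y="0"]) (simp_all add: divide_inverse)
        then show ?thesis
        proof eventually_elim
          case (elim n)
          have "\<sigma> s n < t + \<delta>" "t < \<sigma> s n" using \<sigma>[of s n] elim s by linarith+
          then show ?case using \<delta>(2)[OF \<sigma>(1)] by (simp add: less_imp_le)
        qed
      qed
      ultimately have "dist (path s w i) (path t w i) \<le> e / 2" by (rule tendsto_upperbound) simp
      then show ?thesis using e by linarith
    qed
    then show "\<forall>\<^sub>F s in at_right t. dist (path s w i) (path t w i) < e"
      unfolding eventually_at using \<delta>(1) by (intro exI[of _ \<delta>]) (auto simp: dist_real_def)
  qed
qed

lemma path_coordinate_left:
  assumes w: "w \<in> space M" and t: "0 < t"
  shows "\<exists>l. ((\<lambda>s. path s w i) \<longlongrightarrow> l) (at_left t)"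
proof (cases "w \<in> N0")
  case True
  then show ?thesis by (auto simp: path_def)
next
  case False
  obtain l where l: "((\<lambda>s. L s (d i) w) \<longlongrightarrow> l) (at t within \<rat> \<inter> {0<..<t})"
    using N0(2)[OF w False] t unfolding good_def by blast
  have "((\<lambda>s. path s w i) \<longlongrightarrow> l) (at_left t)"
  proof (rule tendstoI)
    fix e :: real assume e: "e > 0"
    have "\<forall>\<^sub>F s in at t within \<rat> \<inter> {0<..<t}. dist (L s (d i) w) l < e / 2"
      using e by (intro tendstoD[OF l]) auto
    then obtain \<delta>' where \<delta>': "\<delta>' > 0"
      "\<And>s. s \<in> \<rat> \<Longrightarrow> 0 < s \<Longrightarrow> s < t \<Longrightarrow> t - \<delta>' < s \<Longrightarrow> dist (L s (d i) w) l < e / 2"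
      unfolding eventually_at by (auto simp: dist_real_def)
    \<comment> \<open>The left limits are taken along positive rationals; the minimum with
      \<open>t\<close> keeps \<open>s\<close> positive.\<close>
    define \<delta> where "\<delta> = min \<delta>' t"
    have \<delta>: "\<delta> > 0" "\<delta> \<le> \<delta>'" "\<delta> \<le> t" using \<delta>'(1) t by (auto simp: \<delta>_def)
    have "dist (path s w i) l < e" if s: "s < t" "t - \<delta> < s" for s
    proof -
      have s0: "0 < s" using s \<delta> by linarith
      have "(\<lambda>n. dist (L (\<sigma> s n) (d i) w) l) \<longlonglongrightarrow> dist (path s w i) l"
        using s0 by (intro tendsto_dist path_lim(2)[OF w False] tendsto_const) auto
      moreover have "\<forall>\<^sub>F n in sequentially. dist (L (\<sigma> s n) (d i) w) l \<le> e / 2"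
      proof -
        have "\<forall>\<^sub>F n in sequentially. 1 / real (Suc n) < t - s"
          using LIMSEQ_inverse_real_of_nat s(1) by (intro order_tendstoD(2)[where y="0"]) (simp_all add: divide_inverse)
        then show ?thesis
        proof eventually_elim
          case (elim n)
          have "\<sigma> s n < t" "t - \<delta>' < \<sigma> s n" "0 < \<sigma> s n" using \<sigma>[of s n] elim s \<delta> s0 by linarith+
          then show ?case using \<delta>'(2)[OF \<sigma>(1)] by (simp add: less_imp_le)
        qed
      qed
      ultimately have "dist (path s w i) l \<le> e / 2" by (rule tendsto_upperbound) simp
      then show ?thesis using e by linarith
    qed
    then show "\<forall>\<^sub>F s in at_left t. dist (path s w i) l < e"
      unfolding eventually_at using \<delta>(1) by (intro exI[of _ \<delta>]) (auto simp: dist_real_def)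
  qed
  then show ?thesis by blast
qed

text \<open>On a bounded time set the path stays in one \<open>A m k\<close>, where \<open>F\<close>
  is continuous, so coordinatewise limits become limits in \<open>X\<close>. It is applied with
  \<open>\<Psi>\<close> and with \<open>\<Psi>\<close> followed by \<open>ext\<close>.\<close>

lemma path_limitin:
  assumes X: "\<And>m k. continuous_map (top_of_set (A m k)) X F"
  shows "w \<in> space M \<Longrightarrow> cadlag_path X (\<lambda>t. F (path t w))"
proof -
  assume w: "w \<in> space M"
  have step: "limitin X (\<lambda>s. F (path s w)) (F l) G"
    if l: "((\<lambda>s. path s w) \<longlongrightarrow> l) G" and ev: "\<forall>\<^sub>F s in G. s \<in> {0..S}" and G: "G \<noteq> bot" for l G S
  proof -
    obtain m k where mk: "\<And>s. s \<in> {0..S} \<Longrightarrow> path s w \<in> A m k" using path_A_local[OF w] by blast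
    have evA: "\<forall>\<^sub>F s in G. path s w \<in> A m k" using ev by eventually_elim (rule mk)
    \<comment> \<open>A left limit need not be a value of the path; that it lies in the same set is
      due to closedness.\<close>
    then have "l \<in> A m k" using Lim_in_closed_set[OF closed_A _ G l] by blast
    then have "limitin (top_of_set (A m k)) (\<lambda>s. path s w) l G"
      using l evA by (simp add: limitin_subtopology)
    from continuous_map_limit[OF X this] show ?thesis by (simp add: o_def)
  qed
  show "cadlag_path X (\<lambda>t. F (path t w))"
    unfolding cadlag_path_def
  proof (intro conjI allI impI)
    fix t :: real assume t: "0 \<le> t"
    show "limitin X (\<lambda>t. F (path t w)) (F (path t w)) (at_right t)"
    proof (rule step[of "path t w" "at_right t" "t + 1"])
      show "((\<lambda>s. path s w) \<longlongrightarrow> path t w) (at_right t)"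
        unfolding tendsto_sequence_iff using path_coordinate_right[OF w t] by blast
      show "\<forall>\<^sub>F s in at_right t. s \<in> {0..t + 1}"
      proof -
        have "\<forall>\<^sub>F s in at_right t. s \<in> {t<..<t + 1}" by (rule eventually_at_right_real) simp
        then show ?thesis by eventually_elim (use t in auto)
      qed
    qed simp
  next
    fix t :: real assume t: "0 < t"
    have "\<forall>i. \<exists>l. ((\<lambda>s. path s w i) \<longlongrightarrow> l) (at_left t)" using path_coordinate_left[OF w t] by blast
    then obtain l where l: "\<And>i. ((\<lambda>s. path s w i) \<longlongrightarrow> l i) (at_left t)" by metis
    have "limitin X (\<lambda>t. F (path t w)) (F l) (at_left t)"
    proof (rule step[of l "at_left t" t])
      show "((\<lambda>s. path s w) \<longlongrightarrow> l) (at_left t)" unfolding tendsto_sequence_iff using l by blast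
      show "\<forall>\<^sub>F s in at_left t. s \<in> {0..t}"
        using eventually_at_left_real[OF t] by (auto elim!: eventually_mono)
    qed simp
    then show "\<exists>l. limitin X (\<lambda>t. F (path t w)) l (at_left t)" by blast
  qed
qed

text \<open>A general \<phi> is approximated by \<open>d (idx \<phi> n)\<close>. The values of
  \<open>L t\<close> there tend to \<open>\<Psi> (path t w) \<phi>\<close> almost surely, and to
  \<open>L t \<phi>\<close> in probability by the Minlos estimate for the difference vector.\<close>

lemma version_\<Psi>:
  assumes t: "0 \<le> t" shows "AE w in M. \<Psi> (path t w) \<phi> = L t \<phi> w"
proof -
  have m1: "(\<lambda>w. \<Psi> (path t w) \<phi>) \<in> borel_measurable M"
    unfolding \<Psi>_def using t by (intro borel_measurable_lim_metric path_measurable)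
  show ?thesis
  proof (rule AE_limits_agree[where X="\<lambda>n. L t (d (idx \<phi> n))", OF _ m1])
    have "AE w in M. \<forall>i. path t w i = L t (d i) w"
      by (subst AE_all_countable) (blast intro: path_eq_L[OF t])
    then show "AE w in M. (\<lambda>n. L t (d (idx \<phi> n)) w) \<longlonglongrightarrow> \<Psi> (path t w) \<phi>"
      using AE_space
    proof eventually_elim
      case (elim w)
      obtain m where m: "path t w \<in> A m m" using path_A by blast
      have "(\<lambda>n. path t w (idx \<phi> n)) \<longlonglongrightarrow> \<Psi> (path t w) \<phi>" by (rule \<Psi>_limit[OF m])
      then show ?case using elim(1) by simp
    qed
    fix \<epsilon> :: real assume \<epsilon>: "0 < \<epsilon>"
    show "(\<lambda>n. prob {w \<in> space M. \<epsilon> < \<bar>L t (d (idx \<phi> n)) w - L t \<phi> w\<bar>}) \<longlonglongrightarrow> 0"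
    proof (rule order_tendstoI)
      fix a :: real assume "a < 0"
      then show "\<forall>\<^sub>F n in sequentially. a < prob {w \<in> space M. \<epsilon> < \<bar>L t (d (idx \<phi> n)) w - L t \<phi> w\<bar>}"
        by (intro always_eventually allI less_le_trans[OF _ measure_nonneg])
    next
      fix a :: real assume a: "0 < a"
      have "(\<lambda>k. (1 / 2 :: real) ^ k) \<longlonglongrightarrow> 0" by (intro LIMSEQ_realpow_zero) auto
      then have "\<forall>\<^sub>F k in sequentially. (1 / 2 :: real) ^ k < a" using a by (rule order_tendstoD)
      then obtain k0 where k0: "\<And>k. k \<ge> k0 \<Longrightarrow> (1 / 2 :: real) ^ k < a" unfolding eventually_sequentially by blast
      \<comment> \<open>Large enough both to make the Minlos probability less than \<open>a\<close>
        and to have \<open>t\<close> within the horizon.\<close>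
      define k where "k = max k0 (nat \<lceil>t\<rceil>)"
      have tk: "t \<le> real k" unfolding k_def by linarith
      have ka: "4 * (1 / 2) ^ (k + 3) < a"
      proof -
        have "(1 / 2 :: real) ^ k < a" using k0 by (simp add: k_def)
        moreover have "4 * (1 / 2 :: real) ^ (k + 3) \<le> (1 / 2) ^ k" by (simp add: power_add power3_eq_cube)
        ultimately show ?thesis by linarith
      qed
      have "(\<lambda>n. R k * (2 * (1 / real (Suc n)))) \<longlonglongrightarrow> R k * (2 * 0)"
        using LIMSEQ_inverse_real_of_nat by (intro tendsto_intros) (simp add: divide_inverse)
      then have "\<forall>\<^sub>F n in sequentially. R k * (2 * (1 / real (Suc n))) < \<epsilon>"
        by (rule order_tendstoD(2)) (use \<epsilon> in simp)
      then show "\<forall>\<^sub>F n in sequentially. prob {w \<in> space M. \<epsilon> < \<bar>L t (d (idx \<phi> n)) w - L t \<phi> w\<bar>} < a"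
        using eventually_ge_at_top[of "Suc k"]
      proof eventually_elim
        case (elim n)
        define y where "y = d (idx \<phi> n) - \<phi>"
        have [measurable]: "L t \<psi> \<in> borel_measurable M" for \<psi> using t by simp
        \<comment> \<open>As \<open>n\<close> is at least \<open>Suc k\<close>, the approximation
          chosen in the n-th semi-norm is as good in \<open>q (Suc k)\<close>.\<close>
        have qy: "q (Suc k) y \<le> 1 / real (Suc n)"
          using idx[of n \<phi>] q_mono[OF elim(2), of "\<phi> - d (idx \<phi> n)"] seminormD(7)[OF sq, of "Suc k"]
          unfolding y_def by (metis less_imp_le order_trans)
        have "prob {w \<in> space M. \<epsilon> < \<bar>L t (d (idx \<phi> n)) w - L t \<phi> w\<bar>} \<le>
            prob {w \<in> space M. \<exists>x\<in>{y}. R k * (q (Suc k) x + 1 / real (Suc n)) < \<bar>L t x w\<bar>}"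
        proof (rule finite_measure_mono_AE)
          have "R k * (q (Suc k) y + 1 / real (Suc n)) \<le> R k * (2 * (1 / real (Suc n)))"
            using qy R_pos[of k] by (intro mult_left_mono) auto
          then have Ry: "R k * (q (Suc k) y + 1 / real (Suc n)) < \<epsilon>" using elim(1) by linarith
          have "AE w in M. L t y w = L t (d (idx \<phi> n)) w - L t \<phi> w"
            unfolding y_def by (rule cylindrical_rv_diff[OF cyl[OF t]])
          then show "AE w in M. w \<in> {w \<in> space M. \<epsilon> < \<bar>L t (d (idx \<phi> n)) w - L t \<phi> w\<bar>} \<longrightarrow>
              w \<in> {w \<in> space M. \<exists>x\<in>{y}. R k * (q (Suc k) x + 1 / real (Suc n)) < \<bar>L t x w\<bar>}"
            by eventually_elim (use Ry in auto)
        qed measurable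
        also have "\<dots> \<le> 4 * (1 / 2) ^ (k + 3)" by (rule minlos_L[OF t tk]) auto
        finally show ?case using ka by linarith
      qed
    qed
  qed (use t in auto)
qed

end

section \<open>Laws of the regularized process\<close>

lemma space_borel_of [simp]: "space (borel_of X) = topspace X"
  by (simp add: borel_of_def space_measure_of_conv)

lemma sets_borel_of: "sets (borel_of X) = sigma_sets (topspace X) {U. openin X U}"
  unfolding borel_of_def by (rule sets_measure_of) (auto dest: openin_subset)

lemma openin_sets_borel_of: "openin X U \<Longrightarrow> U \<in> sets (borel_of X)"
  unfolding sets_borel_of by blast

lemma closedin_sets_borel_of: "closedin X K \<Longrightarrow> K \<in> sets (borel_of X)"
proof -
  assume K: "closedin X K"
  then have "topspace X - K \<in> sets (borel_of X)" by (intro openin_sets_borel_of) (simp add: closedin_def)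
  then have "topspace X - (topspace X - K) \<in> sets (borel_of X)" by (metis sets.compl_sets space_borel_of)
  then show ?thesis using closedin_subset[OF K] by (simp add: double_diff)
qed

lemma continuous_map_borel_measurable:
  fixes h :: "'b \<Rightarrow> real"
  assumes "continuous_map X euclideanreal h"
  shows "h \<in> borel_measurable (borel_of X)"
proof (rule borel_measurableI)
  fix S :: "real set" assume "open S"
  then have "openin X {x \<in> topspace X. h x \<in> S}" using assms by (intro openin_continuous_map_preimage) auto
  moreover have "h -` S \<inter> space (borel_of X) = {x \<in> topspace X. h x \<in> S}" by auto
  ultimately show "h -` S \<inter> space (borel_of X) \<in> sets (borel_of X)" by (simp add: openin_sets_borel_of)
qed

context dual_frame
begin

text \<open>A countable union of closed sets in the Polish space of real sequences, hence a Borel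
  set that contains all values of \<open>path\<close>.\<close>

definition AA :: "(nat \<Rightarrow> real) set" where "AA = (\<Union>m. A m m)"

lemma AA_borel: "AA \<in> sets borel"
  unfolding AA_def using closed_A by (intro sets.countable_UN) auto

lemma A_AA: "A m k \<subseteq> AA"
  using A_mono[of m "max m k" k "max m k"] by (auto simp: AA_def)

text \<open>The preimage of an open set is relatively open in each \<open>A m m\<close>, hence a
  countable union of Borel sets. No countable base of \<open>X\<close> enters.\<close>

lemma frame_measurable:
  assumes X: "\<And>m. continuous_map (top_of_set (A m m)) X F"
  shows "F \<in> measurable (restrict_space borel AA) (borel_of X)"
  unfolding borel_of_def
proof (rule measurable_measure_of)
  show "{U. openin X U} \<subseteq> Pow (topspace X)" by (auto dest: openin_subset)
  show "F \<in> space (restrict_space borel AA) \<rightarrow> topspace X"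
    using continuous_map_funspace[OF X] by (auto simp: space_restrict_space AA_def)
  fix U assume "U \<in> {U. openin X U}"
  then have op: "openin (top_of_set (A m m)) {x \<in> A m m. F x \<in> U}" for m
    using openin_continuous_map_preimage[OF X, of U m] by simp
  have "{x \<in> A m m. F x \<in> U} \<in> sets borel" for m
  proof -
    obtain V where "open V" "{x \<in> A m m. F x \<in> U} = A m m \<inter> V" using op[of m] unfolding openin_open by blast
    then show ?thesis using closed_A[of m m] by simp
  qed
  then have "(\<Union>m. {x \<in> A m m. F x \<in> U}) \<in> sets borel" by blast
  moreover have "F -` U \<inter> space (restrict_space borel AA) = (\<Union>m. {x \<in> A m m. F x \<in> U})"
    by (auto simp: space_restrict_space AA_def)
  ultimately show "F -` U \<inter> space (restrict_space borel AA) \<in> sets (restrict_space borel AA)"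
    by (auto simp: sets_restrict_space AA_def intro!: image_eqI[where x="\<Union>m. {x \<in> A m m. F x \<in> U}"])
qed

lemma AA_diff:
  assumes "a \<in> AA" "b \<in> AA"
  shows "(\<lambda>i. a i - b i) \<in> AA" "\<Psi> (\<lambda>i. a i - b i) = (\<lambda>x. \<Psi> a x - \<Psi> b x)"
proof -
  obtain m m' where ab: "a \<in> A m m" "b \<in> A m' m'" using assms by (auto simp: AA_def)
  show "(\<lambda>i. a i - b i) \<in> AA" using \<Psi>_diff(1)[OF ab] A_AA by blast
  show "\<Psi> (\<lambda>i. a i - b i) = (\<lambda>x. \<Psi> a x - \<Psi> b x)" using \<Psi>_diff(2)[OF ab] by blast
qed

end

lemma sets_seq_borel: "sets (Pi\<^sub>M UNIV (\<lambda>_::nat. borel :: real measure)) = sets (borel :: (nat \<Rightarrow> real) measure)"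
  by (rule sets_PiM_equal_borel)

context levy_frame
begin

lemma path_AA: "path t w \<in> AA" using path_A by (auto simp: AA_def)

lemma path_borel: "0 \<le> t \<Longrightarrow> path t \<in> measurable M borel"
  by (rule measurable_coordinatewise_then_product) (rule path_measurable)

lemma diff_borel:
  assumes "0 \<le> s" "0 \<le> t"
  shows "(\<lambda>w i. path t w i - path s w i) \<in> measurable M borel"
  using assms by (intro measurable_coordinatewise_then_product borel_measurable_diff path_measurable)

lemma AE_path: "0 \<le> t \<Longrightarrow> AE w in M. \<forall>i. path t w i = L t (d i) w"
  by (subst AE_all_countable) (blast intro: path_eq_L)

section \<open>Independence and stationarity of the coded increments\<close>

definition cylinder :: "nat \<Rightarrow> nat set \<Rightarrow> (nat \<Rightarrow> real set) \<Rightarrow> (nat \<Rightarrow> real) set" where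
  "cylinder n J B = {f \<in> space (vecM n). \<forall>i\<in>J. f i \<in> B i}"

lemma cylinder_sets:
  assumes "finite J" "J \<subseteq> {..<n}" "\<And>i. i \<in> J \<Longrightarrow> B i \<in> sets borel"
  shows "cylinder n J B \<in> sets (vecM n)"
proof -
  have "{f \<in> space (vecM n). f i \<in> B i} \<in> sets (vecM n)" if "i \<in> J" for i
  proof -
    have "(\<lambda>f. f i) -` B i \<inter> space (vecM n) \<in> sets (vecM n)"
      using that assms by (intro measurable_sets[OF measurable_component_singleton]) auto
    moreover have "(\<lambda>f. f i) -` B i \<inter> space (vecM n) = {f \<in> space (vecM n). f i \<in> B i}" by auto
    ultimately show ?thesis by simp
  qed
  then show ?thesis unfolding cylinder_def using assms(1) by (intro sets.sets_Collect_finite_All) auto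
qed

lemma incr_cylinder:
  assumes \<tau>: "0 \<le> \<tau> (Suc j)" "0 \<le> \<tau> j" and J: "J \<subseteq> {..<n}"
  shows "AE w in M. (w \<in> {w \<in> space M. \<forall>i\<in>J. path (\<tau> (Suc j)) w i - path (\<tau> j) w i \<in> B i}) =
    (w \<in> incr n d \<tau> j -` cylinder n J B \<inter> space M)"
  using AE_path[OF \<tau>(1)] AE_path[OF \<tau>(2)]
proof eventually_elim
  case (elim w)
  have "incr n d \<tau> j w \<in> space (vecM n)" by (simp add: incr_def fun_diff_def space_PiM)
  moreover have "incr n d \<tau> j w i = path (\<tau> (Suc j)) w i - path (\<tau> j) w i" if "i \<in> J" for i
    using that J elim by (auto simp: incr_def fun_diff_def vec_def)
  ultimately show ?case by (auto simp: cylinder_def)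
qed

text \<open>The hypothesis gives independence for finitely many coordinates. Cylinder sets are
  stable under intersection and generate the Borel sets of the sequence space, so this extends to
  whole sequences.\<close>

lemma path_increments_indep:
  assumes \<tau>: "0 \<le> \<tau> 0" "\<forall>j<k. \<tau> j < \<tau> (Suc j)"
  shows "indep_vars (\<lambda>_. borel) (\<lambda>j w i. path (\<tau> (Suc j)) w i - path (\<tau> j) w i) {..<k}"
proof -
  have mono: "i < j \<Longrightarrow> j \<le> k \<Longrightarrow> \<tau> i < \<tau> j" for i j
  proof (induction j)
    case (Suc j)
    then show ?case using \<tau>(2) by (cases "i = j") (auto intro: less_trans)
  qed simp
  then have \<tau>m: "\<forall>i j. i < j \<longrightarrow> j \<le> k \<longrightarrow> \<tau> i < \<tau> j" by blast
  have \<tau>0: "0 \<le> \<tau> j" if "j \<le> k" for j using mono[of 0 j] \<tau>(1) that by (cases "j = 0") auto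
  define X where "X j w = (\<lambda>i. path (\<tau> (Suc j)) w i - path (\<tau> j) w i)" for j w
  define G where "G = prod_algebra UNIV (\<lambda>_::nat. borel :: real measure)"
  have Xm: "X j \<in> measurable M borel" if "j < k" for j
    unfolding X_def using that \<tau>0 by (intro diff_borel) auto
  have sG: "sets (borel :: (nat \<Rightarrow> real) measure) = sigma_sets UNIV G"
    unfolding sets_seq_borel[symmetric] sets_PiM G_def by simp
  have eq: "{X j -` S \<inter> space M | S. S \<in> sets borel} = sigma_sets (space M) {X j -` S \<inter> space M | S. S \<in> G}" for j
    unfolding sG by (rule sigma_sets_vimage_commute) simp
  have "indep_sets (\<lambda>j. sigma_sets (space M) {X j -` S \<inter> space M | S. S \<in> G}) {..<k}"
  proof (rule indep_sets_sigma)
    show "Int_stable {X j -` S \<inter> space M | S. S \<in> G}" for j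
      unfolding Int_stable_def
    proof (intro ballI)
      fix a b assume "a \<in> {X j -` S \<inter> space M | S. S \<in> G}" "b \<in> {X j -` S \<inter> space M | S. S \<in> G}"
      then obtain S S' where S: "a = X j -` S \<inter> space M" "b = X j -` S' \<inter> space M" "S \<in> G" "S' \<in> G" by blast
      have "S \<inter> S' \<in> G" using Int_stable_prod_algebra S(3,4) unfolding G_def Int_stable_def by blast
      moreover have "a \<inter> b = X j -` (S \<inter> S') \<inter> space M" using S by auto
      ultimately show "a \<inter> b \<in> {X j -` S \<inter> space M | S. S \<in> G}" by blast
    qed
    show "indep_sets (\<lambda>j. {X j -` S \<inter> space M | S. S \<in> G}) {..<k}"
    proof (rule indep_setsI)
      fix j assume j: "j \<in> {..<k}"
      show "{X j -` S \<inter> space M | S. S \<in> G} \<subseteq> events"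
      proof
        fix a assume "a \<in> {X j -` S \<inter> space M | S. S \<in> G}"
        then obtain S where S: "a = X j -` S \<inter> space M" "S \<in> G" by blast
        have "S \<in> sets borel" unfolding sG using S(2) by blast
        then show "a \<in> events" unfolding S(1) using Xm j by (intro measurable_sets) auto
      qed
    next
      fix E J assume J: "J \<noteq> {}" "J \<subseteq> {..<k}" "finite J" and E: "\<forall>j\<in>J. E j \<in> {X j -` S \<inter> space M | S. S \<in> G}"
      have "\<forall>j\<in>J. \<exists>K B. finite K \<and> (\<forall>i\<in>K. B i \<in> sets borel) \<and> E j = {w \<in> space M. \<forall>i\<in>K. X j w i \<in> B i}"
      proof
        fix j assume "j \<in> J"
        then obtain S where S: "E j = X j -` S \<inter> space M" "S \<in> G" using E by blast
        obtain K B where KB: "S = prod_emb UNIV (\<lambda>_. borel) K (\<Pi>\<^sub>E i\<in>K. B i)" "finite K" "\<And>i. i \<in> K \<Longrightarrow> B i \<in> sets (borel :: real measure)"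
          using S(2) unfolding G_def by (rule prod_algebraE) blast
        have "E j = {w \<in> space M. \<forall>i\<in>K. X j w i \<in> B i}"
          unfolding S(1) KB(1) by (auto simp: prod_emb_def restrict_PiE_iff)
        then show "\<exists>K B. finite K \<and> (\<forall>i\<in>K. B i \<in> sets borel) \<and> E j = {w \<in> space M. \<forall>i\<in>K. X j w i \<in> B i}"
          using KB(2,3) by blast
      qed
      then obtain K where "\<forall>j\<in>J. \<exists>B. finite (K j) \<and> (\<forall>i\<in>K j. B i \<in> sets borel) \<and> E j = {w \<in> space M. \<forall>i\<in>K j. X j w i \<in> B i}"
        by (rule bchoice[THEN exE])
      then obtain B where KB: "\<And>j. j \<in> J \<Longrightarrow> finite (K j) \<and> (\<forall>i\<in>K j. B j i \<in> sets (borel :: real measure)) \<and> E j = {w \<in> space M. \<forall>i\<in>K j. X j w i \<in> B j i}"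
        by (rule bchoice[THEN exE]) blast
      \<comment> \<open>All cylinders in play fit into the same R^n; the successor also makes
        \<open>n\<close> at least 1, as \<open>indep_incr\<close> demands.\<close>
      define n where "n = Suc (Max (insert 0 (\<Union>j\<in>J. K j)))"
      have Kn: "K j \<subseteq> {..<n}" if j: "j \<in> J" for j
      proof
        fix i assume "i \<in> K j"
        then have "i \<le> Max (insert 0 (\<Union>j\<in>J. K j))" using KB J(3) j by (intro Max_ge) auto
        then show "i \<in> {..<n}" by (simp add: n_def)
      qed
      have n1: "1 \<le> n" by (simp add: n_def)
      define V where "V j = incr n d \<tau> j -` cylinder n (K j) (B j) \<inter> space M" for j
      have ind: "indep_vars (\<lambda>_. vecM n) (incr n d \<tau>) {..<k}" by (rule indep_incr[OF n1 \<tau>(1) \<tau>m])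
      have cs: "cylinder n (K j) (B j) \<in> sets (vecM n)" if "j \<in> J" for j
        using KB[OF that] Kn[OF that] by (intro cylinder_sets) auto
      have Vm: "V j \<in> events" if "j \<in> J" for j
        unfolding V_def using ind that J(2) cs[OF that] by (intro measurable_sets[where A="vecM n"]) (auto simp: indep_vars_def)
      have Em: "E j \<in> events" if j: "j \<in> J" for j
      proof -
        have jk: "j < k" using J(2) j by auto
        have "(\<lambda>w. X j w i) \<in> borel_measurable M" for i
          unfolding X_def using jk \<tau>0 by (intro borel_measurable_diff path_measurable) auto
        then have "(\<lambda>w. X j w i) -` B j i \<inter> space M \<in> events" if "i \<in> K j" for i
          using KB[OF j] that by (intro measurable_sets) auto
        then have "{w \<in> space M. X j w i \<in> B j i} \<in> events" if "i \<in> K j" for i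
          using that by (simp add: vimage_def Int_def conj_commute)
        then show ?thesis using KB[OF j] by (auto intro!: sets.sets_Collect_finite_All)
      qed
      \<comment> \<open>Paths and \<open>L\<close> agree only almost surely at each time, so the two
        events are equal up to a null set.\<close>
      have EV: "AE w in M. (w \<in> E j) = (w \<in> V j)" if j: "j \<in> J" for j
      proof -
        have "j < k" using J(2) j by auto
        then have "0 \<le> \<tau> (Suc j)" "0 \<le> \<tau> j" by (auto intro: \<tau>0)
        from incr_cylinder[OF this Kn[OF j], of "B j"] show ?thesis
          using KB[OF j] unfolding V_def X_def by simp
      qed
      have "AE w in M. \<forall>j\<in>J. (w \<in> E j) = (w \<in> V j)" by (rule AE_finite_allI[OF J(3)]) (rule EV)
      then have "prob (\<Inter>j\<in>J. E j) = prob (\<Inter>j\<in>J. V j)"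
        using J Em Vm by (intro finite_measure_eq_AE) (auto elim!: AE_mp intro!: sets.finite_INT)
      also have "\<dots> = (\<Prod>j\<in>J. prob (V j))"
        unfolding V_def by (rule indep_varsD[OF ind J(1,3,2)]) (rule cs)
      also have "\<dots> = (\<Prod>j\<in>J. prob (E j))"
        by (intro prod.cong refl finite_measure_eq_AE[symmetric] EV Em Vm)
      finally show "prob (\<Inter>j\<in>J. E j) = (\<Prod>j\<in>J. prob (E j))" .
    qed
  qed
  then show ?thesis unfolding indep_vars_def2 X_def[symmetric] eq using Xm by auto
qed

text \<open>Laws on the sequence space are determined by cylinders, where stationarity in R^n
  applies after null sets are discarded.\<close>

lemma path_increments_stationary:
  assumes st: "0 \<le> s" "s \<le> t"
  shows "distr M borel (\<lambda>w i. path t w i - path s w i) = distr M borel (path (t - s))"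
proof (rule measure_eqI_PiM_infinite[where I=UNIV and M="\<lambda>_. borel"])
  let ?P = "distr M borel (\<lambda>w i. path t w i - path s w i)" and ?Q = "distr M borel (path (t - s))"
  show "sets ?P = sets (Pi\<^sub>M UNIV (\<lambda>_. borel))" "sets ?Q = sets (Pi\<^sub>M UNIV (\<lambda>_. borel))"
    by (simp_all add: sets_seq_borel)
  have dm: "(\<lambda>w i. path t w i - path s w i) \<in> measurable M borel" using st by (intro diff_borel) auto
  have pm: "path (t - s) \<in> measurable M borel" using st by (intro path_borel) auto
  show "finite_measure ?P" using prob_space_distr[OF dm] by (simp add: prob_space_def)
  fix B J assume J: "finite J" "J \<subseteq> (UNIV :: nat set)" and B: "\<And>i. i \<in> J \<Longrightarrow> B i \<in> sets (borel :: real measure)"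
  define S where "S = prod_emb UNIV (\<lambda>_. borel :: real measure) J (Pi\<^sub>E J B)"
  have Seq: "f \<in> S \<longleftrightarrow> (\<forall>i\<in>J. f i \<in> B i)" for f by (auto simp: S_def prod_emb_def restrict_PiE_iff)
  have Ss: "S \<in> sets borel" unfolding sets_seq_borel[symmetric] S_def by (rule sets_PiM_I[OF J]) (simp add: B)
  define n where "n = Suc (Max (insert 0 J))"
  have n: "1 \<le> n" "J \<subseteq> {..<n}" using J(1) by (auto simp: n_def less_Suc_eq_le)
  have cs: "cylinder n J B \<in> sets (vecM n)" by (rule cylinder_sets[OF J(1) n(2) B])
  have fm: "(\<lambda>w. fun_diff {..<n} (vec n d t w) (vec n d s w)) \<in> measurable M (vecM n)"
    unfolding fun_diff_def using st by (intro measurable_restrict) (simp add: vec_def)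
  have vm: "vec n d (t - s) \<in> measurable M (vecM n)" using st by (intro vec_measurable) simp
  have dd: "distr M (vecM n) (\<lambda>w. fun_diff {..<n} (vec n d t w) (vec n d s w)) = distr M (vecM n) (vec n d (t - s))"
    using levy_Rn[OF n(1), of d] st unfolding levy_process_Rn_def stationary_increments_def Let_def by blast
  have "emeasure ?P S = emeasure M ((\<lambda>w i. path t w i - path s w i) -` S \<inter> space M)" by (rule emeasure_distr[OF dm Ss])
  also have "\<dots> = emeasure M ((\<lambda>w. fun_diff {..<n} (vec n d t w) (vec n d s w)) -` cylinder n J B \<inter> space M)"
  proof (rule emeasure_eq_AE)
    show "AE w in M. (w \<in> (\<lambda>w i. path t w i - path s w i) -` S \<inter> space M) =
        (w \<in> (\<lambda>w. fun_diff {..<n} (vec n d t w) (vec n d s w)) -` cylinder n J B \<inter> space M)"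
      using AE_path[OF order_trans[OF st]] AE_path[OF st(1)]
    proof eventually_elim
      case (elim w)
      have "fun_diff {..<n} (vec n d t w) (vec n d s w) i = path t w i - path s w i" if "i \<in> J" for i
        using that n(2) elim by (auto simp: fun_diff_def vec_def)
      moreover have "fun_diff {..<n} (vec n d t w) (vec n d s w) \<in> space (vecM n)" by (simp add: fun_diff_def space_PiM)
      ultimately show ?case by (auto simp: cylinder_def Seq)
    qed
  qed (use measurable_sets[OF dm Ss] measurable_sets[OF fm cs] in auto)
  also have "\<dots> = emeasure M (vec n d (t - s) -` cylinder n J B \<inter> space M)"
    using emeasure_distr[OF fm cs] emeasure_distr[OF vm cs] dd by simp
  also have "\<dots> = emeasure M (path (t - s) -` S \<inter> space M)"
  proof (rule emeasure_eq_AE)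
    have "0 \<le> t - s" using st by simp
    from AE_path[OF this] show "AE w in M. (w \<in> vec n d (t - s) -` cylinder n J B \<inter> space M) = (w \<in> path (t - s) -` S \<inter> space M)"
    proof eventually_elim
      case (elim w)
      have "vec n d (t - s) w i = path (t - s) w i" if "i \<in> J" for i
        using that n(2) elim by (auto simp: vec_def)
      moreover have "vec n d (t - s) w \<in> space (vecM n)" by (simp add: vec_def space_PiM)
      ultimately show ?case by (auto simp: cylinder_def Seq)
    qed
  qed (use measurable_sets[OF pm Ss] measurable_sets[OF vm cs] in auto)
  also have "\<dots> = emeasure ?Q S" by (rule emeasure_distr[OF pm Ss, symmetric])
  finally show "emeasure ?P (prod_emb UNIV (\<lambda>_. borel) J (Pi\<^sub>E J B)) = emeasure ?Q (prod_emb UNIV (\<lambda>_. borel) J (Pi\<^sub>E J B))"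
    unfolding S_def .
qed

section \<open>Laws on the strong dual\<close>

lemma process_measurable:
  assumes X: "\<And>m. continuous_map (top_of_set (A m m)) X F" and t: "0 \<le> t"
  shows "(\<lambda>w. F (path t w)) \<in> measurable M (borel_of X)"
proof (rule measurable_compose[OF _ frame_measurable[OF X]])
  show "path t \<in> measurable M (restrict_space borel AA)"
    using path_borel[OF t] path_AA by (intro measurable_restrict_space2) auto
qed

lemma path_zero: "AE w in M. path 0 w = (\<lambda>_. 0)"
proof -
  have "AE w in M. \<forall>i. L 0 (d i) w = 0" by (subst AE_all_countable) (blast intro: L0)
  then show ?thesis using AE_path[OF order_refl] by eventually_elim (auto simp: fun_eq_iff)
qed

text \<open>Probability measures on the Polish sequence space are inner regular. A compact set
  inside one \<open>A m m\<close> has a compact image, because \<open>F\<close> is continuous there,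
  and the image is closed as \<open>X\<close> is Hausdorff.\<close>

lemma radon_law:
  assumes X: "\<And>m. continuous_map (top_of_set (A m m)) X F" and H: "Hausdorff_space X" and t: "0 \<le> t"
  shows "distr M (borel_of X) (\<lambda>w. F (path t w)) \<in> radon_prob X"
proof -
  let ?Y = "\<lambda>w. F (path t w)"
  let ?\<mu> = "distr M (borel_of X) ?Y"
  let ?\<nu> = "distr M borel (path t)"
  have Ym: "?Y \<in> measurable M (borel_of X)" by (rule process_measurable[OF X t])
  have pm: "path t \<in> measurable M borel" by (rule path_borel[OF t])
  interpret N: prob_space ?\<nu> by (rule prob_space_distr[OF pm])
  have "\<exists>K. compactin X K \<and> K \<in> sets ?\<mu> \<and> K \<subseteq> \<Gamma> \<and> measure ?\<mu> (\<Gamma> - K) < \<epsilon>"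
    if \<Gamma>: "\<Gamma> \<in> sets ?\<mu>" and \<epsilon>: "0 < \<epsilon>" for \<Gamma> \<epsilon>
  proof -
    have \<Gamma>X: "\<Gamma> \<in> sets (borel_of X)" using \<Gamma> by simp
    \<comment> \<open>These sets increase to the codes of \<Gamma>. Half of \<epsilon> is spent on
      the choice of \<open>m\<close>, the other half on a compact subset of
      \<open>E m\<close>.\<close>
    define E where "E m = {x \<in> A m m. F x \<in> \<Gamma>}" for m
    have Es: "E m \<in> sets borel" for m
    proof -
      have "F -` \<Gamma> \<inter> space (restrict_space borel AA) \<in> sets (restrict_space borel AA)"
        by (rule measurable_sets[OF frame_measurable[OF X] \<Gamma>X])
      then have "F -` \<Gamma> \<inter> AA \<in> sets borel"
        using AA_borel by (auto simp: sets_restrict_space space_restrict_space)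
      then have "(F -` \<Gamma> \<inter> AA) \<inter> A m m \<in> sets borel" by (rule sets.Int[OF _ borel_closed[OF closed_A]])
      moreover have "(F -` \<Gamma> \<inter> AA) \<inter> A m m = E m" using A_AA[of m m] by (auto simp: E_def)
      ultimately show ?thesis by simp
    qed
    have inc: "incseq E" unfolding incseq_def E_def using A_mono by blast
    have "(\<lambda>m. measure ?\<nu> (E m)) \<longlonglongrightarrow> measure ?\<nu> (\<Union>m. E m)"
      using Es inc by (intro N.finite_Lim_measure_incseq) auto
    then have "\<forall>\<^sub>F m in sequentially. measure ?\<nu> (\<Union>m. E m) - \<epsilon> / 2 < measure ?\<nu> (E m)"
      by (rule order_tendstoD(1)) (use \<epsilon> in simp)
    then obtain m where m: "measure ?\<nu> (\<Union>m. E m) - \<epsilon> / 2 < measure ?\<nu> (E m)"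
      unfolding eventually_sequentially by blast
    have "\<exists>K. compact K \<and> K \<subseteq> E m \<and> measure ?\<nu> (E m) - \<epsilon> / 2 < measure ?\<nu> K"
    proof (rule ccontr)
      assume neg: "\<not> ?thesis"
      define c where "c = measure ?\<nu> (E m) - \<epsilon> / 2"
      have le: "measure ?\<nu> K \<le> c" if "compact K" "K \<subseteq> E m" for K
        using neg that unfolding c_def by (meson not_less)
      have c0: "0 \<le> c" using le[of "{}"] by simp
      have "emeasure ?\<nu> (E m) = (SUP K\<in>{K. K \<subseteq> E m \<and> compact K}. emeasure ?\<nu> K)"
        by (rule inner_regular) (use Es in auto)
      also have "\<dots> \<le> ennreal c"
      proof (rule SUP_least)
        fix K assume "K \<in> {K. K \<subseteq> E m \<and> compact K}"
        then have "measure ?\<nu> K \<le> c" by (intro le) auto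
        then show "emeasure ?\<nu> K \<le> ennreal c" unfolding N.emeasure_eq_measure using c0 by (simp add: ennreal_leI)
      qed
      finally have "measure ?\<nu> (E m) \<le> c" unfolding N.emeasure_eq_measure using c0 by simp
      then show False using \<epsilon> by (simp add: c_def)
    qed
    then obtain K where K: "compact K" "K \<subseteq> E m" "measure ?\<nu> (E m) - \<epsilon> / 2 < measure ?\<nu> K" by blast
    have "compactin (top_of_set (A m m)) K"
      using K by (auto simp: compactin_subtopology E_def)
    then have cK: "compactin X (F ` K)" by (rule image_compactin[OF _ X])
    have sK: "F ` K \<in> sets (borel_of X)" by (rule closedin_sets_borel_of[OF compactin_imp_closedin[OF H cK]])
    have Ks: "K \<in> sets borel" using K(1) by (simp add: compact_imp_closed)
    have "measure ?\<mu> (\<Gamma> - F ` K) = prob (?Y -` (\<Gamma> - F ` K) \<inter> space M)"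
      using \<Gamma>X sK by (intro measure_distr[OF Ym]) auto
    also have "\<dots> \<le> prob (path t -` ((\<Union>m. E m) - K) \<inter> space M)"
    proof (rule finite_measure_mono)
      show "?Y -` (\<Gamma> - F ` K) \<inter> space M \<subseteq> path t -` ((\<Union>m. E m) - K) \<inter> space M"
        using path_A by (auto simp: E_def)
      show "path t -` ((\<Union>m. E m) - K) \<inter> space M \<in> events"
        using Es Ks by (intro measurable_sets[OF pm]) auto
    qed
    also have "\<dots> = measure ?\<nu> ((\<Union>m. E m) - K)"
      using Es Ks by (intro measure_distr[OF pm, symmetric]) auto
    also have "\<dots> = measure ?\<nu> (\<Union>m. E m) - measure ?\<nu> K"
      using Es Ks K(2) by (intro N.finite_measure_Diff) auto
    also have "\<dots> < \<epsilon>" using m K(3) by linarith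
    finally have "measure ?\<mu> (\<Gamma> - F ` K) < \<epsilon>" .
    moreover have "F ` K \<subseteq> \<Gamma>" using K(2) by (auto simp: E_def)
    ultimately show ?thesis using cK sK by auto
  qed
  then show ?thesis unfolding radon_prob_def using prob_space_distr[OF Ym] by auto
qed

text \<open>Paths are right-continuous at 0, so bounded continuous functions of them converge
  pointwise and dominated convergence applies.\<close>

lemma weak_continuity:
  fixes X :: "'b topology"
  assumes X: "\<And>m k. continuous_map (top_of_set (A m k)) X F"
  shows "weakly_continuous_at_0 X (\<lambda>t. distr M (borel_of X) (\<lambda>w. F (path t w)))"
  unfolding weakly_continuous_at_0_def
proof (intro allI impI)
  fix h :: "'b \<Rightarrow> real" assume h: "continuous_map X euclideanreal h \<and> bounded (h ` topspace X)"
  have hm: "h \<in> borel_measurable (borel_of X)" using h by (intro continuous_map_borel_measurable) auto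
  obtain B where B: "\<And>x. x \<in> topspace X \<Longrightarrow> \<bar>h x\<bar> \<le> B" using h unfolding bounded_iff by auto
  have Ym: "(\<lambda>w. F (path t w)) \<in> measurable M (borel_of X)" if "0 \<le> t" for t
    by (rule process_measurable[OF X that])
  have eq: "integral\<^sup>L (distr M (borel_of X) (\<lambda>w. F (path t w))) h = (\<integral>w. h (F (path t w)) \<partial>M)" if "0 \<le> t" for t
    by (rule integral_distr[OF Ym[OF that] hm])
  show "((\<lambda>t. integral\<^sup>L (distr M (borel_of X) (\<lambda>w. F (path t w))) h) \<longlongrightarrow>
      integral\<^sup>L (distr M (borel_of X) (\<lambda>w. F (path 0 w))) h) (at_right 0)"
    unfolding tendsto_at_iff_sequentially
  proof (intro allI impI)
    fix \<tau> :: "nat \<Rightarrow> real" assume \<tau>: "\<forall>i. \<tau> i \<in> {0<..} - {0}" "\<tau> \<longlonglongrightarrow> 0"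
    have \<tau>0: "0 \<le> \<tau> n" "0 < \<tau> n" for n using \<tau>(1) by (auto intro: less_imp_le)
    have fl: "filterlim \<tau> (at_right 0) sequentially"
    proof -
      have "\<tau> n \<noteq> 0" for n using \<tau>0(2)[of n] by simp
      then show ?thesis using \<tau>(2) \<tau>0(2) by (auto simp: filterlim_at)
    qed
    have "(\<lambda>n. \<integral>w. h (F (path (\<tau> n) w)) \<partial>M) \<longlonglongrightarrow> (\<integral>w. h (F (path 0 w)) \<partial>M)"
    proof (rule integral_dominated_convergence[where w="\<lambda>_. B"])
      show "(\<lambda>w. h (F (path 0 w))) \<in> borel_measurable M" by (rule measurable_compose[OF Ym hm]) simp
      show "(\<lambda>w. h (F (path (\<tau> n) w))) \<in> borel_measurable M" for n by (rule measurable_compose[OF Ym[OF \<tau>0(1)] hm])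
      show "AE w in M. (\<lambda>n. h (F (path (\<tau> n) w))) \<longlonglongrightarrow> h (F (path 0 w))"
      proof (rule AE_I2)
        fix w assume w: "w \<in> space M"
        have "limitin X (\<lambda>s. F (path s w)) (F (path 0 w)) (at_right 0)"
          using path_limitin[OF X w] unfolding cadlag_path_def by simp
        from continuous_map_limit[OF conjunct1[OF h] this]
        have "((\<lambda>s. h (F (path s w))) \<longlongrightarrow> h (F (path 0 w))) (at_right 0)" by (simp add: o_def)
        then show "(\<lambda>n. h (F (path (\<tau> n) w))) \<longlonglongrightarrow> h (F (path 0 w))" by (rule filterlim_compose[OF _ fl])
      qed
      show "AE w in M. norm (h (F (path (\<tau> n) w))) \<le> B" for n
        using measurable_space[OF Ym[OF \<tau>0(1)]] B by (intro AE_I2) simp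
    qed simp
    then show "((\<lambda>t. integral\<^sup>L (distr M (borel_of X) (\<lambda>w. F (path t w))) h) \<circ> \<tau>) \<longlonglongrightarrow>
        integral\<^sup>L (distr M (borel_of X) (\<lambda>w. F (path 0 w))) h"
      unfolding o_def eq[OF order_refl] eq[OF \<tau>0(1)] .
  qed
qed

text \<open>Differences are formed in the sequence space: by \<open>AA_diff\<close> the increment of
  the decoded process is the decoded increment. Independence and laws are then carried over by the
  measurable map \<open>\<Psi>\<close>.\<close>

lemma levy_process_\<Psi>:
  assumes P: "\<forall>r\<in>P. seminorm r" and qc: "\<And>k. continuous_map (seminorm_topology P) euclideanreal (q k)"
  shows "levy_process_dual M (seminorm_topology P) (\<lambda>t w. \<Psi> (path t w))"
proof -
  let ?X = "strong_dual (tvs_of (seminorm_topology P))"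
  have X: "continuous_map (top_of_set (A m k)) ?X \<Psi>" for m k by (rule \<Psi>_continuous[OF P qc])
  have diff: "fun_diff UNIV (\<Psi> (path t w)) (\<Psi> (path s w)) = \<Psi> (\<lambda>i. path t w i - path s w i)" for s t w
    by (simp add: fun_diff_def AA_diff(2)[OF path_AA path_AA] restrict_def)
  have inAA: "(\<lambda>i. path t w i - path s w i) \<in> AA" for s t w by (rule AA_diff(1)[OF path_AA path_AA])
  have fm: "\<Psi> \<in> measurable (restrict_space borel AA) (borel_of ?X)" by (rule frame_measurable[OF X])
  have "indep_increments M (borel_of ?X) UNIV (\<lambda>t w. \<Psi> (path t w))"
    unfolding indep_increments_def diff
  proof (intro allI impI)
    fix k and \<tau> :: "nat \<Rightarrow> real" assume \<tau>: "0 \<le> \<tau> 0 \<and> (\<forall>j<k. \<tau> j < \<tau> (Suc j))"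
    have ind: "indep_vars (\<lambda>_. borel) (\<lambda>j w i. path (\<tau> (Suc j)) w i - path (\<tau> j) w i) {..<k}"
      using \<tau> by (intro path_increments_indep) auto
    \<comment> \<open>\<open>\<Psi>\<close> is measurable only on \<open>AA\<close>, whereas
      composing independent variables asks for a map that is measurable on the whole sequence space;
      extending by zero does not change the increments, which lie in \<open>AA\<close>.\<close>
    define F where "F a = (if a \<in> AA then \<Psi> a else (\<lambda>_. 0))" for a
    have Fm: "F \<in> measurable borel (borel_of ?X)"
      unfolding F_def
    proof (rule measurable_If_restrict_space_iff[THEN iffD2])
      show "{x \<in> space borel. x \<in> AA} \<in> sets borel" using AA_borel by simp
      have "(\<lambda>_. 0) \<in> tv_dual (tvs_of (seminorm_topology P))"
        unfolding tv_dual_tvs_of[OF P] by (simp add: linear_zero)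
      then show "\<Psi> \<in> restrict_space borel {x. x \<in> AA} \<rightarrow>\<^sub>M borel_of ?X \<and>
          (\<lambda>x _. 0) \<in> restrict_space borel {x. x \<notin> AA} \<rightarrow>\<^sub>M borel_of ?X"
        using fm by simp
    qed
    have "indep_vars (\<lambda>_. borel_of ?X) (\<lambda>j w. F (\<lambda>i. path (\<tau> (Suc j)) w i - path (\<tau> j) w i)) {..<k}"
      by (rule indep_vars_compose2[OF ind]) (rule Fm)
    then show "indep_vars (\<lambda>_. borel_of ?X) (\<lambda>j w. \<Psi> (\<lambda>i. path (\<tau> (Suc j)) w i - path (\<tau> j) w i)) {..<k}"
      using inAA by (simp add: F_def)
  qed
  moreover have "stationary_increments M (borel_of ?X) UNIV (\<lambda>t w. \<Psi> (path t w))"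
    unfolding stationary_increments_def diff
  proof (intro allI impI)
    fix s t :: real assume "0 \<le> s \<and> s \<le> t"
    then have st: "0 \<le> s" "0 \<le> t" "s \<le> t" "0 \<le> t - s" by auto
    have rm: "(\<lambda>w i. path t w i - path s w i) \<in> measurable M (restrict_space borel AA)"
      using diff_borel[OF st(1,2)] inAA by (intro measurable_restrict_space2) auto
    have rp: "path (t - s) \<in> measurable M (restrict_space borel AA)"
      using path_borel[OF st(4)] path_AA by (intro measurable_restrict_space2) auto
    show "distr M (borel_of ?X) (\<lambda>w. \<Psi> (\<lambda>i. path t w i - path s w i)) = distr M (borel_of ?X) (\<lambda>w. \<Psi> (path (t - s) w))"
    proof (rule measure_eqI)
      fix S assume "S \<in> sets (distr M (borel_of ?X) (\<lambda>w. \<Psi> (\<lambda>i. path t w i - path s w i)))"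
      then have S: "S \<in> sets (borel_of ?X)" by simp
      define S' where "S' = \<Psi> -` S \<inter> AA"
      have S': "S' \<in> sets borel"
        using measurable_sets[OF fm S] AA_borel by (auto simp: S'_def sets_restrict_space space_restrict_space)
      have "emeasure (distr M (borel_of ?X) (\<lambda>w. \<Psi> (\<lambda>i. path t w i - path s w i))) S =
          emeasure M ((\<lambda>w. \<Psi> (\<lambda>i. path t w i - path s w i)) -` S \<inter> space M)"
        by (rule emeasure_distr[OF measurable_compose[OF rm fm] S])
      also have "(\<lambda>w. \<Psi> (\<lambda>i. path t w i - path s w i)) -` S \<inter> space M = (\<lambda>w i. path t w i - path s w i) -` S' \<inter> space M"
        using inAA by (auto simp: S'_def)
      also have "emeasure M \<dots> = emeasure (distr M borel (\<lambda>w i. path t w i - path s w i)) S'"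
        by (rule emeasure_distr[OF diff_borel[OF st(1,2)] S', symmetric])
      also have "\<dots> = emeasure (distr M borel (path (t - s))) S'"
        using path_increments_stationary[OF st(1,3)] by simp
      also have "\<dots> = emeasure M (path (t - s) -` S' \<inter> space M)" by (rule emeasure_distr[OF path_borel[OF st(4)] S'])
      also have "path (t - s) -` S' \<inter> space M = (\<lambda>w. \<Psi> (path (t - s) w)) -` S \<inter> space M"
        using path_AA by (auto simp: S'_def)
      also have "emeasure M \<dots> = emeasure (distr M (borel_of ?X) (\<lambda>w. \<Psi> (path (t - s) w))) S"
        by (rule emeasure_distr[OF measurable_compose[OF rp fm] S, symmetric])
      finally show "emeasure (distr M (borel_of ?X) (\<lambda>w. \<Psi> (\<lambda>i. path t w i - path s w i))) S =
          emeasure (distr M (borel_of ?X) (\<lambda>w. \<Psi> (path (t - s) w))) S" .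
    qed simp
  qed
  moreover have "random_process M (borel_of ?X) (\<lambda>t w. \<Psi> (path t w))"
    unfolding random_process_def using process_measurable[OF X] by blast
  moreover have "AE w in M. \<Psi> (path 0 w) = (\<lambda>_. 0)"
    using path_zero by eventually_elim (simp add: zero_A(2))
  moreover have "\<forall>t\<ge>0. distr M (borel_of ?X) (\<lambda>w. \<Psi> (path t w)) \<in> radon_prob ?X"
    using radon_law[OF X strong_dual_Hausdorff[OF P]] by blast
  moreover have "weakly_continuous_at_0 ?X (\<lambda>t. distr M (borel_of ?X) (\<lambda>w. \<Psi> (path t w)))"
    by (rule weak_continuity[OF X])
  ultimately show ?thesis unfolding levy_process_dual_def Let_def by blast
qed

section \<open>Uniqueness\<close>

text \<open>Since the semi-norms increase, the finite sum that bounds a continuous functional can be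
  replaced by a multiple of the last one.\<close>

lemma tv_dual_increasing_dominated:
  fixes p :: "nat \<Rightarrow> 'v \<Rightarrow> real"
  assumes p: "\<And>n. seminorm (p n)" "\<And>n x. p n x \<le> p (Suc n) x"
    and f: "f \<in> tv_dual (tvs_of (seminorm_topology (range p)))"
  shows "linear f \<and> (\<exists>K n. \<forall>x. \<bar>f x\<bar> \<le> K * p n x)"
proof -
  have P: "\<forall>r\<in>range p. seminorm r" using p(1) by blast
  obtain F C where F: "finite F" "F \<subseteq> range p" "0 \<le> C" "\<And>x. \<bar>f x\<bar> \<le> C * (\<Sum>r\<in>F. r x)"
    using tv_dual_dominated[OF P f] by blast
  obtain I where I: "finite I" "F = p ` I" using F(1,2) by (meson finite_subset_image)
  define n where "n = Max (insert 0 I)"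
  have mono: "p i x \<le> p j x" if "i \<le> j" for i j x
    using that
  proof (induction j rule: dec_induct)
    case (step j)
    then show ?case using p(2)[of j x] by linarith
  qed (rule order_refl)
  have "\<bar>f x\<bar> \<le> (C * real (card F)) * p n x" for x
  proof -
    have "r x \<le> p n x" if "r \<in> F" for r
    proof -
      obtain i where i: "i \<in> I" "r = p i" using \<open>r \<in> F\<close> I(2) by blast
      have "i \<le> n" unfolding n_def using I(1) i(1) by (intro Max_ge) auto
      then show ?thesis using mono i(2) by simp
    qed
    then have "(\<Sum>r\<in>F. r x) \<le> real (card F) * p n x" using sum_bounded_above[of F "\<lambda>r. r x"] by simp
    then have "C * (\<Sum>r\<in>F. r x) \<le> C * (real (card F) * p n x)" using F(3) by (rule mult_left_mono)
    then show ?thesis using F(4)[of x] by simp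
  qed
  moreover have "linear f" using f unfolding tv_dual_tvs_of[OF P] by blast
  ultimately show ?thesis by blast
qed

text \<open>
  At a fixed time both processes are continuous for a common countably Hilbertian topology, which is
  separable by nuclearity, so almost sure equality on a countable dense set suffices.
\<close>
lemma regular_version_unique_at:
  assumes T: "nuclear_space T" and qc: "\<And>k. continuous_map T euclideanreal (q k)"
    and Z: "regular_process M T Z" "version_of M Z L" and t: "0 \<le> t"
  shows "AE w in M. \<Psi> (path t w) = Z t w"
proof -
  obtain P where Ph: "\<And>p. p \<in> P \<Longrightarrow> hilbertian p" and TP: "T = seminorm_topology P"
    using T unfolding nuclear_space_def by blast
  have P: "\<forall>r\<in>P. seminorm r" using Ph hilbertian_seminorm by blast
  obtain \<theta>' where \<theta>': "countably_hilbertian T \<theta>'" "AE w in M. Z t w \<in> tv_dual (tvs_of \<theta>')"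
    using Z(1) t unfolding regular_process_def by blast
  obtain p where p: "\<And>n. hilbertian (p n)" "\<And>n. continuous_map T euclideanreal (p n)"
    "\<And>n x. p n x \<le> p (Suc n) x" and \<theta>p: "\<theta>' = seminorm_topology (range p)"
    using \<theta>'(1) unfolding countably_hilbertian_def by blast
  have sp: "seminorm (p n)" for n by (rule hilbertian_seminorm[OF p(1)])
  \<comment> \<open>A sum of Hilbertian semi-norms is merely a semi-norm, which is what
    \<open>nuclear_space_separable\<close> asks for. It dominates both summands, so one dense set
    serves both processes.\<close>
  define s where "s n x = q n x + p n x" for n x
  have ss: "seminorm (s n)" for n
    unfolding seminorm_def s_def
  proof (intro conjI allI)
    fix x y :: 'v and a :: real
    show "0 \<le> q n x + p n x" using seminormD(1)[OF sq, of n x] seminormD(1)[OF sp, of n x] by linarith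
    show "q n (x + y) + p n (x + y) \<le> q n x + p n x + (q n y + p n y)"
      using seminormD(2)[OF sq, of n x y] seminormD(2)[OF sp, of n x y] by linarith
    show "q n (a *\<^sub>R x) + p n (a *\<^sub>R x) = \<bar>a\<bar> * (q n x + p n x)"
      by (simp add: seminormD(3)[OF sq] seminormD(3)[OF sp] distrib_left)
  qed
  have cs: "continuous_map T euclideanreal (s n)" for n
    unfolding s_def using qc p(2) by (intro continuous_map_add)
  have "\<exists>D. countable D \<and> (\<forall>x. \<forall>\<epsilon>>0. \<exists>y\<in>D. s n (x - y) < \<epsilon>)" for n
    by (rule nuclear_space_separable[OF T ss cs])
  then obtain D where D: "\<And>n. countable (D n)" "\<And>n x \<epsilon>. 0 < \<epsilon> \<Longrightarrow> \<exists>y\<in>D n. s n (x - y) < \<epsilon>" by metis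
  have cD: "countable (\<Union>n. D n)" using D(1) by auto
  have "AE w in M. \<forall>y\<in>(\<Union>n. D n). \<Psi> (path t w) y = Z t w y"
  proof (rule iffD2[OF AE_ball_countable[OF cD]], rule ballI)
    fix y
    have "AE w in M. Z t w y = L t y w" using Z(2) t unfolding version_of_def by blast
    then show "AE w in M. \<Psi> (path t w) y = Z t w y" using version_\<Psi>[OF t, of y] by eventually_elim simp
  qed
  then show ?thesis using \<theta>'(2)
  proof eventually_elim
    case (elim w)
    obtain K n where lin: "linear (Z t w)" and K: "\<And>x. \<bar>Z t w x\<bar> \<le> K * p n x"
      using tv_dual_increasing_dominated[where p=p, OF sp p(3)] elim(2) unfolding \<theta>p by blast
    obtain m where m: "path t w \<in> A m m" using path_A by blast
    define f where "f x = \<Psi> (path t w) x - Z t w x" for x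
    define l where "l = max m n"
    have lf: "linear f" unfolding f_def using \<Psi>_linear[OF m] lin by (rule linear_compose_sub)
    have pm: "p i x \<le> p j x" if "i \<le> j" for i j x
      using that
    proof (induction j rule: dec_induct)
      case (step j)
      then show ?case using p(3)[of j x] by linarith
    qed (rule order_refl)
    have fb: "\<bar>f x\<bar> \<le> (real m + \<bar>K\<bar>) * s l x" for x
    proof -
      have nn: "0 \<le> q m x" "0 \<le> p n x" "0 \<le> q l x" "0 \<le> p l x" using seminormD(1)[OF sq] seminormD(1)[OF sp] by auto
      have "\<bar>f x\<bar> \<le> real m * q m x + K * p n x" using \<Psi>_bound[OF m, of x] K[of x] unfolding f_def by linarith
      also have "\<dots> \<le> real m * s l x + \<bar>K\<bar> * s l x"
        using q_mono[of m l x] pm[of n l x] nn by (intro add_mono mult_mono) (auto simp: l_def s_def)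
      finally show ?thesis by (simp add: distrib_right)
    qed
    have "f x = 0" for x
    proof -
      have "\<bar>f x\<bar> \<le> 0 + e" if e: "e > 0" for e
      proof -
        define \<eta> where "\<eta> = e / (real m + \<bar>K\<bar> + 1)"
        have pos: "0 < real m + \<bar>K\<bar> + 1" by (simp add: add_nonneg_pos)
        have \<eta>: "0 < \<eta>" using e pos by (simp add: \<eta>_def)
        obtain y where y: "y \<in> D l" "s l (x - y) < \<eta>" using D(2)[OF \<eta>] by blast
        have "f y = 0" using elim(1) y(1) by (auto simp: f_def)
        then have "\<bar>f x\<bar> = \<bar>f (x - y)\<bar>" by (simp add: linear_diff[OF lf])
        also have "\<dots> \<le> (real m + \<bar>K\<bar>) * \<eta>"
          using fb[of "x - y"] mult_left_mono[OF less_imp_le[OF y(2)], of "real m + \<bar>K\<bar>"] by simp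
        also have "\<dots> \<le> (real m + \<bar>K\<bar> + 1) * \<eta>" using \<eta> by simp
        also have "\<dots> = e" unfolding \<eta>_def using pos by simp
        finally show ?thesis by simp
      qed
      then have "\<bar>f x\<bar> \<le> 0" by (rule field_le_epsilon)
      then show ?thesis by simp
    qed
    then show ?case by (auto simp: f_def fun_eq_iff)
  qed
qed

text \<open>Equality at rational times extends to all times: evaluation at a fixed vector is
  continuous on the strong dual and both paths are right-continuous, so real limits along
  \<open>\<sigma> t\<close> can be compared.\<close>

lemma regular_version_unique:
  assumes T: "nuclear_space T" and qc: "\<And>k. continuous_map T euclideanreal (q k)"
    and Z: "regular_process M T Z" "cadlag_process M (strong_dual (tvs_of T)) Z" "version_of M Z L"
  shows "indistinguishable M (\<lambda>t w. \<Psi> (path t w)) Z"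
proof -
  obtain P where Ph: "\<And>p. p \<in> P \<Longrightarrow> hilbertian p" and TP: "T = seminorm_topology P"
    using T unfolding nuclear_space_def by blast
  have P: "\<forall>r\<in>P. seminorm r" using Ph hilbertian_seminorm by blast
  have X: "continuous_map (top_of_set (A m k)) (strong_dual (tvs_of T)) \<Psi>" for m k
    unfolding TP by (rule \<Psi>_continuous[OF P]) (use qc TP in simp)
  have c: "countable (\<rat> \<inter> {0::real..})" by (rule countable_Int1[OF countable_rat])
  have "AE w in M. \<forall>t\<in>\<rat> \<inter> {0..}. \<Psi> (path t w) = Z t w"
    by (rule iffD2[OF AE_ball_countable[OF c]]) (use regular_version_unique_at[OF T qc Z(1,3)] in auto)
  then show ?thesis
    using Z(2) AE_space unfolding indistinguishable_def cadlag_process_def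
  proof eventually_elim
    case (elim w)
    show ?case
    proof (intro allI impI ext)
      fix t :: real and x assume t: "0 \<le> t"
      have fl: "filterlim (\<sigma> t) (at_right t) sequentially"
        by (rule filterlim_mono[OF \<sigma>_lim at_le order_refl]) auto
      have ev: "((\<lambda>s. Y s x) \<longlongrightarrow> Y t x) (at_right t)" if "cadlag_path (strong_dual (tvs_of T)) Y" for Y
      proof -
        have "limitin (strong_dual (tvs_of T)) Y (Y t) (at_right t)" using that t unfolding cadlag_path_def by blast
        from continuous_map_limit[OF strong_dual_eval_continuous[OF P, of x] this[unfolded TP]]
        show ?thesis by (simp add: o_def)
      qed
      have "(\<lambda>n. Z (\<sigma> t n) w x) \<longlonglongrightarrow> Z t w x" by (rule filterlim_compose[OF ev[OF elim(2)] fl])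
      moreover have "(\<lambda>n. \<Psi> (path (\<sigma> t n) w) x) \<longlonglongrightarrow> \<Psi> (path t w) x"
        by (rule filterlim_compose[OF ev[OF path_limitin[OF X elim(3)]] fl])
      moreover have "\<Psi> (path (\<sigma> t n) w) = Z (\<sigma> t n) w" for n
        using elim(1) \<sigma>(1,2)[of t n] t by auto
      ultimately show "\<Psi> (path t w) x = Z t w x" using LIMSEQ_unique by fastforce
    qed
  qed
qed

end

theorem theorem3p8:
  fixes T :: "'a::real_vector topology"
    and M :: "'w measure"
    and L :: "real \<Rightarrow> 'a \<Rightarrow> 'w \<Rightarrow> real"
  assumes "nuclear_space T"
    and "prob_space M" and "complete_measure M"
    and "cylindrical_levy M L"
    and "\<forall>S>0. equicontinuous_L0 M T (L ` {0..S})"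
  shows "\<exists>\<theta> Y. countably_hilbertian T \<theta> \<and>
    random_process M (borel_of (strong_dual (tvs_completion \<theta>))) Y \<and>
    cadlag_process M (strong_dual (tvs_completion \<theta>)) Y \<and>
    (\<forall>\<phi>. \<forall>t\<ge>0. AE w in M. Y t w (compl_embed \<theta> \<phi>) = L t \<phi> w) \<and>
    (let Y' = (\<lambda>t w. dual_restrict \<theta> (Y t w)) in
       random_process M (borel_of (strong_dual (tvs_of T))) Y' \<and>
       regular_process M T Y' \<and>
       cadlag_process M (strong_dual (tvs_of T)) Y' \<and>
       levy_process_dual M T Y' \<and>
       version_of M Y' L \<and>
       (\<forall>Z. random_process M (borel_of (strong_dual (tvs_of T))) Z \<and>
            regular_process M T Z \<and>
            cadlag_process M (strong_dual (tvs_of T)) Z \<and>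
            version_of M Z L
          \<longrightarrow> indistinguishable M Y' Z))"
proof -
  interpret cyl_levy M L
    by (rule cyl_levy.intro) (use assms(2,4) in \<open>auto simp: cyl_levy_axioms_def\<close>)
  obtain q C where q: "\<And>k. hilbertian (q k)" "\<And>k. continuous_map T euclideanreal (q k)"
    "\<And>k x. q k x \<le> q (Suc k) x" "\<And>k. hs_bound (q k) (q (Suc k)) (C k)"
    "\<And>k t \<psi>. 0 \<le> t \<Longrightarrow> t \<le> real k \<Longrightarrow> 1 - expectation (\<lambda>w. cos (L t \<psi> w)) \<le> (1 / 2) ^ (k + 3) + (q k \<psi>)\<^sup>2"
    using seminorm_sequence[OF assms(1,5)] by metis
  have "\<exists>d :: nat \<Rightarrow> 'a. (\<forall>k x \<epsilon>. 0 < \<epsilon> \<longrightarrow> (\<exists>i. q k (x - d i) < \<epsilon>)) \<and>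
      (\<forall>i j. \<exists>l. d l = d i + d j) \<and> (\<forall>i j. \<exists>l. d l = d i - d j)"
    by (rule dense_sequence) (rule nuclear_space_separable[OF assms(1) hilbertian_seminorm[OF q(1)] q(2)])
  then obtain d :: "nat \<Rightarrow> 'a" where d: "\<forall>k x \<epsilon>. 0 < \<epsilon> \<longrightarrow> (\<exists>i. q k (x - d i) < \<epsilon>)"
    "\<forall>i j. \<exists>l. d l = d i + d j" "\<forall>i j. \<exists>l. d l = d i - d j" by (elim exE conjE)
  interpret levy_frame M L q C d
    by unfold_locales (use q d in auto)
  obtain P where P: "\<forall>r\<in>P. seminorm r" and TP: "T = seminorm_topology P"
    using assms(1) hilbertian_seminorm unfolding nuclear_space_def by metis
  have qc: "continuous_map (seminorm_topology P) euclideanreal (q k)" for k using q(2) TP by simp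
  have X: "continuous_map (top_of_set (A m k)) (strong_dual (tvs_of T)) \<Psi>" for m k
    unfolding TP by (rule \<Psi>_continuous[OF P qc])
  \<comment> \<open>A single family of coded paths yields both processes: extended to the completion
    here, and as functionals on \<Phi> through \<open>\<Psi>\<close>.\<close>
  define Y where "Y t w = ext (\<Psi> (path t w))" for t w
  have lin: "linear (\<Psi> (path t w))" and ex: "ext (\<Psi> (path t w)) (compl_embed \<theta> \<phi>) = \<Psi> (path t w) \<phi>"
    and dual: "\<Psi> (path t w) \<in> tv_dual (tvs_of \<theta>)" for t w \<phi>
  proof -
    obtain m where m: "path t w \<in> A m m" using path_A by blast
    show "linear (\<Psi> (path t w))" by (rule \<Psi>_linear[OF m])
    show "ext (\<Psi> (path t w)) (compl_embed \<theta> \<phi>) = \<Psi> (path t w) \<phi>"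
      by (rule ext_embed[OF \<Psi>_linear[OF m] \<Psi>_bound[OF m]])
    show "\<Psi> (path t w) \<in> tv_dual (tvs_of \<theta>)"
      unfolding tv_dual_tvs_of[OF Pq]
      using \<Psi>_linear[OF m] continuous_map_linear[OF Pq sq q_cont \<Psi>_linear[OF m] \<Psi>_bound[OF m]] by blast
  qed
  \<comment> \<open>Restricting the extension to \<Phi> gives back the decoded path, so the
    remaining claims concern \<open>\<Psi> (path t w)\<close>.\<close>
  have Y': "(\<lambda>t w. dual_restrict \<theta> (Y t w)) = (\<lambda>t w. \<Psi> (path t w))"
    by (simp add: dual_restrict_def Y_def ex fun_eq_iff)
  have ch: "countably_hilbertian T \<theta>" unfolding countably_hilbertian_def using q by blast
  have "random_process M (borel_of (strong_dual (tvs_completion \<theta>))) Y"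
    unfolding random_process_def Y_def
    using process_measurable[of _ "\<lambda>a. ext (\<Psi> a)", OF ext_\<Psi>_continuous] by blast
  moreover have "cadlag_process M (strong_dual (tvs_completion \<theta>)) Y"
    unfolding cadlag_process_def Y_def
    using path_limitin[of _ "\<lambda>a. ext (\<Psi> a)", OF ext_\<Psi>_continuous] by (intro AE_I2) blast
  moreover have "\<forall>\<phi>. \<forall>t\<ge>0. AE w in M. Y t w (compl_embed \<theta> \<phi>) = L t \<phi> w"
    unfolding Y_def ex using version_\<Psi> by blast
  moreover have "random_process M (borel_of (strong_dual (tvs_of T))) (\<lambda>t w. \<Psi> (path t w))"
    unfolding random_process_def using process_measurable[OF X] by blast
  moreover have "regular_process M T (\<lambda>t w. \<Psi> (path t w))"
    unfolding regular_process_def using ch dual by blast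
  moreover have "cadlag_process M (strong_dual (tvs_of T)) (\<lambda>t w. \<Psi> (path t w))"
    unfolding cadlag_process_def using path_limitin[OF X] by (intro AE_I2) blast
  moreover have "levy_process_dual M T (\<lambda>t w. \<Psi> (path t w))"
    unfolding TP by (rule levy_process_\<Psi>[OF P qc])
  moreover have "version_of M (\<lambda>t w. \<Psi> (path t w)) L"
    unfolding version_of_def using version_\<Psi> by blast
  moreover have "indistinguishable M (\<lambda>t w. \<Psi> (path t w)) Z"
    if "regular_process M T Z" "cadlag_process M (strong_dual (tvs_of T)) Z" "version_of M Z L" for Z
    using regular_version_unique[OF assms(1) q(2) that] .
  ultimately show ?thesis
    unfolding Let_def by (intro exI[of _ \<theta>] exI[of _ Y]) (simp only: Y' ch, blast)
qed

end
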